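(* Let $\Bbbk$ be a field. There is a symmetric oplax monoidal functor $$\mathrm{Tw}: (\mathsf{FI}\text{-}\mathsf{comod}, \otimes_{\mathrm{H}}, \mathsf{1}) \to (\mathsf{FI}\text{-}\mathsf{comod}, \otimes_{\mathrm{D}}, \mathsf{1}_0),$$ which is the identity on objects and whose oplax structure is given by $$\bigoplus_{A \sqcup B = S} \pi_S^A(F) \otimes \pi_S^B(G): F(S) \otimes G(S) \longrightarrow \bigoplus_{A \sqcup B = S} F(A) \otimes G(B),$$ and by the unique map $\mathsf{1} \to \mathsf{1}_0$ which is the identity in arity $0$ and the zero map in all other arities.
   Context: $\mathsf{FI}$ is the category of finite sets and injections. $\mathsf{FI}\text{-}\mathsf{comod}=\mathrm{Fun}(\mathsf{FI}^{\mathrm{op}},\mathsf{Ch}_\Bbbk)$ is the category of functors from $\mathsf{FI}^{\mathrm{op}}$ to chain complexes over $\Bbbk$. For $F\in\mathsf{FI}\text{-}\mathsf{comod}$ and $A\subseteq S$, $\pi_S^A(F):F(S)\to F(A)$ is the image under $F$ of the inclusion $A\subseteq S$. The Hadamard tensor product is $(F\otimes_{\mathrm{H}}G)(S)=F(S)\otimes G(S)$, with unit $\mathsf{1}$, $\mathsf{1}(S)=\Bbbk$ for all $S$. The Day convolution product (with respect to disjoint union) is $(F\otimes_{\mathrm{D}}G)(S)=\bigoplus_{A\sqcup B=S}F(A)\otimes G(B)$, with unit $\mathsf{1}_0$ given by $\mathsf{1}_0(\emptyset)=\Bbbk$ and $\mathsf{1}_0(S)=0$ for $S\neq\emptyset$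.
   Formalization: As stated the claim fails: the map 1→1_0 (and the comultiplication) does not commute with the injection ∅→{s}. Here morphisms of the target (FI-comod, ⊗_D, 1_0) are families of chain maps commuting with bijections only; objects, products, units and both formulas are unchanged. *)

theory Defs
  imports "HOL-Algebra.Module" "HOL-Library.FuncSet"
begin

section \<open>Categories\<close>

record ('o, 'a) category =
  Ob :: "'o set"
  Hom :: "'o \<Rightarrow> 'o \<Rightarrow> 'a set"
  Idn :: "'o \<Rightarrow> 'a"
  Comp :: "'a \<Rightarrow> 'a \<Rightarrow> 'a"  (infixr \<open>\<cdot>\<index>\<close> 75)

text \<open>The arrows of all categories below carry their source and target.\<close>

datatype ('o, 'm) arrow = Arrow (src: 'o) (act: 'm) (trg: 'o)

definition is_category :: "('o, 'a, 'z) category_scheme \<Rightarrow> bool" where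
  "is_category C \<longleftrightarrow>
    (\<forall>a \<in> Ob C. Idn C a \<in> Hom C a a) \<and>
    (\<forall>a \<in> Ob C. \<forall>b \<in> Ob C. \<forall>c \<in> Ob C. \<forall>f \<in> Hom C a b. \<forall>g \<in> Hom C b c.
      g \<cdot>\<^bsub>C\<^esub> f \<in> Hom C a c) \<and>
    (\<forall>a \<in> Ob C. \<forall>b \<in> Ob C. \<forall>f \<in> Hom C a b.
      f \<cdot>\<^bsub>C\<^esub> Idn C a = f \<and> Idn C b \<cdot>\<^bsub>C\<^esub> f = f) \<and>
    (\<forall>a \<in> Ob C. \<forall>b \<in> Ob C. \<forall>c \<in> Ob C. \<forall>d \<in> Ob C.
      \<forall>f \<in> Hom C a b. \<forall>g \<in> Hom C b c. \<forall>h \<in> Hom C c d.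
        h \<cdot>\<^bsub>C\<^esub> (g \<cdot>\<^bsub>C\<^esub> f) = (h \<cdot>\<^bsub>C\<^esub> g) \<cdot>\<^bsub>C\<^esub> f)"

definition is_iso :: "('o, 'a, 'z) category_scheme \<Rightarrow> 'o \<Rightarrow> 'o \<Rightarrow> 'a \<Rightarrow> bool" where
  "is_iso C a b f \<longleftrightarrow> f \<in> Hom C a b \<and>
    (\<exists>g \<in> Hom C b a. g \<cdot>\<^bsub>C\<^esub> f = Idn C a \<and> f \<cdot>\<^bsub>C\<^esub> g = Idn C b)"

definition opposite :: "('o, 'a) category \<Rightarrow> ('o, 'a) category" where
  "opposite C = \<lparr>Ob = Ob C, Hom = (\<lambda>a b. Hom C b a), Idn = Idn C,
     Comp = (\<lambda>g f. f \<cdot>\<^bsub>C\<^esub> g)\<rparr>"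

record ('o, 'a, 'p, 'b) func =
  fob :: "'o \<Rightarrow> 'p"
  far :: "'a \<Rightarrow> 'b"

definition is_functor ::
  "('o, 'a, 'y) category_scheme \<Rightarrow> ('p, 'b, 'z) category_scheme \<Rightarrow>
   ('o, 'a, 'p, 'b, 'w) func_scheme \<Rightarrow> bool" where
  "is_functor C D F \<longleftrightarrow>
    (\<forall>a \<in> Ob C. fob F a \<in> Ob D) \<and>
    (\<forall>a \<in> Ob C. \<forall>b \<in> Ob C. \<forall>f \<in> Hom C a b. far F f \<in> Hom D (fob F a) (fob F b)) \<and>
    (\<forall>a \<in> Ob C. far F (Idn C a) = Idn D (fob F a)) \<and>
    (\<forall>a \<in> Ob C. \<forall>b \<in> Ob C. \<forall>c \<in> Ob C. \<forall>f \<in> Hom C a b. \<forall>g \<in> Hom C b c.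
      far F (g \<cdot>\<^bsub>C\<^esub> f) = far F g \<cdot>\<^bsub>D\<^esub> far F f)"

text \<open>
  Functors from \<open>C\<close> to \<open>D\<close>, with those families of arrows that are natural with respect to the
  arrows of \<open>C\<close> lying in \<open>W\<close>.  For \<open>W = UNIV\<close> this is the usual functor category.
\<close>

definition functor_category ::
  "'a set \<Rightarrow> ('o, 'a) category \<Rightarrow> ('p, 'b) category \<Rightarrow>
   (('o, 'a, 'p, 'b) func, (('o, 'a, 'p, 'b) func, 'o \<Rightarrow> 'b) arrow) category" where
  "functor_category W C D =
    \<lparr>Ob = {F. is_functor C D F},
     Hom = (\<lambda>F G. {Arrow F \<eta> G |\<eta>.
        \<eta> \<in> (\<Pi>\<^sub>E a \<in> Ob C. Hom D (fob F a) (fob G a)) \<and>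
        (\<forall>a \<in> Ob C. \<forall>b \<in> Ob C. \<forall>f \<in> Hom C a b \<inter> W.
          \<eta> b \<cdot>\<^bsub>D\<^esub> far F f = far G f \<cdot>\<^bsub>D\<^esub> \<eta> a)}),
     Idn = (\<lambda>F. Arrow F (\<lambda>a \<in> Ob C. Idn D (fob F a)) F),
     Comp = (\<lambda>\<theta> \<eta>. Arrow (src \<eta>) (\<lambda>a \<in> Ob C. act \<theta> a \<cdot>\<^bsub>D\<^esub> act \<eta> a) (trg \<theta>))\<rparr>"


section \<open>Symmetric monoidal categories and oplax functors\<close>

record ('o, 'a) smc = "('o, 'a) category" +
  tob :: "'o \<Rightarrow> 'o \<Rightarrow> 'o"
  tar :: "'a \<Rightarrow> 'a \<Rightarrow> 'a"
  unit_ob :: 'o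
  associator :: "'o \<Rightarrow> 'o \<Rightarrow> 'o \<Rightarrow> 'a"
  left_unitor :: "'o \<Rightarrow> 'a"
  right_unitor :: "'o \<Rightarrow> 'a"
  braiding :: "'o \<Rightarrow> 'o \<Rightarrow> 'a"

definition symmetric_monoidal_category :: "('o, 'a) smc \<Rightarrow> bool" where
  "symmetric_monoidal_category C \<longleftrightarrow>
    is_category C \<and>
    \<comment> \<open>the tensor product is a bifunctor\<close>
    unit_ob C \<in> Ob C \<and>
    (\<forall>a \<in> Ob C. \<forall>b \<in> Ob C. tob C a b \<in> Ob C) \<and>
    (\<forall>a \<in> Ob C. \<forall>a' \<in> Ob C. \<forall>b \<in> Ob C. \<forall>b' \<in> Ob C. \<forall>f \<in> Hom C a a'. \<forall>g \<in> Hom C b b'.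
      tar C f g \<in> Hom C (tob C a b) (tob C a' b')) \<and>
    (\<forall>a \<in> Ob C. \<forall>b \<in> Ob C. tar C (Idn C a) (Idn C b) = Idn C (tob C a b)) \<and>
    (\<forall>a \<in> Ob C. \<forall>a' \<in> Ob C. \<forall>a'' \<in> Ob C. \<forall>b \<in> Ob C. \<forall>b' \<in> Ob C. \<forall>b'' \<in> Ob C.
      \<forall>f \<in> Hom C a a'. \<forall>f' \<in> Hom C a' a''. \<forall>g \<in> Hom C b b'. \<forall>g' \<in> Hom C b' b''.
        tar C (f' \<cdot>\<^bsub>C\<^esub> f) (g' \<cdot>\<^bsub>C\<^esub> g) = tar C f' g' \<cdot>\<^bsub>C\<^esub> tar C f g) \<and>
    \<comment> \<open>the structure isomorphisms are natural isomorphisms\<close>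
    (\<forall>a \<in> Ob C. \<forall>b \<in> Ob C. \<forall>c \<in> Ob C.
      is_iso C (tob C (tob C a b) c) (tob C a (tob C b c)) (associator C a b c)) \<and>
    (\<forall>a \<in> Ob C. is_iso C (tob C (unit_ob C) a) a (left_unitor C a)) \<and>
    (\<forall>a \<in> Ob C. is_iso C (tob C a (unit_ob C)) a (right_unitor C a)) \<and>
    (\<forall>a \<in> Ob C. \<forall>b \<in> Ob C. is_iso C (tob C a b) (tob C b a) (braiding C a b)) \<and>
    (\<forall>a \<in> Ob C. \<forall>a' \<in> Ob C. \<forall>b \<in> Ob C. \<forall>b' \<in> Ob C. \<forall>c \<in> Ob C. \<forall>c' \<in> Ob C.
      \<forall>f \<in> Hom C a a'. \<forall>g \<in> Hom C b b'. \<forall>h \<in> Hom C c c'.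
        associator C a' b' c' \<cdot>\<^bsub>C\<^esub> tar C (tar C f g) h
          = tar C f (tar C g h) \<cdot>\<^bsub>C\<^esub> associator C a b c) \<and>
    (\<forall>a \<in> Ob C. \<forall>a' \<in> Ob C. \<forall>f \<in> Hom C a a'.
      left_unitor C a' \<cdot>\<^bsub>C\<^esub> tar C (Idn C (unit_ob C)) f = f \<cdot>\<^bsub>C\<^esub> left_unitor C a) \<and>
    (\<forall>a \<in> Ob C. \<forall>a' \<in> Ob C. \<forall>f \<in> Hom C a a'.
      right_unitor C a' \<cdot>\<^bsub>C\<^esub> tar C f (Idn C (unit_ob C)) = f \<cdot>\<^bsub>C\<^esub> right_unitor C a) \<and>
    (\<forall>a \<in> Ob C. \<forall>a' \<in> Ob C. \<forall>b \<in> Ob C. \<forall>b' \<in> Ob C. \<forall>f \<in> Hom C a a'. \<forall>g \<in> Hom C b b'.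
      braiding C a' b' \<cdot>\<^bsub>C\<^esub> tar C f g = tar C g f \<cdot>\<^bsub>C\<^esub> braiding C a b) \<and>
    \<comment> \<open>pentagon, triangle, hexagon, symmetry\<close>
    (\<forall>a \<in> Ob C. \<forall>b \<in> Ob C. \<forall>c \<in> Ob C. \<forall>d \<in> Ob C.
      associator C a b (tob C c d) \<cdot>\<^bsub>C\<^esub> associator C (tob C a b) c d
        = tar C (Idn C a) (associator C b c d) \<cdot>\<^bsub>C\<^esub> associator C a (tob C b c) d
            \<cdot>\<^bsub>C\<^esub> tar C (associator C a b c) (Idn C d)) \<and>
    (\<forall>a \<in> Ob C. \<forall>b \<in> Ob C.
      tar C (Idn C a) (left_unitor C b) \<cdot>\<^bsub>C\<^esub> associator C a (unit_ob C) b
        = tar C (right_unitor C a) (Idn C b)) \<and>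
    (\<forall>a \<in> Ob C. \<forall>b \<in> Ob C. \<forall>c \<in> Ob C.
      associator C b c a \<cdot>\<^bsub>C\<^esub> braiding C a (tob C b c) \<cdot>\<^bsub>C\<^esub> associator C a b c
        = tar C (Idn C b) (braiding C a c) \<cdot>\<^bsub>C\<^esub> associator C b a c
            \<cdot>\<^bsub>C\<^esub> tar C (braiding C a b) (Idn C c)) \<and>
    (\<forall>a \<in> Ob C. \<forall>b \<in> Ob C. braiding C b a \<cdot>\<^bsub>C\<^esub> braiding C a b = Idn C (tob C a b))"

record ('o, 'a, 'p, 'b) oplax_func = "('o, 'a, 'p, 'b) func" +
  comult :: "'o \<Rightarrow> 'o \<Rightarrow> 'b"
  counit :: 'b

definition symmetric_oplax_monoidal_functor ::
  "('o, 'a) smc \<Rightarrow> ('p, 'b) smc \<Rightarrow> ('o, 'a, 'p, 'b) oplax_func \<Rightarrow> bool" where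
  "symmetric_oplax_monoidal_functor C D T \<longleftrightarrow>
    symmetric_monoidal_category C \<and> symmetric_monoidal_category D \<and> is_functor C D T \<and>
    counit T \<in> Hom D (fob T (unit_ob C)) (unit_ob D) \<and>
    (\<forall>a \<in> Ob C. \<forall>b \<in> Ob C.
      comult T a b \<in> Hom D (fob T (tob C a b)) (tob D (fob T a) (fob T b))) \<and>
    \<comment> \<open>naturality\<close>
    (\<forall>a \<in> Ob C. \<forall>a' \<in> Ob C. \<forall>b \<in> Ob C. \<forall>b' \<in> Ob C. \<forall>f \<in> Hom C a a'. \<forall>g \<in> Hom C b b'.
      comult T a' b' \<cdot>\<^bsub>D\<^esub> far T (tar C f g)
        = tar D (far T f) (far T g) \<cdot>\<^bsub>D\<^esub> comult T a b) \<and>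
    \<comment> \<open>coassociativity\<close>
    (\<forall>a \<in> Ob C. \<forall>b \<in> Ob C. \<forall>c \<in> Ob C.
      associator D (fob T a) (fob T b) (fob T c)
          \<cdot>\<^bsub>D\<^esub> tar D (comult T a b) (Idn D (fob T c)) \<cdot>\<^bsub>D\<^esub> comult T (tob C a b) c
        = tar D (Idn D (fob T a)) (comult T b c) \<cdot>\<^bsub>D\<^esub> comult T a (tob C b c)
          \<cdot>\<^bsub>D\<^esub> far T (associator C a b c)) \<and>
    \<comment> \<open>counitality\<close>
    (\<forall>a \<in> Ob C.
      left_unitor D (fob T a) \<cdot>\<^bsub>D\<^esub> tar D (counit T) (Idn D (fob T a))
          \<cdot>\<^bsub>D\<^esub> comult T (unit_ob C) a
        = far T (left_unitor C a)) \<and>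
    (\<forall>a \<in> Ob C.
      right_unitor D (fob T a) \<cdot>\<^bsub>D\<^esub> tar D (Idn D (fob T a)) (counit T)
          \<cdot>\<^bsub>D\<^esub> comult T a (unit_ob C)
        = far T (right_unitor C a)) \<and>
    \<comment> \<open>symmetry\<close>
    (\<forall>a \<in> Ob C. \<forall>b \<in> Ob C.
      braiding D (fob T a) (fob T b) \<cdot>\<^bsub>D\<^esub> comult T a b
        = comult T b a \<cdot>\<^bsub>D\<^esub> far T (braiding C a b))"


section \<open>Vector spaces\<close>

text \<open>
  All vector spaces have their carrier in the following type, which contains a copy of an
  arbitrary type \<open>'v\<close> and of the scalars, and which is closed under the tensor products and
  direct sums used below: elements of tensor products are lists of pairs (formal sums of pure
  tensors), elements of direct sums are families, indexed by degrees or by subsets of \<open>'s\<close>.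
\<close>

datatype ('k, 's, 'v) univ =
    Atom 'v
  | Scalar (scalar: 'k)
  | Formal (formal: "(('k, 's, 'v) univ \<times> ('k, 's, 'v) univ) list")
  | Graded (graded: "int \<Rightarrow> ('k, 's, 'v) univ")
  | Indexed (indexed: "'s set \<Rightarrow> ('k, 's, 'v) univ")

type_synonym ('k, 's, 'v) vsp = "('k, ('k, 's, 'v) univ) module"

text \<open>
  The ring multiplication and unit of a \<^typ>\<open>('a, 'b) module\<close> record play no role for modules.
\<close>

definition linear_map :: "'k ring \<Rightarrow> ('k, 'u) module \<Rightarrow> ('k, 'u) module \<Rightarrow> ('u \<Rightarrow> 'u) \<Rightarrow> bool" where
  "linear_map K M N f \<longleftrightarrow>
    f \<in> carrier M \<rightarrow> carrier N \<and>
    (\<forall>x \<in> carrier M. \<forall>y \<in> carrier M. f (x \<oplus>\<^bsub>M\<^esub> y) = f x \<oplus>\<^bsub>N\<^esub> f y) \<and>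
    (\<forall>c \<in> carrier K. \<forall>x \<in> carrier M. f (c \<odot>\<^bsub>M\<^esub> x) = c \<odot>\<^bsub>N\<^esub> f x)"

definition ground_space :: "'k ring \<Rightarrow> ('k, 's, 'v) vsp" where
  "ground_space K = \<lparr>carrier = Scalar ` carrier K, mult = undefined, one = undefined,
     zero = Scalar \<zero>\<^bsub>K\<^esub>, add = (\<lambda>x y. Scalar (scalar x \<oplus>\<^bsub>K\<^esub> scalar y)),
     smult = (\<lambda>c x. Scalar (c \<otimes>\<^bsub>K\<^esub> scalar x))\<rparr>"

definition zero_space :: "'k ring \<Rightarrow> ('k, 's, 'v) vsp" where
  "zero_space K = \<lparr>carrier = {Scalar \<zero>\<^bsub>K\<^esub>}, mult = undefined, one = undefined,
     zero = Scalar \<zero>\<^bsub>K\<^esub>, add = (\<lambda>x y. Scalar \<zero>\<^bsub>K\<^esub>),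
     smult = (\<lambda>c x. Scalar \<zero>\<^bsub>K\<^esub>)\<rparr>"

subsection \<open>Tensor products\<close>

text \<open>
  \<open>M \<otimes> N\<close> is the commutative monoid generated by symbols \<open>(x, y)\<close> modulo the relations making
  \<open>(x, y)\<close> biadditive and balanced; a list stands for the sum of its entries.
\<close>

inductive tensor_eq ::
    "'k ring \<Rightarrow> ('k, 'u) module \<Rightarrow> ('k, 'u) module \<Rightarrow> ('u \<times> 'u) list \<Rightarrow> ('u \<times> 'u) list \<Rightarrow> bool"
  for K M N where
  refl: "l \<in> lists (carrier M \<times> carrier N) \<Longrightarrow> tensor_eq K M N l l"
| sym: "tensor_eq K M N l l' \<Longrightarrow> tensor_eq K M N l' l"
| trans: "tensor_eq K M N l l' \<Longrightarrow> tensor_eq K M N l' l'' \<Longrightarrow> tensor_eq K M N l l''"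
| append: "tensor_eq K M N l l' \<Longrightarrow> tensor_eq K M N m m' \<Longrightarrow> tensor_eq K M N (l @ m) (l' @ m')"
| comm: "l \<in> lists (carrier M \<times> carrier N) \<Longrightarrow> m \<in> lists (carrier M \<times> carrier N) \<Longrightarrow>
    tensor_eq K M N (l @ m) (m @ l)"
| zero: "y \<in> carrier N \<Longrightarrow> tensor_eq K M N [(\<zero>\<^bsub>M\<^esub>, y)] []"
| add_left: "x \<in> carrier M \<Longrightarrow> x' \<in> carrier M \<Longrightarrow> y \<in> carrier N \<Longrightarrow>
    tensor_eq K M N [(x \<oplus>\<^bsub>M\<^esub> x', y)] [(x, y), (x', y)]"
| add_right: "x \<in> carrier M \<Longrightarrow> y \<in> carrier N \<Longrightarrow> y' \<in> carrier N \<Longrightarrow>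
    tensor_eq K M N [(x, y \<oplus>\<^bsub>N\<^esub> y')] [(x, y), (x, y')]"
| balanced: "c \<in> carrier K \<Longrightarrow> x \<in> carrier M \<Longrightarrow> y \<in> carrier N \<Longrightarrow>
    tensor_eq K M N [(c \<odot>\<^bsub>M\<^esub> x, y)] [(x, c \<odot>\<^bsub>N\<^esub> y)]"

text \<open>Equivalence classes are represented by a chosen member, so that they stay in the type.\<close>

definition tensor_class ::
  "'k ring \<Rightarrow> ('k, 's, 'v) vsp \<Rightarrow> ('k, 's, 'v) vsp \<Rightarrow>
   (('k, 's, 'v) univ \<times> ('k, 's, 'v) univ) list \<Rightarrow> ('k, 's, 'v) univ" where
  "tensor_class K M N l = Formal (SOME l'. tensor_eq K M N l l')"

definition tensor ::
  "'k ring \<Rightarrow> ('k, 's, 'v) vsp \<Rightarrow> ('k, 's, 'v) vsp \<Rightarrow> ('k, 's, 'v) vsp" where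
  "tensor K M N =
    \<lparr>carrier = tensor_class K M N ` lists (carrier M \<times> carrier N),
     mult = undefined, one = undefined,
     zero = tensor_class K M N [],
     add = (\<lambda>u v. tensor_class K M N (formal u @ formal v)),
     smult = (\<lambda>c u. tensor_class K M N (map (\<lambda>(x, y). (c \<odot>\<^bsub>M\<^esub> x, y)) (formal u)))\<rparr>"

definition pure_tensor ::
  "'k ring \<Rightarrow> ('k, 's, 'v) vsp \<Rightarrow> ('k, 's, 'v) vsp \<Rightarrow>
   ('k, 's, 'v) univ \<Rightarrow> ('k, 's, 'v) univ \<Rightarrow> ('k, 's, 'v) univ" where
  "pure_tensor K M N x y = tensor_class K M N [(x, y)]"

text \<open>The linear map out of a tensor product, with values in \<open>P\<close>, induced by a bilinear map.\<close>

definition tensor_lift ::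
  "('k, 's, 'v) vsp \<Rightarrow> (('k, 's, 'v) univ \<Rightarrow> ('k, 's, 'v) univ \<Rightarrow> ('k, 's, 'v) univ) \<Rightarrow>
   ('k, 's, 'v) univ \<Rightarrow> ('k, 's, 'v) univ" where
  "tensor_lift P \<beta> u = foldr (\<lambda>(x, y) s. \<beta> x y \<oplus>\<^bsub>P\<^esub> s) (formal u) \<zero>\<^bsub>P\<^esub>"

subsection \<open>Direct sums\<close>

text \<open>
  \<open>fam\<close> is the constructor turning a family of elements into an element (\<^const>\<open>Graded\<close> or
  \<^const>\<open>Indexed\<close>), and \<open>unfam\<close> the corresponding selector.
\<close>

definition direct_sum ::
  "(('i \<Rightarrow> 'u) \<Rightarrow> 'u) \<Rightarrow> ('u \<Rightarrow> 'i \<Rightarrow> 'u) \<Rightarrow> 'i set \<Rightarrow> ('i \<Rightarrow> ('k, 'u) module) \<Rightarrow>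
   ('k, 'u) module" where
  "direct_sum fam unfam I M =
    \<lparr>carrier = fam ` {f \<in> \<Pi>\<^sub>E i \<in> I. carrier (M i). finite {i \<in> I. f i \<noteq> \<zero>\<^bsub>M i\<^esub>}},
     mult = undefined, one = undefined,
     zero = fam (\<lambda>i \<in> I. \<zero>\<^bsub>M i\<^esub>),
     add = (\<lambda>u v. fam (\<lambda>i \<in> I. unfam u i \<oplus>\<^bsub>M i\<^esub> unfam v i)),
     smult = (\<lambda>c u. fam (\<lambda>i \<in> I. c \<odot>\<^bsub>M i\<^esub> unfam u i))\<rparr>"


section \<open>Chain complexes\<close>

record ('k, 'u) cpx =
  Mod :: "int \<Rightarrow> ('k, 'u) module"
  bd :: "int \<Rightarrow> 'u \<Rightarrow> 'u"

definition chain_complex :: "'k ring \<Rightarrow> ('k, 'u) cpx \<Rightarrow> bool" where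
  "chain_complex K C \<longleftrightarrow>
    (\<forall>n. module K (Mod C n)) \<and>
    (\<forall>n. linear_map K (Mod C n) (Mod C (n - 1)) (bd C n)) \<and>
    (\<forall>n. \<forall>x \<in> carrier (Mod C n). bd C (n - 1) (bd C n x) = \<zero>\<^bsub>Mod C (n - 2)\<^esub>)"

definition chain_map ::
  "'k ring \<Rightarrow> ('k, 'u) cpx \<Rightarrow> ('k, 'u) cpx \<Rightarrow> (int \<Rightarrow> 'u \<Rightarrow> 'u) \<Rightarrow> bool" where
  "chain_map K C D \<phi> \<longleftrightarrow>
    (\<forall>n. \<phi> n \<in> extensional (carrier (Mod C n)) \<and> linear_map K (Mod C n) (Mod D n) (\<phi> n)) \<and>
    (\<forall>n. \<forall>x \<in> carrier (Mod C n). \<phi> (n - 1) (bd C n x) = bd D n (\<phi> n x))"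

type_synonym ('k, 's, 'v) ch = "('k, ('k, 's, 'v) univ) cpx"
type_synonym ('k, 's, 'v) ch_map =
  "(('k, 's, 'v) ch, int \<Rightarrow> ('k, 's, 'v) univ \<Rightarrow> ('k, 's, 'v) univ) arrow"

definition Ch :: "'k ring \<Rightarrow> (('k, 's, 'v) ch, ('k, 's, 'v) ch_map) category" where
  "Ch K =
    \<lparr>Ob = {C. chain_complex K C},
     Hom = (\<lambda>C D. {Arrow C \<phi> D |\<phi>. chain_map K C D \<phi>}),
     Idn = (\<lambda>C. Arrow C (\<lambda>n. \<lambda>x \<in> carrier (Mod C n). x) C),
     Comp = (\<lambda>\<psi> \<phi>. Arrow (src \<phi>)
       (\<lambda>n. compose (carrier (Mod (src \<phi>) n)) (act \<psi> n) (act \<phi> n)) (trg \<psi>))\<rparr>"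

definition zero_map :: "('k, 's, 'v) ch \<Rightarrow> ('k, 's, 'v) ch \<Rightarrow> ('k, 's, 'v) ch_map" where
  "zero_map C D = Arrow C (\<lambda>n. \<lambda>x \<in> carrier (Mod C n). \<zero>\<^bsub>Mod D n\<^esub>) D"

definition ground_cpx :: "'k ring \<Rightarrow> ('k, 's, 'v) ch" where
  "ground_cpx K = \<lparr>Mod = (\<lambda>n. if n = 0 then ground_space K else zero_space K),
     bd = (\<lambda>n x. Scalar \<zero>\<^bsub>K\<^esub>)\<rparr>"

definition zero_cpx :: "'k ring \<Rightarrow> ('k, 's, 'v) ch" where
  "zero_cpx K = \<lparr>Mod = (\<lambda>n. zero_space K), bd = (\<lambda>n x. Scalar \<zero>\<^bsub>K\<^esub>)\<rparr>"

subsection \<open>Tensor products of complexes\<close>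

definition cpx_tensor_mod ::
  "'k ring \<Rightarrow> ('k, 's, 'v) ch \<Rightarrow> ('k, 's, 'v) ch \<Rightarrow> int \<Rightarrow> ('k, 's, 'v) vsp" where
  "cpx_tensor_mod K C D n =
    direct_sum Graded graded UNIV (\<lambda>p. tensor K (Mod C p) (Mod D (n - p)))"

text \<open>The element \<open>x \<otimes> y\<close>, for \<open>x\<close> of degree \<open>p\<close> and \<open>y\<close> of degree \<open>q\<close>.\<close>

definition cpx_pure ::
  "'k ring \<Rightarrow> ('k, 's, 'v) ch \<Rightarrow> ('k, 's, 'v) ch \<Rightarrow> int \<Rightarrow> int \<Rightarrow>
   ('k, 's, 'v) univ \<Rightarrow> ('k, 's, 'v) univ \<Rightarrow> ('k, 's, 'v) univ" where
  "cpx_pure K C D p q x y =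
    Graded (\<lambda>i. if i = p then pure_tensor K (Mod C p) (Mod D q) x y
                else \<zero>\<^bsub>tensor K (Mod C i) (Mod D (p + q - i))\<^esub>)"

text \<open>
  The linear map from the degree \<open>n\<close> part of \<open>C \<otimes> D\<close> to \<open>P\<close> given by \<open>x \<otimes> y \<mapsto> \<beta> p q x y\<close>
  for \<open>x\<close> of degree \<open>p\<close> and \<open>y\<close> of degree \<open>q\<close>, \<open>p + q = n\<close>.
\<close>

definition cpx_lift ::
  "'k ring \<Rightarrow> ('k, 's, 'v) ch \<Rightarrow> ('k, 's, 'v) ch \<Rightarrow> ('k, 's, 'v) vsp \<Rightarrow>
   (int \<Rightarrow> int \<Rightarrow> ('k, 's, 'v) univ \<Rightarrow> ('k, 's, 'v) univ \<Rightarrow> ('k, 's, 'v) univ) \<Rightarrow>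
   int \<Rightarrow> ('k, 's, 'v) univ \<Rightarrow> ('k, 's, 'v) univ" where
  "cpx_lift K C D P \<beta> n u =
    (\<Oplus>\<^bsub>P\<^esub> p \<in> {p. graded u p \<noteq> \<zero>\<^bsub>tensor K (Mod C p) (Mod D (n - p))\<^esub>}.
       tensor_lift P (\<beta> p (n - p)) (graded u p))"

definition signed :: "('k, 's, 'v) vsp \<Rightarrow> int \<Rightarrow> ('k, 's, 'v) univ \<Rightarrow> ('k, 's, 'v) univ" where
  "signed M i x = (if even i then x else \<ominus>\<^bsub>M\<^esub> x)"

definition cpx_tensor ::
  "'k ring \<Rightarrow> ('k, 's, 'v) ch \<Rightarrow> ('k, 's, 'v) ch \<Rightarrow> ('k, 's, 'v) ch" where
  "cpx_tensor K C D =
    \<lparr>Mod = cpx_tensor_mod K C D,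
     bd = (\<lambda>n. let P = cpx_tensor_mod K C D (n - 1) in
       cpx_lift K C D P
        (\<lambda>p q x y. cpx_pure K C D (p - 1) q (bd C p x) y
           \<oplus>\<^bsub>P\<^esub> signed P p (cpx_pure K C D p (q - 1) x (bd D q y))) n)\<rparr>"

definition cpx_tensor_out ::
  "'k ring \<Rightarrow> ('k, 's, 'v) ch \<Rightarrow> ('k, 's, 'v) ch \<Rightarrow> ('k, 's, 'v) ch \<Rightarrow>
   (int \<Rightarrow> int \<Rightarrow> ('k, 's, 'v) univ \<Rightarrow> ('k, 's, 'v) univ \<Rightarrow> ('k, 's, 'v) univ) \<Rightarrow>
   ('k, 's, 'v) ch_map" where
  "cpx_tensor_out K C D E \<beta> = Arrow (cpx_tensor K C D)
     (\<lambda>n. \<lambda>u \<in> carrier (Mod (cpx_tensor K C D) n). cpx_lift K C D (Mod E n) \<beta> n u) E"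

definition cpx_tensor_map ::
  "'k ring \<Rightarrow> ('k, 's, 'v) ch_map \<Rightarrow> ('k, 's, 'v) ch_map \<Rightarrow> ('k, 's, 'v) ch_map" where
  "cpx_tensor_map K \<phi> \<psi> =
    cpx_tensor_out K (src \<phi>) (src \<psi>) (cpx_tensor K (trg \<phi>) (trg \<psi>))
      (\<lambda>p q x y. cpx_pure K (trg \<phi>) (trg \<psi>) p q (act \<phi> p x) (act \<psi> q y))"

definition cpx_assoc ::
  "'k ring \<Rightarrow> ('k, 's, 'v) ch \<Rightarrow> ('k, 's, 'v) ch \<Rightarrow> ('k, 's, 'v) ch \<Rightarrow> ('k, 's, 'v) ch_map" where
  "cpx_assoc K C D E =
    (let T = cpx_tensor K C (cpx_tensor K D E) in
     cpx_tensor_out K (cpx_tensor K C D) E T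
      (\<lambda>m r u z. cpx_lift K C D (Mod T (m + r))
        (\<lambda>p q x y. cpx_pure K C (cpx_tensor K D E) p (q + r) x (cpx_pure K D E q r y z)) m u))"

definition cpx_left_unitor :: "'k ring \<Rightarrow> ('k, 's, 'v) ch \<Rightarrow> ('k, 's, 'v) ch_map" where
  "cpx_left_unitor K C = cpx_tensor_out K (ground_cpx K) C C
    (\<lambda>p q c x. if p = 0 then scalar c \<odot>\<^bsub>Mod C q\<^esub> x else \<zero>\<^bsub>Mod C (p + q)\<^esub>)"

definition cpx_right_unitor :: "'k ring \<Rightarrow> ('k, 's, 'v) ch \<Rightarrow> ('k, 's, 'v) ch_map" where
  "cpx_right_unitor K C = cpx_tensor_out K C (ground_cpx K) C
    (\<lambda>p q x c. if q = 0 then scalar c \<odot>\<^bsub>Mod C p\<^esub> x else \<zero>\<^bsub>Mod C (p + q)\<^esub>)"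

definition cpx_braiding ::
  "'k ring \<Rightarrow> ('k, 's, 'v) ch \<Rightarrow> ('k, 's, 'v) ch \<Rightarrow> ('k, 's, 'v) ch_map" where
  "cpx_braiding K C D = cpx_tensor_out K C D (cpx_tensor K D C)
    (\<lambda>p q x y. signed (Mod (cpx_tensor K D C) (p + q)) (p * q) (cpx_pure K D C q p y x))"

subsection \<open>Direct sums of complexes\<close>

definition cpx_sum :: "'s set set \<Rightarrow> ('s set \<Rightarrow> ('k, 's, 'v) ch) \<Rightarrow> ('k, 's, 'v) ch" where
  "cpx_sum I C =
    \<lparr>Mod = (\<lambda>n. direct_sum Indexed indexed I (\<lambda>A. Mod (C A) n)),
     bd = (\<lambda>n u. Indexed (\<lambda>A \<in> I. bd (C A) n (indexed u A)))\<rparr>"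

definition cpx_inj ::
  "'s set set \<Rightarrow> ('s set \<Rightarrow> ('k, 's, 'v) ch) \<Rightarrow> 's set \<Rightarrow> int \<Rightarrow>
   ('k, 's, 'v) univ \<Rightarrow> ('k, 's, 'v) univ" where
  "cpx_inj I C A n x = Indexed (\<lambda>B \<in> I. if B = A then x else \<zero>\<^bsub>Mod (C B) n\<^esub>)"


section \<open>FI-comodules\<close>

text \<open>The finite sets are the finite subsets of the type \<open>'s\<close>; for infinite \<open>'s\<close> this is equivalent to
  the category of all finite sets and injections.\<close>

type_synonym 's fi_map = "('s set, 's \<Rightarrow> 's) arrow"

definition FI :: "('s set, 's fi_map) category" where
  "FI =
    \<lparr>Ob = {S. finite S},
     Hom = (\<lambda>S T. {Arrow S f T |f. f \<in> S \<rightarrow>\<^sub>E T \<and> inj_on f S}),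
     Idn = (\<lambda>S. Arrow S (\<lambda>x \<in> S. x) S),
     Comp = (\<lambda>g f. Arrow (src f) (compose (src f) (act g) (act f)) (trg g))\<rparr>"

definition FI_bijections :: "'s fi_map set" where
  "FI_bijections = {f. bij_betw (act f) (src f) (trg f)}"

definition fi_incl :: "'s set \<Rightarrow> 's set \<Rightarrow> 's fi_map" where
  "fi_incl A S = Arrow A (\<lambda>x \<in> A. x) S"

definition fi_preimage :: "'s fi_map \<Rightarrow> 's set \<Rightarrow> 's set" where
  "fi_preimage f B = {x \<in> src f. act f x \<in> B}"

definition fi_restrict :: "'s fi_map \<Rightarrow> 's set \<Rightarrow> 's fi_map" where
  "fi_restrict f B = Arrow (fi_preimage f B) (restrict (act f) (fi_preimage f B)) B"

type_synonym ('k, 's, 'v) comod = "('s set, 's fi_map, ('k, 's, 'v) ch, ('k, 's, 'v) ch_map) func"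
type_synonym ('k, 's, 'v) comod_map =
  "(('k, 's, 'v) comod, 's set \<Rightarrow> ('k, 's, 'v) ch_map) arrow"

text \<open>
  FI-comodules, with families of chain maps natural with respect to the injections in \<open>W\<close>.
  \<open>comod_category UNIV K\<close> is the category \<open>Fun(FI\<^sup>o\<^sup>p, Ch)\<close>; \<open>comod_category FI_bijections K\<close> has the
  same objects, but its morphisms need only be equivariant for the symmetric groups.
\<close>

definition comod_category ::
  "'s fi_map set \<Rightarrow> 'k ring \<Rightarrow> (('k, 's, 'v) comod, ('k, 's, 'v) comod_map) category" where
  "comod_category W K = functor_category W (opposite FI) (Ch K)"

definition comod_arrow ::
  "('k, 's, 'v) comod \<Rightarrow> ('s set \<Rightarrow> ('k, 's, 'v) ch_map) \<Rightarrow> ('k, 's, 'v) comod \<Rightarrow>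
   ('k, 's, 'v) comod_map" where
  "comod_arrow F \<eta> G = Arrow F (\<lambda>S \<in> {S. finite S}. \<eta> S) G"

definition comod_proj :: "('k, 's, 'v) comod \<Rightarrow> 's set \<Rightarrow> 's set \<Rightarrow> ('k, 's, 'v) ch_map"
  (\<open>\<pi>\<close>) where
  "\<pi> F S A = far F (fi_incl A S)"

subsection \<open>Hadamard tensor product\<close>

definition hadamard_ob ::
  "'k ring \<Rightarrow> ('k, 's, 'v) comod \<Rightarrow> ('k, 's, 'v) comod \<Rightarrow> ('k, 's, 'v) comod" where
  "hadamard_ob K F G =
    \<lparr>fob = (\<lambda>S. cpx_tensor K (fob F S) (fob G S)),
     far = (\<lambda>f. cpx_tensor_map K (far F f) (far G f))\<rparr>"

definition hadamard_unit :: "'k ring \<Rightarrow> ('k, 's, 'v) comod" where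
  "hadamard_unit K = \<lparr>fob = (\<lambda>S. ground_cpx K), far = (\<lambda>f. Idn (Ch K) (ground_cpx K))\<rparr>"

definition hadamard ::
  "'k ring \<Rightarrow> (('k, 's, 'v) comod, ('k, 's, 'v) comod_map) smc" where
  "hadamard K = category.extend (comod_category UNIV K)
    (smc.fields
      (hadamard_ob K)
      (\<lambda>\<eta> \<theta>. comod_arrow (hadamard_ob K (src \<eta>) (src \<theta>))
         (\<lambda>S. cpx_tensor_map K (act \<eta> S) (act \<theta> S)) (hadamard_ob K (trg \<eta>) (trg \<theta>)))
      (hadamard_unit K)
      (\<lambda>F G H. comod_arrow (hadamard_ob K (hadamard_ob K F G) H)
         (\<lambda>S. cpx_assoc K (fob F S) (fob G S) (fob H S)) (hadamard_ob K F (hadamard_ob K G H)))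
      (\<lambda>F. comod_arrow (hadamard_ob K (hadamard_unit K) F)
         (\<lambda>S. cpx_left_unitor K (fob F S)) F)
      (\<lambda>F. comod_arrow (hadamard_ob K F (hadamard_unit K))
         (\<lambda>S. cpx_right_unitor K (fob F S)) F)
      (\<lambda>F G. comod_arrow (hadamard_ob K F G)
         (\<lambda>S. cpx_braiding K (fob F S) (fob G S)) (hadamard_ob K G F)))"

subsection \<open>Day convolution\<close>

text \<open>
  A decomposition \<open>S = A \<squnion> B\<close> is given by \<open>A \<subseteq> S\<close>, with \<open>B = S - A\<close>.
\<close>

definition day_summand ::
  "'k ring \<Rightarrow> ('k, 's, 'v) comod \<Rightarrow> ('k, 's, 'v) comod \<Rightarrow> 's set \<Rightarrow> 's set \<Rightarrow> ('k, 's, 'v) ch" where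
  "day_summand K F G S A = cpx_tensor K (fob F A) (fob G (S - A))"

definition day_cpx ::
  "'k ring \<Rightarrow> ('k, 's, 'v) comod \<Rightarrow> ('k, 's, 'v) comod \<Rightarrow> 's set \<Rightarrow> ('k, 's, 'v) ch" where
  "day_cpx K F G S = cpx_sum (Pow S) (day_summand K F G S)"

text \<open>The element \<open>x \<otimes> y\<close> of the summand \<open>F(A) \<otimes> G(S - A)\<close>.\<close>

definition day_pure ::
  "'k ring \<Rightarrow> ('k, 's, 'v) comod \<Rightarrow> ('k, 's, 'v) comod \<Rightarrow> 's set \<Rightarrow> 's set \<Rightarrow> int \<Rightarrow> int \<Rightarrow>
   ('k, 's, 'v) univ \<Rightarrow> ('k, 's, 'v) univ \<Rightarrow> ('k, 's, 'v) univ" where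
  "day_pure K F G S A p q x y = cpx_inj (Pow S) (day_summand K F G S) A (p + q)
     (cpx_pure K (fob F A) (fob G (S - A)) p q x y)"

text \<open>
  The linear map to \<open>P\<close> given by \<open>x \<otimes> y \<mapsto> \<beta> A B p q x y\<close> for \<open>x\<close> in \<open>F(A)\<close> of degree \<open>p\<close> and
  \<open>y\<close> in \<open>G(B)\<close> of degree \<open>q\<close>.
\<close>

definition day_lift ::
  "'k ring \<Rightarrow> ('k, 's, 'v) comod \<Rightarrow> ('k, 's, 'v) comod \<Rightarrow> 's set \<Rightarrow> ('k, 's, 'v) vsp \<Rightarrow>
   ('s set \<Rightarrow> 's set \<Rightarrow> int \<Rightarrow> int \<Rightarrow>
     ('k, 's, 'v) univ \<Rightarrow> ('k, 's, 'v) univ \<Rightarrow> ('k, 's, 'v) univ) \<Rightarrow>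
   int \<Rightarrow> ('k, 's, 'v) univ \<Rightarrow> ('k, 's, 'v) univ" where
  "day_lift K F G S P \<beta> n u =
    (\<Oplus>\<^bsub>P\<^esub> A \<in> Pow S.
       cpx_lift K (fob F A) (fob G (S - A)) P (\<beta> A (S - A)) n (indexed u A))"

definition day_out ::
  "'k ring \<Rightarrow> ('k, 's, 'v) comod \<Rightarrow> ('k, 's, 'v) comod \<Rightarrow> 's set \<Rightarrow> ('k, 's, 'v) ch \<Rightarrow>
   ('s set \<Rightarrow> 's set \<Rightarrow> int \<Rightarrow> int \<Rightarrow>
     ('k, 's, 'v) univ \<Rightarrow> ('k, 's, 'v) univ \<Rightarrow> ('k, 's, 'v) univ) \<Rightarrow>
   ('k, 's, 'v) ch_map" where
  "day_out K F G S E \<beta> = Arrow (day_cpx K F G S)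
     (\<lambda>n. \<lambda>u \<in> carrier (Mod (day_cpx K F G S) n). day_lift K F G S (Mod E n) \<beta> n u) E"

text \<open>
  An injection \<open>f : S \<rightarrow> T\<close> acts on the summand of \<open>T = B \<squnion> B'\<close> by restricting \<open>f\<close> to
  \<open>f\<inverse>(B) \<rightarrow> B\<close> and \<open>f\<inverse>(B') \<rightarrow> B'\<close>; this is the functoriality of the coend over
  \<open>FI\<^sup>o\<^sup>p\<close>, since every injection \<open>S \<rightarrow> B \<squnion> B'\<close> splits uniquely in this way.
\<close>

definition day_ob ::
  "'k ring \<Rightarrow> ('k, 's, 'v) comod \<Rightarrow> ('k, 's, 'v) comod \<Rightarrow> ('k, 's, 'v) comod" where
  "day_ob K F G =
    \<lparr>fob = day_cpx K F G,
     far = (\<lambda>f. day_out K F G (trg f) (day_cpx K F G (src f))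
       (\<lambda>B B' p q x y. day_pure K F G (src f) (fi_preimage f B) p q
          (act (far F (fi_restrict f B)) p x) (act (far G (fi_restrict f B')) q y)))\<rparr>"

definition day_unit :: "'k ring \<Rightarrow> ('k, 's, 'v) comod" where
  "day_unit K =
    (let U = (\<lambda>S. if S = {} then ground_cpx K else zero_cpx K) in
     \<lparr>fob = U,
      far = (\<lambda>f. if trg f = {} then Idn (Ch K) (ground_cpx K)
                 else zero_map (U (trg f)) (U (src f)))\<rparr>)"

definition day ::
  "'s fi_map set \<Rightarrow> 'k ring \<Rightarrow> (('k, 's, 'v) comod, ('k, 's, 'v) comod_map) smc" where
  "day W K = category.extend (comod_category W K)
    (smc.fields
      (day_ob K)
      (\<lambda>\<eta> \<theta>. comod_arrow (day_ob K (src \<eta>) (src \<theta>))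
         (\<lambda>S. day_out K (src \<eta>) (src \<theta>) S (day_cpx K (trg \<eta>) (trg \<theta>) S)
           (\<lambda>A B p q x y. day_pure K (trg \<eta>) (trg \<theta>) S A p q
              (act (act \<eta> A) p x) (act (act \<theta> B) q y)))
         (day_ob K (trg \<eta>) (trg \<theta>)))
      (day_unit K)
      (\<lambda>F G H. comod_arrow (day_ob K (day_ob K F G) H)
         (\<lambda>S. let T = day_cpx K F (day_ob K G H) S in
           day_out K (day_ob K F G) H S T
            (\<lambda>U C m r u z. day_lift K F G U (Mod T (m + r))
              (\<lambda>A B p q x y. day_pure K F (day_ob K G H) S A p (q + r) x
                 (day_pure K G H (B \<union> C) B q r y z)) m u))
         (day_ob K F (day_ob K G H)))
      (\<lambda>F. comod_arrow (day_ob K (day_unit K) F)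
         (\<lambda>S. day_out K (day_unit K) F S (fob F S)
           (\<lambda>A B p q c x. if A = {} \<and> p = 0 then scalar c \<odot>\<^bsub>Mod (fob F B) q\<^esub> x
                          else \<zero>\<^bsub>Mod (fob F S) (p + q)\<^esub>)) F)
      (\<lambda>F. comod_arrow (day_ob K F (day_unit K))
         (\<lambda>S. day_out K F (day_unit K) S (fob F S)
           (\<lambda>A B p q x c. if B = {} \<and> q = 0 then scalar c \<odot>\<^bsub>Mod (fob F A) p\<^esub> x
                          else \<zero>\<^bsub>Mod (fob F S) (p + q)\<^esub>)) F)
      (\<lambda>F G. comod_arrow (day_ob K F G)
         (\<lambda>S. day_out K F G S (day_cpx K G F S)
           (\<lambda>A B p q x y. signed (Mod (day_cpx K G F S) (p + q)) (p * q)
              (day_pure K G F S B q p y x)))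
         (day_ob K G F)))"

subsection \<open>The oplax structure\<close>

text \<open>
  The map into the finite direct sum over \<open>A \<squnion> B = S\<close> whose component at \<open>(A, B)\<close> is
  \<open>\<pi> F S A \<otimes> \<pi> G S B\<close>.
\<close>

definition Tw_comult ::
  "'k ring \<Rightarrow> ('k, 's, 'v) comod \<Rightarrow> ('k, 's, 'v) comod \<Rightarrow> ('k, 's, 'v) comod_map" where
  "Tw_comult K F G = comod_arrow (hadamard_ob K F G)
     (\<lambda>S. Arrow (cpx_tensor K (fob F S) (fob G S))
       (\<lambda>n. \<lambda>u \<in> carrier (Mod (cpx_tensor K (fob F S) (fob G S)) n).
          Indexed (\<lambda>A \<in> Pow S. act (cpx_tensor_map K (\<pi> F S A) (\<pi> G S (S - A))) n u))
       (day_cpx K F G S))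
     (day_ob K F G)"

text \<open>
  The counit \<open>1 \<rightarrow> 1\<^sub>0\<close> is the identity in arity \<open>0\<close> and zero in all other arities.
\<close>

definition is_Tw_counit :: "'k ring \<Rightarrow> ('k, 's, 'v) comod_map \<Rightarrow> bool" where
  "is_Tw_counit K e \<longleftrightarrow>
    act e {} = Idn (Ch K) (ground_cpx K) \<and>
    (\<forall>S. finite S \<and> S \<noteq> {} \<longrightarrow> act e S = zero_map (ground_cpx K) (zero_cpx K))"

text \<open>
  Such a family is not natural for the injection \<open>\<emptyset> \<rightarrow> {s}\<close>: on \<open>1({s})\<close> one composite
  is \<open>1({s}) \<rightarrow> 1(\<emptyset>) = 1\<^sub>0(\<emptyset>)\<close>, the identity of the ground field, while the other passes through
  \<open>1\<^sub>0({s}) = 0\<close>.  The family is natural for bijections only, and the same holds for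
  \<^const>\<open>Tw_comult\<close> (restriction along \<open>S \<subseteq> T\<close> identifies several summands of the Day
  convolution).  Therefore the target of the functor has to be taken to be
  \<^term>\<open>day FI_bijections K\<close> instead of \<^term>\<open>day UNIV K\<close>.
\<close>

lemma no_FI_natural_counit:
  fixes K :: "'k ring" and e :: "('k, 's, 'v) comod_map"
  assumes K: "field K"
    and e: "e \<in> Hom (day UNIV K) (unit_ob (hadamard K)) (unit_ob (day UNIV K))"
  shows "act e {} \<noteq> Idn (Ch K) (ground_cpx K)"
proof
  assume id: "act e {} = Idn (Ch K) (ground_cpx K)"
  interpret field K by (rule K)
  obtain s :: 's where True by blast
  let ?f = "fi_incl {} {s}"
  have "?f \<in> Hom (opposite FI) {s} {}"
    by (auto simp: opposite_def FI_def fi_incl_def intro!: exI[of _ "\<lambda>x \<in> {}. x"])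
  moreover have "{s} \<in> Ob (opposite FI)" "{} \<in> Ob (opposite FI)"
    by (simp_all add: opposite_def FI_def)
  moreover obtain \<eta> where \<eta>: "act e = \<eta>"
      "\<eta> \<in> (\<Pi>\<^sub>E a \<in> Ob (opposite FI). Hom (Ch K) (fob (hadamard_unit K) a) (fob (day_unit K) a))"
      "\<forall>a \<in> Ob (opposite FI). \<forall>b \<in> Ob (opposite FI). \<forall>f \<in> Hom (opposite FI) a b \<inter> UNIV.
          \<eta> b \<cdot>\<^bsub>Ch K\<^esub> far (hadamard_unit K) f = far (day_unit K) f \<cdot>\<^bsub>Ch K\<^esub> \<eta> a"
    using e unfolding day_def hadamard_def comod_category_def functor_category_def
      category.defs smc.defs by auto
  ultimately have nat: "act e {} \<cdot>\<^bsub>Ch K\<^esub> far (hadamard_unit K) ?f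
      = far (day_unit K) ?f \<cdot>\<^bsub>Ch K\<^esub> act e {s}"
    and es: "act e {s} \<in> Hom (Ch K) (ground_cpx K) (zero_cpx K)"
    by (blast, fastforce simp: hadamard_unit_def day_unit_def)
  from es obtain \<phi> where \<phi>: "act e {s} = Arrow (ground_cpx K) \<phi> (zero_cpx K)"
      "chain_map K (ground_cpx K) (zero_cpx K) \<phi>"
    by (auto simp: Ch_def)
  let ?x = "Scalar \<one>\<^bsub>K\<^esub> :: ('k, 's, 'v) univ"
  have x: "?x \<in> carrier (Mod (ground_cpx K) 0)"
    by (simp add: ground_cpx_def ground_space_def)
  have "\<phi> 0 ?x \<in> carrier (Mod (zero_cpx K) 0)"
    using \<phi>(2) x unfolding chain_map_def linear_map_def by blast
  then have "act (far (day_unit K) ?f \<cdot>\<^bsub>Ch K\<^esub> act e {s}) 0 ?x = Scalar \<zero>\<^bsub>K\<^esub>"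
    using x by (simp add: \<phi>(1) Ch_def compose_def day_unit_def fi_incl_def zero_map_def
        zero_cpx_def ground_cpx_def ground_space_def)
  moreover have "act (act e {} \<cdot>\<^bsub>Ch K\<^esub> far (hadamard_unit K) ?f) 0 ?x = ?x"
    using x by (simp add: id Ch_def compose_def hadamard_unit_def)
  ultimately show False using nat by simp
qed

end

theory Submission
  imports Defs
begin

text \<open>
  A chain map out of \<open>\<Oplus> F(A) \<otimes> G(B)\<close> is determined by its values on the elements \<open>x \<otimes> y\<close>,
  and any family of bilinear maps satisfying the Leibniz rule extends to such a chain map.  Hence
  every coherence axiom reduces to an identity between iterated elements \<open>x \<otimes> y \<otimes> \<dots>\<close>, in which
  only the index sets and the Koszul signs have to be compared.  The Hadamard product and the Day
  convolution differ only in the pairs \<open>(A, B)\<close> that are allowed, so both are treated at once.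
  On elements, the oplax structure is \<open>x \<otimes> y \<mapsto> \<Sum> x|A \<otimes> y|B\<close>, the sum over all \<open>S = A \<squnion> B\<close>, where
  \<open>x|A\<close> is the restriction along \<open>A \<subseteq> S\<close>; coassociativity holds because both
  composites send \<open>x \<otimes> y \<otimes> z\<close> to the sum of \<open>x|A \<otimes> y|B \<otimes> z|C\<close> over all \<open>S = A \<squnion> B \<squnion> C\<close>.
\<close>

section \<open>Linear and bilinear maps\<close>

text \<open>Tensor products are carried by chosen representatives of classes of lists, so their
  elements cannot be handled directly. \<open>tensor_sum\<close> isolates what is needed instead:
  bilinear generators, an induction principle, and a lift with its values on generators. The lift is
  a parameter because the structure maps are defined by concrete lifts. The property is stable under
  direct sums, which carries it from two modules to complexes and then to Day convolution.

  The oplax structure is a sum over subsets, and this decides which maps it commutes with. For an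
  injection f : S -> T the terms for T become terms for preimages, and taking preimages is a
  bijection from the subsets of T to those of S only if f is onto. Hence naturality is a parameter
  \<open>W\<close>: the products and their coherence allow all injections, the oplax structure only
  bijections. Equality of morphisms does not involve \<open>W\<close>, so morphisms of both kinds
  can be compared in one category.

  Inverses are found without further lifts where possible: the associator and the right unitor are
  inverted through the braiding.\<close>

definition lin where
  "lin K M N f \<longleftrightarrow> module K M \<and> module K N \<and> linear_map K M N f"

lemma linI:
  assumes "module K M" "module K N"
    and "\<And>x. x \<in> carrier M \<Longrightarrow> f x \<in> carrier N"
    and "\<And>x y. x \<in> carrier M \<Longrightarrow> y \<in> carrier M \<Longrightarrow> f (x \<oplus>\<^bsub>M\<^esub> y) = f x \<oplus>\<^bsub>N\<^esub> f y"
    and "\<And>c x. c \<in> carrier K \<Longrightarrow> x \<in> carrier M \<Longrightarrow> f (c \<odot>\<^bsub>M\<^esub> x) = c \<odot>\<^bsub>N\<^esub> f x"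
  shows "lin K M N f"
  using assms unfolding lin_def linear_map_def by auto

lemma lin_modules: "lin K M N f \<Longrightarrow> module K M" "lin K M N f \<Longrightarrow> module K N"
  by (simp_all add: lin_def)

lemma lin_closed: "lin K M N f \<Longrightarrow> x \<in> carrier M \<Longrightarrow> f x \<in> carrier N"
  by (auto simp: lin_def linear_map_def)

lemma lin_add: "lin K M N f \<Longrightarrow> x \<in> carrier M \<Longrightarrow> y \<in> carrier M \<Longrightarrow> f (x \<oplus>\<^bsub>M\<^esub> y) = f x \<oplus>\<^bsub>N\<^esub> f y"
  by (auto simp: lin_def linear_map_def)

lemma lin_smult: "lin K M N f \<Longrightarrow> c \<in> carrier K \<Longrightarrow> x \<in> carrier M \<Longrightarrow> f (c \<odot>\<^bsub>M\<^esub> x) = c \<odot>\<^bsub>N\<^esub> f x"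
  by (auto simp: lin_def linear_map_def)

lemma module_closed:
  assumes "module K M"
  shows module_zero_closed: "\<zero>\<^bsub>M\<^esub> \<in> carrier M"
    and module_add_closed: "x \<in> carrier M \<Longrightarrow> y \<in> carrier M \<Longrightarrow> x \<oplus>\<^bsub>M\<^esub> y \<in> carrier M"
    and module_smult_closed: "c \<in> carrier K \<Longrightarrow> x \<in> carrier M \<Longrightarrow> c \<odot>\<^bsub>M\<^esub> x \<in> carrier M"
proof -
  interpret module K M by fact
  show "\<zero>\<^bsub>M\<^esub> \<in> carrier M" "x \<in> carrier M \<Longrightarrow> y \<in> carrier M \<Longrightarrow> x \<oplus>\<^bsub>M\<^esub> y \<in> carrier M"
    "c \<in> carrier K \<Longrightarrow> x \<in> carrier M \<Longrightarrow> c \<odot>\<^bsub>M\<^esub> x \<in> carrier M" by auto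
qed

text \<open>Zero equals the zero scalar times itself, so compatibility with scalars gives it
  directly.\<close>

lemma lin_zero: assumes "lin K M N f" shows "f \<zero>\<^bsub>M\<^esub> = \<zero>\<^bsub>N\<^esub>"
proof -
  interpret M: module K M by (rule lin_modules[OF assms])
  interpret N: module K N by (rule lin_modules[OF assms])
  have "f \<zero>\<^bsub>M\<^esub> = f (\<zero>\<^bsub>K\<^esub> \<odot>\<^bsub>M\<^esub> \<zero>\<^bsub>M\<^esub>)" by simp
  also have "\<dots> = \<zero>\<^bsub>N\<^esub>" 
    using lin_smult[OF assms, of "\<zero>\<^bsub>K\<^esub>" "\<zero>\<^bsub>M\<^esub>"] lin_closed[OF assms, of "\<zero>\<^bsub>M\<^esub>"]
    by (simp del: M.smult_r_null)
  finally show ?thesis .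
qed

text \<open>\<open>finsum\<close> over an infinite set is zero by convention on both sides; that
  case falls to \<open>lin_zero\<close>, and no finiteness has to be carried along.\<close>

lemma lin_finsum:
  assumes "lin K M N f" "g \<in> A \<rightarrow> carrier M"
  shows "f (\<Oplus>\<^bsub>M\<^esub>i\<in>A. g i) = (\<Oplus>\<^bsub>N\<^esub>i\<in>A. f (g i))"
proof -
  interpret M: module K M by (rule lin_modules[OF assms(1)])
  interpret N: module K N by (rule lin_modules[OF assms(1)])
  show ?thesis using assms(2)
  proof (induction A rule: infinite_finite_induct)
    case (insert a A)
    moreover have "(\<lambda>i. f (g i)) \<in> A \<rightarrow> carrier N" "f (g a) \<in> carrier N"
      using insert.prems lin_closed[OF assms(1)] by auto
    ultimately show ?case
      by (simp add: lin_add[OF assms(1)] M.M.finsum_closed)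
  qed (simp_all add: lin_zero[OF assms(1)])
qed

lemma lin_id: "module K M \<Longrightarrow> lin K M M (\<lambda>x. x)"
  by (rule linI) auto

lemma lin_comp: "lin K M N f \<Longrightarrow> lin K N P g \<Longrightarrow> lin K M P (\<lambda>x. g (f x))"
  by (rule linI) (auto simp: lin_modules lin_closed lin_add lin_smult)

lemma lin_const_zero: "module K M \<Longrightarrow> module K N \<Longrightarrow> lin K M N (\<lambda>x. \<zero>\<^bsub>N\<^esub>)"
proof (rule linI)
  assume "module K N"
  then interpret module K N .
  show "\<zero>\<^bsub>N\<^esub> = \<zero>\<^bsub>N\<^esub> \<oplus>\<^bsub>N\<^esub> \<zero>\<^bsub>N\<^esub>" by simp
  show "c \<in> carrier K \<Longrightarrow> \<zero>\<^bsub>N\<^esub> = c \<odot>\<^bsub>N\<^esub> \<zero>\<^bsub>N\<^esub>" for c by simp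
qed (auto simp: module_zero_closed)

lemma lin_plus: assumes "lin K M N f" "lin K M N g" shows "lin K M N (\<lambda>x. f x \<oplus>\<^bsub>N\<^esub> g x)"
proof -
  interpret N: module K N by (rule lin_modules[OF assms(1)])
  show ?thesis
    by (rule linI) (use assms in \<open>auto simp: lin_modules lin_closed lin_add lin_smult
        N.M.add.m_ac N.smult_r_distr\<close>)
qed

lemma lin_scale:
  assumes "lin K M N f" "c \<in> carrier K" shows "lin K M N (\<lambda>x. c \<odot>\<^bsub>N\<^esub> f x)"
proof -
  interpret N: module K N by (rule lin_modules[OF assms(1)])
  show ?thesis
    by (rule linI) (use assms in \<open>auto simp: lin_modules lin_closed lin_add lin_smult
        N.smult_r_distr N.smult_assoc1[symmetric] N.R.m_comm\<close>)
qed

text \<open>Only values on the carrier count. This absorbs the difference between a formula and its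
  restriction to a carrier, or between a sign written with \<open>signed\<close> and one written as
  a scalar.\<close>

lemma lin_cong:
  assumes "lin K M N f" "\<And>x. x \<in> carrier M \<Longrightarrow> f x = g x" shows "lin K M N g"
proof -
  have c: "x \<in> carrier M \<Longrightarrow> y \<in> carrier M \<Longrightarrow> x \<oplus>\<^bsub>M\<^esub> y \<in> carrier M"
    "c \<in> carrier K \<Longrightarrow> x \<in> carrier M \<Longrightarrow> c \<odot>\<^bsub>M\<^esub> x \<in> carrier M" for x y c
    using lin_modules(1)[OF assms(1)] by (auto simp: module_closed)
  show ?thesis
    by (rule linI[OF lin_modules[OF assms(1)]])
      (use lin_closed[OF assms(1)] lin_add[OF assms(1)] lin_smult[OF assms(1)] c in
        \<open>simp_all flip: assms(2)\<close>)
qed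

section \<open>Bilinear maps and their universal property\<close>

definition bilinear where
  "bilinear K M N P \<beta> \<longleftrightarrow> (\<forall>y \<in> carrier N. lin K M P (\<lambda>x. \<beta> x y)) \<and>
    (\<forall>x \<in> carrier M. lin K N P (\<beta> x))"

lemma bilinear_left: "bilinear K M N P \<beta> \<Longrightarrow> y \<in> carrier N \<Longrightarrow> lin K M P (\<lambda>x. \<beta> x y)"
  by (simp add: bilinear_def)

lemma bilinear_right: "bilinear K M N P \<beta> \<Longrightarrow> x \<in> carrier M \<Longrightarrow> lin K N P (\<beta> x)"
  by (simp add: bilinear_def)

lemma bilinear_closed:
  "bilinear K M N P \<beta> \<Longrightarrow> x \<in> carrier M \<Longrightarrow> y \<in> carrier N \<Longrightarrow> \<beta> x y \<in> carrier P"
  by (drule (1) bilinear_right) (rule lin_closed)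

lemma bilinear_comp: "bilinear K M N P \<beta> \<Longrightarrow> lin K P Q f \<Longrightarrow> bilinear K M N Q (\<lambda>x y. f (\<beta> x y))"
  by (auto simp: bilinear_def intro: lin_comp)

lemma bilinear_comp2:
  assumes "bilinear K M' N' P \<beta>" "lin K M M' f" "lin K N N' g"
  shows "bilinear K M N P (\<lambda>x y. \<beta> (f x) (g y))"
  unfolding bilinear_def
  by (intro conjI ballI lin_comp[OF assms(2), of P "\<lambda>x. \<beta> x (g y)" for y]
      lin_comp[OF assms(3), of P "\<beta> (f x)" for x] bilinear_left[OF assms(1)] bilinear_right[OF assms(1)])
    (use assms in \<open>auto intro: lin_closed\<close>)

lemma bilinear_plus:
  "bilinear K M N P \<beta> \<Longrightarrow> bilinear K M N P \<gamma> \<Longrightarrow> bilinear K M N P (\<lambda>x y. \<beta> x y \<oplus>\<^bsub>P\<^esub> \<gamma> x y)"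
  by (auto simp: bilinear_def intro: lin_plus)

lemma bilinear_scale:
  "bilinear K M N P \<beta> \<Longrightarrow> c \<in> carrier K \<Longrightarrow> bilinear K M N P (\<lambda>x y. c \<odot>\<^bsub>P\<^esub> \<beta> x y)"
  by (auto simp: bilinear_def intro: lin_scale)

lemma bilinear_flip: "bilinear K M N P \<beta> \<Longrightarrow> bilinear K N M P (\<lambda>y x. \<beta> x y)"
  by (auto simp: bilinear_def)

lemma bilinear_zero:
  "module K M \<Longrightarrow> module K N \<Longrightarrow> module K P \<Longrightarrow> bilinear K M N P (\<lambda>x y. \<zero>\<^bsub>P\<^esub>)"
  by (auto simp: bilinear_def intro: lin_const_zero)

lemma bilinear_cong:
  "bilinear K M N P \<beta> \<Longrightarrow> (\<And>x y. x \<in> carrier M \<Longrightarrow> y \<in> carrier N \<Longrightarrow> \<beta> x y = \<gamma> x y) \<Longrightarrow>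
    bilinear K M N P \<gamma>"
  unfolding bilinear_def by (auto intro: lin_cong)

text \<open>The common universal property of tensor products and of direct sums of tensor products.\<close>

definition tensor_sum where
  "tensor_sum K J X Y T \<tau> \<Lambda> \<longleftrightarrow> module K T \<and>
    (\<forall>j \<in> J. bilinear K (X j) (Y j) T (\<tau> j)) \<and>
    (\<forall>Q. \<zero>\<^bsub>T\<^esub> \<in> Q \<and> (\<forall>j \<in> J. \<forall>x \<in> carrier (X j). \<forall>y \<in> carrier (Y j). \<tau> j x y \<in> Q) \<and>
      (\<forall>u \<in> Q \<inter> carrier T. \<forall>v \<in> Q \<inter> carrier T. u \<oplus>\<^bsub>T\<^esub> v \<in> Q) \<longrightarrow> carrier T \<subseteq> Q) \<and>
    (\<forall>P \<beta>. module K P \<and> (\<forall>j \<in> J. bilinear K (X j) (Y j) P (\<beta> j)) \<longrightarrow> lin K T P (\<Lambda> P \<beta>) \<and>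
      (\<forall>j \<in> J. \<forall>x \<in> carrier (X j). \<forall>y \<in> carrier (Y j). \<Lambda> P \<beta> (\<tau> j x y) = \<beta> j x y))"

lemma tensor_sum_module: "tensor_sum K J X Y T \<tau> \<Lambda> \<Longrightarrow> module K T"
  unfolding tensor_sum_def by blast

lemma tensor_sum_bilinear: "tensor_sum K J X Y T \<tau> \<Lambda> \<Longrightarrow> j \<in> J \<Longrightarrow> bilinear K (X j) (Y j) T (\<tau> j)"
  by (simp add: tensor_sum_def)

text \<open>A scalar multiple of a generator is again a generator, the scalar being absorbed in one
  factor. The generators therefore span additively, and sums are the only induction step.\<close>

lemma tensor_sum_induct:
  assumes "tensor_sum K J X Y T \<tau> \<Lambda>" "u \<in> carrier T"
    and "Q \<zero>\<^bsub>T\<^esub>"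
    and "\<And>j x y. j \<in> J \<Longrightarrow> x \<in> carrier (X j) \<Longrightarrow> y \<in> carrier (Y j) \<Longrightarrow> Q (\<tau> j x y)"
    and "\<And>u v. u \<in> carrier T \<Longrightarrow> v \<in> carrier T \<Longrightarrow> Q u \<Longrightarrow> Q v \<Longrightarrow> Q (u \<oplus>\<^bsub>T\<^esub> v)"
  shows "Q u"
proof -
  have "carrier T \<subseteq> Collect Q"
    using assms(1)[unfolded tensor_sum_def, THEN conjunct2, THEN conjunct2, THEN conjunct1, THEN spec,
        of "Collect Q"] assms(3-) by auto
  then show ?thesis using assms(2) by auto
qed

lemma tensor_sum_lift:
  assumes "tensor_sum K J X Y T \<tau> \<Lambda>" "module K P"
    "\<forall>j \<in> J. bilinear K (X j) (Y j) P (\<beta> j)"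
  shows "lin K T P (\<Lambda> P \<beta>)"
    and "j \<in> J \<Longrightarrow> x \<in> carrier (X j) \<Longrightarrow> y \<in> carrier (Y j) \<Longrightarrow> \<Lambda> P \<beta> (\<tau> j x y) = \<beta> j x y"
  using assms(1)[unfolded tensor_sum_def, THEN conjunct2, THEN conjunct2, THEN conjunct2, THEN spec,
      of P, THEN spec, of \<beta>] assms(2,3) by simp_all

text \<open>The uniqueness half of the universal property; equality of maps out of products is
  reduced to generators through it.\<close>

lemma tensor_sum_ext:
  assumes "tensor_sum K J X Y T \<tau> \<Lambda>" "lin K T P f" "lin K T P g" "u \<in> carrier T"
    and "\<And>j x y. j \<in> J \<Longrightarrow> x \<in> carrier (X j) \<Longrightarrow> y \<in> carrier (Y j) \<Longrightarrow> f (\<tau> j x y) = g (\<tau> j x y)"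
  shows "f u = g u"
  by (rule tensor_sum_induct[OF assms(1,4)])
    (use assms(2,3,5) in \<open>auto simp: lin_zero lin_add\<close>)

text \<open>Surjectivity of \<open>h\<close> is enough, because everything attached to
  \<open>j\<close> is required to depend on \<open>h j\<close> alone. The new lift has to agree with
  the old one only for bilinear families and on the carrier, which leaves room for lifts that sum
  over more than the support.\<close>

lemma tensor_sum_reindex:
  assumes "tensor_sum K J X Y T \<tau> \<Lambda>" "h ` J = J'"
    and X: "\<And>j. j \<in> J \<Longrightarrow> X j = X' (h j)" "\<And>j. j \<in> J \<Longrightarrow> Y j = Y' (h j)"
    and \<tau>: "\<And>j x y. j \<in> J \<Longrightarrow> x \<in> carrier (X j) \<Longrightarrow> y \<in> carrier (Y j) \<Longrightarrow> \<tau> j x y = \<tau>' (h j) x y"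
    and \<Lambda>: "\<And>P \<beta> u. module K P \<Longrightarrow> (\<And>j. j \<in> J' \<Longrightarrow> bilinear K (X' j) (Y' j) P (\<beta> j)) \<Longrightarrow>
      u \<in> carrier T \<Longrightarrow> \<Lambda>' P \<beta> u = \<Lambda> P (\<lambda>j. \<beta> (h j)) u"
  shows "tensor_sum K J' X' Y' T \<tau>' \<Lambda>'"
proof -
  note ts = assms(1)
  show ?thesis unfolding tensor_sum_def
  proof (intro conjI ballI allI impI; (elim conjE)?)
    show "module K T" by (rule tensor_sum_module[OF ts])
    fix j assume "j \<in> J'"
    then obtain i where i: "i \<in> J" "j = h i" using assms(2) by auto
    show "bilinear K (X' j) (Y' j) T (\<tau>' j)"
      using tensor_sum_bilinear[OF ts i(1)] \<tau> i X by (auto intro: bilinear_cong)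
  next
    fix Q assume Q: "\<zero>\<^bsub>T\<^esub> \<in> Q" "\<forall>j\<in>J'. \<forall>x\<in>carrier (X' j). \<forall>y\<in>carrier (Y' j). \<tau>' j x y \<in> Q"
      "\<forall>u\<in>Q \<inter> carrier T. \<forall>v\<in>Q \<inter> carrier T. u \<oplus>\<^bsub>T\<^esub> v \<in> Q"
    show "carrier T \<subseteq> Q"
    proof
      fix u assume u: "u \<in> carrier T"
      show "u \<in> Q"
        by (rule tensor_sum_induct[OF ts u, of "\<lambda>u. u \<in> Q"]) (use Q X \<tau> assms(2) in auto)
    qed
  next
    fix P \<beta> assume P: "module K P" and b: "\<forall>j\<in>J'. bilinear K (X' j) (Y' j) P (\<beta> j)"
    have b': "\<forall>j \<in> J. bilinear K (X j) (Y j) P (\<beta> (h j))" using b assms(2) X by auto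
    note L = tensor_sum_lift[OF ts P, of "\<lambda>j. \<beta> (h j)", OF b']
    show "lin K T P (\<Lambda>' P \<beta>)" by (rule lin_cong[OF L(1)]) (use b \<Lambda>[OF P, of \<beta>] in auto)
    fix j x y assume j: "j \<in> J'" and xy: "x \<in> carrier (X' j)" "y \<in> carrier (Y' j)"
    then obtain i where i: "i \<in> J" "j = h i" using assms(2) by auto
    have xy': "x \<in> carrier (X i)" "y \<in> carrier (Y i)" using xy i X by auto
    have "\<tau> i x y \<in> carrier T"
      using bilinear_closed[OF tensor_sum_bilinear[OF ts i(1)] xy'] .
    then show "\<Lambda>' P \<beta> (\<tau>' j x y) = \<beta> j x y"
      using \<Lambda>[OF P, of \<beta> "\<tau> i x y"] b \<tau>[OF i(1) xy'] L(2)[OF i(1) xy'] i by auto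
  qed
qed

section \<open>Tensor products of modules\<close>

lemma tensor_eq_lists:
  assumes "tensor_eq K M N l l'" "module K M" "module K N"
  shows "l \<in> lists (carrier M \<times> carrier N) \<and> l' \<in> lists (carrier M \<times> carrier N)"
proof -
  interpret M: module K M by fact
  interpret N: module K N by fact
  show ?thesis using assms(1) by induction (auto simp: in_lists_conv_set)
qed

locale tensor_modules = M: module K M + N: module K N
  for K :: "'k ring" and M N :: "('k, 's, 'v) vsp"
begin

abbreviation "L \<equiv> lists (carrier M \<times> carrier N)"
abbreviation teq (infix \<open>\<approx>\<close> 50) where "l \<approx> l' \<equiv> tensor_eq K M N l l'"
abbreviation "cls \<equiv> tensor_class K M N"

lemma teq_L: "l \<approx> l' \<Longrightarrow> l \<in> L" "l \<approx> l' \<Longrightarrow> l' \<in> L"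
  using tensor_eq_lists M.module_axioms N.module_axioms by blast+

text \<open>Equivalent lists define the same predicate \<open>tensor_eq K M N l\<close>, hence
  \<open>SOME\<close> picks the same member; conversely each list is equivalent to the member picked
  for it.\<close>

lemma cls_eq_iff: assumes "l \<in> L" "l' \<in> L" shows "cls l = cls l' \<longleftrightarrow> l \<approx> l'"
proof
  assume "l \<approx> l'"
  then have "tensor_eq K M N l = tensor_eq K M N l'" by (blast intro: tensor_eq.sym tensor_eq.trans)
  then show "cls l = cls l'" by (simp add: tensor_class_def)
next
  assume e: "cls l = cls l'"
  have "l \<approx> (SOME m. l \<approx> m)" "l' \<approx> (SOME m. l' \<approx> m)"
    using someI[of "tensor_eq K M N l", OF tensor_eq.refl[OF assms(1)]]
      someI[of "tensor_eq K M N l'", OF tensor_eq.refl[OF assms(2)]] .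
  with e show "l \<approx> l'" by (auto simp: tensor_class_def intro: tensor_eq.trans tensor_eq.sym)
qed

lemma formal_cls: "l \<in> L \<Longrightarrow> l \<approx> formal (cls l)"
  by (simp add: tensor_class_def) (rule someI, rule tensor_eq.refl)

lemma carrierE:
  assumes "u \<in> carrier (tensor K M N)" obtains l where "l \<in> L" "u = cls l"
  using assms by (auto simp: tensor_def)

lemma cls_closed: "l \<in> L \<Longrightarrow> cls l \<in> carrier (tensor K M N)"
  by (simp add: tensor_def)

definition scale where "scale c l = map (\<lambda>(x, y). (c \<odot>\<^bsub>M\<^esub> x, y)) l"

lemma scale_L: "c \<in> carrier K \<Longrightarrow> l \<in> L \<Longrightarrow> scale c l \<in> L"
  by (auto simp: scale_def in_lists_conv_set)

lemma scale_append [simp]: "scale c (l @ m) = scale c l @ scale c m"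
  by (simp add: scale_def)

text \<open>Well-definedness of scalar multiplication. Commutativity of \<open>K\<close> enters in
  the case \<open>balanced\<close>, where two scalars acting on the left factor have to be
  exchanged.\<close>

lemma teq_scale: "l \<approx> l' \<Longrightarrow> c \<in> carrier K \<Longrightarrow> scale c l \<approx> scale c l'"
proof (induction rule: tensor_eq.induct)
  case (refl l)
  then show ?case by (simp add: tensor_eq.refl scale_L)
next
  case (append l l' m m')
  then show ?case by (simp add: tensor_eq.append)
next
  case (comm l m)
  then show ?case by (simp add: tensor_eq.comm scale_L)
next
  case (zero y)
  then show ?case by (simp add: scale_def tensor_eq.zero)
next
  case (add_left x x' y)
  then show ?case by (simp add: scale_def M.smult_r_distr tensor_eq.add_left)
next
  case (add_right x y y')
  then show ?case by (simp add: scale_def tensor_eq.add_right)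
next
  case (balanced d x y)
  have "c \<odot>\<^bsub>M\<^esub> (d \<odot>\<^bsub>M\<^esub> x) = d \<odot>\<^bsub>M\<^esub> (c \<odot>\<^bsub>M\<^esub> x)"
    using balanced by (simp add: M.smult_assoc1[symmetric] M.R.m_comm)
  with balanced show ?case by (simp add: scale_def tensor_eq.balanced)
qed (auto intro: tensor_eq.intros)

lemma add_cls: "l \<in> L \<Longrightarrow> m \<in> L \<Longrightarrow> cls l \<oplus>\<^bsub>tensor K M N\<^esub> cls m = cls (l @ m)"
  using tensor_eq.append[OF formal_cls formal_cls, of l m]
  by (simp add: tensor_def) (meson append_in_lists_conv cls_eq_iff formal_cls tensor_eq.sym teq_L(2))

lemma smult_cls: "c \<in> carrier K \<Longrightarrow> l \<in> L \<Longrightarrow> c \<odot>\<^bsub>tensor K M N\<^esub> cls l = cls (scale c l)"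
  using teq_scale[OF formal_cls, of l c]
  by (simp add: tensor_def scale_def[symmetric]) (metis cls_eq_iff scale_L teq_L(2))

lemma zero_cls: "\<zero>\<^bsub>tensor K M N\<^esub> = cls []"
  by (simp add: tensor_def)

text \<open>Each entry splits by additivity in the left factor. The relation \<open>comm\<close>
  then moves the entry belonging to \<open>d\<close> past the part already scaled by
  \<open>c\<close>.\<close>

lemma scale_add:
  assumes "c \<in> carrier K" "d \<in> carrier K" "l \<in> L"
  shows "scale (c \<oplus>\<^bsub>K\<^esub> d) l \<approx> scale c l @ scale d l"
  using assms(3)
proof (induction l)
  case (Cons z l)
  obtain x y where z: "z = (x, y)" "x \<in> carrier M" "y \<in> carrier N" using Cons.hyps by auto
  let ?a = "(c \<odot>\<^bsub>M\<^esub> x, y)" and ?b = "(d \<odot>\<^bsub>M\<^esub> x, y)"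
  have ab: "?a \<in> carrier M \<times> carrier N" "?b \<in> carrier M \<times> carrier N" using z assms by auto
  have "[((c \<oplus>\<^bsub>K\<^esub> d) \<odot>\<^bsub>M\<^esub> x, y)] \<approx> [?a, ?b]"
    using z assms by (simp add: M.smult_l_distr tensor_eq.add_left)
  from tensor_eq.append[OF this Cons.IH]
  have "scale (c \<oplus>\<^bsub>K\<^esub> d) (z # l) \<approx> [?a] @ ([?b] @ scale c l) @ scale d l"
    using z by (simp add: scale_def)
  also have "tensor_eq K M N ([?a] @ ([?b] @ scale c l) @ scale d l) ([?a] @ (scale c l @ [?b]) @ scale d l)"
    using ab Cons.hyps assms
    by (intro tensor_eq.append tensor_eq.comm tensor_eq.refl) (auto simp: scale_L)
  finally (tensor_eq.trans) show ?case using z by (simp add: scale_def)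
qed (simp add: scale_def tensor_eq.refl)

lemma scale_zero: "l \<in> L \<Longrightarrow> scale \<zero>\<^bsub>K\<^esub> l \<approx> []"
proof (induction l)
  case (Cons z l)
  obtain x y where z: "z = (x, y)" "x \<in> carrier M" "y \<in> carrier N" using Cons.prems by auto
  have "[(\<zero>\<^bsub>M\<^esub>, y)] @ scale \<zero>\<^bsub>K\<^esub> l \<approx> [] @ []"
    using z Cons.prems by (intro tensor_eq.append tensor_eq.zero Cons.IH) auto
  then show ?case using z by (simp add: scale_def)
qed (simp add: scale_def tensor_eq.refl)

lemma scale_one: "l \<in> L \<Longrightarrow> scale \<one>\<^bsub>K\<^esub> l = l"
  by (induction l) (auto simp: scale_def)

lemma scale_scale:
  "c \<in> carrier K \<Longrightarrow> d \<in> carrier K \<Longrightarrow> l \<in> L \<Longrightarrow> scale (c \<otimes>\<^bsub>K\<^esub> d) l = scale c (scale d l)"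
  by (induction l) (auto simp: scale_def M.smult_assoc1)

lemma cls_eqI: "l \<approx> l' \<Longrightarrow> cls l = cls l'"
  using cls_eq_iff teq_L by blast

lemma module_tensor: "module K (tensor K M N)"
proof (rule moduleI)
  let ?T = "tensor K M N"
  show "cring K" by unfold_locales
  show "abelian_group ?T"
  proof (rule abelian_groupI)
    show "\<zero>\<^bsub>?T\<^esub> \<in> carrier ?T" by (simp add: zero_cls cls_closed)
    fix u assume u: "u \<in> carrier ?T"
    then obtain l where l: "l \<in> L" "u = cls l" by (rule carrierE)
    show "\<zero>\<^bsub>?T\<^esub> \<oplus>\<^bsub>?T\<^esub> u = u" using l by (simp add: zero_cls add_cls)
    \<comment> \<open>The negative of a class is its multiple by -1: \<open>scale_add\<close> merges
      it with the list itself, and \<open>scale_zero\<close> empties the result.\<close>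
    let ?m = "scale (\<ominus>\<^bsub>K\<^esub> \<one>\<^bsub>K\<^esub>) l"
    have "?m @ l = ?m @ scale \<one>\<^bsub>K\<^esub> l" using l by (simp add: scale_one)
    also have "tensor_eq K M N (scale (\<ominus>\<^bsub>K\<^esub> \<one>\<^bsub>K\<^esub> \<oplus>\<^bsub>K\<^esub> \<one>\<^bsub>K\<^esub>) l) (?m @ scale \<one>\<^bsub>K\<^esub> l)"
      using l by (intro scale_add) auto
    then have "tensor_eq K M N (?m @ scale \<one>\<^bsub>K\<^esub> l) []"
      using scale_zero[of l] l by (simp add: M.R.l_neg) (meson tensor_eq.sym tensor_eq.trans)
    finally have "cls (?m @ l) = \<zero>\<^bsub>?T\<^esub>" by (simp add: zero_cls cls_eqI)
    then show "\<exists>v \<in> carrier ?T. v \<oplus>\<^bsub>?T\<^esub> u = \<zero>\<^bsub>?T\<^esub>"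
      using l by (intro bexI[of _ "cls ?m"]) (auto simp: add_cls scale_L cls_closed)
    fix v assume v: "v \<in> carrier ?T"
    then obtain m where m: "m \<in> L" "v = cls m" by (rule carrierE)
    show "u \<oplus>\<^bsub>?T\<^esub> v \<in> carrier ?T" using l m by (simp add: add_cls cls_closed)
    show "u \<oplus>\<^bsub>?T\<^esub> v = v \<oplus>\<^bsub>?T\<^esub> u" using l m by (simp add: add_cls cls_eqI tensor_eq.comm)
    fix w assume w: "w \<in> carrier ?T"
    then obtain n where n: "n \<in> L" "w = cls n" by (rule carrierE)
    show "u \<oplus>\<^bsub>?T\<^esub> v \<oplus>\<^bsub>?T\<^esub> w = u \<oplus>\<^bsub>?T\<^esub> (v \<oplus>\<^bsub>?T\<^esub> w)" using l m n by (simp add: add_cls)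
  qed
  fix c u assume c: "c \<in> carrier K" and u: "u \<in> carrier ?T"
  from u obtain l where l: "l \<in> L" "u = cls l" by (rule carrierE)
  show "c \<odot>\<^bsub>?T\<^esub> u \<in> carrier ?T" using c l by (simp add: smult_cls scale_L cls_closed)
  fix d assume d: "d \<in> carrier K"
    show "(c \<oplus>\<^bsub>K\<^esub> d) \<odot>\<^bsub>?T\<^esub> u = c \<odot>\<^bsub>?T\<^esub> u \<oplus>\<^bsub>?T\<^esub> d \<odot>\<^bsub>?T\<^esub> u"
      using c d l by (simp add: smult_cls add_cls scale_L cls_eqI scale_add)
    show "(c \<otimes>\<^bsub>K\<^esub> d) \<odot>\<^bsub>?T\<^esub> u = c \<odot>\<^bsub>?T\<^esub> (d \<odot>\<^bsub>?T\<^esub> u)"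
      using c d l by (simp add: smult_cls scale_L scale_scale)
next
  let ?T = "tensor K M N"
  fix u assume "u \<in> carrier ?T"
  then obtain l where "l \<in> L" "u = cls l" by (rule carrierE)
  then show "\<one>\<^bsub>K\<^esub> \<odot>\<^bsub>?T\<^esub> u = u" by (simp add: smult_cls scale_one)
next
  let ?T = "tensor K M N"
  fix c u v assume c: "c \<in> carrier K" and "u \<in> carrier ?T" "v \<in> carrier ?T"
  then obtain l m where l: "l \<in> L" "u = cls l" and m: "m \<in> L" "v = cls m" by (auto elim!: carrierE)
  show "c \<odot>\<^bsub>?T\<^esub> (u \<oplus>\<^bsub>?T\<^esub> v) = c \<odot>\<^bsub>?T\<^esub> u \<oplus>\<^bsub>?T\<^esub> c \<odot>\<^bsub>?T\<^esub> v"
    using c l m by (simp add: smult_cls add_cls scale_L)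
qed

lemma bilinear_pure: "bilinear K M N (tensor K M N) (pure_tensor K M N)"
proof -
  \<comment> \<open>Scalars act on left factors by definition, so linearity in the right factor has
    to pass through the relation \<open>balanced\<close>.\<close>
  have sw: "cls [(x, c \<odot>\<^bsub>N\<^esub> y)] = c \<odot>\<^bsub>tensor K M N\<^esub> cls [(x, y)]"
    if "x \<in> carrier M" "y \<in> carrier N" "c \<in> carrier K" for x y c
    using that by (simp add: smult_cls scale_def) (metis cls_eqI tensor_eq.balanced)
  show ?thesis
    unfolding bilinear_def pure_tensor_def
    by (intro conjI ballI linI module_tensor M.module_axioms N.module_axioms)
      (auto simp: sw smult_cls add_cls cls_closed scale_def
        intro!: cls_eqI tensor_eq.add_left tensor_eq.add_right)
qed

text \<open>Each defining relation of the tensor product preserves the sum of the values of a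
  bilinear map along a list. This invariance lets \<open>tensor_lift\<close>, which folds over the
  chosen representative, be computed on any list of the class.\<close>

lemma foldr_teq:
  assumes b: "bilinear K M N P \<beta>" and P: "module K P"
  defines "S \<equiv> \<lambda>l. foldr (\<lambda>(x, y) s. \<beta> x y \<oplus>\<^bsub>P\<^esub> s) l \<zero>\<^bsub>P\<^esub>"
  shows "l \<in> L \<Longrightarrow> S l \<in> carrier P"
    and "l \<in> L \<Longrightarrow> m \<in> L \<Longrightarrow> S (l @ m) = S l \<oplus>\<^bsub>P\<^esub> S m"
    and "l \<in> L \<Longrightarrow> c \<in> carrier K \<Longrightarrow> S (scale c l) = c \<odot>\<^bsub>P\<^esub> S l"
    and "l \<approx> l' \<Longrightarrow> S l = S l'"
proof -
  interpret P: module K P by fact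
  have \<beta>: "x \<in> carrier M \<Longrightarrow> y \<in> carrier N \<Longrightarrow> \<beta> x y \<in> carrier P" for x y
    by (rule bilinear_closed[OF b])
  show 1: "l \<in> L \<Longrightarrow> S l \<in> carrier P" for l
    unfolding S_def by (induction l) (auto simp: \<beta>)
  show 2: "l \<in> L \<Longrightarrow> m \<in> L \<Longrightarrow> S (l @ m) = S l \<oplus>\<^bsub>P\<^esub> S m" for l m
  proof (induction l)
    case Nil then show ?case using 1[of m] by (simp add: S_def)
  next
    case (Cons z l)
    have "S l \<in> carrier P" "S m \<in> carrier P" using 1 Cons by auto
    then show ?case using Cons \<beta> by (auto simp: S_def P.M.a_assoc split: prod.splits)
  qed
  show "l \<in> L \<Longrightarrow> c \<in> carrier K \<Longrightarrow> S (scale c l) = c \<odot>\<^bsub>P\<^esub> S l"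
  proof (induction l)
    case (Cons z l)
    obtain x y where z: "z = (x, y)" "x \<in> carrier M" "y \<in> carrier N" using Cons.prems by auto
    have "S l \<in> carrier P" using 1 Cons by auto
    then show ?case using Cons z \<beta> lin_smult[OF bilinear_left[OF b z(3)], of c x]
      by (auto simp: S_def scale_def P.smult_r_distr)
  qed (simp add: S_def scale_def)
  show "l \<approx> l' \<Longrightarrow> S l = S l'"
  proof (induction rule: tensor_eq.induct)
    case (append l l' m m')
    then show ?case using 2 teq_L by metis
  next
    case (comm l m)
    then show ?case using 1 2 by (simp add: P.M.a_comm)
  next
    case (zero y)
    then show ?case using lin_zero[OF bilinear_left[OF b]] by (simp add: S_def)
  next
    case (add_left x x' y)
    then show ?case using lin_add[OF bilinear_left[OF b]] \<beta> by (simp add: S_def)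
  next
    case (add_right x y y')
    then show ?case using lin_add[OF bilinear_right[OF b]] \<beta> by (simp add: S_def)
  next
    case (balanced c x y)
    then show ?case using lin_smult[OF bilinear_left[OF b]] lin_smult[OF bilinear_right[OF b]]
      by (simp add: S_def)
  qed auto
qed

lemma tensor_sum_tensor:
  "tensor_sum K {()} (\<lambda>_. M) (\<lambda>_. N) (tensor K M N) (\<lambda>_. pure_tensor K M N)
    (\<lambda>P \<beta>. tensor_lift P (\<beta> ()))"
  unfolding tensor_sum_def
proof (intro conjI allI impI ballI; (elim conjE)?)
  let ?T = "tensor K M N"
  show "module K ?T" by (rule module_tensor)
  show "bilinear K M N ?T (pure_tensor K M N)" by (rule bilinear_pure)
  fix Q assume Q: "\<zero>\<^bsub>?T\<^esub> \<in> Q"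
    "\<forall>j \<in> {()}. \<forall>x\<in>carrier M. \<forall>y\<in>carrier N. pure_tensor K M N x y \<in> Q"
    "\<forall>u\<in>Q \<inter> carrier ?T. \<forall>v\<in>Q \<inter> carrier ?T. u \<oplus>\<^bsub>?T\<^esub> v \<in> Q"
  show "carrier ?T \<subseteq> Q"
  proof
    fix u assume "u \<in> carrier ?T"
    then obtain l where "l \<in> L" "u = cls l" by (rule carrierE)
    moreover have "l \<in> L \<Longrightarrow> cls l \<in> Q"
    proof (induction l)
      case Nil then show ?case using Q(1) by (simp add: zero_cls)
    next
      case (Cons z l)
      then have "cls [z] \<in> Q \<inter> carrier ?T" "cls l \<in> Q \<inter> carrier ?T"
        using Q(2) by (auto simp: pure_tensor_def cls_closed)
      then have "cls [z] \<oplus>\<^bsub>?T\<^esub> cls l \<in> Q" using Q(3) by blast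
      then show ?case using Cons.prems by (subst (asm) add_cls) auto
    qed
    ultimately show "u \<in> Q" by simp
  qed
next
  let ?T = "tensor K M N"
  fix P \<beta> assume P: "module K P" and "\<forall>j\<in>{()}. bilinear K M N P (\<beta> j)"
  then have b: "bilinear K M N P (\<beta> ())" by simp
  interpret P: module K P by fact
  note S = foldr_teq[OF b P]
  \<comment> \<open>Replaces the chosen representative by an arbitrary list, on which linearity is
    visible.\<close>
  have c: "tensor_lift P (\<beta> ()) (cls l) = foldr (\<lambda>(x, y) s. \<beta> () x y \<oplus>\<^bsub>P\<^esub> s) l \<zero>\<^bsub>P\<^esub>" if "l \<in> L" for l
    using S(4)[OF formal_cls[OF that]] by (simp add: tensor_lift_def)
  show "lin K ?T P (tensor_lift P (\<beta> ()))"
    by (rule linI[OF module_tensor P]; (erule carrierE)+)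
      (simp_all add: c S add_cls smult_cls scale_L del: foldr_append)
  fix j x y assume "j \<in> {()}" "x \<in> carrier M" "y \<in> carrier N"
  then show "tensor_lift P (\<beta> ()) (pure_tensor K M N x y) = \<beta> j x y"
    using lin_closed[OF bilinear_left[OF b]] by (simp add: pure_tensor_def c)
qed

end

section \<open>Direct sums\<close>

text \<open>The pair \<open>fam\<close>, \<open>unfam\<close> stands for \<open>Graded\<close>,
  \<open>graded\<close> or for \<open>Indexed\<close>, \<open>indexed\<close>, so that sums over
  degrees and sums over subsets share one treatment.\<close>

locale direct_sum_modules =
  fixes K :: "'k ring" and fam :: "('i \<Rightarrow> 'u) \<Rightarrow> 'u" and unfam :: "'u \<Rightarrow> 'i \<Rightarrow> 'u"
    and I :: "'i set" and M :: "'i \<Rightarrow> ('k, 'u) module"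
  assumes unfam_fam [simp]: "unfam (fam f) = f"
    and K: "cring K"
    and modules: "i \<in> I \<Longrightarrow> module K (M i)"
begin

abbreviation "DS \<equiv> direct_sum fam unfam I M"

definition supp where "supp u = {i \<in> I. unfam u i \<noteq> \<zero>\<^bsub>M i\<^esub>}"

definition inj where "inj i x = fam (\<lambda>j \<in> I. if j = i then x else \<zero>\<^bsub>M j\<^esub>)"

lemma DS_carrier_iff:
  "u \<in> carrier DS \<longleftrightarrow> u \<in> range fam \<and> unfam u \<in> (\<Pi>\<^sub>E i \<in> I. carrier (M i)) \<and> finite (supp u)"
  by (auto simp: direct_sum_def supp_def)

lemma DS_component: "u \<in> carrier DS \<Longrightarrow> i \<in> I \<Longrightarrow> unfam u i \<in> carrier (M i)"
  by (auto simp: DS_carrier_iff)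

lemma DS_finite_supp: "u \<in> carrier DS \<Longrightarrow> finite (supp u)"
  by (auto simp: DS_carrier_iff)

lemma DS_eqI:
  assumes "u \<in> carrier DS" "v \<in> carrier DS" "\<And>i. i \<in> I \<Longrightarrow> unfam u i = unfam v i" shows "u = v"
proof -
  have "unfam u = unfam v" using assms by (intro PiE_ext[of _ I]) (auto simp: DS_carrier_iff)
  then show ?thesis using assms by (auto simp: DS_carrier_iff)
qed

lemma DS_famI:
  assumes "\<And>i. i \<in> I \<Longrightarrow> f i \<in> carrier (M i)" "finite {i \<in> I. f i \<noteq> \<zero>\<^bsub>M i\<^esub>}"
  shows "fam (\<lambda>i \<in> I. f i) \<in> carrier DS"
proof -
  have "{i \<in> I. (\<lambda>i \<in> I. f i) i \<noteq> \<zero>\<^bsub>M i\<^esub>} = {i \<in> I. f i \<noteq> \<zero>\<^bsub>M i\<^esub>}" by auto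
  with assms show ?thesis by (auto simp: DS_carrier_iff supp_def)
qed

lemma unfam_zero: "i \<in> I \<Longrightarrow> unfam \<zero>\<^bsub>DS\<^esub> i = \<zero>\<^bsub>M i\<^esub>"
  and unfam_add: "i \<in> I \<Longrightarrow> unfam (u \<oplus>\<^bsub>DS\<^esub> v) i = unfam u i \<oplus>\<^bsub>M i\<^esub> unfam v i"
  and unfam_smult: "i \<in> I \<Longrightarrow> unfam (c \<odot>\<^bsub>DS\<^esub> u) i = c \<odot>\<^bsub>M i\<^esub> unfam u i"
  by (simp_all add: direct_sum_def)

lemma DS_closed:
  shows DS_zero_closed: "\<zero>\<^bsub>DS\<^esub> \<in> carrier DS"
    and DS_add_closed: "u \<in> carrier DS \<Longrightarrow> v \<in> carrier DS \<Longrightarrow> u \<oplus>\<^bsub>DS\<^esub> v \<in> carrier DS"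
    and DS_smult_closed: "c \<in> carrier K \<Longrightarrow> u \<in> carrier DS \<Longrightarrow> c \<odot>\<^bsub>DS\<^esub> u \<in> carrier DS"
proof -
  have "fam (\<lambda>i \<in> I. \<zero>\<^bsub>M i\<^esub>) \<in> carrier DS"
    using modules by (intro DS_famI) (auto intro: module_zero_closed)
  then show "\<zero>\<^bsub>DS\<^esub> \<in> carrier DS" by (simp add: direct_sum_def)
  { assume u: "u \<in> carrier DS" and v: "v \<in> carrier DS"
    have "\<zero>\<^bsub>M i\<^esub> \<oplus>\<^bsub>M i\<^esub> \<zero>\<^bsub>M i\<^esub> = \<zero>\<^bsub>M i\<^esub>" if "i \<in> I" for i
    proof - interpret module K "M i" using modules that by simp show ?thesis by simp qed
    then have "{i \<in> I. unfam u i \<oplus>\<^bsub>M i\<^esub> unfam v i \<noteq> \<zero>\<^bsub>M i\<^esub>} \<subseteq> supp u \<union> supp v"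
      by (auto simp: supp_def)
    then have "fam (\<lambda>i \<in> I. unfam u i \<oplus>\<^bsub>M i\<^esub> unfam v i) \<in> carrier DS"
      using u v by (intro DS_famI)
        (auto intro: module_add_closed[OF modules] DS_component finite_subset simp: DS_finite_supp)
    then show "u \<oplus>\<^bsub>DS\<^esub> v \<in> carrier DS" by (simp add: direct_sum_def) }
  { assume c: "c \<in> carrier K" and u: "u \<in> carrier DS"
    have "c \<odot>\<^bsub>M i\<^esub> \<zero>\<^bsub>M i\<^esub> = \<zero>\<^bsub>M i\<^esub>" if "i \<in> I" for i
    proof - interpret module K "M i" using modules that by simp show ?thesis using c by simp qed
    then have "{i \<in> I. c \<odot>\<^bsub>M i\<^esub> unfam u i \<noteq> \<zero>\<^bsub>M i\<^esub>} \<subseteq> supp u"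
      by (auto simp: supp_def)
    then have "fam (\<lambda>i \<in> I. c \<odot>\<^bsub>M i\<^esub> unfam u i) \<in> carrier DS"
      using c u by (intro DS_famI)
        (auto intro: module_smult_closed[OF modules] DS_component finite_subset simp: DS_finite_supp)
    then show "c \<odot>\<^bsub>DS\<^esub> u \<in> carrier DS" by (simp add: direct_sum_def) }
qed

lemma module_DS: "module K DS"
proof (rule moduleI[OF K], rule abelian_groupI)
  note [simp] = DS_closed unfam_add unfam_zero unfam_smult
  interpret K: cring K by (rule K)
  have M: "\<zero>\<^bsub>M i\<^esub> \<oplus>\<^bsub>M i\<^esub> unfam u i = unfam u i" "\<one>\<^bsub>K\<^esub> \<odot>\<^bsub>M i\<^esub> unfam u i = unfam u i"
    "unfam u i \<oplus>\<^bsub>M i\<^esub> unfam v i \<oplus>\<^bsub>M i\<^esub> unfam w i = unfam u i \<oplus>\<^bsub>M i\<^esub> (unfam v i \<oplus>\<^bsub>M i\<^esub> unfam w i)"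
    "unfam u i \<oplus>\<^bsub>M i\<^esub> unfam v i = unfam v i \<oplus>\<^bsub>M i\<^esub> unfam u i"
    "(\<ominus>\<^bsub>K\<^esub> \<one>\<^bsub>K\<^esub>) \<odot>\<^bsub>M i\<^esub> unfam u i \<oplus>\<^bsub>M i\<^esub> unfam u i = \<zero>\<^bsub>M i\<^esub>"
    "c \<in> carrier K \<Longrightarrow> d \<in> carrier K \<Longrightarrow>
      (c \<oplus>\<^bsub>K\<^esub> d) \<odot>\<^bsub>M i\<^esub> unfam u i = c \<odot>\<^bsub>M i\<^esub> unfam u i \<oplus>\<^bsub>M i\<^esub> d \<odot>\<^bsub>M i\<^esub> unfam u i"
    "c \<in> carrier K \<Longrightarrow> d \<in> carrier K \<Longrightarrow> (c \<otimes>\<^bsub>K\<^esub> d) \<odot>\<^bsub>M i\<^esub> unfam u i = c \<odot>\<^bsub>M i\<^esub> (d \<odot>\<^bsub>M i\<^esub> unfam u i)"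
    "c \<in> carrier K \<Longrightarrow> c \<odot>\<^bsub>M i\<^esub> (unfam u i \<oplus>\<^bsub>M i\<^esub> unfam v i) = c \<odot>\<^bsub>M i\<^esub> unfam u i \<oplus>\<^bsub>M i\<^esub> c \<odot>\<^bsub>M i\<^esub> unfam v i"
    if "i \<in> I" "u \<in> carrier DS" "v \<in> carrier DS" "w \<in> carrier DS" for i u v w c d
  proof -
    interpret module K "M i" using modules that by simp
    note [simp] = that DS_component
    show "\<zero>\<^bsub>M i\<^esub> \<oplus>\<^bsub>M i\<^esub> unfam u i = unfam u i" "\<one>\<^bsub>K\<^esub> \<odot>\<^bsub>M i\<^esub> unfam u i = unfam u i"
      by simp_all
    show "unfam u i \<oplus>\<^bsub>M i\<^esub> unfam v i \<oplus>\<^bsub>M i\<^esub> unfam w i = unfam u i \<oplus>\<^bsub>M i\<^esub> (unfam v i \<oplus>\<^bsub>M i\<^esub> unfam w i)"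
      "unfam u i \<oplus>\<^bsub>M i\<^esub> unfam v i = unfam v i \<oplus>\<^bsub>M i\<^esub> unfam u i" by (simp_all add: M.add.m_ac)
    show "(\<ominus>\<^bsub>K\<^esub> \<one>\<^bsub>K\<^esub>) \<odot>\<^bsub>M i\<^esub> unfam u i \<oplus>\<^bsub>M i\<^esub> unfam u i = \<zero>\<^bsub>M i\<^esub>"
      by (simp add: smult_l_minus M.l_neg)
  qed (use that in \<open>auto simp: module.smult_l_distr[OF modules] module.smult_assoc1[OF modules]
      module.smult_r_distr[OF modules] DS_component\<close>)
  fix u assume u: "u \<in> carrier DS"
  show "\<zero>\<^bsub>DS\<^esub> \<oplus>\<^bsub>DS\<^esub> u = u" by (rule DS_eqI) (use u in \<open>simp_all add: M\<close>)
  show "\<exists>v \<in> carrier DS. v \<oplus>\<^bsub>DS\<^esub> u = \<zero>\<^bsub>DS\<^esub>"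
    by (rule bexI[of _ "(\<ominus>\<^bsub>K\<^esub> \<one>\<^bsub>K\<^esub>) \<odot>\<^bsub>DS\<^esub> u"], rule DS_eqI) (use u in \<open>simp_all add: M\<close>)
  show "\<one>\<^bsub>K\<^esub> \<odot>\<^bsub>DS\<^esub> u = u" by (rule DS_eqI) (use u in \<open>simp_all add: M\<close>)
  fix v assume v: "v \<in> carrier DS"
  show "u \<oplus>\<^bsub>DS\<^esub> v = v \<oplus>\<^bsub>DS\<^esub> u" by (rule DS_eqI) (use u v in \<open>simp_all add: M\<close>)
  fix w assume w: "w \<in> carrier DS"
  show "u \<oplus>\<^bsub>DS\<^esub> v \<oplus>\<^bsub>DS\<^esub> w = u \<oplus>\<^bsub>DS\<^esub> (v \<oplus>\<^bsub>DS\<^esub> w)" 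
    by (rule DS_eqI) (use u v w in \<open>simp_all add: M\<close>)
next
  note [simp] = DS_closed unfam_add unfam_zero unfam_smult
  interpret K: cring K by (rule K)
  fix c u assume c: "c \<in> carrier K" and u: "u \<in> carrier DS"
  fix d assume d: "d \<in> carrier K"
  show "(c \<oplus>\<^bsub>K\<^esub> d) \<odot>\<^bsub>DS\<^esub> u = c \<odot>\<^bsub>DS\<^esub> u \<oplus>\<^bsub>DS\<^esub> d \<odot>\<^bsub>DS\<^esub> u"
    by (rule DS_eqI) (use u c d in \<open>simp_all add: module.smult_l_distr[OF modules] DS_component\<close>)
  show "(c \<otimes>\<^bsub>K\<^esub> d) \<odot>\<^bsub>DS\<^esub> u = c \<odot>\<^bsub>DS\<^esub> (d \<odot>\<^bsub>DS\<^esub> u)"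
    by (rule DS_eqI) (use u c d in \<open>simp_all add: module.smult_assoc1[OF modules] DS_component\<close>)
next
  note [simp] = DS_closed unfam_add unfam_zero unfam_smult
  fix c u v assume "c \<in> carrier K" "u \<in> carrier DS" "v \<in> carrier DS"
  then show "c \<odot>\<^bsub>DS\<^esub> (u \<oplus>\<^bsub>DS\<^esub> v) = c \<odot>\<^bsub>DS\<^esub> u \<oplus>\<^bsub>DS\<^esub> c \<odot>\<^bsub>DS\<^esub> v"
    by - (rule DS_eqI, simp_all add: module.smult_r_distr[OF modules] DS_component)
qed (simp_all add: DS_closed)

lemma inj_closed: "i \<in> I \<Longrightarrow> x \<in> carrier (M i) \<Longrightarrow> inj i x \<in> carrier DS"
  unfolding inj_def
  by (intro DS_famI) (auto intro: module_zero_closed[OF modules] finite_subset[of _ "{i}"])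

lemma unfam_inj: "j \<in> I \<Longrightarrow> unfam (inj i x) j = (if j = i then x else \<zero>\<^bsub>M j\<^esub>)"
  by (simp add: inj_def)

lemma lin_inj: assumes "i \<in> I" shows "lin K (M i) DS (inj i)"
proof (rule linI[OF modules[OF assms] module_DS inj_closed[OF assms]])
  fix x y assume x: "x \<in> carrier (M i)" "y \<in> carrier (M i)"
  then have "x \<oplus>\<^bsub>M i\<^esub> y \<in> carrier (M i)" by (simp add: module_add_closed[OF modules[OF assms]])
  then show "inj i (x \<oplus>\<^bsub>M i\<^esub> y) = inj i x \<oplus>\<^bsub>DS\<^esub> inj i y"
    using x assms
    by - (rule DS_eqI, auto simp: inj_closed DS_add_closed unfam_add unfam_inj
        module_zero_closed[OF modules]
        abelian_monoid.l_zero[OF abelian_group.axioms(1)[OF module.axioms(2)[OF modules]]])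
next
  fix c x assume c: "c \<in> carrier K" "x \<in> carrier (M i)"
  then have "c \<odot>\<^bsub>M i\<^esub> x \<in> carrier (M i)" by (simp add: module_smult_closed[OF modules[OF assms]])
  then show "inj i (c \<odot>\<^bsub>M i\<^esub> x) = c \<odot>\<^bsub>DS\<^esub> inj i x"
    using c assms
    by - (rule DS_eqI, auto simp: inj_closed DS_smult_closed unfam_smult unfam_inj
        module.smult_r_null[OF modules])
qed

lemma lin_unfam: "i \<in> I \<Longrightarrow> lin K DS (M i) (\<lambda>u. unfam u i)"
  by (rule linI) (auto simp: module_DS modules DS_component unfam_add unfam_smult)

text \<open>Any finite set between the support and \<open>I\<close> may be used: the support itself
  for induction over elements, and all subsets of a finite set for the oplax structure.\<close>

lemma DS_decomp: 
  assumes u: "u \<in> carrier DS" and A: "finite A" "supp u \<subseteq> A" "A \<subseteq> I"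
  shows "u = (\<Oplus>\<^bsub>DS\<^esub>i\<in>A. inj i (unfam u i))"
proof -
  interpret D: module K DS by (rule module_DS)
  have cl: "(\<lambda>i. inj i (unfam u i)) \<in> A \<rightarrow> carrier DS"
    using u A by (auto intro!: inj_closed DS_component)
  show ?thesis
  proof (rule DS_eqI[OF u])
    show "(\<Oplus>\<^bsub>DS\<^esub>i\<in>A. inj i (unfam u i)) \<in> carrier DS"
      using cl by (rule D.M.finsum_closed)
    fix j assume j: "j \<in> I"
    interpret Mj: module K "M j" by (rule modules[OF j])
    have uj: "unfam u j \<in> carrier (M j)" using u j by (rule DS_component)
    have "unfam (\<Oplus>\<^bsub>DS\<^esub>i\<in>A. inj i (unfam u i)) j
        = (\<Oplus>\<^bsub>M j\<^esub>i\<in>A. unfam (inj i (unfam u i)) j)"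
      using lin_finsum[OF lin_unfam[OF j] cl] .
    also have "\<dots> = (\<Oplus>\<^bsub>M j\<^esub>i\<in>A. if j = i then unfam u i else \<zero>\<^bsub>M j\<^esub>)"
      using j uj by (intro Mj.M.finsum_cong') (auto simp: unfam_inj)
    also have "\<dots> = unfam u j"
    proof (cases "j \<in> A")
      case True
      moreover have "(\<lambda>i. if j = i then unfam u i else \<zero>\<^bsub>M j\<^esub>)
          = (\<lambda>i. if j = i then unfam u j else \<zero>\<^bsub>M j\<^esub>)" by auto
      ultimately show ?thesis using Mj.M.finsum_singleton[of j A "\<lambda>_. unfam u j"] A uj by simp
    next
      case False
      then have "unfam u j = \<zero>\<^bsub>M j\<^esub>" using A j by (auto simp: supp_def)
      moreover have "(\<Oplus>\<^bsub>M j\<^esub>i\<in>A. if j = i then unfam u i else \<zero>\<^bsub>M j\<^esub>) = (\<Oplus>\<^bsub>M j\<^esub>i\<in>A. \<zero>\<^bsub>M j\<^esub>)"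
        using False by (intro Mj.M.finsum_cong') auto
      ultimately show ?thesis by (simp add: Mj.M.finsum_zero)
    qed
    finally show "unfam u j = unfam (\<Oplus>\<^bsub>DS\<^esub>i\<in>A. inj i (unfam u i)) j" by simp
  qed
qed

text \<open>Summing over the support keeps the sum finite when the index set is infinite, as it is
  for degrees.\<close>

definition lift where
  "lift P \<phi> u = (\<Oplus>\<^bsub>P\<^esub>i \<in> supp u. \<phi> i (unfam u i))"

text \<open>Different elements have different supports. Enlarging them to a common finite set adds
  only zero terms and makes the sums comparable, which is what additivity of \<open>lift\<close>
  needs.\<close>

lemma lift_superset:
  assumes "\<And>i. i \<in> I \<Longrightarrow> lin K (M i) P (\<phi> i)" "module K P" "u \<in> carrier DS"
    and "finite A" "supp u \<subseteq> A" "A \<subseteq> I"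
  shows "lift P \<phi> u = (\<Oplus>\<^bsub>P\<^esub>i \<in> A. \<phi> i (unfam u i))"
proof -
  interpret P: module K P by fact
  have z: "\<phi> i (unfam u i) = \<zero>\<^bsub>P\<^esub>" if "i \<in> A - supp u" for i
    using that assms(6) lin_zero[OF assms(1)] by (auto simp: supp_def)
  show ?thesis unfolding lift_def
    by (rule P.M.add.finprod_mono_neutral_cong_left)
      (use z assms lin_closed[OF assms(1)] in \<open>auto simp: subset_iff DS_component\<close>)
qed

lemma lin_lift:
  assumes \<phi>: "\<And>i. i \<in> I \<Longrightarrow> lin K (M i) P (\<phi> i)" and P: "module K P"
  shows "lin K DS P (lift P \<phi>)"
    and "i \<in> I \<Longrightarrow> x \<in> carrier (M i) \<Longrightarrow> lift P \<phi> (inj i x) = \<phi> i x"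
proof -
  interpret P: module K P by fact
  interpret D: module K DS by (rule module_DS)
  note sup = lift_superset[OF \<phi> P]
  have cl: "(\<lambda>i. \<phi> i (unfam u i)) \<in> A \<rightarrow> carrier P" if "u \<in> carrier DS" "A \<subseteq> I" for u A
    using that lin_closed[OF \<phi>] by (auto simp: subset_iff DS_component)
  have sI: "supp u \<subseteq> I" for u by (auto simp: supp_def)
  show "lin K DS P (lift P \<phi>)"
  proof (rule linI[OF module_DS P])
    fix u assume u: "u \<in> carrier DS"
    show "lift P \<phi> u \<in> carrier P" unfolding lift_def by (rule P.M.finsum_closed) (rule cl[OF u sI])
    { fix c assume c: "c \<in> carrier K"
      have "supp (c \<odot>\<^bsub>DS\<^esub> u) \<subseteq> supp u" using c
        by (auto simp: supp_def unfam_smult module.smult_r_null[OF modules])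
      then have "lift P \<phi> (c \<odot>\<^bsub>DS\<^esub> u) = (\<Oplus>\<^bsub>P\<^esub>i \<in> supp u. \<phi> i (unfam (c \<odot>\<^bsub>DS\<^esub> u) i))"
        using u c by (intro sup) (auto simp: DS_finite_supp sI)
      also have "\<dots> = (\<Oplus>\<^bsub>P\<^esub>i \<in> supp u. c \<odot>\<^bsub>P\<^esub> \<phi> i (unfam u i))"
        using sI[of u] u c lin_closed[OF \<phi>] lin_smult[OF \<phi>]
        by (intro P.M.finsum_cong') (auto simp: unfam_smult DS_component subset_iff)
      also have "\<dots> = c \<odot>\<^bsub>P\<^esub> lift P \<phi> u" unfolding lift_def
        by (rule lin_finsum[OF lin_scale[OF lin_id[OF P] c], symmetric]) (rule cl[OF u sI])
      finally show "lift P \<phi> (c \<odot>\<^bsub>DS\<^esub> u) = c \<odot>\<^bsub>P\<^esub> lift P \<phi> u" . }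
    fix v assume v: "v \<in> carrier DS"
    \<comment> \<open>With the support of the sum included in the union, all three lifts can be
      written over the same set at once.\<close>
    let ?A = "supp u \<union> supp v \<union> supp (u \<oplus>\<^bsub>DS\<^esub> v)"
    have A: "finite ?A" "?A \<subseteq> I" using u v sI by (simp_all add: DS_finite_supp DS_add_closed)
    have "lift P \<phi> (u \<oplus>\<^bsub>DS\<^esub> v) = (\<Oplus>\<^bsub>P\<^esub>i \<in> ?A. \<phi> i (unfam (u \<oplus>\<^bsub>DS\<^esub> v) i))"
      using A u v by (intro sup) (auto simp: DS_add_closed)
    also have "\<dots> = (\<Oplus>\<^bsub>P\<^esub>i \<in> ?A. \<phi> i (unfam u i) \<oplus>\<^bsub>P\<^esub> \<phi> i (unfam v i))"
      using A(2) u v lin_closed[OF \<phi>] lin_add[OF \<phi>]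
      by (intro P.M.finsum_cong') (auto simp: unfam_add DS_component subset_iff)
    also have "\<dots> = (\<Oplus>\<^bsub>P\<^esub>i \<in> ?A. \<phi> i (unfam u i)) \<oplus>\<^bsub>P\<^esub> (\<Oplus>\<^bsub>P\<^esub>i \<in> ?A. \<phi> i (unfam v i))"
      by (intro P.M.finsum_addf cl A u v)
    also have "\<dots> = lift P \<phi> u \<oplus>\<^bsub>P\<^esub> lift P \<phi> v"
      using A u v by (subst (1 2) sup[of _ ?A]) auto
    finally show "lift P \<phi> (u \<oplus>\<^bsub>DS\<^esub> v) = lift P \<phi> u \<oplus>\<^bsub>P\<^esub> lift P \<phi> v" .
  qed
  assume i: "i \<in> I" and x: "x \<in> carrier (M i)"
  have "lift P \<phi> (inj i x) = (\<Oplus>\<^bsub>P\<^esub>j \<in> {i}. \<phi> j (unfam (inj i x) j))"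
    using i x by (intro sup) (auto simp: inj_closed supp_def unfam_inj split: if_splits)
  also have "\<dots> = \<phi> i x" using i x lin_closed[OF \<phi>[OF i] x] by (simp add: unfam_inj)
  finally show "lift P \<phi> (inj i x) = \<phi> i x" .
qed

lemma DS_subsetI:
  assumes "\<zero>\<^bsub>DS\<^esub> \<in> Q" "\<And>i x. i \<in> I \<Longrightarrow> x \<in> carrier (M i) \<Longrightarrow> inj i x \<in> Q"
    and "\<And>u v. u \<in> carrier DS \<Longrightarrow> v \<in> carrier DS \<Longrightarrow> u \<in> Q \<Longrightarrow> v \<in> Q \<Longrightarrow> u \<oplus>\<^bsub>DS\<^esub> v \<in> Q"
  shows "carrier DS \<subseteq> Q"
proof
  fix u assume u: "u \<in> carrier DS"
  interpret D: module K DS by (rule module_DS)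
  have "A \<subseteq> I \<Longrightarrow> (\<Oplus>\<^bsub>DS\<^esub>i\<in>A. inj i (unfam u i)) \<in> Q" if "finite A" for A
    using that
  proof (induction A)
    case (insert a A)
    then have c: "(\<lambda>i. inj i (unfam u i)) \<in> A \<rightarrow> carrier DS" "inj a (unfam u a) \<in> carrier DS"
      using u by (auto intro!: inj_closed DS_component)
    then show ?case using insert u
      by (simp add: D.M.finsum_insert D.M.finsum_closed assms DS_component)
  qed (simp add: assms(1))
  then have "(\<Oplus>\<^bsub>DS\<^esub>i\<in>supp u. inj i (unfam u i)) \<in> Q"
    using DS_finite_supp[OF u] by (auto simp: supp_def)
  then show "u \<in> Q" using DS_decomp[OF u DS_finite_supp[OF u]] by (simp add: supp_def)
qed

text \<open>Every element of a direct sum is a sum of injected elements, and each summand is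
  generated by its own bilinear families; so the disjoint union of the index sets generates the
  direct sum. This is applied over degrees and then over subsets.\<close>

lemma tensor_sum_DS:
  assumes ts: "\<And>i. i \<in> I \<Longrightarrow> tensor_sum K (J i) (X i) (Y i) (M i) (\<tau> i) (\<Lambda> i)"
  shows "tensor_sum K (Sigma I J) (\<lambda>(i, j). X i j) (\<lambda>(i, j). Y i j) DS
    (\<lambda>(i, j) x y. inj i (\<tau> i j x y)) (\<lambda>P \<beta>. lift P (\<lambda>i. \<Lambda> i P (\<lambda>j. \<beta> (i, j))))"
  unfolding tensor_sum_def
proof (intro conjI allI impI ballI; (elim conjE)?)
  show "module K DS" by (rule module_DS)
next
  fix ij assume "ij \<in> Sigma I J"
  then obtain i j where ij: "ij = (i, j)" "i \<in> I" "j \<in> J i" by auto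
  show "bilinear K (case ij of (i, j) \<Rightarrow> X i j) (case ij of (i, j) \<Rightarrow> Y i j) DS
      (case ij of (i, j) \<Rightarrow> \<lambda>x y. inj i (\<tau> i j x y))"
    using bilinear_comp[OF tensor_sum_bilinear[OF ts[OF ij(2)] ij(3)] lin_inj[OF ij(2)]] ij by simp
next
  fix Q assume Q: "\<zero>\<^bsub>DS\<^esub> \<in> Q"
    "\<forall>u \<in> Q \<inter> carrier DS. \<forall>v \<in> Q \<inter> carrier DS. u \<oplus>\<^bsub>DS\<^esub> v \<in> Q"
    "\<forall>ij\<in>Sigma I J. \<forall>x\<in>carrier (case ij of (i, j) \<Rightarrow> X i j). \<forall>y\<in>carrier (case ij of (i, j) \<Rightarrow> Y i j).
      (case ij of (i, j) \<Rightarrow> \<lambda>x y. inj i (\<tau> i j x y)) x y \<in> Q"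
  show "carrier DS \<subseteq> Q"
  proof (rule DS_subsetI)
    fix i x assume i: "i \<in> I" and x: "x \<in> carrier (M i)"
    show "inj i x \<in> Q"
      by (rule tensor_sum_induct[OF ts[OF i] x])
        (use Q i in \<open>auto simp: lin_zero[OF lin_inj] lin_add[OF lin_inj] inj_closed\<close>)
  qed (use Q in auto)
next
  fix P \<beta>
  assume P: "module K P" and b: "\<forall>ij \<in> Sigma I J. bilinear K (case ij of (i, j) \<Rightarrow> X i j)
    (case ij of (i, j) \<Rightarrow> Y i j) P (\<beta> ij)"
  have L: "lin K (M i) P (\<Lambda> i P (\<lambda>j. \<beta> (i, j)))"
    "\<And>j x y. j \<in> J i \<Longrightarrow> x \<in> carrier (X i j) \<Longrightarrow> y \<in> carrier (Y i j) \<Longrightarrow>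
      \<Lambda> i P (\<lambda>j. \<beta> (i, j)) (\<tau> i j x y) = \<beta> (i, j) x y" if i: "i \<in> I" for i
    using tensor_sum_lift[OF ts[OF i] P, of "\<lambda>j. \<beta> (i, j)"] b i by auto
  note LL = lin_lift[of P "\<lambda>i. \<Lambda> i P (\<lambda>j. \<beta> (i, j))", OF L(1) P]
  show "lin K DS P (lift P (\<lambda>i. \<Lambda> i P (\<lambda>j. \<beta> (i, j))))" by (rule LL(1))
  fix ij x y assume "ij \<in> Sigma I J" "x \<in> carrier (case ij of (i, j) \<Rightarrow> X i j)"
    "y \<in> carrier (case ij of (i, j) \<Rightarrow> Y i j)"
  then show "lift P (\<lambda>i. \<Lambda> i P (\<lambda>j. \<beta> (i, j))) ((case ij of (i, j) \<Rightarrow> \<lambda>x y. inj i (\<tau> i j x y)) x y)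
      = \<beta> ij x y"
    using LL(2) L(2) bilinear_closed[OF tensor_sum_bilinear[OF ts]] by auto
qed

end

section \<open>Chain complexes\<close>

text \<open>As an element of \<open>K\<close>, a sign passes through every linear map by
  \<open>lin_smult\<close>, and products of signs become sums of exponents. The negation inside
  \<open>signed\<close> is converted to this form whenever it occurs.\<close>

definition koszul :: "'k ring \<Rightarrow> int \<Rightarrow> 'k" where
  "koszul K i = (if even i then \<one>\<^bsub>K\<^esub> else \<ominus>\<^bsub>K\<^esub> \<one>\<^bsub>K\<^esub>)"

lemma koszul_closed [simp]: "cring K \<Longrightarrow> koszul K i \<in> carrier K"
proof -
  assume "cring K"
  then interpret cring K .
  show ?thesis by (simp add: koszul_def)
qed

lemma koszul_mult: "cring K \<Longrightarrow> koszul K i \<otimes>\<^bsub>K\<^esub> koszul K j = koszul K (i + j)"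
proof -
  assume "cring K"
  then interpret cring K .
  show ?thesis by (auto simp: koszul_def l_minus r_minus)
qed

lemma signed_eq_koszul:
  assumes "module K M" "x \<in> carrier M" shows "signed M i x = koszul K i \<odot>\<^bsub>M\<^esub> x"
proof -
  interpret module K M by fact
  show ?thesis using assms(2) by (simp add: signed_def koszul_def smult_l_minus)
qed

lemma koszul_smult:
  assumes "module K M" "x \<in> carrier M"
  shows "koszul K i \<odot>\<^bsub>M\<^esub> (koszul K j \<odot>\<^bsub>M\<^esub> x) = koszul K (i + j) \<odot>\<^bsub>M\<^esub> x"
proof -
  interpret module K M by fact
  have "cring K" by unfold_locales
  then show ?thesis using assms(2) by (simp add: smult_assoc1[symmetric] koszul_mult)
qed

lemma koszul_even_smult: "module K M \<Longrightarrow> x \<in> carrier M \<Longrightarrow> even i \<Longrightarrow> koszul K i \<odot>\<^bsub>M\<^esub> x = x"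
  by (simp add: koszul_def module.smult_one)

lemma koszul_cancel:
  assumes "module K M" "x \<in> carrier M" "odd (i + j)"
  shows "koszul K i \<odot>\<^bsub>M\<^esub> x \<oplus>\<^bsub>M\<^esub> koszul K j \<odot>\<^bsub>M\<^esub> x = \<zero>\<^bsub>M\<^esub>"
proof -
  interpret module K M by fact
  show ?thesis using assms(2,3) by (auto simp: koszul_def smult_l_minus M.r_neg M.l_neg)
qed

lemma chain_complex_module: "chain_complex K C \<Longrightarrow> module K (Mod C n)"
  by (simp add: chain_complex_def)

lemma chain_complex_bd: "chain_complex K C \<Longrightarrow> lin K (Mod C n) (Mod C (n - 1)) (bd C n)"
  by (simp add: chain_complex_def lin_def)

lemma chain_complex_bd_bd:
  "chain_complex K C \<Longrightarrow> x \<in> carrier (Mod C n) \<Longrightarrow> bd C (n - 1) (bd C n x) = \<zero>\<^bsub>Mod C (n - 2)\<^esub>"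
  by (simp add: chain_complex_def)

lemma chain_complexI:
  assumes "\<And>n. lin K (Mod C n) (Mod C (n - 1)) (bd C n)"
    and "\<And>n x. x \<in> carrier (Mod C n) \<Longrightarrow> bd C (n - 1) (bd C n x) = \<zero>\<^bsub>Mod C (n - 2)\<^esub>"
  shows "chain_complex K C"
  using assms by (auto simp: chain_complex_def lin_def)

section \<open>The tensor product of two complexes\<close>

locale tensor_complexes =
  fixes K :: "'k ring" and C D :: "('k, 's, 'v) ch"
  assumes K: "cring K" and C: "chain_complex K C" and D: "chain_complex K D"
begin

lemmas modules = chain_complex_module[OF C] chain_complex_module[OF D]

abbreviation "T \<equiv> cpx_tensor K C D"

lemma tensor_sum_pieces:
  "tensor_sum K {()} (\<lambda>_. Mod C p) (\<lambda>_. Mod D q) (tensor K (Mod C p) (Mod D q))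
    (\<lambda>_. pure_tensor K (Mod C p) (Mod D q)) (\<lambda>P \<beta>. tensor_lift P (\<beta> ()))"
proof -
  interpret tensor_modules K "Mod C p" "Mod D q"
    by (intro tensor_modules.intro modules)
  show ?thesis by (rule tensor_sum_tensor)
qed

text \<open>The degree \<open>n\<close> part is defined as a sum over \<open>p\<close> alone, with
  \<open>q\<close> hidden as \<open>n - p\<close>. Reindexing by pairs frees later statements from
  this asymmetry.\<close>

lemma tensor_sum_cpx_tensor:
  "tensor_sum K {(p, q). p + q = n} (\<lambda>(p, q). Mod C p) (\<lambda>(p, q). Mod D q) (Mod T n)
    (\<lambda>(p, q). cpx_pure K C D p q) (\<lambda>P \<beta>. cpx_lift K C D P (\<lambda>p q. \<beta> (p, q)) n)"
proof -
  interpret S: direct_sum_modules K Graded graded UNIV "\<lambda>p. tensor K (Mod C p) (Mod D (n - p))"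
    by (rule direct_sum_modules.intro) (auto simp: K tensor_sum_module[OF tensor_sum_pieces])
  have T: "Mod T n = S.DS" by (simp add: cpx_tensor_def cpx_tensor_mod_def)
  have e: "a + (n - a) = n" for a :: int by simp
  show ?thesis unfolding T
    by (rule tensor_sum_reindex[OF S.tensor_sum_DS[OF tensor_sum_pieces],
          where h = "\<lambda>(p, _). (p, n - p)"])
      (auto simp: e fun_eq_iff image_iff cpx_pure_def S.inj_def cpx_lift_def S.lift_def S.supp_def)
qed

lemma module_T: "module K (Mod T n)"
  by (rule tensor_sum_module[OF tensor_sum_cpx_tensor])

lemma bilinear_cpx_pure:
  "n = p + q \<Longrightarrow> bilinear K (Mod C p) (Mod D q) (Mod T n) (cpx_pure K C D p q)"
  using tensor_sum_bilinear[OF tensor_sum_cpx_tensor[of n], of "(p, q)"] by simp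

lemma cpx_pure_closed:
  "n = p + q \<Longrightarrow> x \<in> carrier (Mod C p) \<Longrightarrow> y \<in> carrier (Mod D q) \<Longrightarrow>
    cpx_pure K C D p q x y \<in> carrier (Mod T n)"
  by (rule bilinear_closed[OF bilinear_cpx_pure])

lemma cpx_lift:
  assumes "module K P" "\<And>p q. p + q = n \<Longrightarrow> bilinear K (Mod C p) (Mod D q) P (\<beta> p q)"
  shows lin_cpx_lift: "lin K (Mod T n) P (cpx_lift K C D P \<beta> n)"
    and cpx_lift_pure: "n = p + q \<Longrightarrow> x \<in> carrier (Mod C p) \<Longrightarrow> y \<in> carrier (Mod D q) \<Longrightarrow>
      cpx_lift K C D P \<beta> n (cpx_pure K C D p q x y) = \<beta> p q x y"
  using tensor_sum_lift[OF tensor_sum_cpx_tensor[of n] assms(1), of "\<lambda>(p, q). \<beta> p q"] assms(2)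
  by auto

lemma cpx_tensor_ext:
  assumes "lin K (Mod T n) P f" "lin K (Mod T n) P g" "u \<in> carrier (Mod T n)"
    and "\<And>p q x y. n = p + q \<Longrightarrow> x \<in> carrier (Mod C p) \<Longrightarrow> y \<in> carrier (Mod D q) \<Longrightarrow>
      f (cpx_pure K C D p q x y) = g (cpx_pure K C D p q x y)"
  shows "f u = g u"
  by (rule tensor_sum_ext[OF tensor_sum_cpx_tensor assms(1-3)]) (use assms(4) in auto)

lemma bilinear_bd:
  assumes n: "n = p + q"
  shows "bilinear K (Mod C p) (Mod D q) (Mod T (n - 1))
    (\<lambda>x y. cpx_pure K C D (p - 1) q (bd C p x) y
      \<oplus>\<^bsub>Mod T (n - 1)\<^esub> koszul K p \<odot>\<^bsub>Mod T (n - 1)\<^esub> cpx_pure K C D p (q - 1) x (bd D q y))"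
  using n chain_complex_bd[OF C, of p] chain_complex_bd[OF D, of q]
  by (intro bilinear_plus bilinear_scale
      bilinear_comp2[where f = "bd C p" and g = "\<lambda>y. y", OF bilinear_cpx_pure]
      bilinear_comp2[where f = "\<lambda>x. x" and g = "bd D q", OF bilinear_cpx_pure])
    (auto simp: K intro: lin_id modules)

text \<open>A lift takes on generators the values of the form that defines it, here the Leibniz
  formula. The sign becomes a scalar, so that linear maps can be moved past it.\<close>

lemma bd_T:
  shows lin_bd_T: "lin K (Mod T n) (Mod T (n - 1)) (bd T n)"
    and bd_T_pure: "n = p + q \<Longrightarrow> x \<in> carrier (Mod C p) \<Longrightarrow> y \<in> carrier (Mod D q) \<Longrightarrow>
      bd T n (cpx_pure K C D p q x y) = cpx_pure K C D (p - 1) q (bd C p x) y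
        \<oplus>\<^bsub>Mod T (n - 1)\<^esub> koszul K p \<odot>\<^bsub>Mod T (n - 1)\<^esub> cpx_pure K C D p (q - 1) x (bd D q y)"
proof -
  let ?P = "Mod T (n - 1)"
  let ?\<beta> = "\<lambda>p q x y. cpx_pure K C D (p - 1) q (bd C p x) y
           \<oplus>\<^bsub>?P\<^esub> signed ?P p (cpx_pure K C D p (q - 1) x (bd D q y))"
  have T: "bd T n = cpx_lift K C D ?P ?\<beta> n" by (simp add: cpx_tensor_def Let_def)
  have s: "signed ?P p (cpx_pure K C D p (q - 1) x (bd D q y))
      = koszul K p \<odot>\<^bsub>?P\<^esub> cpx_pure K C D p (q - 1) x (bd D q y)"
    if "n = p + q" "x \<in> carrier (Mod C p)" "y \<in> carrier (Mod D q)" for p q x y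
    using that lin_closed[OF chain_complex_bd[OF D]]
    by (intro signed_eq_koszul module_T cpx_pure_closed) auto
  have b: "bilinear K (Mod C p) (Mod D q) ?P (?\<beta> p q)" if "p + q = n" for p q
    by (rule bilinear_cong[OF bilinear_bd]) (use that s in auto)
  show "lin K (Mod T n) ?P (bd T n)" unfolding T by (rule lin_cpx_lift[OF module_T b])
  assume xy: "n = p + q" "x \<in> carrier (Mod C p)" "y \<in> carrier (Mod D q)"
  have "cpx_lift K C D ?P ?\<beta> n (cpx_pure K C D p q x y) = ?\<beta> p q x y"
    by (rule cpx_lift_pure[OF module_T b]) (use xy in auto)
  then show "bd T n (cpx_pure K C D p q x y) = cpx_pure K C D (p - 1) q (bd C p x) y
      \<oplus>\<^bsub>?P\<^esub> koszul K p \<odot>\<^bsub>?P\<^esub> cpx_pure K C D p (q - 1) x (bd D q y)"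
    unfolding T using s xy by simp
qed

lemma chain_complex_T: "chain_complex K T"
proof (rule chain_complexI[OF lin_bd_T])
  fix n u assume u: "u \<in> carrier (Mod T n)"
  have l: "lin K (Mod T n) (Mod T (n - 2)) (\<lambda>u. bd T (n - 1) (bd T n u))"
    using lin_comp[OF lin_bd_T[of n] lin_bd_T[of "n - 1"]] by simp
  show "bd T (n - 1) (bd T n u) = \<zero>\<^bsub>Mod T (n - 2)\<^esub>"
  proof (rule cpx_tensor_ext[OF l _ u])
    show "lin K (Mod T n) (Mod T (n - 2)) (\<lambda>u. \<zero>\<^bsub>Mod T (n - 2)\<^esub>)"
      by (intro lin_const_zero module_T)
    fix p q x y assume n: "n = p + q" and x: "x \<in> carrier (Mod C p)" and y: "y \<in> carrier (Mod D q)"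
    let ?P = "Mod T (n - 2)" and ?t = "cpx_pure K C D"
    interpret P: module K ?P by (rule module_T)
    have dx: "bd C p x \<in> carrier (Mod C (p - 1))" using lin_closed[OF chain_complex_bd[OF C] x] .
    have dy: "bd D q y \<in> carrier (Mod D (q - 1))" using lin_closed[OF chain_complex_bd[OF D] y] .
    have z: "?t (p - 2) q \<zero>\<^bsub>Mod C (p - 2)\<^esub> y = \<zero>\<^bsub>?P\<^esub>" "?t p (q - 2) x \<zero>\<^bsub>Mod D (q - 2)\<^esub> = \<zero>\<^bsub>?P\<^esub>"
      using lin_zero[OF bilinear_left[OF bilinear_cpx_pure[of "n - 2"] y]]
        lin_zero[OF bilinear_right[OF bilinear_cpx_pure[of "n - 2"] x]] n by auto
    \<comment> \<open>Since the differential squares to zero in each factor, only this mixed term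
      survives. It occurs with exponents \<open>p - 1\<close> and \<open>p\<close>, hence
      cancels.\<close>
    define w where "w = ?t (p - 1) (q - 1) (bd C p x) (bd D q y)"
    have w: "w \<in> carrier ?P" unfolding w_def using dx dy n by (intro cpx_pure_closed) auto
    have n': "n - 1 = p - 1 + q" "n - 1 = p + (q - 1)" using n by simp_all
    have "bd T (n - 1) (bd T n (?t p q x y))
      = bd T (n - 1) (?t (p - 1) q (bd C p x) y)
        \<oplus>\<^bsub>?P\<^esub> koszul K p \<odot>\<^bsub>?P\<^esub> bd T (n - 1) (?t p (q - 1) x (bd D q y))"
      using n x y dx dy lin_add[OF lin_bd_T[of "n - 1"]] lin_smult[OF lin_bd_T[of "n - 1"]]
      by (simp add: bd_T_pure cpx_pure_closed module_smult_closed[OF module_T] K)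
    also have "bd T (n - 1) (?t (p - 1) q (bd C p x) y) = koszul K (p - 1) \<odot>\<^bsub>?P\<^esub> w"
      using bd_T_pure[OF n'(1) dx y] chain_complex_bd_bd[OF C x] w z
      by (simp add: w_def K)
    also have "bd T (n - 1) (?t p (q - 1) x (bd D q y)) = w"
      using bd_T_pure[OF n'(2) x dy] chain_complex_bd_bd[OF D y] w z
      by (simp add: w_def K)
    finally show "bd T (n - 1) (bd T n (?t p q x y)) = \<zero>\<^bsub>?P\<^esub>"
      using w by (simp add: koszul_cancel[OF module_T])
  qed
qed

end

section \<open>Unit complexes and finite direct sums of complexes\<close>

lemma ground_space_module:
  assumes "cring K" shows "module K (ground_space K :: ('k, 's, 'v) vsp)"
proof -
  interpret cring K by fact
  show ?thesis
    by (rule moduleI[OF assms], rule abelian_groupI)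
      (auto simp: ground_space_def add.m_ac l_distr r_distr m_assoc
        intro!: bexI[of _ "Scalar (\<ominus>\<^bsub>K\<^esub> x)" for x] l_neg)
qed

lemma zero_space_module:
  assumes "cring K" shows "module K (zero_space K :: ('k, 's, 'v) vsp)"
  by (rule moduleI[OF assms], rule abelian_groupI) (auto simp: zero_space_def)

lemma chain_complex_ground:
  assumes "cring K" shows "chain_complex K (ground_cpx K)"
proof -
  interpret cring K by fact
  have z: "\<zero>\<^bsub>Mod (ground_cpx K) n\<^esub> = Scalar \<zero>\<^bsub>K\<^esub>" for n
    by (simp add: ground_cpx_def ground_space_def zero_space_def)
  have m: "module K (Mod (ground_cpx K) n)" for n
    by (simp add: ground_cpx_def ground_space_module zero_space_module assms)
  have b: "bd (ground_cpx K) n = (\<lambda>x. \<zero>\<^bsub>Mod (ground_cpx K) (n - 1)\<^esub>)" for n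
    unfolding z by (simp add: ground_cpx_def)
  show ?thesis
    by (rule chain_complexI, unfold b) (rule lin_const_zero[OF m m], simp add: z)
qed

lemma chain_complex_zero:
  assumes "cring K" shows "chain_complex K (zero_cpx K)"
proof -
  have z: "\<zero>\<^bsub>Mod (zero_cpx K) n\<^esub> = Scalar \<zero>\<^bsub>K\<^esub>" for n
    by (simp add: zero_cpx_def zero_space_def)
  have m: "module K (Mod (zero_cpx K) n)" for n
    by (simp add: zero_cpx_def zero_space_module assms)
  have b: "bd (zero_cpx K) n = (\<lambda>x. \<zero>\<^bsub>Mod (zero_cpx K) (n - 1)\<^esub>)" for n
    unfolding z by (simp add: zero_cpx_def)
  show ?thesis
    by (rule chain_complexI, unfold b) (rule lin_const_zero[OF m m], simp add: z)
qed

context direct_sum_modules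
begin

text \<open>A finite direct sum is also a product: with finitely many components the condition on
  supports is automatic. The oplax structure is defined through its components in this way.\<close>

lemma lin_family:
  assumes "finite I" "\<And>i. i \<in> I \<Longrightarrow> lin K N (M i) (f i)" "module K N"
  shows "lin K N DS (\<lambda>x. fam (\<lambda>i \<in> I. f i x))"
proof (rule linI[OF assms(3) module_DS])
  show c: "fam (\<lambda>i \<in> I. f i x) \<in> carrier DS" if "x \<in> carrier N" for x
    using that assms by (intro DS_famI) (auto intro: lin_closed)
  show "fam (\<lambda>i \<in> I. f i (x \<oplus>\<^bsub>N\<^esub> y)) = fam (\<lambda>i \<in> I. f i x) \<oplus>\<^bsub>DS\<^esub> fam (\<lambda>i \<in> I. f i y)"
    if "x \<in> carrier N" "y \<in> carrier N" for x y
    by (rule DS_eqI) (use that c in \<open>simp_all add: module_add_closed[OF assms(3)] DS_add_closed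
        unfam_add lin_add[OF assms(2)]\<close>)
  show "fam (\<lambda>i \<in> I. f i (d \<odot>\<^bsub>N\<^esub> x)) = d \<odot>\<^bsub>DS\<^esub> fam (\<lambda>i \<in> I. f i x)"
    if "d \<in> carrier K" "x \<in> carrier N" for d x
    by (rule DS_eqI) (use that c in \<open>simp_all add: module_smult_closed[OF assms(3)] DS_smult_closed
        unfam_smult lin_smult[OF assms(2)]\<close>)
qed

end

locale sum_complexes =
  fixes K :: "'k ring" and I :: "'s set set" and C :: "'s set \<Rightarrow> ('k, 's, 'v) ch"
  assumes K: "cring K" and I: "finite I" and C: "A \<in> I \<Longrightarrow> chain_complex K (C A)"
begin

abbreviation "S \<equiv> cpx_sum I C"

lemma direct_sum_modules: "direct_sum_modules K Indexed indexed I (\<lambda>A. Mod (C A) n)"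
  by (rule direct_sum_modules.intro) (auto simp: K chain_complex_module[OF C])

lemma Mod_S: "Mod S n = direct_sum Indexed indexed I (\<lambda>A. Mod (C A) n)"
  by (simp add: cpx_sum_def)

lemma bd_S: "bd S n u = Indexed (\<lambda>A \<in> I. bd (C A) n (indexed u A))"
  by (simp add: cpx_sum_def)

lemma chain_complex_S: "chain_complex K S"
proof (rule chain_complexI)
  fix n
  interpret M: direct_sum_modules K Indexed indexed I "\<lambda>A. Mod (C A) n"
    by (rule direct_sum_modules)
  interpret N: direct_sum_modules K Indexed indexed I "\<lambda>A. Mod (C A) (n - 1)"
    by (rule direct_sum_modules)
  interpret P: direct_sum_modules K Indexed indexed I "\<lambda>A. Mod (C A) (n - 2)"
    by (rule direct_sum_modules)
  show "lin K (Mod S n) (Mod S (n - 1)) (bd S n)"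
    unfolding Mod_S bd_S[abs_def]
    by (intro N.lin_family I M.module_DS lin_comp[OF M.lin_unfam chain_complex_bd[OF C]])
  fix u assume "u \<in> carrier (Mod S n)"
  then have "indexed u A \<in> carrier (Mod (C A) n)" if "A \<in> I" for A
    using that by (simp add: Mod_S M.DS_component)
  then have "(\<lambda>A\<in>I. bd (C A) (n - 1) (if A \<in> I then bd (C A) n (indexed u A) else undefined))
      = (\<lambda>A\<in>I. \<zero>\<^bsub>Mod (C A) (n - 2)\<^esub>)"
    by (auto simp: chain_complex_bd_bd[OF C])
  then show "bd S (n - 1) (bd S n u) = \<zero>\<^bsub>Mod S (n - 2)\<^esub>"
    by (simp add: bd_S Mod_S direct_sum_def restrict_def)
qed

lemma lin_cpx_inj: "A \<in> I \<Longrightarrow> lin K (Mod (C A) n) (Mod S n) (cpx_inj I C A n)"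
proof -
  interpret M: direct_sum_modules K Indexed indexed I "\<lambda>A. Mod (C A) n"
    by (rule direct_sum_modules)
  have "cpx_inj I C A n = M.inj A" by (intro ext) (simp add: cpx_inj_def M.inj_def)
  then show "A \<in> I \<Longrightarrow> ?thesis" by (simp add: Mod_S M.lin_inj)
qed

lemma bd_cpx_inj:
  "A \<in> I \<Longrightarrow> bd S n (cpx_inj I C A n x) = cpx_inj I C A (n - 1) (bd (C A) n x)"
proof -
  assume A: "A \<in> I"
  have "(\<lambda>B\<in>I. bd (C B) n ((\<lambda>B\<in>I. if B = A then x else \<zero>\<^bsub>Mod (C B) n\<^esub>) B))
      = (\<lambda>B\<in>I. if B = A then bd (C A) n x else \<zero>\<^bsub>Mod (C B) (n - 1)\<^esub>)"
    by (auto simp: lin_zero[OF chain_complex_bd[OF C]])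
  then show ?thesis by (simp add: bd_S cpx_inj_def)
qed

end

section \<open>Chain maps\<close>

definition ch_arr :: "'k ring \<Rightarrow> ('k, 's, 'v) ch_map \<Rightarrow> bool" where
  "ch_arr K \<phi> \<longleftrightarrow> chain_complex K (src \<phi>) \<and> chain_complex K (trg \<phi>) \<and>
    chain_map K (src \<phi>) (trg \<phi>) (act \<phi>)"

lemma Hom_Ch_iff:
  "chain_complex K C \<Longrightarrow> chain_complex K D \<Longrightarrow>
    \<phi> \<in> Hom (Ch K) C D \<longleftrightarrow> ch_arr K \<phi> \<and> src \<phi> = C \<and> trg \<phi> = D"
  by (cases \<phi>) (auto simp: Ch_def ch_arr_def)

lemma ch_arr_lin: "ch_arr K \<phi> \<Longrightarrow> lin K (Mod (src \<phi>) n) (Mod (trg \<phi>) n) (act \<phi> n)"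
  by (auto simp: ch_arr_def chain_map_def lin_def chain_complex_module)

lemma ch_arr_bd:
  "ch_arr K \<phi> \<Longrightarrow> x \<in> carrier (Mod (src \<phi>) n) \<Longrightarrow>
    act \<phi> (n - 1) (bd (src \<phi>) n x) = bd (trg \<phi>) n (act \<phi> n x)"
  by (auto simp: ch_arr_def chain_map_def)

lemma ch_arrI:
  assumes "chain_complex K C" "chain_complex K D"
    and l: "\<And>n. lin K (Mod C n) (Mod D n) (f n)"
    and b: "\<And>n x. x \<in> carrier (Mod C n) \<Longrightarrow> f (n - 1) (bd C n x) = bd D n (f n x)"
  shows "ch_arr K (Arrow C (\<lambda>n. \<lambda>x \<in> carrier (Mod C n). f n x) D)"
proof -
  have "lin K (Mod C n) (Mod D n) (\<lambda>x \<in> carrier (Mod C n). f n x)" for n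
    by (rule lin_cong[OF l]) simp
  moreover have "bd C n x \<in> carrier (Mod C (n - 1))" if "x \<in> carrier (Mod C n)" for n x
    using lin_closed[OF chain_complex_bd[OF assms(1)] that] .
  ultimately show ?thesis using assms by (simp add: ch_arr_def chain_map_def lin_def)
qed

text \<open>The components of a chain map are extensional, so there is no freedom outside the
  carriers and agreement on elements is equality of arrows.\<close>

lemma ch_arr_ext:
  assumes "ch_arr K \<phi>" "ch_arr K \<psi>" "src \<phi> = src \<psi>" "trg \<phi> = trg \<psi>"
    and "\<And>n x. x \<in> carrier (Mod (src \<phi>) n) \<Longrightarrow> act \<phi> n x = act \<psi> n x"
  shows "\<phi> = \<psi>"
proof (rule arrow.expand, intro conjI ext)
  fix n x
  have "act \<phi> n \<in> extensional (carrier (Mod (src \<phi>) n))" "act \<psi> n \<in> extensional (carrier (Mod (src \<psi>) n))"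
    using assms(1,2) by (auto simp: ch_arr_def chain_map_def)
  then show "act \<phi> n x = act \<psi> n x"
    using assms(3,5) by (cases "x \<in> carrier (Mod (src \<phi>) n)") (auto simp: extensional_def)
qed (use assms in auto)

lemma ch_comp:
  assumes "ch_arr K \<phi>" "ch_arr K \<psi>" "trg \<phi> = src \<psi>"
  shows "ch_arr K (\<psi> \<cdot>\<^bsub>Ch K\<^esub> \<phi>)"
proof -
  have eq: "\<psi> \<cdot>\<^bsub>Ch K\<^esub> \<phi> = Arrow (src \<phi>)
      (\<lambda>n. \<lambda>x \<in> carrier (Mod (src \<phi>) n). act \<psi> n (act \<phi> n x)) (trg \<psi>)"
    by (simp add: Ch_def compose_def)
  show ?thesis unfolding eq
  proof (rule ch_arrI)
    fix n show "lin K (Mod (src \<phi>) n) (Mod (trg \<psi>) n) (\<lambda>x. act \<psi> n (act \<phi> n x))"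
      using lin_comp[OF ch_arr_lin[OF assms(1)] ch_arr_lin[OF assms(2), folded assms(3)]] .
    fix x assume x: "x \<in> carrier (Mod (src \<phi>) n)"
    show "act \<psi> (n - 1) (act \<phi> (n - 1) (bd (src \<phi>) n x)) = bd (trg \<psi>) n (act \<psi> n (act \<phi> n x))"
      using ch_arr_bd[OF assms(1) x] ch_arr_bd[OF assms(2), of "act \<phi> n x" n]
        lin_closed[OF ch_arr_lin[OF assms(1)] x] assms(3) by simp
  qed (use assms in \<open>auto simp: ch_arr_def\<close>)
qed

lemma ch_comp_simps [simp]:
  "src (\<psi> \<cdot>\<^bsub>Ch K\<^esub> \<phi>) = src \<phi>" "trg (\<psi> \<cdot>\<^bsub>Ch K\<^esub> \<phi>) = trg \<psi>"
  "x \<in> carrier (Mod (src \<phi>) n) \<Longrightarrow> act (\<psi> \<cdot>\<^bsub>Ch K\<^esub> \<phi>) n x = act \<psi> n (act \<phi> n x)"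
  by (simp_all add: Ch_def compose_def)

lemma ch_id: assumes "chain_complex K C" shows "ch_arr K (Idn (Ch K) C)"
proof -
  have "Idn (Ch K) C = Arrow C (\<lambda>n. \<lambda>x \<in> carrier (Mod C n). x) C" by (simp add: Ch_def)
  then show ?thesis using assms by (simp only:) (intro ch_arrI lin_id, auto simp: chain_complex_module)
qed

lemma ch_id_simps [simp]:
  "src (Idn (Ch K) C) = C" "trg (Idn (Ch K) C) = C"
  "x \<in> carrier (Mod C n) \<Longrightarrow> act (Idn (Ch K) C) n x = x"
  by (simp_all add: Ch_def)

lemma ch_zero_map:
  assumes "chain_complex K C" "chain_complex K D" shows "ch_arr K (zero_map C D)"
  unfolding zero_map_def
  by (intro ch_arrI assms lin_const_zero chain_complex_module)
    (simp add: lin_zero[OF chain_complex_bd[OF assms(2)]])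

lemma zero_map_simps [simp]:
  "src (zero_map C D) = C" "trg (zero_map C D) = D"
  "x \<in> carrier (Mod C n) \<Longrightarrow> act (zero_map C D) n x = \<zero>\<^bsub>Mod D n\<^esub>"
  by (simp_all add: zero_map_def)

section \<open>FI-comodules\<close>

definition fi_arr :: "'s fi_map \<Rightarrow> bool" where
  "fi_arr f \<longleftrightarrow> finite (src f) \<and> finite (trg f) \<and> f \<in> Hom FI (src f) (trg f)"

lemma fi_arr_iff:
  "fi_arr f \<longleftrightarrow> finite (src f) \<and> finite (trg f) \<and> act f \<in> src f \<rightarrow>\<^sub>E trg f \<and> inj_on (act f) (src f)"
  by (cases f) (auto simp: fi_arr_def FI_def)

lemma fi_arr_finite: "fi_arr f \<Longrightarrow> finite (src f)" "fi_arr f \<Longrightarrow> finite (trg f)"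
  by (auto simp: fi_arr_def)

lemma FI_comp_simps [simp]:
  "src (g \<cdot>\<^bsub>FI\<^esub> f) = src f" "trg (g \<cdot>\<^bsub>FI\<^esub> f) = trg g"
  "act (g \<cdot>\<^bsub>FI\<^esub> f) = compose (src f) (act g) (act f)"
  by (simp_all add: FI_def)

lemma FI_id_simps [simp]:
  "src (Idn FI S) = S" "trg (Idn FI S) = S" "act (Idn FI S) = (\<lambda>x \<in> S. x)"
  by (simp_all add: FI_def)

lemma fi_arr_id: "finite S \<Longrightarrow> fi_arr (Idn FI S)"
  by (simp add: fi_arr_iff)

lemma fi_arr_comp: "fi_arr f \<Longrightarrow> fi_arr g \<Longrightarrow> trg f = src g \<Longrightarrow> fi_arr (g \<cdot>\<^bsub>FI\<^esub> f)"
  by (auto simp: fi_arr_iff compose_def inj_on_def PiE_iff Pi_iff)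

lemma fi_incl_simps [simp]: "src (fi_incl A S) = A" "trg (fi_incl A S) = S"
  "act (fi_incl A S) = (\<lambda>x \<in> A. x)"
  by (simp_all add: fi_incl_def)

lemma fi_arr_incl: "finite S \<Longrightarrow> A \<subseteq> S \<Longrightarrow> fi_arr (fi_incl A S)"
  by (auto simp: fi_arr_iff finite_subset)

lemma fi_restrict_simps [simp]: "src (fi_restrict f B) = fi_preimage f B" "trg (fi_restrict f B) = B"
  "act (fi_restrict f B) = restrict (act f) (fi_preimage f B)"
  by (simp_all add: fi_restrict_def)

lemma fi_arr_restrict: "fi_arr f \<Longrightarrow> B \<subseteq> trg f \<Longrightarrow> fi_arr (fi_restrict f B)"
  by (auto simp: fi_arr_iff finite_subset inj_on_def fi_preimage_def)

lemma fi_arr_eqI: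
  assumes "fi_arr f" "fi_arr g" "src f = src g" "trg f = trg g" "\<And>x. x \<in> src f \<Longrightarrow> act f x = act g x"
  shows "f = g"
proof (rule arrow.expand, intro conjI)
  show "act f = act g" using assms by (intro PiE_ext[of "act f" "src f" "\<lambda>_. trg f"]) (auto simp: fi_arr_iff)
qed (use assms in auto)

lemma fi_preimage_id: "A \<subseteq> S \<Longrightarrow> fi_preimage (Idn FI S) A = A"
  by (auto simp: fi_preimage_def)

lemma fi_restrict_id: "A \<subseteq> S \<Longrightarrow> fi_restrict (Idn FI S) A = Idn FI A"
  by (rule arrow.expand) (auto simp: fi_preimage_id fun_eq_iff)

lemma fi_preimage_comp:
  "fi_arr f \<Longrightarrow> trg f = src g \<Longrightarrow> fi_preimage (g \<cdot>\<^bsub>FI\<^esub> f) A = fi_preimage f (fi_preimage g A)"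
  by (auto simp: fi_preimage_def fi_arr_iff compose_def)

lemma fi_restrict_comp:
  "fi_arr f \<Longrightarrow> trg f = src g \<Longrightarrow>
    fi_restrict (g \<cdot>\<^bsub>FI\<^esub> f) A = fi_restrict g A \<cdot>\<^bsub>FI\<^esub> fi_restrict f (fi_preimage g A)"
  by (rule arrow.expand)
    (auto simp: fi_preimage_comp fun_eq_iff compose_def restrict_def, auto simp: fi_preimage_def)

text \<open>For the pair \<open>(S, S)\<close> the action through restrictions is therefore the
  action of the injection itself. This is what lets the Hadamard product fit the pattern of Day
  convolution.\<close>

lemma fi_restrict_trg: "fi_arr f \<Longrightarrow> fi_restrict f (trg f) = f" "fi_arr f \<Longrightarrow> fi_preimage f (trg f) = src f"
proof -
  assume f: "fi_arr f"
  then show p: "fi_preimage f (trg f) = src f" by (auto simp: fi_preimage_def fi_arr_iff)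
  show "fi_restrict f (trg f) = f"
    by (rule arrow.expand) (use f p in \<open>auto simp: fi_arr_iff PiE_def extensional_restrict\<close>)
qed

lemma fi_preimage_Un: "fi_preimage f (A \<union> B) = fi_preimage f A \<union> fi_preimage f B"
  by (auto simp: fi_preimage_def)

lemma fi_preimage_restrict: "A \<subseteq> B \<Longrightarrow> fi_preimage (fi_restrict f B) A = fi_preimage f A"
  by (auto simp: fi_preimage_def)

lemma fi_restrict_restrict: "A \<subseteq> B \<Longrightarrow> fi_restrict (fi_restrict f B) A = fi_restrict f A"
  by (rule arrow.expand) (auto simp: fi_preimage_restrict fun_eq_iff restrict_def fi_preimage_def)

section \<open>Functors on the opposite of the category of injections, and their morphisms\<close>

definition comodule :: "'k ring \<Rightarrow> ('k, 's, 'v) comod \<Rightarrow> bool" where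
  "comodule K F \<longleftrightarrow> is_functor (opposite FI) (Ch K) F"

lemma opposite_simps [simp]: "Ob (opposite C) = Ob C" "Hom (opposite C) a b = Hom C b a"
  "Idn (opposite C) = Idn C" "Comp (opposite C) g f = f \<cdot>\<^bsub>C\<^esub> g"
  by (simp_all add: opposite_def)

lemma Ob_simps [simp]: "Ob FI = {S. finite S}" "Ob (Ch K) = {C. chain_complex K C}"
  by (simp_all add: FI_def Ch_def)

lemma Hom_FI_iff: "finite S \<Longrightarrow> finite T \<Longrightarrow> f \<in> Hom FI S T \<longleftrightarrow> fi_arr f \<and> src f = S \<and> trg f = T"
  by (cases f) (auto simp: fi_arr_def FI_def)

lemma comodule_cpx: "comodule K F \<Longrightarrow> finite S \<Longrightarrow> chain_complex K (fob F S)"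
  by (auto simp: comodule_def is_functor_def)

lemma comodule_far:
  assumes "comodule K F" "fi_arr f"
  shows "ch_arr K (far F f)" "src (far F f) = fob F (trg f)" "trg (far F f) = fob F (src f)"
proof -
  have "far F f \<in> Hom (Ch K) (fob F (trg f)) (fob F (src f))"
    using assms unfolding comodule_def is_functor_def fi_arr_def by simp
  then show "ch_arr K (far F f)" "src (far F f) = fob F (trg f)" "trg (far F f) = fob F (src f)"
    using assms by (simp_all add: Hom_Ch_iff comodule_cpx fi_arr_finite)
qed

lemma comodule_id:
  "comodule K F \<Longrightarrow> finite S \<Longrightarrow> x \<in> carrier (Mod (fob F S) n) \<Longrightarrow> act (far F (Idn FI S)) n x = x"
  by (simp add: comodule_def is_functor_def)

lemma comodule_comp:
  assumes "comodule K F" "fi_arr f" "fi_arr g" "trg f = src g" "x \<in> carrier (Mod (fob F (trg g)) n)"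
  shows "act (far F (g \<cdot>\<^bsub>FI\<^esub> f)) n x = act (far F f) n (act (far F g) n x)"
proof -
  have "far F (g \<cdot>\<^bsub>FI\<^esub> f) = far F f \<cdot>\<^bsub>Ch K\<^esub> far F g"
    using assms unfolding comodule_def is_functor_def fi_arr_def by auto
  then show ?thesis using assms by (simp add: comodule_far)
qed

lemma comoduleI:
  assumes c: "\<And>S. finite S \<Longrightarrow> chain_complex K (fob F S)"
    and f: "\<And>f. fi_arr f \<Longrightarrow> ch_arr K (far F f)" "\<And>f. fi_arr f \<Longrightarrow> src (far F f) = fob F (trg f)"
      "\<And>f. fi_arr f \<Longrightarrow> trg (far F f) = fob F (src f)"
    and i: "\<And>S n x. finite S \<Longrightarrow> x \<in> carrier (Mod (fob F S) n) \<Longrightarrow> act (far F (Idn FI S)) n x = x"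
    and o: "\<And>f g n x. fi_arr f \<Longrightarrow> fi_arr g \<Longrightarrow> trg f = src g \<Longrightarrow> x \<in> carrier (Mod (fob F (trg g)) n) \<Longrightarrow>
      act (far F (g \<cdot>\<^bsub>FI\<^esub> f)) n x = act (far F f) n (act (far F g) n x)"
  shows "comodule K F"
proof -
  have "far F (Idn FI S) = Idn (Ch K) (fob F S)" if "finite S" for S
    by (rule ch_arr_ext[OF f(1)[OF fi_arr_id[OF that]] ch_id[OF c[OF that]]])
      (use that f[OF fi_arr_id[OF that]] i in simp_all)
  moreover have "far F (g \<cdot>\<^bsub>FI\<^esub> f) = far F f \<cdot>\<^bsub>Ch K\<^esub> far F g"
    if "fi_arr f" "fi_arr g" "trg f = src g" for f g
    by (rule ch_arr_ext[where K = K]) (use that f[OF fi_arr_comp[OF that]] f o in \<open>simp_all add: ch_comp\<close>)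
  ultimately show ?thesis using c f
    by (auto simp: comodule_def is_functor_def Hom_FI_iff Hom_Ch_iff)
qed

lemma far_closed:
  "comodule K F \<Longrightarrow> fi_arr f \<Longrightarrow> S = src f \<Longrightarrow> x \<in> carrier (Mod (fob F (trg f)) n) \<Longrightarrow>
    act (far F f) n x \<in> carrier (Mod (fob F S) n)"
  using lin_closed[OF ch_arr_lin[OF comodule_far(1)]] comodule_far(2,3) by metis

lemma far_lin:
  "comodule K F \<Longrightarrow> fi_arr f \<Longrightarrow> T = trg f \<Longrightarrow> S = src f \<Longrightarrow>
    lin K (Mod (fob F T) n) (Mod (fob F S) n) (act (far F f) n)"
  using ch_arr_lin[OF comodule_far(1)] comodule_far(2,3) by metis

lemma comodule_module: "comodule K F \<Longrightarrow> finite S \<Longrightarrow> module K (Mod (fob F S) n)"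
  by (simp add: comodule_cpx chain_complex_module)

lemma comodule_bd_lin:
  "comodule K F \<Longrightarrow> finite S \<Longrightarrow> lin K (Mod (fob F S) n) (Mod (fob F S) (n - 1)) (bd (fob F S) n)"
  by (simp add: comodule_cpx chain_complex_bd)

text \<open>
  Morphisms of comodules are handled through their sources and targets, so that conditions of the
  form \<open>\<eta> \<in> Hom F G\<close> become equations that can be used for rewriting.
\<close>

definition comod_arr ::
  "'s fi_map set \<Rightarrow> 'k ring \<Rightarrow> ('k, 's, 'v) comod_map \<Rightarrow> bool" where
  "comod_arr W K \<eta> \<longleftrightarrow> comodule K (src \<eta>) \<and> comodule K (trg \<eta>) \<and>
    \<eta> \<in> Hom (comod_category W K) (src \<eta>) (trg \<eta>)"

lemma Ob_comod_category [simp]: "Ob (comod_category W K) = {F. comodule K F}"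
  by (simp add: comod_category_def functor_category_def comodule_def)

lemma Hom_comod_iff:
  "comodule K F \<Longrightarrow> comodule K G \<Longrightarrow>
    \<eta> \<in> Hom (comod_category W K) F G \<longleftrightarrow> comod_arr W K \<eta> \<and> src \<eta> = F \<and> trg \<eta> = G"
  by (auto simp: comod_arr_def comod_category_def functor_category_def)

text \<open>Chain maps with the same ends are equal when they agree on elements, so each naturality
  square becomes an equation between elements. The equations start from elements at
  \<open>trg f\<close> and end at \<open>src f\<close>, because the functors are
  contravariant.\<close>

lemma comod_arr_iff:
  "comod_arr W K \<eta> \<longleftrightarrow> comodule K (src \<eta>) \<and> comodule K (trg \<eta>) \<and> act \<eta> \<in> extensional {S. finite S} \<and>
    (\<forall>S. finite S \<longrightarrow> ch_arr K (act \<eta> S) \<and> src (act \<eta> S) = fob (src \<eta>) S \<and> trg (act \<eta> S) = fob (trg \<eta>) S) \<and>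
    (\<forall>f n x. fi_arr f \<longrightarrow> f \<in> W \<longrightarrow> x \<in> carrier (Mod (fob (src \<eta>) (trg f)) n) \<longrightarrow>
      act (act \<eta> (src f)) n (act (far (src \<eta>) f) n x) = act (far (trg \<eta>) f) n (act (act \<eta> (trg f)) n x))"
  (is "_ \<longleftrightarrow> ?F \<and> ?G \<and> ?e \<and> ?c \<and> ?n")
proof (cases "?F \<and> ?G")
  case True
  then have F: ?F and G: ?G by auto
  have h: "\<eta> \<in> Hom (comod_category W K) (src \<eta>) (trg \<eta>) \<longleftrightarrow>
      act \<eta> \<in> (\<Pi>\<^sub>E S \<in> {S. finite S}. Hom (Ch K) (fob (src \<eta>) S) (fob (trg \<eta>) S)) \<and>
      (\<forall>S T. finite S \<longrightarrow> finite T \<longrightarrow> (\<forall>f \<in> Hom FI S T \<inter> W.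
        act \<eta> S \<cdot>\<^bsub>Ch K\<^esub> far (src \<eta>) f = far (trg \<eta>) f \<cdot>\<^bsub>Ch K\<^esub> act \<eta> T))"
    by (cases \<eta>) (auto simp: comod_category_def functor_category_def)
  have c: "act \<eta> \<in> (\<Pi>\<^sub>E S \<in> {S. finite S}. Hom (Ch K) (fob (src \<eta>) S) (fob (trg \<eta>) S)) \<longleftrightarrow> ?e \<and> ?c"
    using F G by (auto simp: PiE_iff Hom_Ch_iff comodule_cpx)
  have n: "(\<forall>S T. finite S \<longrightarrow> finite T \<longrightarrow> (\<forall>f \<in> Hom FI S T \<inter> W.
        act \<eta> S \<cdot>\<^bsub>Ch K\<^esub> far (src \<eta>) f = far (trg \<eta>) f \<cdot>\<^bsub>Ch K\<^esub> act \<eta> T)) \<longleftrightarrow>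
      (\<forall>f. fi_arr f \<longrightarrow> f \<in> W \<longrightarrow>
        act \<eta> (src f) \<cdot>\<^bsub>Ch K\<^esub> far (src \<eta>) f = far (trg \<eta>) f \<cdot>\<^bsub>Ch K\<^esub> act \<eta> (trg f))"
    by (auto simp: Hom_FI_iff fi_arr_finite)
  have e: "act \<eta> (src f) \<cdot>\<^bsub>Ch K\<^esub> far (src \<eta>) f = far (trg \<eta>) f \<cdot>\<^bsub>Ch K\<^esub> act \<eta> (trg f) \<longleftrightarrow>
      (\<forall>n x. x \<in> carrier (Mod (fob (src \<eta>) (trg f)) n) \<longrightarrow>
        act (act \<eta> (src f)) n (act (far (src \<eta>) f) n x) = act (far (trg \<eta>) f) n (act (act \<eta> (trg f)) n x))"
    (is "?l = ?r \<longleftrightarrow> ?E") if f: "fi_arr f" and cc: ?c for f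
  proof
    note [simp] = comodule_far[OF F f] comodule_far[OF G f] fi_arr_finite[OF f]
      cc[rule_format, OF fi_arr_finite(1)[OF f]] cc[rule_format, OF fi_arr_finite(2)[OF f]]
    { assume eq: "?l = ?r"
      show ?E
      proof (intro allI impI)
        fix n x assume "x \<in> carrier (Mod (fob (src \<eta>) (trg f)) n)"
        then show "act (act \<eta> (src f)) n (act (far (src \<eta>) f) n x)
            = act (far (trg \<eta>) f) n (act (act \<eta> (trg f)) n x)"
          using arg_cong[OF eq, of "\<lambda>\<phi>. act \<phi> n x"] by simp
      qed }
    assume E: ?E
    show "?l = ?r"
      by (rule ch_arr_ext[where K = K]) (use E in \<open>simp_all add: ch_comp\<close>)
  qed
  have "?c \<Longrightarrow> (\<forall>f. fi_arr f \<longrightarrow> f \<in> W \<longrightarrow>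
        act \<eta> (src f) \<cdot>\<^bsub>Ch K\<^esub> far (src \<eta>) f = far (trg \<eta>) f \<cdot>\<^bsub>Ch K\<^esub> act \<eta> (trg f)) \<longleftrightarrow> ?n"
  proof -
    assume c: ?c
    have "(\<forall>f. fi_arr f \<longrightarrow> f \<in> W \<longrightarrow>
        act \<eta> (src f) \<cdot>\<^bsub>Ch K\<^esub> far (src \<eta>) f = far (trg \<eta>) f \<cdot>\<^bsub>Ch K\<^esub> act \<eta> (trg f)) \<longleftrightarrow>
      (\<forall>f. fi_arr f \<longrightarrow> f \<in> W \<longrightarrow> (\<forall>n x. x \<in> carrier (Mod (fob (src \<eta>) (trg f)) n) \<longrightarrow>
        act (act \<eta> (src f)) n (act (far (src \<eta>) f) n x)
          = act (far (trg \<eta>) f) n (act (act \<eta> (trg f)) n x)))"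
      by (intro all_cong1 imp_cong HOL.refl e[OF _ c])
    then show ?thesis by blast
  qed
  then have "(?c \<and> (\<forall>f. fi_arr f \<longrightarrow> f \<in> W \<longrightarrow>
        act \<eta> (src f) \<cdot>\<^bsub>Ch K\<^esub> far (src \<eta>) f = far (trg \<eta>) f \<cdot>\<^bsub>Ch K\<^esub> act \<eta> (trg f))) \<longleftrightarrow> ?c \<and> ?n"
    by (rule conj_cong[OF HOL.refl])
  then show ?thesis unfolding comod_arr_def h c n using F G by argo
qed (auto simp: comod_arr_def)

context
  fixes W :: "'s fi_map set" and K :: "'k ring" and \<eta> :: "('k, 's, 'v) comod_map"
  assumes \<eta>: "comod_arr W K \<eta>"
begin

lemma comod_arr_comodule: "comodule K (src \<eta>)" "comodule K (trg \<eta>)"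
  using \<eta> by (simp_all add: comod_arr_iff)

lemma comod_arr_component:
  assumes "finite S"
  shows "ch_arr K (act \<eta> S)" "src (act \<eta> S) = fob (src \<eta>) S" "trg (act \<eta> S) = fob (trg \<eta>) S"
  using assms \<eta> by (simp_all add: comod_arr_iff)

lemma comod_arr_lin:
  "finite S \<Longrightarrow> F = src \<eta> \<Longrightarrow> G = trg \<eta> \<Longrightarrow>
    lin K (Mod (fob F S) n) (Mod (fob G S) n) (act (act \<eta> S) n)"
  using ch_arr_lin comod_arr_component by metis

lemma comod_arr_closed:
  "finite S \<Longrightarrow> G = trg \<eta> \<Longrightarrow> x \<in> carrier (Mod (fob (src \<eta>) S) n) \<Longrightarrow>
    act (act \<eta> S) n x \<in> carrier (Mod (fob G S) n)"
  using lin_closed[OF comod_arr_lin] by metis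

lemma comod_arr_bd:
  "finite S \<Longrightarrow> F = src \<eta> \<Longrightarrow> x \<in> carrier (Mod (fob F S) n) \<Longrightarrow>
    act (act \<eta> S) (n - 1) (bd (fob F S) n x) = bd (fob (trg \<eta>) S) n (act (act \<eta> S) n x)"
  using ch_arr_bd comod_arr_component by metis

lemma comod_arr_natural:
  "fi_arr f \<Longrightarrow> f \<in> W \<Longrightarrow> S = src f \<Longrightarrow> F = src \<eta> \<Longrightarrow> x \<in> carrier (Mod (fob F (trg f)) n) \<Longrightarrow>
    act (act \<eta> S) n (act (far F f) n x) = act (far (trg \<eta>) f) n (act (act \<eta> (trg f)) n x)"
  using \<eta> by (simp add: comod_arr_iff)

end

lemma comod_arr_ext:
  assumes "comod_arr W K \<eta>" "comod_arr W K \<theta>" "src \<eta> = src \<theta>" "trg \<eta> = trg \<theta>"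
    and "\<And>S n x. finite S \<Longrightarrow> x \<in> carrier (Mod (fob (src \<eta>) S) n) \<Longrightarrow>
      act (act \<eta> S) n x = act (act \<theta> S) n x"
  shows "\<eta> = \<theta>"
proof (rule arrow.expand, intro conjI)
  have "act \<eta> S = act \<theta> S" if "finite S" for S
    by (rule ch_arr_ext[where K = K])
      (use that assms comod_arr_component[OF assms(1)] comod_arr_component[OF assms(2)] in simp_all)
  then show "act \<eta> = act \<theta>" using assms(1,2)
    by (intro extensionalityI[of _ "{S. finite S}"]) (auto simp: comod_arr_iff)
qed (use assms in auto)

lemma comod_arrow_simps [simp]:
  "src (comod_arrow F t G) = F" "trg (comod_arrow F t G) = G"
  "finite S \<Longrightarrow> act (comod_arrow F t G) S = t S"
  by (simp_all add: comod_arrow_def)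

lemma comod_arrow_arr:
  assumes "comodule K F" "comodule K G"
    and "\<And>S. finite S \<Longrightarrow> ch_arr K (t S) \<and> src (t S) = fob F S \<and> trg (t S) = fob G S"
    and "\<And>f n x. fi_arr f \<Longrightarrow> f \<in> W \<Longrightarrow> x \<in> carrier (Mod (fob F (trg f)) n) \<Longrightarrow>
      act (t (src f)) n (act (far F f) n x) = act (far G f) n (act (t (trg f)) n x)"
  shows "comod_arr W K (comod_arrow F t G)"
  using assms by (simp add: comod_arr_iff fi_arr_finite) (simp add: comod_arrow_def)

abbreviation comod_comp where "comod_comp W K \<equiv> Comp (comod_category W K)"

lemma comod_comp_eq:
  "comod_comp W K \<theta> \<eta> = comod_arrow (src \<eta>) (\<lambda>S. act \<theta> S \<cdot>\<^bsub>Ch K\<^esub> act \<eta> S) (trg \<theta>)"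
  by (simp add: comod_category_def functor_category_def comod_arrow_def)

lemma comod_comp_simps:
  "src (comod_comp W K \<theta> \<eta>) = src \<eta>" "trg (comod_comp W K \<theta> \<eta>) = trg \<theta>"
  "comod_arr W K \<eta> \<Longrightarrow> finite S \<Longrightarrow> x \<in> carrier (Mod (fob (src \<eta>) S) n) \<Longrightarrow>
    act (act (comod_comp W K \<theta> \<eta>) S) n x = act (act \<theta> S) n (act (act \<eta> S) n x)"
  by (simp_all add: comod_comp_eq comod_arr_component)

lemma comod_comp_arr:
  assumes "comod_arr W K \<eta>" "comod_arr W K \<theta>" "trg \<eta> = src \<theta>"
  shows "comod_arr W K (comod_comp W K \<theta> \<eta>)"
  unfolding comod_comp_eq
proof (rule comod_arrow_arr)
  fix f n x assume f: "fi_arr f" "f \<in> W" and x: "x \<in> carrier (Mod (fob (src \<eta>) (trg f)) n)"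
  note c = comod_arr_component[OF assms(1)] comod_arr_component[OF assms(2)] fi_arr_finite[OF f(1)]
  show "act (act \<theta> (src f) \<cdot>\<^bsub>Ch K\<^esub> act \<eta> (src f)) n (act (far (src \<eta>) f) n x)
      = act (far (trg \<theta>) f) n (act (act \<theta> (trg f) \<cdot>\<^bsub>Ch K\<^esub> act \<eta> (trg f)) n x)"
    using f x c assms(3)
    by (simp add: far_closed[OF comod_arr_comodule(1)[OF assms(1)]] comod_arr_closed[OF assms(1)]
        comod_arr_natural[OF assms(1)] comod_arr_natural[OF assms(2)])
qed (use assms in \<open>simp_all add: ch_comp comod_arr_component comod_arr_comodule\<close>)

lemma comod_id_eq: "Idn (comod_category W K) F = comod_arrow F (\<lambda>S. Idn (Ch K) (fob F S)) F"
  by (simp add: comod_category_def functor_category_def comod_arrow_def)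

lemma comod_id_simps:
  "src (Idn (comod_category W K) F) = F" "trg (Idn (comod_category W K) F) = F"
  "finite S \<Longrightarrow> x \<in> carrier (Mod (fob F S) n) \<Longrightarrow> act (act (Idn (comod_category W K) F) S) n x = x"
  by (simp_all add: comod_id_eq)

lemma comod_id_arr: "comodule K F \<Longrightarrow> comod_arr W K (Idn (comod_category W K) F)"
  unfolding comod_id_eq
  by (rule comod_arrow_arr) (simp_all add: ch_id comodule_cpx fi_arr_finite far_closed)

lemma category_comod: "is_category (comod_category W K)"
  unfolding is_category_def
proof (intro conjI ballI)
  show "Idn (comod_category W K) a \<in> Hom (comod_category W K) a a" if "a \<in> Ob (comod_category W K)" for a
    using that by (simp add: Hom_comod_iff comod_id_arr comod_id_simps)
qed (auto simp: Hom_comod_iff comod_comp_arr comod_comp_simps comod_id_arr comod_id_simps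
    comod_arr_closed intro!: comod_arr_ext[where W = W and K = K])

text \<open>Inverses chosen separately in each arity are automatically natural: insert
  \<open>\<eta>\<close> after its inverse and apply naturality of \<open>\<eta>\<close>. So only
  chain isomorphisms have to be exhibited.\<close>

lemma comod_isoI:
  fixes \<eta> :: "('k, 's, 'v) comod_map"
  assumes \<eta>: "comod_arr W K \<eta>"
    and i: "\<And>S. finite S \<Longrightarrow> \<exists>\<psi>. ch_arr K \<psi> \<and> src \<psi> = fob (trg \<eta>) S \<and> trg \<psi> = fob (src \<eta>) S \<and>
      (\<forall>n. \<forall>x \<in> carrier (Mod (fob (src \<eta>) S) n). act \<psi> n (act (act \<eta> S) n x) = x) \<and>
      (\<forall>n. \<forall>y \<in> carrier (Mod (fob (trg \<eta>) S) n). act (act \<eta> S) n (act \<psi> n y) = y)"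
  shows "is_iso (comod_category W K) (src \<eta>) (trg \<eta>) \<eta>"
proof -
  obtain \<psi> :: "'s set \<Rightarrow> ('k, 's, 'v) ch_map" where
    \<psi>: "\<And>S. finite S \<Longrightarrow> ch_arr K (\<psi> S) \<and> src (\<psi> S) = fob (trg \<eta>) S \<and> trg (\<psi> S) = fob (src \<eta>) S"
    and l: "\<And>S n x. finite S \<Longrightarrow> x \<in> carrier (Mod (fob (src \<eta>) S) n) \<Longrightarrow>
      act (\<psi> S) n (act (act \<eta> S) n x) = x"
    and r: "\<And>S n y. finite S \<Longrightarrow> y \<in> carrier (Mod (fob (trg \<eta>) S) n) \<Longrightarrow>
      act (act \<eta> S) n (act (\<psi> S) n y) = y"
    using i by metis
  have cl: "act (\<psi> S) n y \<in> carrier (Mod (fob (src \<eta>) S) n)"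
    if "finite S" "y \<in> carrier (Mod (fob (trg \<eta>) S) n)" for S n y
    using that \<psi> lin_closed[OF ch_arr_lin] by metis
  note c = comod_arr_comodule[OF \<eta>]
  let ?\<theta> = "comod_arrow (trg \<eta>) \<psi> (src \<eta>)"
  have \<theta>: "comod_arr W K ?\<theta>"
  proof (rule comod_arrow_arr[OF c(2,1) \<psi>])
    fix f n y assume f: "fi_arr f" "f \<in> W" and y: "y \<in> carrier (Mod (fob (trg \<eta>) (trg f)) n)"
    note fi = fi_arr_finite[OF f(1)]
    have "act (\<psi> (src f)) n (act (far (trg \<eta>) f) n y)
      = act (\<psi> (src f)) n (act (far (trg \<eta>) f) n (act (act \<eta> (trg f)) n (act (\<psi> (trg f)) n y)))"
      using r y fi by simp
    also have "\<dots> = act (\<psi> (src f)) n (act (act \<eta> (src f)) n (act (far (src \<eta>) f) n (act (\<psi> (trg f)) n y)))"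
      using f y cl fi by (simp add: comod_arr_natural[OF \<eta>])
    also have "\<dots> = act (far (src \<eta>) f) n (act (\<psi> (trg f)) n y)"
      using f y cl fi by (simp add: l far_closed[OF c(1)])
    finally show "act (\<psi> (src f)) n (act (far (trg \<eta>) f) n y) = act (far (src \<eta>) f) n (act (\<psi> (trg f)) n y)" .
  qed
  have "comod_comp W K ?\<theta> \<eta> = Idn (comod_category W K) (src \<eta>)"
    by (rule comod_arr_ext[where W = W and K = K])
      (use \<theta> \<eta> c l in \<open>simp_all add: comod_comp_arr comod_id_arr comod_comp_simps comod_id_simps\<close>)
  moreover have "comod_comp W K \<eta> ?\<theta> = Idn (comod_category W K) (trg \<eta>)"
    by (rule comod_arr_ext[where W = W and K = K])
      (use \<theta> \<eta> c r in \<open>simp_all add: comod_comp_arr comod_id_arr comod_comp_simps comod_id_simps\<close>)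
  ultimately show ?thesis unfolding is_iso_def using \<eta> \<theta> c
    by (auto simp: Hom_comod_iff intro!: bexI[of _ ?\<theta>])
qed

section \<open>Convolution products of comodules\<close>

text \<open>The common shape of \<open>cpx_tensor_out\<close> and \<open>day_out\<close>. The lift
  receives the target module as an argument because that module varies with the degree.\<close>

definition lift_map ::
  "('k, 's, 'v) ch \<Rightarrow> (('k, 's, 'v) vsp \<Rightarrow> int \<Rightarrow> ('k, 's, 'v) univ \<Rightarrow> ('k, 's, 'v) univ) \<Rightarrow>
   ('k, 's, 'v) ch \<Rightarrow> ('k, 's, 'v) ch_map" where
  "lift_map C l E = Arrow C (\<lambda>n. \<lambda>u \<in> carrier (Mod C n). l (Mod E n) n u) E"

lemma lift_map_simps [simp]: "src (lift_map C l E) = C" "trg (lift_map C l E) = E"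
  "u \<in> carrier (Mod C n) \<Longrightarrow> act (lift_map C l E) n u = l (Mod E n) n u"
  by (simp_all add: lift_map_def)

text \<open>
  The Hadamard product and the Day convolution are both of the form
  \<open>(F \<boxtimes> G)(S) = \<Oplus> F(A) \<otimes> G(B)\<close>, where \<open>(A, B)\<close> runs through a family \<open>D S\<close> of pairs of
  subsets with union \<open>S\<close>: only \<open>A = B = S\<close> in the first case, all \<open>A \<squnion> B = S\<close> in the second.
  The unit is the ground field in the arities in \<open>Z\<close>, and \<open>z S\<close> is the only
  \<open>A \<in> Z\<close> that occurs in a pair \<open>(A, B)\<close> of the family \<open>D S\<close>.
\<close>

locale convolution =
  fixes K :: "'k ring" and W :: "'s fi_map set"
    and M :: "(('k, 's, 'v) comod, ('k, 's, 'v) comod_map) smc"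
    and D :: "'s set \<Rightarrow> 's set \<Rightarrow> 's set \<Rightarrow> bool" and Z :: "'s set set" and z :: "'s set \<Rightarrow> 's set"
    and pr :: "('k, 's, 'v) comod \<Rightarrow> ('k, 's, 'v) comod \<Rightarrow> 's set \<Rightarrow> 's set \<Rightarrow> 's set \<Rightarrow> int \<Rightarrow> int \<Rightarrow>
      ('k, 's, 'v) univ \<Rightarrow> ('k, 's, 'v) univ \<Rightarrow> ('k, 's, 'v) univ"
    and lft :: "('k, 's, 'v) comod \<Rightarrow> ('k, 's, 'v) comod \<Rightarrow> 's set \<Rightarrow> ('k, 's, 'v) vsp \<Rightarrow>
      ('s set \<Rightarrow> 's set \<Rightarrow> int \<Rightarrow> int \<Rightarrow> ('k, 's, 'v) univ \<Rightarrow> ('k, 's, 'v) univ \<Rightarrow> ('k, 's, 'v) univ) \<Rightarrow>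
      int \<Rightarrow> ('k, 's, 'v) univ \<Rightarrow> ('k, 's, 'v) univ"
  assumes K: "cring K"
    and M: "Ob M = Ob (comod_category W K)" "Hom M = Hom (comod_category W K)"
      "Idn M = Idn (comod_category W K)" "Comp M = Comp (comod_category W K)"
    and W: "fi_arr f \<Longrightarrow> f \<in> W \<Longrightarrow> D (trg f) A B \<Longrightarrow> fi_restrict f A \<in> W"
    and D_Un: "D S A B \<Longrightarrow> A \<union> B = S"
    and D_sym: "D S A B \<Longrightarrow> D S B A"
    and D_assoc: "D S U C \<Longrightarrow> D U A B \<Longrightarrow> D S A (B \<union> C)" "D S U C \<Longrightarrow> D U A B \<Longrightarrow> D (B \<union> C) B C"
    and D_preimage: "fi_arr f \<Longrightarrow> D (trg f) A B \<Longrightarrow> D (src f) (fi_preimage f A) (fi_preimage f B)"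
    and D_unit: "D S A B \<Longrightarrow> A \<in> Z \<Longrightarrow> A = z S" "D S A B \<Longrightarrow> A \<in> Z \<Longrightarrow> B = S"
    and z: "z S \<in> Z" "D S (z S) S"
    and Z_src: "fi_arr f \<Longrightarrow> trg f \<in> Z \<Longrightarrow> src f \<in> Z"
    and tensor_sum_tob: "comodule K F \<Longrightarrow> comodule K G \<Longrightarrow> finite S \<Longrightarrow>
      tensor_sum K {(A, B, p, q). D S A B \<and> p + q = n} (\<lambda>(A, B, p, q). Mod (fob F A) p)
        (\<lambda>(A, B, p, q). Mod (fob G B) q) (Mod (fob (tob M F G) S) n)
        (\<lambda>(A, B, p, q). pr F G S A B p q) (\<lambda>P \<beta>. lft F G S P (\<lambda>A B p q. \<beta> (A, B, p, q)) n)"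
    and tob_cpx: "comodule K F \<Longrightarrow> comodule K G \<Longrightarrow> finite S \<Longrightarrow> chain_complex K (fob (tob M F G) S)"
    and bd_pr: "comodule K F \<Longrightarrow> comodule K G \<Longrightarrow> finite S \<Longrightarrow> D S A B \<Longrightarrow> n = p + q \<Longrightarrow>
      x \<in> carrier (Mod (fob F A) p) \<Longrightarrow> y \<in> carrier (Mod (fob G B) q) \<Longrightarrow>
      bd (fob (tob M F G) S) n (pr F G S A B p q x y) = pr F G S A B (p - 1) q (bd (fob F A) p x) y
        \<oplus>\<^bsub>Mod (fob (tob M F G) S) (n - 1)\<^esub> koszul K p \<odot>\<^bsub>Mod (fob (tob M F G) S) (n - 1)\<^esub>
          pr F G S A B p (q - 1) x (bd (fob G B) q y)"
    and far_tob: "comodule K F \<Longrightarrow> comodule K G \<Longrightarrow> fi_arr f \<Longrightarrow>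
      far (tob M F G) f = lift_map (fob (tob M F G) (trg f)) (\<lambda>P. lft F G (trg f) P
        (\<lambda>A B p q x y. pr F G (src f) (fi_preimage f A) (fi_preimage f B) p q
          (act (far F (fi_restrict f A)) p x) (act (far G (fi_restrict f B)) q y)))
        (fob (tob M F G) (src f))"
    and tar: "comod_arr W K \<eta> \<Longrightarrow> comod_arr W K \<theta> \<Longrightarrow>
      tar M \<eta> \<theta> = comod_arrow (tob M (src \<eta>) (src \<theta>))
        (\<lambda>S. lift_map (fob (tob M (src \<eta>) (src \<theta>)) S) (\<lambda>P. lft (src \<eta>) (src \<theta>) S P
          (\<lambda>A B p q x y. pr (trg \<eta>) (trg \<theta>) S A B p q (act (act \<eta> A) p x) (act (act \<theta> B) q y)))
          (fob (tob M (trg \<eta>) (trg \<theta>)) S)) (tob M (trg \<eta>) (trg \<theta>))"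
    and unit: "fob (unit_ob M) S = (if S \<in> Z then ground_cpx K else zero_cpx K)"
      "fi_arr f \<Longrightarrow> far (unit_ob M) f = (if trg f \<in> Z then Idn (Ch K) (ground_cpx K)
        else zero_map (fob (unit_ob M) (trg f)) (fob (unit_ob M) (src f)))"
    and associator: "comodule K F \<Longrightarrow> comodule K G \<Longrightarrow> comodule K H \<Longrightarrow>
      associator M F G H = comod_arrow (tob M (tob M F G) H)
        (\<lambda>S. lift_map (fob (tob M (tob M F G) H) S) (\<lambda>P. lft (tob M F G) H S P
          (\<lambda>U C m r u c. lft F G U (Mod (fob (tob M F (tob M G H)) S) (m + r))
            (\<lambda>A B p q x y. pr F (tob M G H) S A (B \<union> C) p (q + r) x (pr G H (B \<union> C) B C q r y c)) m u))
          (fob (tob M F (tob M G H)) S)) (tob M F (tob M G H))"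
    and left_unitor: "comodule K F \<Longrightarrow>
      left_unitor M F = comod_arrow (tob M (unit_ob M) F)
        (\<lambda>S. lift_map (fob (tob M (unit_ob M) F) S) (\<lambda>P. lft (unit_ob M) F S P
          (\<lambda>A B p q c x. if A \<in> Z \<and> p = 0 then scalar c \<odot>\<^bsub>Mod (fob F B) q\<^esub> x
            else \<zero>\<^bsub>Mod (fob F S) (p + q)\<^esub>)) (fob F S)) F"
    and right_unitor: "comodule K F \<Longrightarrow>
      right_unitor M F = comod_arrow (tob M F (unit_ob M))
        (\<lambda>S. lift_map (fob (tob M F (unit_ob M)) S) (\<lambda>P. lft F (unit_ob M) S P
          (\<lambda>A B p q x c. if B \<in> Z \<and> q = 0 then scalar c \<odot>\<^bsub>Mod (fob F A) p\<^esub> x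
            else \<zero>\<^bsub>Mod (fob F S) (p + q)\<^esub>)) (fob F S)) F"
    and braiding: "comodule K F \<Longrightarrow> comodule K G \<Longrightarrow>
      braiding M F G = comod_arrow (tob M F G)
        (\<lambda>S. lift_map (fob (tob M F G) S) (\<lambda>P. lft F G S P
          (\<lambda>A B p q x y. signed (Mod (fob (tob M G F) S) (p + q)) (p * q) (pr G F S B A q p y x)))
          (fob (tob M G F) S)) (tob M G F)"
begin

abbreviation T (infixr \<open>\<boxtimes>\<close> 70) where "F \<boxtimes> G \<equiv> tob M F G"
abbreviation "arr \<equiv> comod_arr W K"
abbreviation "com \<equiv> comodule K"
abbreviation "el F S n \<equiv> carrier (Mod (fob F S) n)"
abbreviation "U \<equiv> unit_ob M"

lemmas com_id = comodule_id[of K]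
  and com_comp = comodule_comp[of K]
  and com_far = comodule_far[of K]
  and com_far_closed = far_closed[of K]

lemma D_subset: "D S A B \<Longrightarrow> A \<subseteq> S" "D S A B \<Longrightarrow> B \<subseteq> S"
  using D_Un[of S A B] by auto

lemma D_finite: "D S A B \<Longrightarrow> finite S \<Longrightarrow> finite A" "D S A B \<Longrightarrow> finite S \<Longrightarrow> finite B"
  using D_subset[of S A B] finite_subset by auto

text \<open>Regrouping to the left is regrouping to the right after both pairs have been flipped, so
  only one direction is assumed of \<open>D\<close>.\<close>

lemma D_assoc': assumes "D S A V" "D V B C" shows "D S (A \<union> B) C" "D (A \<union> B) A B"
  using D_assoc(1)[OF D_sym[OF assms(1)] D_sym[OF assms(2)]]
    D_assoc(2)[OF D_sym[OF assms(1)] D_sym[OF assms(2)]] D_sym by (auto simp: Un_commute)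

lemma W2: "fi_arr f \<Longrightarrow> f \<in> W \<Longrightarrow> D (trg f) A B \<Longrightarrow> fi_restrict f B \<in> W"
  by (rule W[OF _ _ D_sym])

lemma fi_restrict_D:
  "fi_arr f \<Longrightarrow> D (trg f) A B \<Longrightarrow> fi_arr (fi_restrict f A)"
  "fi_arr f \<Longrightarrow> D (trg f) A B \<Longrightarrow> fi_arr (fi_restrict f B)"
  using D_subset[of "trg f" A B] by (simp_all add: fi_arr_restrict)

subsection \<open>Generating elements\<close>

lemma pr_bilinear:
  "com F \<Longrightarrow> com G \<Longrightarrow> finite S \<Longrightarrow> D S A B \<Longrightarrow> n = p + q \<Longrightarrow>
    bilinear K (Mod (fob F A) p) (Mod (fob G B) q) (Mod (fob (F \<boxtimes> G) S) n) (pr F G S A B p q)"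
  using tensor_sum_bilinear[OF tensor_sum_tob[of F G S n], of "(A, B, p, q)"] by auto

lemma pr_closed:
  "com F \<Longrightarrow> com G \<Longrightarrow> finite S \<Longrightarrow> D S A B \<Longrightarrow> n = p + q \<Longrightarrow> x \<in> el F A p \<Longrightarrow> y \<in> el G B q \<Longrightarrow>
    pr F G S A B p q x y \<in> el (F \<boxtimes> G) S n"
  by (rule bilinear_closed[OF pr_bilinear])

lemma tob_module: "com F \<Longrightarrow> com G \<Longrightarrow> finite S \<Longrightarrow> module K (Mod (fob (F \<boxtimes> G) S) n)"
  by (simp add: tob_cpx chain_complex_module)

lemma tob_ext:
  assumes "com F" "com G" "finite S"
    and "lin K (Mod (fob (F \<boxtimes> G) S) n) P f" "lin K (Mod (fob (F \<boxtimes> G) S) n) P g" "u \<in> el (F \<boxtimes> G) S n"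
    and "\<And>A B p q x y. D S A B \<Longrightarrow> n = p + q \<Longrightarrow> x \<in> el F A p \<Longrightarrow> y \<in> el G B q \<Longrightarrow>
      f (pr F G S A B p q x y) = g (pr F G S A B p q x y)"
  shows "f u = g u"
  by (rule tensor_sum_ext[OF tensor_sum_tob[OF assms(1-3)] assms(4-6)]) (use assms(7) in auto)

lemma lft:
  assumes "com F" "com G" "finite S" "module K P"
    "\<And>A B p q. D S A B \<Longrightarrow> n = p + q \<Longrightarrow> bilinear K (Mod (fob F A) p) (Mod (fob G B) q) P (\<beta> A B p q)"
  shows lin_lft: "lin K (Mod (fob (F \<boxtimes> G) S) n) P (lft F G S P \<beta> n)"
    and lft_pr: "D S A B \<Longrightarrow> n = p + q \<Longrightarrow> x \<in> el F A p \<Longrightarrow> y \<in> el G B q \<Longrightarrow>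
      lft F G S P \<beta> n (pr F G S A B p q x y) = \<beta> A B p q x y"
  using tensor_sum_lift[OF tensor_sum_tob[OF assms(1-3), of n] assms(4), of "\<lambda>(A, B, p, q). \<beta> A B p q"]
    assms(5) by auto

text \<open>These are the bilinear families that extend to chain maps out of the product in arity
  \<open>S\<close>; the equation is the Leibniz rule. The degree \<open>n\<close> is kept apart from
  \<open>p + q\<close> so that it can be matched with any form of the sum.\<close>

definition bimap where
  "bimap F G S E \<beta> \<longleftrightarrow> com F \<and> com G \<and> finite S \<and> chain_complex K E \<and>
    (\<forall>A B p q n. D S A B \<longrightarrow> n = p + q \<longrightarrow>
      bilinear K (Mod (fob F A) p) (Mod (fob G B) q) (Mod E n) (\<beta> A B p q) \<and>
      (\<forall>x \<in> el F A p. \<forall>y \<in> el G B q. bd E n (\<beta> A B p q x y) =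
        \<beta> A B (p - 1) q (bd (fob F A) p x) y \<oplus>\<^bsub>Mod E (n - 1)\<^esub>
          koszul K p \<odot>\<^bsub>Mod E (n - 1)\<^esub> \<beta> A B p (q - 1) x (bd (fob G B) q y)))"

text \<open>Both the boundary of the lift and the lift of the boundary are linear, so they may be
  compared on generators, where the Leibniz rule for \<open>\<beta>\<close> meets that of the
  product.\<close>

lemma bimap_lift:
  assumes "bimap F G S E \<beta>"
  shows "ch_arr K (lift_map (fob (F \<boxtimes> G) S) (\<lambda>P. lft F G S P \<beta>) E)"
    and "D S A B \<Longrightarrow> n = p + q \<Longrightarrow> x \<in> el F A p \<Longrightarrow> y \<in> el G B q \<Longrightarrow>
      act (lift_map (fob (F \<boxtimes> G) S) (\<lambda>P. lft F G S P \<beta>) E) n (pr F G S A B p q x y) = \<beta> A B p q x y"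
proof -
  have F: "com F" "com G" "finite S" and E: "chain_complex K E"
    and b: "\<And>A B p q n. D S A B \<Longrightarrow> n = p + q \<Longrightarrow>
      bilinear K (Mod (fob F A) p) (Mod (fob G B) q) (Mod E n) (\<beta> A B p q)"
    and d: "\<And>A B p q n x y. D S A B \<Longrightarrow> n = p + q \<Longrightarrow> x \<in> el F A p \<Longrightarrow> y \<in> el G B q \<Longrightarrow>
      bd E n (\<beta> A B p q x y) = \<beta> A B (p - 1) q (bd (fob F A) p x) y \<oplus>\<^bsub>Mod E (n - 1)\<^esub>
          koszul K p \<odot>\<^bsub>Mod E (n - 1)\<^esub> \<beta> A B p (q - 1) x (bd (fob G B) q y)"
    using assms by (auto simp: bimap_def)
  have L: "lin K (Mod (fob (F \<boxtimes> G) S) n) (Mod E n) (lft F G S (Mod E n) \<beta> n)" for n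
    by (rule lin_lft[OF F chain_complex_module[OF E] b])
  have P: "lft F G S (Mod E n) \<beta> n (pr F G S A B p q x y) = \<beta> A B p q x y"
    if "D S A B" "n = p + q" "x \<in> el F A p" "y \<in> el G B q" for A B p q n x y
    by (rule lft_pr[OF F chain_complex_module[OF E] b]) (use that in auto)
  show "ch_arr K (lift_map (fob (F \<boxtimes> G) S) (\<lambda>P. lft F G S P \<beta>) E)"
    unfolding lift_map_def
  proof (rule ch_arrI[OF tob_cpx[OF F] E L])
    fix n u assume u: "u \<in> el (F \<boxtimes> G) S n"
    show "lft F G S (Mod E (n - 1)) \<beta> (n - 1) (bd (fob (F \<boxtimes> G) S) n u) = bd E n (lft F G S (Mod E n) \<beta> n u)"
    proof (rule tob_ext[OF F _ _ u])
      show "lin K (Mod (fob (F \<boxtimes> G) S) n) (Mod E (n - 1))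
          (\<lambda>u. lft F G S (Mod E (n - 1)) \<beta> (n - 1) (bd (fob (F \<boxtimes> G) S) n u))"
        by (rule lin_comp[OF chain_complex_bd[OF tob_cpx[OF F]] L])
      show "lin K (Mod (fob (F \<boxtimes> G) S) n) (Mod E (n - 1)) (\<lambda>u. bd E n (lft F G S (Mod E n) \<beta> n u))"
        by (rule lin_comp[OF L chain_complex_bd[OF E]])
      fix A B p q x y assume AB: "D S A B" and n: "n = p + q" and x: "x \<in> el F A p" and y: "y \<in> el G B q"
      have dx: "bd (fob F A) p x \<in> el F A (p - 1)" and dy: "bd (fob G B) q y \<in> el G B (q - 1)"
        using x y lin_closed[OF comodule_bd_lin] F D_finite[OF AB] by auto
      show "lft F G S (Mod E (n - 1)) \<beta> (n - 1) (bd (fob (F \<boxtimes> G) S) n (pr F G S A B p q x y))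
          = bd E n (lft F G S (Mod E n) \<beta> n (pr F G S A B p q x y))"
        using AB n x y dx dy F
        by (simp add: P d bd_pr lin_add[OF L] lin_smult[OF L] pr_closed K
            module_smult_closed[OF tob_module])
    qed
  qed
  show "D S A B \<Longrightarrow> n = p + q \<Longrightarrow> x \<in> el F A p \<Longrightarrow> y \<in> el G B q \<Longrightarrow>
      act (lift_map (fob (F \<boxtimes> G) S) (\<lambda>P. lft F G S P \<beta>) E) n (pr F G S A B p q x y) = \<beta> A B p q x y"
    using F by (simp add: P pr_closed)
qed

text \<open>Chain maps in the two factors commute with the differentials, so the Leibniz rule is
  inherited from the target product. With \<open>a\<close> and \<open>b\<close> taken as preimages
  this gives the action of an injection, with identities it gives the tensor product of two
  morphisms.\<close>

lemma bimap_pr: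
  assumes F: "com F" "com G" "com F'" "com G'" "finite S" "finite S'"
    and ab: "\<And>A B. D S A B \<Longrightarrow> D S' (a A) (b B)"
    and \<phi>: "\<And>A B. D S A B \<Longrightarrow> ch_arr K (\<phi> A) \<and> src (\<phi> A) = fob F A \<and> trg (\<phi> A) = fob F' (a A)"
    and \<psi>: "\<And>A B. D S A B \<Longrightarrow> ch_arr K (\<psi> B) \<and> src (\<psi> B) = fob G B \<and> trg (\<psi> B) = fob G' (b B)"
  shows "bimap F G S (fob (F' \<boxtimes> G') S')
    (\<lambda>A B p q x y. pr F' G' S' (a A) (b B) p q (act (\<phi> A) p x) (act (\<psi> B) q y))"
  unfolding bimap_def
proof (intro conjI allI impI ballI)
  fix A B and p q n :: int assume AB: "D S A B" and n: "n = p + q"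
  have l: "lin K (Mod (fob F A) p) (Mod (fob F' (a A)) p) (act (\<phi> A) p)"
    "lin K (Mod (fob G B) p) (Mod (fob G' (b B)) p) (act (\<psi> B) p)" for p
    using \<phi>[OF AB] \<psi>[OF AB] ch_arr_lin by metis+
  show "bilinear K (Mod (fob F A) p) (Mod (fob G B) q) (Mod (fob (F' \<boxtimes> G') S') n)
      (\<lambda>x y. pr F' G' S' (a A) (b B) p q (act (\<phi> A) p x) (act (\<psi> B) q y))"
    by (rule bilinear_comp2[OF pr_bilinear[OF F(3,4,6) ab[OF AB] n] l])
  fix x y assume x: "x \<in> el F A p" and y: "y \<in> el G B q"
  have "act (\<phi> A) (p - 1) (bd (fob F A) p x) = bd (fob F' (a A)) p (act (\<phi> A) p x)"
    "act (\<psi> B) (q - 1) (bd (fob G B) q y) = bd (fob G' (b B)) q (act (\<psi> B) q y)"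
    using \<phi>[OF AB] \<psi>[OF AB] ch_arr_bd x y by metis+
  then show "bd (fob (F' \<boxtimes> G') S') n (pr F' G' S' (a A) (b B) p q (act (\<phi> A) p x) (act (\<psi> B) q y)) =
      pr F' G' S' (a A) (b B) (p - 1) q (act (\<phi> A) (p - 1) (bd (fob F A) p x)) (act (\<psi> B) q y)
      \<oplus>\<^bsub>Mod (fob (F' \<boxtimes> G') S') (n - 1)\<^esub> koszul K p \<odot>\<^bsub>Mod (fob (F' \<boxtimes> G') S') (n - 1)\<^esub>
        pr F' G' S' (a A) (b B) p (q - 1) (act (\<phi> A) p x) (act (\<psi> B) (q - 1) (bd (fob G B) q y))"
    using bd_pr[OF F(3,4,6) ab[OF AB] n] lin_closed[OF l(1) x] lin_closed[OF l(2) y] by simp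
qed (use F tob_cpx in auto)

lemma pr_add_right:
  "com F \<Longrightarrow> com G \<Longrightarrow> finite S \<Longrightarrow> D S A B \<Longrightarrow> x \<in> el F A p \<Longrightarrow> y \<in> el G B q \<Longrightarrow> y' \<in> el G B q \<Longrightarrow>
    pr F G S A B p q x (y \<oplus>\<^bsub>Mod (fob G B) q\<^esub> y')
      = pr F G S A B p q x y \<oplus>\<^bsub>Mod (fob (F \<boxtimes> G) S) (p + q)\<^esub> pr F G S A B p q x y'"
  using lin_add[OF bilinear_right[OF pr_bilinear]] by simp

lemma pr_smult_left:
  "com F \<Longrightarrow> com G \<Longrightarrow> finite S \<Longrightarrow> D S A B \<Longrightarrow> n = p \<Longrightarrow> c \<in> carrier K \<Longrightarrow> x \<in> el F A p \<Longrightarrow> y \<in> el G B q \<Longrightarrow>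
    pr F G S A B p q (c \<odot>\<^bsub>Mod (fob F A) n\<^esub> x) y = c \<odot>\<^bsub>Mod (fob (F \<boxtimes> G) S) (p + q)\<^esub> pr F G S A B p q x y"
  using lin_smult[OF bilinear_left[OF pr_bilinear]] by simp

lemma pr_smult_right:
  "com F \<Longrightarrow> com G \<Longrightarrow> finite S \<Longrightarrow> D S A B \<Longrightarrow> n = q \<Longrightarrow> c \<in> carrier K \<Longrightarrow> x \<in> el F A p \<Longrightarrow> y \<in> el G B q \<Longrightarrow>
    pr F G S A B p q x (c \<odot>\<^bsub>Mod (fob G B) n\<^esub> y) = c \<odot>\<^bsub>Mod (fob (F \<boxtimes> G) S) (p + q)\<^esub> pr F G S A B p q x y"
  using lin_smult[OF bilinear_right[OF pr_bilinear]] by simp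

lemma pr_zero_left:
  "com F \<Longrightarrow> com G \<Longrightarrow> finite S \<Longrightarrow> D S A B \<Longrightarrow> y \<in> el G B q \<Longrightarrow>
    pr F G S A B p q \<zero>\<^bsub>Mod (fob F A) p\<^esub> y = \<zero>\<^bsub>Mod (fob (F \<boxtimes> G) S) (p + q)\<^esub>"
  using lin_zero[OF bilinear_left[OF pr_bilinear]] by simp

lemma pr_zero_right:
  "com F \<Longrightarrow> com G \<Longrightarrow> finite S \<Longrightarrow> D S A B \<Longrightarrow> x \<in> el F A p \<Longrightarrow>
    pr F G S A B p q x \<zero>\<^bsub>Mod (fob G B) q\<^esub> = \<zero>\<^bsub>Mod (fob (F \<boxtimes> G) S) (p + q)\<^esub>"
  using lin_zero[OF bilinear_right[OF pr_bilinear]] by simp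

subsection \<open>The product is a bifunctor\<close>

lemma bimap_far:
  assumes "com F" "com G" "fi_arr f"
  shows "bimap F G (trg f) (fob (F \<boxtimes> G) (src f))
    (\<lambda>A B p q x y. pr F G (src f) (fi_preimage f A) (fi_preimage f B) p q
          (act (far F (fi_restrict f A)) p x) (act (far G (fi_restrict f B)) q y))"
  using assms
  by (intro bimap_pr) (auto simp: D_preimage fi_arr_finite com_far fi_restrict_D)

lemma far_pr:
  assumes "com F" "com G" "fi_arr f"
  shows "S = trg f \<Longrightarrow> D S A B \<Longrightarrow> n = p + q \<Longrightarrow> x \<in> el F A p \<Longrightarrow> y \<in> el G B q \<Longrightarrow>
    act (far (F \<boxtimes> G) f) n (pr F G S A B p q x y) =
      pr F G (src f) (fi_preimage f A) (fi_preimage f B) p q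
          (act (far F (fi_restrict f A)) p x) (act (far G (fi_restrict f B)) q y)"
  using bimap_lift(2)[OF bimap_far[OF assms]] assms by (simp add: far_tob)

text \<open>On generators the functor laws of the product are those of \<open>F\<close> and
  \<open>G\<close>, together with the compatibility of preimages and restrictions with
  composition.\<close>

lemma com_tob:
  assumes F: "com F" and G: "com G" shows "com (F \<boxtimes> G)"
proof -
  have c: "ch_arr K (far (F \<boxtimes> G) f)" if "fi_arr f" for f
    using bimap_lift(1)[OF bimap_far[OF F G that]] by (simp add: far_tob F G that)
  have s: "src (far (F \<boxtimes> G) f) = fob (F \<boxtimes> G) (trg f)" "trg (far (F \<boxtimes> G) f) = fob (F \<boxtimes> G) (src f)"
    if "fi_arr f" for f using that by (simp_all add: far_tob F G)
  have l: "lin K (Mod (fob (F \<boxtimes> G) (trg f)) n) (Mod (fob (F \<boxtimes> G) (src f)) n) (act (far (F \<boxtimes> G) f) n)"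
    if "fi_arr f" for f n using ch_arr_lin[OF c[OF that], of n] by (simp add: s that)
  show ?thesis
  proof (rule comoduleI[OF tob_cpx[OF F G] c s])
    fix S n u assume S: "finite S" and u: "u \<in> el (F \<boxtimes> G) S n"
    show "act (far (F \<boxtimes> G) (Idn FI S)) n u = u"
    proof (rule tob_ext[OF F G S _ lin_id u])
      show "lin K (Mod (fob (F \<boxtimes> G) S) n) (Mod (fob (F \<boxtimes> G) S) n) (act (far (F \<boxtimes> G) (Idn FI S)) n)"
        using l[OF fi_arr_id[OF S], of n] by simp
      fix A B p q x y assume AB: "D S A B" and "n = p + q" "x \<in> el F A p" "y \<in> el G B q"
      with D_subset[OF AB] D_finite[OF AB S] show "act (far (F \<boxtimes> G) (Idn FI S)) n (pr F G S A B p q x y) = pr F G S A B p q x y"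
        by (simp add: far_pr F G S fi_arr_id fi_preimage_id fi_restrict_id com_id)
    qed (simp add: tob_module F G S)
  next
    fix f g n u assume f: "fi_arr f" and g: "fi_arr g" and fg: "trg f = src g"
      and u: "u \<in> el (F \<boxtimes> G) (trg g) n"
    note gf = fi_arr_comp[OF f g fg]
    show "act (far (F \<boxtimes> G) (g \<cdot>\<^bsub>FI\<^esub> f)) n u = act (far (F \<boxtimes> G) f) n (act (far (F \<boxtimes> G) g) n u)"
    proof (rule tob_ext[OF F G fi_arr_finite(2)[OF g] _ _ u])
      show "lin K (Mod (fob (F \<boxtimes> G) (trg g)) n) (Mod (fob (F \<boxtimes> G) (src f)) n)
          (act (far (F \<boxtimes> G) (g \<cdot>\<^bsub>FI\<^esub> f)) n)"
        using l[OF gf, of n] by simp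
      show "lin K (Mod (fob (F \<boxtimes> G) (trg g)) n) (Mod (fob (F \<boxtimes> G) (src f)) n)
          (\<lambda>u. act (far (F \<boxtimes> G) f) n (act (far (F \<boxtimes> G) g) n u))"
        by (rule lin_comp[OF l[OF g] l[OF f, unfolded fg]])
      fix A B p q x y assume AB: "D (trg g) A B" and "n = p + q" "x \<in> el F A p" "y \<in> el G B q"
      moreover have "D (trg f) (fi_preimage g A) (fi_preimage g B)"
        using D_preimage[OF g AB] fg by simp
      ultimately show "act (far (F \<boxtimes> G) (g \<cdot>\<^bsub>FI\<^esub> f)) n (pr F G (trg g) A B p q x y)
          = act (far (F \<boxtimes> G) f) n (act (far (F \<boxtimes> G) g) n (pr F G (trg g) A B p q x y))"
        using f g fg gf fi_restrict_D[OF g AB] fi_restrict_D[OF f]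
        by (simp add: far_pr F G fi_preimage_comp fi_restrict_comp com_comp com_far_closed)
    qed
  qed
qed

text \<open>Naturality of a lift is an equality of linear maps out of a product, so generators
  suffice. Tensor products of morphisms, the left unitor, the braiding and the associator are all
  obtained from this criterion.\<close>

lemma lift_arr:
  assumes F: "com F" and G: "com G" and E: "com E"
    and b: "\<And>S. finite S \<Longrightarrow> bimap F G S (fob E S) (\<beta> S)"
    and nat: "\<And>f A B p q x y. fi_arr f \<Longrightarrow> f \<in> W \<Longrightarrow> D (trg f) A B \<Longrightarrow> x \<in> el F A p \<Longrightarrow> y \<in> el G B q \<Longrightarrow>
      \<beta> (src f) (fi_preimage f A) (fi_preimage f B) p q
        (act (far F (fi_restrict f A)) p x) (act (far G (fi_restrict f B)) q y)
      = act (far E f) (p + q) (\<beta> (trg f) A B p q x y)"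
  shows "arr (comod_arrow (F \<boxtimes> G)
    (\<lambda>S. lift_map (fob (F \<boxtimes> G) S) (\<lambda>P. lft F G S P (\<beta> S)) (fob E S)) E)"
proof (rule comod_arrow_arr[OF com_tob[OF F G] E])
  let ?t = "\<lambda>S. lift_map (fob (F \<boxtimes> G) S) (\<lambda>P. lft F G S P (\<beta> S)) (fob E S)"
  have t: "ch_arr K (?t S)" if "finite S" for S by (rule bimap_lift(1)[OF b[OF that]])
  then show "ch_arr K (?t S) \<and> src (?t S) = fob (F \<boxtimes> G) S \<and> trg (?t S) = fob E S"
    if "finite S" for S using that by simp
  have tp: "act (?t S) n (pr F G S A B p q x y) = \<beta> S A B p q x y"
    if "finite S" "D S A B" "n = p + q" "x \<in> el F A p" "y \<in> el G B q" for S n A B p q x y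
    using bimap_lift(2)[OF b[OF that(1)] that(2-5)] .
  fix f n u assume f: "fi_arr f" "f \<in> W" and u: "u \<in> el (F \<boxtimes> G) (trg f) n"
  note fin = fi_arr_finite[OF f(1)]
  have l: "lin K (Mod (fob (F \<boxtimes> G) S) n) (Mod (fob E S) n) (act (?t S) n)"
    if "finite S" for S using ch_arr_lin[OF t[OF that], of n] by simp
  show "act (?t (src f)) n (act (far (F \<boxtimes> G) f) n u) = act (far E f) n (act (?t (trg f)) n u)"
  proof (rule tob_ext[OF F G fin(2) _ _ u])
    show "lin K (Mod (fob (F \<boxtimes> G) (trg f)) n) (Mod (fob E (src f)) n)
        (\<lambda>u. act (?t (src f)) n (act (far (F \<boxtimes> G) f) n u))"
      using f by (intro lin_comp[OF far_lin l]) (auto simp: fin com_tob F G)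
    show "lin K (Mod (fob (F \<boxtimes> G) (trg f)) n) (Mod (fob E (src f)) n)
        (\<lambda>u. act (far E f) n (act (?t (trg f)) n u))"
      using f by (intro lin_comp[OF l far_lin]) (auto simp: fin E)
    fix A B p q x y assume AB: "D (trg f) A B" and n: "n = p + q" and xy: "x \<in> el F A p" "y \<in> el G B q"
    then show "act (?t (src f)) n (act (far (F \<boxtimes> G) f) n (pr F G (trg f) A B p q x y))
      = act (far E f) n (act (?t (trg f)) n (pr F G (trg f) A B p q x y))"
      using f fin fi_restrict_D[OF f(1) AB] D_preimage[OF f(1) AB] D_finite[OF AB] nat[OF f AB xy]
      by (simp add: tp far_pr com_far_closed F G del: lift_map_simps)
  qed
qed

lemma bimap_tar:
  assumes "arr \<eta>" "arr \<theta>" "finite S"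
  shows "bimap (src \<eta>) (src \<theta>) S (fob (trg \<eta> \<boxtimes> trg \<theta>) S)
    (\<lambda>A B p q x y. pr (trg \<eta>) (trg \<theta>) S A B p q (act (act \<eta> A) p x) (act (act \<theta> B) q y))"
  using assms
  by (intro bimap_pr[where a = "\<lambda>A. A" and b = "\<lambda>B. B"])
    (auto simp: comod_arr_comodule comod_arr_component D_finite)

lemma tar_simps:
  assumes "arr \<eta>" "arr \<theta>"
  shows "src (tar M \<eta> \<theta>) = src \<eta> \<boxtimes> src \<theta>" "trg (tar M \<eta> \<theta>) = trg \<eta> \<boxtimes> trg \<theta>"
    and tar_pr: "finite S \<Longrightarrow> D S A B \<Longrightarrow> n = p + q \<Longrightarrow> x \<in> el (src \<eta>) A p \<Longrightarrow> y \<in> el (src \<theta>) B q \<Longrightarrow>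
      F = src \<eta> \<Longrightarrow> G = src \<theta> \<Longrightarrow> act (act (tar M \<eta> \<theta>) S) n (pr F G S A B p q x y) =
        pr (trg \<eta>) (trg \<theta>) S A B p q (act (act \<eta> A) p x) (act (act \<theta> B) q y)"
  using bimap_lift(2)[OF bimap_tar[OF assms]] assms by (simp_all add: tar)

lemma tar_arr:
  assumes \<eta>: "arr \<eta>" and \<theta>: "arr \<theta>" shows "arr (tar M \<eta> \<theta>)"
proof -
  note C = comod_arr_comodule[OF \<eta>] comod_arr_comodule[OF \<theta>]
  show ?thesis
    unfolding tar[OF \<eta> \<theta>]
  proof (rule lift_arr[OF C(1,3) com_tob[OF C(2,4)] bimap_tar[OF \<eta> \<theta>]])
    fix f A B p q x y
    assume f: "fi_arr f" "f \<in> W" and AB: "D (trg f) A B" and "x \<in> el (src \<eta>) A p" "y \<in> el (src \<theta>) B q"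
    then show "pr (trg \<eta>) (trg \<theta>) (src f) (fi_preimage f A) (fi_preimage f B) p q
        (act (act \<eta> (fi_preimage f A)) p (act (far (src \<eta>) (fi_restrict f A)) p x))
        (act (act \<theta> (fi_preimage f B)) q (act (far (src \<theta>) (fi_restrict f B)) q y))
      = act (far (trg \<eta> \<boxtimes> trg \<theta>) f) (p + q)
          (pr (trg \<eta>) (trg \<theta>) (trg f) A B p q (act (act \<eta> A) p x) (act (act \<theta> B) q y))"
      using C fi_restrict_D[OF f(1) AB] D_finite[OF AB] fi_arr_finite[OF f(1)] W[OF f AB] W2[OF f AB]
      by (simp add: far_pr comod_arr_closed[OF \<eta>] comod_arr_closed[OF \<theta>]
          comod_arr_natural[OF \<eta>] comod_arr_natural[OF \<theta>])
  qed
qed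

text \<open>Equality of morphisms is equality of components and does not involve naturality. The set
  \<open>W'\<close> is therefore independent of \<open>W\<close>; this is needed to compare
  morphisms out of Hadamard products that are natural for bijections only.\<close>

lemma arr_ext2_any:
  assumes "com F" "com G" and e: "comod_arr W' K \<eta>" "comod_arr W' K \<theta>" "src \<eta> = F \<boxtimes> G" "src \<theta> = F \<boxtimes> G" "trg \<eta> = trg \<theta>"
    and "\<And>S A B p q x y. finite S \<Longrightarrow> D S A B \<Longrightarrow> finite A \<Longrightarrow> finite B \<Longrightarrow>
      x \<in> el F A p \<Longrightarrow> y \<in> el G B q \<Longrightarrow>
      act (act \<eta> S) (p + q) (pr F G S A B p q x y) = act (act \<theta> S) (p + q) (pr F G S A B p q x y)"
  shows "\<eta> = \<theta>"
proof (rule comod_arr_ext[OF e(1,2)])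
  fix S n u assume S: "finite S" and u: "u \<in> el (src \<eta>) S n"
  show "act (act \<eta> S) n u = act (act \<theta> S) n u"
    by (rule tob_ext[OF assms(1,2) S comod_arr_lin[OF e(1) S _ HOL.refl] comod_arr_lin[OF e(2) S]])
      (use u S e assms(8) D_finite in auto)
qed (use e in auto)

lemmas arr_ext2 = arr_ext2_any[where W' = W]

end

lemma koszul_cong: "even i = even j \<Longrightarrow> koszul K i = koszul K j"
  by (simp add: koszul_def)

lemma scalar_lin:
  assumes "module K P" "x \<in> carrier P"
  shows "lin K (ground_space K) P (\<lambda>c. scalar c \<odot>\<^bsub>P\<^esub> x)"
proof -
  interpret module K P by fact
  have "cring K" by unfold_locales
  show ?thesis
    by (rule linI[OF ground_space_module[OF \<open>cring K\<close>] assms(1)])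
      (auto simp: ground_space_def smult_l_distr smult_assoc1 assms(2))
qed

lemma module_simps:
  assumes "module K P"
  shows "x \<in> carrier P \<Longrightarrow> \<zero>\<^bsub>P\<^esub> \<oplus>\<^bsub>P\<^esub> x = x" "x \<in> carrier P \<Longrightarrow> x \<oplus>\<^bsub>P\<^esub> \<zero>\<^bsub>P\<^esub> = x"
    "c \<in> carrier K \<Longrightarrow> c \<odot>\<^bsub>P\<^esub> \<zero>\<^bsub>P\<^esub> = \<zero>\<^bsub>P\<^esub>" "\<zero>\<^bsub>P\<^esub> \<in> carrier P"
    "c \<in> carrier K \<Longrightarrow> x \<in> carrier P \<Longrightarrow> c \<odot>\<^bsub>P\<^esub> x \<in> carrier P"
proof -
  interpret module K P by fact
  show "x \<in> carrier P \<Longrightarrow> \<zero>\<^bsub>P\<^esub> \<oplus>\<^bsub>P\<^esub> x = x" "x \<in> carrier P \<Longrightarrow> x \<oplus>\<^bsub>P\<^esub> \<zero>\<^bsub>P\<^esub> = x"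
    "c \<in> carrier K \<Longrightarrow> c \<odot>\<^bsub>P\<^esub> \<zero>\<^bsub>P\<^esub> = \<zero>\<^bsub>P\<^esub>" "\<zero>\<^bsub>P\<^esub> \<in> carrier P"
    "c \<in> carrier K \<Longrightarrow> x \<in> carrier P \<Longrightarrow> c \<odot>\<^bsub>P\<^esub> x \<in> carrier P" by simp_all
qed

lemma module_add_comm:
  assumes "module K P" shows "x \<in> carrier P \<Longrightarrow> y \<in> carrier P \<Longrightarrow> x \<oplus>\<^bsub>P\<^esub> y = y \<oplus>\<^bsub>P\<^esub> x"
proof -
  interpret module K P by fact
  show "x \<in> carrier P \<Longrightarrow> y \<in> carrier P \<Longrightarrow> x \<oplus>\<^bsub>P\<^esub> y = y \<oplus>\<^bsub>P\<^esub> x" by (rule M.a_comm)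
qed

context convolution
begin

lemma bimap_cong:
  assumes "bimap F G S E \<beta>"
    and eq: "\<And>A B p q x y. D S A B \<Longrightarrow> x \<in> el F A p \<Longrightarrow> y \<in> el G B q \<Longrightarrow> \<beta> A B p q x y = \<gamma> A B p q x y"
  shows "bimap F G S E \<gamma>"
  unfolding bimap_def
proof (intro conjI allI impI ballI)
  have F: "com F" "com G" "finite S" using assms(1) by (auto simp: bimap_def)
  fix A B and p q n :: int assume AB: "D S A B" and n: "n = p + q"
  show "bilinear K (Mod (fob F A) p) (Mod (fob G B) q) (Mod E n) (\<gamma> A B p q)"
    by (rule bilinear_cong[of _ _ _ _ "\<beta> A B p q"]) (use assms AB n in \<open>auto simp: bimap_def\<close>)
  fix x y assume x: "x \<in> el F A p" and y: "y \<in> el G B q"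
  have "bd (fob F A) p x \<in> el F A (p - 1)" "bd (fob G B) q y \<in> el G B (q - 1)"
    using x y lin_closed[OF comodule_bd_lin] F D_finite[OF AB] by auto
  then show "bd E n (\<gamma> A B p q x y) = \<gamma> A B (p - 1) q (bd (fob F A) p x) y \<oplus>\<^bsub>Mod E (n - 1)\<^esub>
      koszul K p \<odot>\<^bsub>Mod E (n - 1)\<^esub> \<gamma> A B p (q - 1) x (bd (fob G B) q y)"
    using assms(1) AB n x y eq by (simp add: bimap_def)
qed (use assms in \<open>auto simp: bimap_def\<close>)

lemma lift_act:
  assumes "finite S" "bimap F G S E \<beta>" "D S A B" "n = p + q" "x \<in> el F A p" "y \<in> el G B q"
    and "act \<eta> S = lift_map (fob (F \<boxtimes> G) S) (\<lambda>P. lft F G S P \<beta>) E"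
  shows "act (act \<eta> S) n (pr F G S A B p q x y) = \<beta> A B p q x y"
  unfolding assms(7) using bimap_lift(2)[OF assms(2-6)] .

subsection \<open>The unit\<close>

lemma unit_zero: "\<zero>\<^bsub>Mod (fob U S) n\<^esub> = Scalar \<zero>\<^bsub>K\<^esub>"
  by (simp add: unit ground_cpx_def zero_cpx_def ground_space_def zero_space_def)

lemma unit_bd: "bd (fob U S) n c = Scalar \<zero>\<^bsub>K\<^esub>"
  by (simp add: unit ground_cpx_def zero_cpx_def)

lemma unit_degenerate: "c \<in> el U S n \<Longrightarrow> \<not> (S \<in> Z \<and> n = 0) \<Longrightarrow> c = Scalar \<zero>\<^bsub>K\<^esub>"
  by (auto simp: unit ground_cpx_def zero_cpx_def zero_space_def split: if_splits)

lemma unit_ground: "S \<in> Z \<Longrightarrow> Mod (fob U S) 0 = ground_space K"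
  by (simp add: unit ground_cpx_def)

lemma unit_scalar: "c \<in> el U S n \<Longrightarrow> scalar c \<in> carrier K \<and> Scalar (scalar c) = c"
proof -
  interpret cring K by (rule K)
  show "c \<in> el U S n \<Longrightarrow> ?thesis"
    by (auto simp: unit ground_cpx_def zero_cpx_def ground_space_def zero_space_def split: if_splits)
qed

lemma unit_cpx: "chain_complex K (fob U S)"
  by (simp add: unit chain_complex_ground chain_complex_zero K)

text \<open>The ground complex and the zero complex have the same zero,
  \<open>Scalar \<zero>\<close>. Hence even the zero maps among the structure maps of the unit leave
  the underlying element unchanged.\<close>

lemma far_unit:
  assumes "fi_arr f" "c \<in> el U (trg f) n"
  shows "act (far U f) n c = c"
  using assms unit_degenerate[OF assms(2)] unit_zero[of "src f" n]
  by (auto simp: unit split: if_splits)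

lemma com_unit: "com U"
proof (rule comoduleI[OF unit_cpx])
  show "ch_arr K (far U f)" "src (far U f) = fob U (trg f)" "trg (far U f) = fob U (src f)"
    if "fi_arr f" for f
    using that Z_src[OF that] unit_cpx
    by (auto simp: unit(2) ch_id ch_zero_map) (auto simp: unit(1) chain_complex_ground K ch_id)
  show "act (far U (Idn FI S)) n c = c" if "finite S" "c \<in> el U S n" for S n c
    using that by (simp add: far_unit fi_arr_id)
  show "act (far U (g \<cdot>\<^bsub>FI\<^esub> f)) n c = act (far U f) n (act (far U g) n c)"
    if "fi_arr f" "fi_arr g" "trg f = src g" "c \<in> el U (trg g) n" for f g n c
  proof -
    have "c \<in> el U (trg f) n"
      using that Z_src[OF that(2)] unit_degenerate[OF that(4)] module_zero_closed[OF chain_complex_module[OF unit_cpx]] unit_zero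
      by (cases "trg g \<in> Z") (auto simp: unit(1))
    then show ?thesis using that by (simp add: far_unit fi_arr_comp)
  qed
qed

lemma bimap_left_unitor:
  assumes F: "com F" and S: "finite S"
  shows "bimap U F S (fob F S) (\<lambda>A B p q c x. if A \<in> Z \<and> p = 0 then scalar c \<odot>\<^bsub>Mod (fob F B) q\<^esub> x
            else \<zero>\<^bsub>Mod (fob F S) (p + q)\<^esub>)" (is "bimap _ _ _ _ ?\<beta>")
  unfolding bimap_def
proof (intro conjI allI impI ballI com_unit F S comodule_cpx)
  fix A B and p q n :: int assume AB: "D S A B" and n: "n = p + q"
  have m: "module K (Mod (fob F S) n)" for n by (rule comodule_module[OF F S])
  have mB: "module K (Mod (fob F B) n)" for n by (rule comodule_module[OF F D_finite(2)[OF AB S]])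
  have mU: "module K (Mod (fob U A) n)" for n by (rule chain_complex_module[OF unit_cpx])
  show "bilinear K (Mod (fob U A) p) (Mod (fob F B) q) (Mod (fob F S) n) (?\<beta> A B p q)"
  proof (cases "A \<in> Z \<and> p = 0")
    case True
    then have "B = S" using D_unit(2)[OF AB] by simp
    with True n show ?thesis
      by (auto simp: bilinear_def unit_ground intro!: scalar_lin m lin_scale lin_id)
        (auto simp: ground_space_def)
  next
    case False
    have "bilinear K (Mod (fob U A) p) (Mod (fob F B) q) (Mod (fob F S) n) (\<lambda>_ _. \<zero>\<^bsub>Mod (fob F S) n\<^esub>)"
      by (rule bilinear_zero[OF mU mB m])
    with False n show ?thesis by (simp only: if_False)
  qed
  fix c x assume c: "c \<in> el U A p" and x: "x \<in> el F B q"
  have nn: "p - 1 + q = n - 1" "p + (q - 1) = n - 1" using n by auto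
  have k: "koszul K p \<in> carrier K" by (simp add: K)
  show "bd (fob F S) n (?\<beta> A B p q c x) = ?\<beta> A B (p - 1) q (bd (fob U A) p c) x
      \<oplus>\<^bsub>Mod (fob F S) (n - 1)\<^esub> koszul K p \<odot>\<^bsub>Mod (fob F S) (n - 1)\<^esub> ?\<beta> A B p (q - 1) c (bd (fob F B) q x)"
  proof (cases "A \<in> Z \<and> p = 0")
    case True
    then have [simp]: "B = S" using D_unit(2)[OF AB] by simp
    have "bd (fob F S) q x \<in> el F S (q - 1)" using x lin_closed[OF comodule_bd_lin[OF F S]] by simp
    with True n x unit_scalar[OF c] show ?thesis
      by (simp add: lin_smult[OF comodule_bd_lin[OF F S]] koszul_even_smult[OF m] module_simps[OF m])
  next
    case False
    then have t2: "?\<beta> A B p (q - 1) c (bd (fob F B) q x) = \<zero>\<^bsub>Mod (fob F S) (n - 1)\<^esub>"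
      and t0: "?\<beta> A B p q c x = \<zero>\<^bsub>Mod (fob F S) n\<^esub>" by (auto simp: nn n[symmetric])
    \<comment> \<open>The delicate case is \<open>p = 1\<close>: the boundary of \<open>c\<close>
      lies in degree 0, where the form is not zero by definition. It vanishes because that boundary
      is the zero scalar.\<close>
    have t1: "?\<beta> A B (p - 1) q (bd (fob U A) p c) x = \<zero>\<^bsub>Mod (fob F S) (n - 1)\<^esub>"
    proof (cases "A \<in> Z \<and> p - 1 = 0")
      case True
      then have "B = S" using D_unit(2)[OF AB] by simp
      moreover have "q = n - 1" using True n by simp
      ultimately show ?thesis using True x module.smult_l_null[OF m, of x "n - 1"] by (simp add: unit_bd)
    next
      case False then show ?thesis by (simp only: False if_False nn)
    qed
    show ?thesis unfolding t0 t1 t2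
      by (simp add: lin_zero[OF comodule_bd_lin[OF F S]] module_simps[OF m] k)
  qed
qed

lemma left_unitor_simps:
  assumes F: "com F"
  shows "arr (left_unitor M F)" "src (left_unitor M F) = U \<boxtimes> F" "trg (left_unitor M F) = F"
    and left_unitor_pr: "finite S \<Longrightarrow> D S A B \<Longrightarrow> n = p + q \<Longrightarrow> c \<in> el U A p \<Longrightarrow> x \<in> el F B q \<Longrightarrow>
      act (act (left_unitor M F) S) n (pr U F S A B p q c x) =
        (if A \<in> Z \<and> p = 0 then scalar c \<odot>\<^bsub>Mod (fob F B) q\<^esub> x else \<zero>\<^bsub>Mod (fob F S) (p + q)\<^esub>)"
proof -
  show "arr (left_unitor M F)"
    unfolding left_unitor[OF F]
  proof (rule lift_arr[OF com_unit F F bimap_left_unitor[OF F]])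
    fix f A B p q c x assume f: "fi_arr f" "f \<in> W" and AB: "D (trg f) A B"
      and c: "c \<in> el U A p" and x: "x \<in> el F B q"
    note fin = fi_arr_finite[OF f(1)]
    have fc: "act (far U (fi_restrict f A)) p c = c"
      using far_unit[OF fi_restrict_D(1)[OF f(1) AB]] c by simp
    note l = far_lin[OF F f(1) HOL.refl HOL.refl]
    show "(if fi_preimage f A \<in> Z \<and> p = 0
          then scalar (act (far U (fi_restrict f A)) p c) \<odot>\<^bsub>Mod (fob F (fi_preimage f B)) q\<^esub> act (far F (fi_restrict f B)) q x
          else \<zero>\<^bsub>Mod (fob F (src f)) (p + q)\<^esub>) =
         act (far F f) (p + q)
          (if A \<in> Z \<and> p = 0 then scalar c \<odot>\<^bsub>Mod (fob F B) q\<^esub> x else \<zero>\<^bsub>Mod (fob F (trg f)) (p + q)\<^esub>)"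
    proof (cases "A \<in> Z \<and> p = 0")
      case True
      then have "B = trg f" using D_unit(2)[OF AB] by simp
      moreover have "fi_preimage f A \<in> Z" using Z_src[OF fi_restrict_D(1)[OF f(1) AB]] True by simp
      ultimately show ?thesis using True f x fc unit_scalar[OF c]
        by (simp add: fi_restrict_trg lin_smult[OF l])
    next
      case False
      then have c0: "scalar c = \<zero>\<^bsub>K\<^esub>" using unit_degenerate[OF c] by auto
      \<comment> \<open>The preimage of \<open>A\<close> may lie in \<open>Z\<close> although
        \<open>A\<close> does not, as when a nonempty set has empty preimage. The left side then
        multiplies by \<open>scalar c\<close>, which is zero.\<close>
      have "scalar c \<odot>\<^bsub>Mod (fob F (fi_preimage f B)) q\<^esub> act (far F (fi_restrict f B)) q x
          = \<zero>\<^bsub>Mod (fob F (src f)) (p + q)\<^esub>" if "fi_preimage f A \<in> Z" "p = 0"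
      proof -
        have "fi_preimage f B = src f" using D_unit(2)[OF D_preimage[OF f(1) AB]] that by simp
        moreover have "act (far F (fi_restrict f B)) q x \<in> el F (fi_preimage f B) q"
          using fi_restrict_D[OF f(1) AB] x by (simp add: com_far_closed F)
        ultimately show ?thesis
          using that c0 by (simp add: module.smult_l_null[OF comodule_module[OF F fin(1)]])
      qed
      with False fc lin_zero[OF l] show ?thesis by auto
    qed
  qed
  show "src (left_unitor M F) = U \<boxtimes> F" "trg (left_unitor M F) = F"
    by (simp_all add: left_unitor[OF F])
  show "finite S \<Longrightarrow> D S A B \<Longrightarrow> n = p + q \<Longrightarrow> c \<in> el U A p \<Longrightarrow> x \<in> el F B q \<Longrightarrow>
      act (act (left_unitor M F) S) n (pr U F S A B p q c x) =
        (if A \<in> Z \<and> p = 0 then scalar c \<odot>\<^bsub>Mod (fob F B) q\<^esub> x else \<zero>\<^bsub>Mod (fob F S) (p + q)\<^esub>)"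
    by (rule lift_act[OF _ bimap_left_unitor[OF F]]) (simp_all add: left_unitor[OF F])
qed

subsection \<open>The braiding\<close>

lemma pr_smult_closed:
  "com F \<Longrightarrow> com G \<Longrightarrow> finite S \<Longrightarrow> D S A B \<Longrightarrow> n = p + q \<Longrightarrow> x \<in> el F A p \<Longrightarrow> y \<in> el G B q \<Longrightarrow>
    c \<in> carrier K \<Longrightarrow> c \<odot>\<^bsub>Mod (fob (F \<boxtimes> G) S) n\<^esub> pr F G S A B p q x y \<in> el (F \<boxtimes> G) S n"
  by (simp add: module_smult_closed[OF tob_module] pr_closed)

lemma bimap_braiding:
  assumes F: "com F" and G: "com G" and S: "finite S"
  shows "bimap F G S (fob (G \<boxtimes> F) S)
    (\<lambda>A B p q x y. koszul K (p * q) \<odot>\<^bsub>Mod (fob (G \<boxtimes> F) S) (p + q)\<^esub> pr G F S B A q p y x)"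
    (is "bimap _ _ _ ?E ?\<beta>")
  unfolding bimap_def
proof (intro conjI allI impI ballI F G S tob_cpx)
  fix A B and p q n :: int assume AB: "D S A B" and n: "n = p + q"
  note BA = D_sym[OF AB]
  have "bilinear K (Mod (fob F A) p) (Mod (fob G B) q) (Mod ?E n) (\<lambda>x y. pr G F S B A q p y x)"
    by (rule bilinear_flip[OF pr_bilinear[OF G F S BA]]) (simp add: n)
  then show "bilinear K (Mod (fob F A) p) (Mod (fob G B) q) (Mod ?E n) (?\<beta> A B p q)"
    unfolding n by (rule bilinear_scale) (simp add: K)
  fix x y assume x: "x \<in> el F A p" and y: "y \<in> el G B q"
  have d: "bd (fob F A) p x \<in> el F A (p - 1)" "bd (fob G B) q y \<in> el G B (q - 1)"
    using x y lin_closed[OF comodule_bd_lin] F G S D_finite[OF AB] by auto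
  have nn: "p - 1 + q = n - 1" "p + (q - 1) = n - 1" "p + q = n" using n by auto
  note m = tob_module[OF G F S]
  have cl: "pr G F S B A (q - 1) p (bd (fob G B) q y) x \<in> el (G \<boxtimes> F) S (n - 1)"
    "pr G F S B A q (p - 1) y (bd (fob F A) p x) \<in> el (G \<boxtimes> F) S (n - 1)"
    "pr G F S B A q p y x \<in> el (G \<boxtimes> F) S n"
    using d x y n by (auto intro!: pr_closed G F S BA)
  \<comment> \<open>These parities explain the exponent \<open>p * q\<close>: it turns the Leibniz
    signs of \<open>y \<otimes> x\<close> into those of \<open>x \<otimes> y\<close>, with the two
    boundary terms exchanged.\<close>
  have k1: "koszul K (p * q + q) = koszul K ((p - 1) * q)"
    and k2: "koszul K (p * q) = koszul K (p + p * (q - 1))"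
    by (rule koszul_cong, auto)+
  show "bd ?E n (?\<beta> A B p q x y) = ?\<beta> A B (p - 1) q (bd (fob F A) p x) y
      \<oplus>\<^bsub>Mod ?E (n - 1)\<^esub> koszul K p \<odot>\<^bsub>Mod ?E (n - 1)\<^esub> ?\<beta> A B p (q - 1) x (bd (fob G B) q y)"
    unfolding nn
    using lin_smult[OF chain_complex_bd[OF tob_cpx[OF G F S]] _ cl(3), of "koszul K (p * q)"] cl
      bd_pr[OF G F S BA _ y x, of n] n
    by (simp add: K module.smult_r_distr[OF m] module_simps[OF m] koszul_smult[OF m] k1 k2[symmetric]
        module_add_comm[OF m])
qed

lemma braiding_simps:
  assumes F: "com F" and G: "com G"
  shows "arr (braiding M F G)" "src (braiding M F G) = F \<boxtimes> G" "trg (braiding M F G) = G \<boxtimes> F"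
    and braiding_pr: "finite S \<Longrightarrow> D S A B \<Longrightarrow> n = p + q \<Longrightarrow> x \<in> el F A p \<Longrightarrow> y \<in> el G B q \<Longrightarrow>
      act (act (braiding M F G) S) n (pr F G S A B p q x y) =
        koszul K (p * q) \<odot>\<^bsub>Mod (fob (G \<boxtimes> F) S) n\<^esub> pr G F S B A q p y x"
proof -
  let ?\<beta> = "\<lambda>S A B p q x y. signed (Mod (fob (G \<boxtimes> F) S) (p + q)) (p * q) (pr G F S B A q p y x)"
  have s: "koszul K (p * q) \<odot>\<^bsub>Mod (fob (G \<boxtimes> F) S) (p + q)\<^esub> pr G F S B A q p y x = ?\<beta> S A B p q x y"
    if "finite S" "D S A B" "x \<in> el F A p" "y \<in> el G B q" for S A B p q x y
    using that D_sym[OF that(2)] by (intro signed_eq_koszul[symmetric] tob_module pr_closed F G) auto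
  have b: "bimap F G S (fob (G \<boxtimes> F) S) (?\<beta> S)" if "finite S" for S
    by (rule bimap_cong[OF bimap_braiding[OF F G that] s]) (use that in auto)
  show "arr (braiding M F G)"
    unfolding braiding[OF F G]
  proof (rule lift_arr[OF F G com_tob[OF G F] b])
    fix f A B p q x y assume f: "fi_arr f" "f \<in> W" and AB: "D (trg f) A B"
      and x: "x \<in> el F A p" and y: "y \<in> el G B q"
    note fin = fi_arr_finite[OF f(1)]
    have "act (far F (fi_restrict f A)) p x \<in> el F (fi_preimage f A) p"
      "act (far G (fi_restrict f B)) q y \<in> el G (fi_preimage f B) q"
      using fi_restrict_D[OF f(1) AB] x y by (simp_all add: com_far_closed F G)
    moreover have "pr G F (trg f) B A q p y x \<in> el (G \<boxtimes> F) (trg f) (p + q)"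
      using x y D_sym[OF AB] fin by (intro pr_closed F G) auto
    ultimately show "?\<beta> (src f) (fi_preimage f A) (fi_preimage f B) p q
        (act (far F (fi_restrict f A)) p x) (act (far G (fi_restrict f B)) q y)
      = act (far (G \<boxtimes> F) f) (p + q) (?\<beta> (trg f) A B p q x y)"
      using f AB x y fin D_sym[OF AB] D_preimage[OF f(1) AB]
      by (simp add: s[symmetric] lin_smult[OF far_lin[OF com_tob[OF G F] f(1) HOL.refl HOL.refl]] K
          far_pr G F)
  qed
  show "src (braiding M F G) = F \<boxtimes> G" "trg (braiding M F G) = G \<boxtimes> F"
    by (simp_all add: braiding[OF F G])
  assume S: "finite S" "D S A B" "n = p + q" "x \<in> el F A p" "y \<in> el G B q"
  have "act (act (braiding M F G) S) n (pr F G S A B p q x y) = ?\<beta> S A B p q x y"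
    by (rule lift_act[OF S(1) b[OF S(1)] S(2-5)]) (simp add: braiding[OF F G] S(1))
  with S show "act (act (braiding M F G) S) n (pr F G S A B p q x y) =
        koszul K (p * q) \<odot>\<^bsub>Mod (fob (G \<boxtimes> F) S) n\<^esub> pr G F S B A q p y x" by (simp add: s)
qed

subsection \<open>The right unitor\<close>

text \<open>A morphism out of a product is the lift of its own values on generators. A structure map
  defined as a lift can thus be identified with a composite of known morphisms, which supplies the
  Leibniz rule and naturality.\<close>

lemma lift_eq:
  assumes F: "com F" and G: "com G" and \<theta>: "arr \<theta>" "src \<theta> = F \<boxtimes> G" "trg \<theta> = E"
    and \<beta>: "\<And>S A B p q x y. finite S \<Longrightarrow> D S A B \<Longrightarrow> x \<in> el F A p \<Longrightarrow> y \<in> el G B q \<Longrightarrow>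
      act (act \<theta> S) (p + q) (pr F G S A B p q x y) = \<beta> S A B p q x y"
  shows "comod_arrow (F \<boxtimes> G)
    (\<lambda>S. lift_map (fob (F \<boxtimes> G) S) (\<lambda>P. lft F G S P (\<beta> S)) (fob E S)) E = \<theta>"
proof -
  have "lift_map (fob (F \<boxtimes> G) S) (\<lambda>P. lft F G S P (\<beta> S)) (fob E S) = act \<theta> S" if S: "finite S" for S
  proof -
    note l = comod_arr_lin[OF \<theta>(1) S \<theta>(2,3)[symmetric]]
    have "bimap F G S (fob E S) (\<lambda>A B p q x y. act (act \<theta> S) (p + q) (pr F G S A B p q x y))"
      unfolding bimap_def
    proof (intro conjI allI impI ballI F G S)
      show "chain_complex K (fob E S)" using comod_arr_comodule(2)[OF \<theta>(1)] \<theta>(3) S by (simp add: comodule_cpx)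
      fix A B and p q n :: int assume AB: "D S A B" and n: "n = p + q"
      have "bilinear K (Mod (fob F A) p) (Mod (fob G B) q) (Mod (fob E S) n)
          (\<lambda>x y. act (act \<theta> S) n (pr F G S A B p q x y))"
        by (rule bilinear_comp[OF pr_bilinear[OF F G S AB n] l])
      then show "bilinear K (Mod (fob F A) p) (Mod (fob G B) q) (Mod (fob E S) n)
          (\<lambda>x y. act (act \<theta> S) (p + q) (pr F G S A B p q x y))" using n by simp
      fix x y assume x: "x \<in> el F A p" and y: "y \<in> el G B q"
      have e: "p - 1 + q = n - 1" "p + (q - 1) = n - 1" "p + q = n" using n by auto
      have "pr F G S A B (p - 1) q (bd (fob F A) p x) y \<in> el (F \<boxtimes> G) S (n - 1)"
        "pr F G S A B p (q - 1) x (bd (fob G B) q y) \<in> el (F \<boxtimes> G) S (n - 1)"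
        using x y lin_closed[OF comodule_bd_lin[OF F D_finite(1)[OF AB S]] x]
          lin_closed[OF comodule_bd_lin[OF G D_finite(2)[OF AB S]] y]
        by (auto intro!: pr_closed F G S AB simp: n)
      then show "bd (fob E S) n (act (act \<theta> S) (p + q) (pr F G S A B p q x y))
        = act (act \<theta> S) (p - 1 + q) (pr F G S A B (p - 1) q (bd (fob F A) p x) y)
          \<oplus>\<^bsub>Mod (fob E S) (n - 1)\<^esub> koszul K p \<odot>\<^bsub>Mod (fob E S) (n - 1)\<^esub>
            act (act \<theta> S) (p + (q - 1)) (pr F G S A B p (q - 1) x (bd (fob G B) q y))"
        using comod_arr_bd[OF \<theta>(1) S \<theta>(2)[symmetric] pr_closed[OF F G S AB n x y]] \<theta>(3)
        by (simp add: e bd_pr[OF F G S AB n x y] lin_add[OF l] lin_smult[OF l] K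
            module_smult_closed[OF tob_module[OF F G S]])
    qed
    then have b: "bimap F G S (fob E S) (\<beta> S)" by (rule bimap_cong) (rule \<beta>[OF S])
    let ?t = "lift_map (fob (F \<boxtimes> G) S) (\<lambda>P. lft F G S P (\<beta> S)) (fob E S)"
    have t: "lin K (Mod (fob (F \<boxtimes> G) S) n) (Mod (fob E S) n) (act ?t n)" for n
      using ch_arr_lin[OF bimap_lift(1)[OF b], of n] by simp
    show ?thesis
    proof (rule ch_arr_ext[OF bimap_lift(1)[OF b] comod_arr_component(1)[OF \<theta>(1) S]])
      fix n u assume "u \<in> carrier (Mod (src ?t) n)"
      then have u: "u \<in> el (F \<boxtimes> G) S n" by simp
      show "act ?t n u = act (act \<theta> S) n u"
        by (rule tob_ext[OF F G S t l u]) (simp add: \<beta> S bimap_lift(2)[OF b] del: lift_map_simps(3))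
    qed (use comod_arr_component[OF \<theta>(1) S] \<theta> in simp_all)
  qed
  then show ?thesis using \<theta>(1)
    by (intro arrow.expand) (auto simp: \<theta>(2,3) comod_arr_iff comod_arrow_def fun_eq_iff extensional_def)
qed

text \<open>The sign of the braiding disappears: either \<open>c\<close> has degree 0 and the
  exponent is zero, or the left unitor sends the generator to zero.\<close>

lemma left_unitor_braiding_pr:
  assumes F: "com F" and S: "finite S" and AB: "D S A B" and n: "n = p + q"
    and x: "x \<in> el F A p" and c: "c \<in> el U B q"
  shows "act (act (comod_comp W K (left_unitor M F) (braiding M F U)) S) n (pr F U S A B p q x c) =
    (if B \<in> Z \<and> q = 0 then scalar c \<odot>\<^bsub>Mod (fob F A) p\<^esub> x else \<zero>\<^bsub>Mod (fob F S) (p + q)\<^esub>)"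
proof -
  note m = comodule_module[OF F S] and BA = D_sym[OF AB]
  note b = braiding_simps[OF F com_unit]
  have w: "pr U F S B A q p c x \<in> el (U \<boxtimes> F) S n" by (rule pr_closed[OF com_unit F S BA _ c x]) (simp add: n)
  have w': "pr F U S A B p q x c \<in> el (src (braiding M F U)) S n"
    unfolding b(2) by (rule pr_closed[OF F com_unit S AB n x c])
  have "act (act (comod_comp W K (left_unitor M F) (braiding M F U)) S) n (pr F U S A B p q x c)
      = koszul K (p * q) \<odot>\<^bsub>Mod (fob F S) n\<^esub> act (act (left_unitor M F) S) n (pr U F S B A q p c x)"
    unfolding comod_comp_simps(3)[OF b(1) S w'] braiding_pr[OF F com_unit S AB n x c]
    by (rule lin_smult[OF comod_arr_lin[OF left_unitor_simps(1)[OF F] S] _ w])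
      (simp_all add: left_unitor_simps F K)
  also have "act (act (left_unitor M F) S) n (pr U F S B A q p c x)
      = (if B \<in> Z \<and> q = 0 then scalar c \<odot>\<^bsub>Mod (fob F A) p\<^esub> x else \<zero>\<^bsub>Mod (fob F S) (q + p)\<^esub>)"
    by (rule left_unitor_pr[OF F S BA _ c x]) (simp add: n)
  finally show ?thesis
  proof (cases "B \<in> Z \<and> q = 0")
    case True
    then have "A = S" using D_unit(2)[OF BA] by simp
    moreover assume "act (act (comod_comp W K (left_unitor M F) (braiding M F U)) S) n (pr F U S A B p q x c)
      = koszul K (p * q) \<odot>\<^bsub>Mod (fob F S) n\<^esub> (if B \<in> Z \<and> q = 0 then scalar c \<odot>\<^bsub>Mod (fob F A) p\<^esub> x
          else \<zero>\<^bsub>Mod (fob F S) (q + p)\<^esub>)"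
    ultimately show ?thesis using True n x unit_scalar[OF c]
      by (simp add: koszul_even_smult[OF m] module_simps[OF m])
  next
    case False
    then have nz: "(B \<in> Z \<and> q = 0) = False" by simp
    have e: "q + p = n" "p + q = n" using n by auto
    assume "act (act (comod_comp W K (left_unitor M F) (braiding M F U)) S) n (pr F U S A B p q x c)
      = koszul K (p * q) \<odot>\<^bsub>Mod (fob F S) n\<^esub> (if B \<in> Z \<and> q = 0 then scalar c \<odot>\<^bsub>Mod (fob F A) p\<^esub> x
          else \<zero>\<^bsub>Mod (fob F S) (q + p)\<^esub>)"
    then show ?thesis by (simp add: nz e module_simps[OF m] K)
  qed
qed

text \<open>From this the right unitor inherits its being a morphism and its invertibility, and
  later the right counit law is reduced to the left one.\<close>

lemma right_unitor_eq:
  assumes F: "com F" shows "right_unitor M F = comod_comp W K (left_unitor M F) (braiding M F U)"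
  unfolding right_unitor[OF F]
  by (rule lift_eq[OF F com_unit])
    (simp_all add: left_unitor_braiding_pr F comod_comp_arr comod_comp_simps left_unitor_simps
      braiding_simps com_unit)

lemma right_unitor_simps:
  assumes F: "com F"
  shows "src (right_unitor M F) = F \<boxtimes> U" "trg (right_unitor M F) = F"
    and right_unitor_pr: "finite S \<Longrightarrow> D S A B \<Longrightarrow> n = p + q \<Longrightarrow> x \<in> el F A p \<Longrightarrow> c \<in> el U B q \<Longrightarrow>
      act (act (right_unitor M F) S) n (pr F U S A B p q x c) =
        (if B \<in> Z \<and> q = 0 then scalar c \<odot>\<^bsub>Mod (fob F A) p\<^esub> x else \<zero>\<^bsub>Mod (fob F S) (p + q)\<^esub>)"
    and right_unitor_arr: "arr (right_unitor M F)"
  unfolding right_unitor_eq[OF F]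
  by (simp_all only: left_unitor_braiding_pr F)
    (simp_all add: comod_comp_arr comod_comp_simps left_unitor_simps braiding_simps com_unit F)

subsection \<open>The associator\<close>

text \<open>A lift inside the form of another lift, because the first argument \<open>u\<close> is
  itself an element of a product. Linearity in \<open>u\<close> is that of the inner lift.\<close>

definition assoc_form where
  "assoc_form F G H S V C m r u c = lft F G V (Mod (fob (F \<boxtimes> G \<boxtimes> H) S) (m + r))
    (\<lambda>A B p q x y. pr F (G \<boxtimes> H) S A (B \<union> C) p (q + r) x (pr G H (B \<union> C) B C q r y c)) m u"

context
  fixes F G H :: "('k, 's, 'v) comod"
  assumes F: "com F" and G: "com G" and H: "com H"
begin

lemmas FGH = F G H com_tob[OF F G] com_tob[OF G H] com_tob[OF F com_tob[OF G H]]
  com_tob[OF com_tob[OF F G] H]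

lemma assoc_form_bilinear:
  assumes S: "finite S" and V: "D S V C" and c: "c \<in> el H C r" and A: "D V A B" and m: "m = p + q"
  shows "bilinear K (Mod (fob F A) p) (Mod (fob G B) q) (Mod (fob (F \<boxtimes> G \<boxtimes> H) S) (m + r))
    (\<lambda>x y. pr F (G \<boxtimes> H) S A (B \<union> C) p (q + r) x (pr G H (B \<union> C) B C q r y c))"
proof -
  have D: "D S A (B \<union> C)" "D (B \<union> C) B C" using D_assoc[OF V A] by auto
  have fin: "finite (B \<union> C)" using D_finite[OF D(1) S] by simp
  show ?thesis
    by (rule bilinear_comp2[OF pr_bilinear[OF FGH(1,5) S D(1)] lin_id
          bilinear_left[OF pr_bilinear[OF G H fin D(2)] c]])
      (use m D_finite[OF D(1) S] in \<open>auto intro: comodule_module[OF F]\<close>)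
qed

lemma assoc_form_lin:
  assumes S: "finite S" and V: "D S V C" and c: "c \<in> el H C r" and n: "n = m + r"
  shows "lin K (Mod (fob (F \<boxtimes> G) V) m) (Mod (fob (F \<boxtimes> G \<boxtimes> H) S) n) (\<lambda>u. assoc_form F G H S V C m r u c)"
  unfolding assoc_form_def n
  by (rule lin_lft[OF F G D_finite(1)[OF V S] comodule_module[OF FGH(6) S] assoc_form_bilinear[OF S V c]])

lemma assoc_form_pr:
  assumes S: "finite S" and V: "D S V C" and c: "c \<in> el H C r"
    and A: "D V A B" and m: "m = p + q" and x: "x \<in> el F A p" and y: "y \<in> el G B q"
  shows "assoc_form F G H S V C m r (pr F G V A B p q x y) c
    = pr F (G \<boxtimes> H) S A (B \<union> C) p (q + r) x (pr G H (B \<union> C) B C q r y c)"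
  unfolding assoc_form_def
  by (rule lft_pr[OF F G D_finite(1)[OF V S] comodule_module[OF FGH(6) S] assoc_form_bilinear[OF S V c]])
    (use A m x y in auto)

text \<open>For the inner lift \<open>c\<close> is only a parameter, so linearity in
  \<open>c\<close> is not a property of lifts. It is proved by extending from generators in
  \<open>u\<close>, where the expression is explicit.\<close>

lemma assoc_form_lin2:
  assumes S: "finite S" and V: "D S V C" and u: "u \<in> el (F \<boxtimes> G) V m" and n: "n = m + r"
  shows "lin K (Mod (fob H C) r) (Mod (fob (F \<boxtimes> G \<boxtimes> H) S) n) (assoc_form F G H S V C m r u)"
proof (rule linI)
  note fin = D_finite[OF V S]
  let ?N = "Mod (fob (F \<boxtimes> G \<boxtimes> H) S) n"
  show mC: "module K (Mod (fob H C) r)" "module K ?N"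
    using fin S by (simp_all add: comodule_module FGH)
  note l = assoc_form_lin[OF S V _ n]
  show "assoc_form F G H S V C m r u c \<in> carrier ?N" if "c \<in> el H C r" for c
    by (rule lin_closed[OF l[OF that] u])
  show "assoc_form F G H S V C m r u (c \<oplus>\<^bsub>Mod (fob H C) r\<^esub> c')
      = assoc_form F G H S V C m r u c \<oplus>\<^bsub>?N\<^esub> assoc_form F G H S V C m r u c'"
    if c: "c \<in> el H C r" and c': "c' \<in> el H C r" for c c'
  proof (rule tob_ext[OF F G fin(1) l lin_plus[OF l l] u])
    show cc: "c \<oplus>\<^bsub>Mod (fob H C) r\<^esub> c' \<in> el H C r" using c c' mC by (simp add: module_add_closed)
    show "c \<in> el H C r" "c' \<in> el H C r" by (fact c c')+
    fix A B p q x y assume A: "D V A B" and m: "m = p + q" and x: "x \<in> el F A p" and y: "y \<in> el G B q"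
    have D: "D S A (B \<union> C)" "D (B \<union> C) B C" using D_assoc[OF V A] by auto
    have fin': "finite (B \<union> C)" using D_finite[OF D(1) S] by simp
    have e: "p + (q + r) = n" using m n by simp
    show "assoc_form F G H S V C m r (pr F G V A B p q x y) (c \<oplus>\<^bsub>Mod (fob H C) r\<^esub> c')
        = assoc_form F G H S V C m r (pr F G V A B p q x y) c \<oplus>\<^bsub>?N\<^esub>
          assoc_form F G H S V C m r (pr F G V A B p q x y) c'"
      by (simp add: assoc_form_pr[OF S V _ A m x y] c c' cc pr_add_right[OF G H fin' D(2) y]
        pr_add_right[OF F FGH(5) S D(1) x] pr_closed[OF G H fin' D(2)] y e)
  qed
  show "assoc_form F G H S V C m r u (d \<odot>\<^bsub>Mod (fob H C) r\<^esub> c) = d \<odot>\<^bsub>?N\<^esub> assoc_form F G H S V C m r u c"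
    if d: "d \<in> carrier K" and c: "c \<in> el H C r" for c d
  proof (rule tob_ext[OF F G fin(1) l lin_scale[OF l d] u])
    show dc: "d \<odot>\<^bsub>Mod (fob H C) r\<^esub> c \<in> el H C r" using c d mC by (simp add: module_smult_closed)
    show "c \<in> el H C r" by (fact c)
    fix A B p q x y assume A: "D V A B" and m: "m = p + q" and x: "x \<in> el F A p" and y: "y \<in> el G B q"
    have D: "D S A (B \<union> C)" "D (B \<union> C) B C" using D_assoc[OF V A] by auto
    have fin': "finite (B \<union> C)" using D_finite[OF D(1) S] by simp
    have e: "p + (q + r) = n" using m n by simp
    show "assoc_form F G H S V C m r (pr F G V A B p q x y) (d \<odot>\<^bsub>Mod (fob H C) r\<^esub> c)
        = d \<odot>\<^bsub>?N\<^esub> assoc_form F G H S V C m r (pr F G V A B p q x y) c"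
      by (simp add: assoc_form_pr[OF S V _ A m x y] c d dc pr_smult_right[OF G H fin' D(2)]
        pr_smult_right[OF F FGH(5) S D(1)] x pr_closed[OF G H fin' D(2)] y e)
  qed
qed

lemma bimap_associator:
  assumes S: "finite S"
  shows "bimap (F \<boxtimes> G) H S (fob (F \<boxtimes> G \<boxtimes> H) S) (assoc_form F G H S)"
  unfolding bimap_def
proof (intro conjI allI impI ballI FGH S comodule_cpx)
  fix V C and m r n :: int assume V: "D S V C" and n: "n = m + r"
  note fin = D_finite[OF V S]
  let ?N = "Mod (fob (F \<boxtimes> G \<boxtimes> H) S) (n - 1)"
  show "bilinear K (Mod (fob (F \<boxtimes> G) V) m) (Mod (fob H C) r) (Mod (fob (F \<boxtimes> G \<boxtimes> H) S) n)
      (assoc_form F G H S V C m r)"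
    unfolding bilinear_def using assoc_form_lin[OF S V _ n] assoc_form_lin2[OF S V _ n] by auto
  fix u c assume u: "u \<in> el (F \<boxtimes> G) V m" and c: "c \<in> el H C r"
  have dc: "bd (fob H C) r c \<in> el H C (r - 1)" using lin_closed[OF comodule_bd_lin[OF H fin(2)] c] .
  have k: "koszul K i \<in> carrier K" for i by (simp add: K)
  show "bd (fob (F \<boxtimes> G \<boxtimes> H) S) n (assoc_form F G H S V C m r u c)
    = assoc_form F G H S V C (m - 1) r (bd (fob (F \<boxtimes> G) V) m u) c \<oplus>\<^bsub>?N\<^esub>
      koszul K m \<odot>\<^bsub>?N\<^esub> assoc_form F G H S V C m (r - 1) u (bd (fob H C) r c)"
  proof (rule tob_ext[OF F G fin(1) _ _ u])
    show "lin K (Mod (fob (F \<boxtimes> G) V) m) ?N (\<lambda>u. bd (fob (F \<boxtimes> G \<boxtimes> H) S) n (assoc_form F G H S V C m r u c))"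
      by (rule lin_comp[OF assoc_form_lin[OF S V c n] comodule_bd_lin[OF FGH(6) S]])
    show "lin K (Mod (fob (F \<boxtimes> G) V) m) ?N (\<lambda>u. assoc_form F G H S V C (m - 1) r (bd (fob (F \<boxtimes> G) V) m u) c \<oplus>\<^bsub>?N\<^esub>
      koszul K m \<odot>\<^bsub>?N\<^esub> assoc_form F G H S V C m (r - 1) u (bd (fob H C) r c))"
      by (intro lin_plus lin_scale k assoc_form_lin[OF S V dc]
          lin_comp[OF comodule_bd_lin[OF FGH(4) fin(1)] assoc_form_lin[OF S V c]]) (auto simp: n)
    fix A B p q x y assume A: "D V A B" and m: "m = p + q" and x: "x \<in> el F A p" and y: "y \<in> el G B q"
    have D: "D S A (B \<union> C)" "D (B \<union> C) B C" using D_assoc[OF V A] by auto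
    have finA: "finite A" "finite B" using D_finite[OF A fin(1)] by auto
    have finB: "finite (B \<union> C)" using finA fin by simp
    have dx: "bd (fob F A) p x \<in> el F A (p - 1)" and dy: "bd (fob G B) q y \<in> el G B (q - 1)"
      using lin_closed[OF comodule_bd_lin[OF F finA(1)] x] lin_closed[OF comodule_bd_lin[OF G finA(2)] y] .
    \<comment> \<open>The triple tensor \<open>x \<otimes> y \<otimes> c\<close>, bracketed to the
      right. Both sides expand to its three boundary terms, with sign exponents \<open>0\<close>,
      \<open>p\<close> and \<open>p + q\<close>.\<close>
    define w where "w p q r x y c = pr F (G \<boxtimes> H) S A (B \<union> C) p (q + r) x (pr G H (B \<union> C) B C q r y c)"
      for p q r x y c
    have w: "w p q r x y c \<in> el (F \<boxtimes> G \<boxtimes> H) S (p + q + r)"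
      if "x \<in> el F A p" "y \<in> el G B q" "c \<in> el H C r" for p q r x y c
      unfolding w_def using that by (intro pr_closed FGH S D finB) auto
    have aw: "assoc_form F G H S V C (p + q) r (pr F G V A B p q x y) c = w p q r x y c"
      if "x \<in> el F A p" "y \<in> el G B q" "c \<in> el H C r" for p q r x y c
      unfolding w_def by (rule assoc_form_pr[OF S V that(3) A HOL.refl that(1,2)])
    have yc: "pr G H (B \<union> C) B C q r y c \<in> el (G \<boxtimes> H) (B \<union> C) (q + r)"
      "pr G H (B \<union> C) B C (q - 1) r (bd (fob G B) q y) c \<in> el (G \<boxtimes> H) (B \<union> C) (q + r - 1)"
      "pr G H (B \<union> C) B C q (r - 1) y (bd (fob H C) r c) \<in> el (G \<boxtimes> H) (B \<union> C) (q + r - 1)"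
      using y c dy dc by (auto intro!: pr_closed G H finB D)
    note mN = comodule_module[OF FGH(6) S] and mBC = tob_module[OF G H finB]
    have e: "p + q + r = n" "p + q = m" "p - 1 + q + r = n - 1" "p + (q - 1) + r = n - 1" "p + q + (r - 1) = n - 1"
        "p + (q + r - 1) = n - 1" "p - 1 + (q + r) = n - 1" "p - 1 + q = m - 1" "p + (q - 1) = m - 1"
        "q + (r - 1) = q + r - 1" "q - 1 + r = q + r - 1" "p + (q + r) = n"
        "m - 1 + r = n - 1" "m + (r - 1) = n - 1" "m + r = n"
      using n m by auto
    have ww: "w (p - 1) q r (bd (fob F A) p x) y c \<in> carrier ?N"
      "w p (q - 1) r x (bd (fob G B) q y) c \<in> carrier ?N"
      "w p q (r - 1) x y (bd (fob H C) r c) \<in> carrier ?N"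
      using w[OF dx y c] w[OF x dy c] w[OF x y dc] by (simp_all only: e)
    have "bd (fob (F \<boxtimes> G \<boxtimes> H) S) n (w p q r x y c)
      = w (p - 1) q r (bd (fob F A) p x) y c \<oplus>\<^bsub>?N\<^esub> koszul K p \<odot>\<^bsub>?N\<^esub>
        pr F (G \<boxtimes> H) S A (B \<union> C) p (q + r - 1) x (bd (fob (G \<boxtimes> H) (B \<union> C)) (q + r) (pr G H (B \<union> C) B C q r y c))"
      unfolding w_def by (rule bd_pr[OF F FGH(5) S D(1) _ x yc(1)]) (simp add: e)
    also have "bd (fob (G \<boxtimes> H) (B \<union> C)) (q + r) (pr G H (B \<union> C) B C q r y c)
      = pr G H (B \<union> C) B C (q - 1) r (bd (fob G B) q y) c \<oplus>\<^bsub>Mod (fob (G \<boxtimes> H) (B \<union> C)) (q + r - 1)\<^esub>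
        koszul K q \<odot>\<^bsub>Mod (fob (G \<boxtimes> H) (B \<union> C)) (q + r - 1)\<^esub> pr G H (B \<union> C) B C q (r - 1) y (bd (fob H C) r c)"
      by (rule bd_pr[OF G H finB D(2) HOL.refl y c])
    also have "pr F (G \<boxtimes> H) S A (B \<union> C) p (q + r - 1) x \<dots>
      = w p (q - 1) r x (bd (fob G B) q y) c \<oplus>\<^bsub>?N\<^esub> koszul K q \<odot>\<^bsub>?N\<^esub> w p q (r - 1) x y (bd (fob H C) r c)"
      unfolding w_def using x yc mBC
      by (simp add: pr_add_right[OF F FGH(5) S D(1)] pr_smult_right[OF F FGH(5) S D(1)] k
          module_simps[OF mBC] e)
    finally have 1: "bd (fob (F \<boxtimes> G \<boxtimes> H) S) n (w p q r x y c)
      = w (p - 1) q r (bd (fob F A) p x) y c \<oplus>\<^bsub>?N\<^esub> koszul K p \<odot>\<^bsub>?N\<^esub>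
        (w p (q - 1) r x (bd (fob G B) q y) c \<oplus>\<^bsub>?N\<^esub> koszul K q \<odot>\<^bsub>?N\<^esub> w p q (r - 1) x y (bd (fob H C) r c))" .
    have xy: "pr F G V A B (p - 1) q (bd (fob F A) p x) y \<in> el (F \<boxtimes> G) V (m - 1)"
      "pr F G V A B p (q - 1) x (bd (fob G B) q y) \<in> el (F \<boxtimes> G) V (m - 1)"
      using x y dx dy by (auto intro!: pr_closed F G fin A simp: e)
    have l: "lin K (Mod (fob (F \<boxtimes> G) V) (m - 1)) ?N (\<lambda>u. assoc_form F G H S V C (m - 1) r u c)"
      by (rule assoc_form_lin[OF S V c]) (simp add: n)
    have "assoc_form F G H S V C (m - 1) r (bd (fob (F \<boxtimes> G) V) m (pr F G V A B p q x y)) c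
      = w (p - 1) q r (bd (fob F A) p x) y c \<oplus>\<^bsub>?N\<^esub> koszul K p \<odot>\<^bsub>?N\<^esub> w p (q - 1) r x (bd (fob G B) q y) c"
      using aw[OF dx y c] aw[OF x dy c] xy
      by (simp only: bd_pr[OF F G fin(1) A m x y] lin_add[OF l] lin_smult[OF l] k e
          module_smult_closed[OF tob_module[OF F G fin(1)]])
    then show "bd (fob (F \<boxtimes> G \<boxtimes> H) S) n (assoc_form F G H S V C m r (pr F G V A B p q x y) c)
      = assoc_form F G H S V C (m - 1) r (bd (fob (F \<boxtimes> G) V) m (pr F G V A B p q x y)) c \<oplus>\<^bsub>?N\<^esub>
        koszul K m \<odot>\<^bsub>?N\<^esub> assoc_form F G H S V C m (r - 1) (pr F G V A B p q x y) (bd (fob H C) r c)"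
      using aw[OF x y c] aw[OF x y dc] 1 ww
      by (simp add: e module.smult_r_distr[OF mN] koszul_smult[OF mN] module_simps[OF mN] k
          abelian_monoid.a_assoc[OF abelian_group.axioms(1)[OF module.axioms(2)[OF mN]]])
  qed
qed

text \<open>Naturality comes down to restriction in stages: restricting an injection to
  \<open>V\<close> and then to \<open>A\<close>, or to \<open>B \<union> C\<close> and then to
  \<open>B\<close>, is the same as restricting it once.\<close>

lemma associator_simps:
  shows "arr (associator M F G H)" "src (associator M F G H) = (F \<boxtimes> G) \<boxtimes> H"
      "trg (associator M F G H) = F \<boxtimes> G \<boxtimes> H"
    and associator_pr: "finite S \<Longrightarrow> D S V C \<Longrightarrow> D V A B \<Longrightarrow> m = p + q \<Longrightarrow> n = m + r \<Longrightarrow>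
      x \<in> el F A p \<Longrightarrow> y \<in> el G B q \<Longrightarrow> c \<in> el H C r \<Longrightarrow>
      act (act (associator M F G H) S) n (pr (F \<boxtimes> G) H S V C m r (pr F G V A B p q x y) c)
      = pr F (G \<boxtimes> H) S A (B \<union> C) p (q + r) x (pr G H (B \<union> C) B C q r y c)"
proof -
  have a: "associator M F G H = comod_arrow ((F \<boxtimes> G) \<boxtimes> H)
        (\<lambda>S. lift_map (fob ((F \<boxtimes> G) \<boxtimes> H) S) (\<lambda>P. lft (F \<boxtimes> G) H S P (assoc_form F G H S))
          (fob (F \<boxtimes> G \<boxtimes> H) S)) (F \<boxtimes> G \<boxtimes> H)"
    unfolding associator[OF F G H] assoc_form_def[abs_def] ..
  show "arr (associator M F G H)"
    unfolding a
  proof (rule lift_arr[OF FGH(4) H FGH(6) bimap_associator])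
    fix f V C m r u c assume f: "fi_arr f" "f \<in> W" and V: "D (trg f) V C"
      and u: "u \<in> el (F \<boxtimes> G) V m" and c: "c \<in> el H C r"
    note fin = fi_arr_finite[OF f(1)] and finV = D_finite[OF V fi_arr_finite(2)[OF f(1)]]
    note V' = D_preimage[OF f(1) V] and fV = fi_restrict_D[OF f(1) V]
    have c': "act (far H (fi_restrict f C)) r c \<in> el H (fi_preimage f C) r"
      using fV c by (simp add: com_far_closed H)
    show "assoc_form F G H (src f) (fi_preimage f V) (fi_preimage f C) m r
          (act (far (F \<boxtimes> G) (fi_restrict f V)) m u) (act (far H (fi_restrict f C)) r c)
        = act (far (F \<boxtimes> G \<boxtimes> H) f) (m + r) (assoc_form F G H (trg f) V C m r u c)"
    proof (rule tob_ext[OF F G finV(1) _ _ u])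
      show "lin K (Mod (fob (F \<boxtimes> G) V) m) (Mod (fob (F \<boxtimes> G \<boxtimes> H) (src f)) (m + r))
        (\<lambda>u. assoc_form F G H (src f) (fi_preimage f V) (fi_preimage f C) m r
          (act (far (F \<boxtimes> G) (fi_restrict f V)) m u) (act (far H (fi_restrict f C)) r c))"
        by (rule lin_comp[OF far_lin[OF FGH(4) fV(1)] assoc_form_lin[OF fin(1) V' c']]) auto
      show "lin K (Mod (fob (F \<boxtimes> G) V) m) (Mod (fob (F \<boxtimes> G \<boxtimes> H) (src f)) (m + r))
        (\<lambda>u. act (far (F \<boxtimes> G \<boxtimes> H) f) (m + r) (assoc_form F G H (trg f) V C m r u c))"
        by (rule lin_comp[OF assoc_form_lin[OF fin(2) V c] far_lin[OF FGH(6) f(1)]]) auto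
      fix A B p q x y assume A: "D V A B" and m: "m = p + q" and x: "x \<in> el F A p" and y: "y \<in> el G B q"
      have D: "D (trg f) A (B \<union> C)" "D (B \<union> C) B C" using D_assoc[OF V A] by auto
      have sub: "A \<subseteq> V" "B \<subseteq> V" using D_subset[OF A] by auto
      have A': "D (fi_preimage f V) (fi_preimage f A) (fi_preimage f B)"
        using D_preimage[OF fV(1), of A B] A sub by (simp add: fi_preimage_restrict)
      note fA = fi_restrict_D[OF f(1) D(1)]
      have fB: "fi_arr (fi_restrict f B)" using fi_restrict_D[OF fA(2), of B C] D(2) by (simp add: fi_restrict_restrict)
      have cl: "pr G H (B \<union> C) B C q r y c \<in> el (G \<boxtimes> H) (B \<union> C) (q + r)"
        using D_finite[OF D(1) fin(2)] by (intro pr_closed G H D y c) auto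
      have x': "act (far F (fi_restrict f A)) p x \<in> el F (fi_preimage f A) p"
        "act (far G (fi_restrict f B)) q y \<in> el G (fi_preimage f B) q"
        using fA fB x y by (simp_all add: com_far_closed F G)
      show "assoc_form F G H (src f) (fi_preimage f V) (fi_preimage f C) m r
          (act (far (F \<boxtimes> G) (fi_restrict f V)) m (pr F G V A B p q x y)) (act (far H (fi_restrict f C)) r c)
        = act (far (F \<boxtimes> G \<boxtimes> H) f) (m + r) (assoc_form F G H (trg f) V C m r (pr F G V A B p q x y) c)"
        using f fV fA fB m D A x y c
        by (simp add: far_pr FGH cl sub assoc_form_pr[OF fin(2) V] assoc_form_pr[OF fin(1) V' c' A' _ x']
            fi_preimage_restrict fi_restrict_restrict fi_preimage_Un[symmetric] add.assoc)
    qed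
  qed
  show "src (associator M F G H) = (F \<boxtimes> G) \<boxtimes> H" "trg (associator M F G H) = F \<boxtimes> G \<boxtimes> H"
    by (simp_all add: a)
  assume S: "finite S" and V: "D S V C" and A: "D V A B" and m: "m = p + q" and n: "n = m + r" and
      x: "x \<in> el F A p" and y: "y \<in> el G B q" and c: "c \<in> el H C r"
  have "act (act (associator M F G H) S) n (pr (F \<boxtimes> G) H S V C m r (pr F G V A B p q x y) c)
      = assoc_form F G H S V C m r (pr F G V A B p q x y) c"
    by (rule lift_act[OF S bimap_associator[OF S] V n _ c])
      (use S m in \<open>auto simp: a intro!: pr_closed F G D_finite(1)[OF V] A x y\<close>)
  then show "act (act (associator M F G H) S) n (pr (F \<boxtimes> G) H S V C m r (pr F G V A B p q x y) c)
      = pr F (G \<boxtimes> H) S A (B \<union> C) p (q + r) x (pr G H (B \<union> C) B C q r y c)"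
    by (simp add: assoc_form_pr[OF S V c A m x y])
qed

end

end

lemma is_iso_comp:
  assumes "is_category C" "a \<in> Ob C" "b \<in> Ob C" "c \<in> Ob C" "is_iso C a b f" "is_iso C b c g"
  shows "is_iso C a c (g \<cdot>\<^bsub>C\<^esub> f)"
proof -
  obtain f' where f: "f \<in> Hom C a b" "f' \<in> Hom C b a" "f' \<cdot>\<^bsub>C\<^esub> f = Idn C a" "f \<cdot>\<^bsub>C\<^esub> f' = Idn C b"
    using assms(5) by (auto simp: is_iso_def)
  obtain g' where g: "g \<in> Hom C b c" "g' \<in> Hom C c b" "g' \<cdot>\<^bsub>C\<^esub> g = Idn C b" "g \<cdot>\<^bsub>C\<^esub> g' = Idn C c"
    using assms(6) by (auto simp: is_iso_def)
  have cl: "\<And>a b c f g. a \<in> Ob C \<Longrightarrow> b \<in> Ob C \<Longrightarrow> c \<in> Ob C \<Longrightarrow> f \<in> Hom C a b \<Longrightarrow> g \<in> Hom C b c \<Longrightarrow>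
      g \<cdot>\<^bsub>C\<^esub> f \<in> Hom C a c"
    and un: "\<And>a b f. a \<in> Ob C \<Longrightarrow> b \<in> Ob C \<Longrightarrow> f \<in> Hom C a b \<Longrightarrow> f \<cdot>\<^bsub>C\<^esub> Idn C a = f \<and> Idn C b \<cdot>\<^bsub>C\<^esub> f = f"
    and as: "\<And>a b c d f g h. a \<in> Ob C \<Longrightarrow> b \<in> Ob C \<Longrightarrow> c \<in> Ob C \<Longrightarrow> d \<in> Ob C \<Longrightarrow> f \<in> Hom C a b \<Longrightarrow>
      g \<in> Hom C b c \<Longrightarrow> h \<in> Hom C c d \<Longrightarrow> h \<cdot>\<^bsub>C\<^esub> (g \<cdot>\<^bsub>C\<^esub> f) = (h \<cdot>\<^bsub>C\<^esub> g) \<cdot>\<^bsub>C\<^esub> f"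
    using assms(1) unfolding is_category_def by blast+
  note O = assms(2-4)
  have gf: "g \<cdot>\<^bsub>C\<^esub> f \<in> Hom C a c" and fg': "f' \<cdot>\<^bsub>C\<^esub> g' \<in> Hom C c a"
    using cl O f g by blast+
  have "(f' \<cdot>\<^bsub>C\<^esub> g') \<cdot>\<^bsub>C\<^esub> (g \<cdot>\<^bsub>C\<^esub> f) = f' \<cdot>\<^bsub>C\<^esub> ((g' \<cdot>\<^bsub>C\<^esub> g) \<cdot>\<^bsub>C\<^esub> f)"
    using as[OF O(1,3,2,1) gf g(2) f(2)] as[OF O(1,2,3,2) f(1) g(1,2)] by simp
  moreover have "(g \<cdot>\<^bsub>C\<^esub> f) \<cdot>\<^bsub>C\<^esub> (f' \<cdot>\<^bsub>C\<^esub> g') = g \<cdot>\<^bsub>C\<^esub> ((f \<cdot>\<^bsub>C\<^esub> f') \<cdot>\<^bsub>C\<^esub> g')"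
    using as[OF O(3,1,2,3) fg' f(1) g(1)] as[OF O(3,2,1,2) g(2) f(2,1)] by simp
  ultimately show ?thesis
    unfolding is_iso_def using gf fg' f g un[OF O(1,2) f(1)] un[OF O(3,2) g(2)] by auto
qed

context convolution
begin

abbreviation "idn \<equiv> Idn (comod_category W K)"
abbreviation cmp (infixr \<open>\<bullet>\<close> 75) where "\<theta> \<bullet> \<eta> \<equiv> comod_comp W K \<theta> \<eta>"

lemmas arr_closed = comod_arr_closed[where W = W and K = K]
  and arr_com = comod_arr_comodule[where W = W and K = K]

lemma arr_smult:
  "arr \<eta> \<Longrightarrow> finite S \<Longrightarrow> F = src \<eta> \<Longrightarrow> m = n \<Longrightarrow> c \<in> carrier K \<Longrightarrow> x \<in> el F S n \<Longrightarrow>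
    act (act \<eta> S) n (c \<odot>\<^bsub>Mod (fob F S) m\<^esub> x) = c \<odot>\<^bsub>Mod (fob (trg \<eta>) S) n\<^esub> act (act \<eta> S) n x"
  using lin_smult[OF comod_arr_lin] by metis

lemma arr_zero:
  "arr \<eta> \<Longrightarrow> finite S \<Longrightarrow> F = src \<eta> \<Longrightarrow> m = n \<Longrightarrow>
    act (act \<eta> S) n \<zero>\<^bsub>Mod (fob F S) m\<^esub> = \<zero>\<^bsub>Mod (fob (trg \<eta>) S) n\<^esub>"
  using lin_zero[OF comod_arr_lin] by metis

subsection \<open>Equality of morphisms out of products\<close>

text \<open>With the third factor fixed, a generator depends linearly on the first, so extension
  from generators can be applied a second time inside it.\<close>

lemma arr_ext3_any:
  assumes F: "com F" and G: "com G" and H: "com H"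
    and e: "comod_arr W' K \<eta>" "comod_arr W' K \<theta>" "src \<eta> = (F \<boxtimes> G) \<boxtimes> H" "src \<theta> = (F \<boxtimes> G) \<boxtimes> H" "trg \<eta> = trg \<theta>"
    and eq: "\<And>S V A B C p q r x y c. finite S \<Longrightarrow> D S V C \<Longrightarrow> D V A B \<Longrightarrow> finite V \<Longrightarrow> finite A \<Longrightarrow> finite B \<Longrightarrow>
      finite C \<Longrightarrow> x \<in> el F A p \<Longrightarrow> y \<in> el G B q \<Longrightarrow> c \<in> el H C r \<Longrightarrow>
      act (act \<eta> S) (p + q + r) (pr (F \<boxtimes> G) H S V C (p + q) r (pr F G V A B p q x y) c)
      = act (act \<theta> S) (p + q + r) (pr (F \<boxtimes> G) H S V C (p + q) r (pr F G V A B p q x y) c)"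
  shows "\<eta> = \<theta>"
proof (rule arr_ext2_any[OF com_tob[OF F G] H e])
  fix S V C m r u c assume S: "finite S" "D S V C" "finite V" "finite C"
    and u: "u \<in> el (F \<boxtimes> G) V m" and c: "c \<in> el H C r"
  note l = bilinear_left[OF pr_bilinear[OF com_tob[OF F G] H S(1,2) HOL.refl] c]
  show "act (act \<eta> S) (m + r) (pr (F \<boxtimes> G) H S V C m r u c) = act (act \<theta> S) (m + r) (pr (F \<boxtimes> G) H S V C m r u c)"
    by (rule tob_ext[OF F G S(3) lin_comp[OF l comod_arr_lin[OF e(1) S(1) e(3)[symmetric] HOL.refl]]
          lin_comp[OF l comod_arr_lin[OF e(2) S(1) e(4)[symmetric] e(5)]] u])
      (use S c eq D_finite[of V] in auto)
qed

lemmas arr_ext3 = arr_ext3_any[where W' = W]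

text \<open>Serves the second inverse law of the associator, whose source is bracketed to the
  right.\<close>

lemma arr_ext3':
  assumes F: "com F" and G: "com G" and H: "com H"
    and e: "arr \<eta>" "arr \<theta>" "src \<eta> = F \<boxtimes> G \<boxtimes> H" "src \<theta> = F \<boxtimes> G \<boxtimes> H" "trg \<eta> = trg \<theta>"
    and eq: "\<And>S V A B C p q r x y c. finite S \<Longrightarrow> D S A V \<Longrightarrow> D V B C \<Longrightarrow> finite V \<Longrightarrow> finite A \<Longrightarrow> finite B \<Longrightarrow>
      finite C \<Longrightarrow> x \<in> el F A p \<Longrightarrow> y \<in> el G B q \<Longrightarrow> c \<in> el H C r \<Longrightarrow>
      act (act \<eta> S) (p + (q + r)) (pr F (G \<boxtimes> H) S A V p (q + r) x (pr G H V B C q r y c))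
      = act (act \<theta> S) (p + (q + r)) (pr F (G \<boxtimes> H) S A V p (q + r) x (pr G H V B C q r y c))"
  shows "\<eta> = \<theta>"
proof (rule arr_ext2[OF F com_tob[OF G H] e])
  fix S A V p m x u assume S: "finite S" "D S A V" "finite A" "finite V"
    and x: "x \<in> el F A p" and u: "u \<in> el (G \<boxtimes> H) V m"
  note l = bilinear_right[OF pr_bilinear[OF F com_tob[OF G H] S(1,2) HOL.refl] x]
  show "act (act \<eta> S) (p + m) (pr F (G \<boxtimes> H) S A V p m x u) = act (act \<theta> S) (p + m) (pr F (G \<boxtimes> H) S A V p m x u)"
    by (rule tob_ext[OF G H S(4) lin_comp[OF l comod_arr_lin[OF e(1) S(1) e(3)[symmetric] HOL.refl]]
          lin_comp[OF l comod_arr_lin[OF e(2) S(1) e(4)[symmetric] e(5)]] u])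
      (use S x eq D_finite[of V] in auto)
qed

lemma arr_ext4:
  assumes F: "com F" and G: "com G" and H: "com H" and I: "com I"
    and e: "arr \<eta>" "arr \<theta>" "src \<eta> = ((F \<boxtimes> G) \<boxtimes> H) \<boxtimes> I" "src \<theta> = ((F \<boxtimes> G) \<boxtimes> H) \<boxtimes> I" "trg \<eta> = trg \<theta>"
    and eq: "\<And>S V X A B C E p q r s x y c d. finite S \<Longrightarrow> D S X E \<Longrightarrow> D X V C \<Longrightarrow> D V A B \<Longrightarrow> finite X \<Longrightarrow>
      finite E \<Longrightarrow> finite V \<Longrightarrow> finite A \<Longrightarrow> finite B \<Longrightarrow> finite C \<Longrightarrow>
      x \<in> el F A p \<Longrightarrow> y \<in> el G B q \<Longrightarrow> c \<in> el H C r \<Longrightarrow> d \<in> el I E s \<Longrightarrow>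
      act (act \<eta> S) (p + q + r + s) (pr ((F \<boxtimes> G) \<boxtimes> H) I S X E (p + q + r) s
        (pr (F \<boxtimes> G) H X V C (p + q) r (pr F G V A B p q x y) c) d)
      = act (act \<theta> S) (p + q + r + s) (pr ((F \<boxtimes> G) \<boxtimes> H) I S X E (p + q + r) s
        (pr (F \<boxtimes> G) H X V C (p + q) r (pr F G V A B p q x y) c) d)"
  shows "\<eta> = \<theta>"
proof (rule arr_ext3[OF com_tob[OF F G] H I e])
  fix S X V C E m r s u c d assume S: "finite S" "D S X E" "D X V C" "finite X" "finite V" "finite C" "finite E"
    and u: "u \<in> el (F \<boxtimes> G) V m" and c: "c \<in> el H C r" and d: "d \<in> el I E s"
  note FG = com_tob[OF F G]
  note l = lin_comp[OF bilinear_left[OF pr_bilinear[OF FG H S(4,3) HOL.refl] c]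
      bilinear_left[OF pr_bilinear[OF com_tob[OF FG H] I S(1,2) HOL.refl] d]]
  show "act (act \<eta> S) (m + r + s) (pr ((F \<boxtimes> G) \<boxtimes> H) I S X E (m + r) s (pr (F \<boxtimes> G) H X V C m r u c) d)
      = act (act \<theta> S) (m + r + s) (pr ((F \<boxtimes> G) \<boxtimes> H) I S X E (m + r) s (pr (F \<boxtimes> G) H X V C m r u c) d)"
    by (rule tob_ext[OF F G S(5) lin_comp[OF l comod_arr_lin[OF e(1) S(1) e(3)[symmetric] HOL.refl]]
          lin_comp[OF l comod_arr_lin[OF e(2) S(1) e(4)[symmetric] e(5)]] u])
      (use S c d eq D_finite[of V] in auto)
qed

subsection \<open>The axioms of a symmetric monoidal category\<close>

lemma koszul_K [simp]: "koszul K i \<in> carrier K"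
  by (simp add: K)

text \<open>These rewrite rules settle the ends of composites and their being morphisms, while
  \<open>pr_simps\<close> evaluates composites on generators. With both, a coherence axiom is left
  with index sets and signs only.\<close>

lemmas arr_simps = tar_arr comod_comp_arr comod_id_arr left_unitor_simps(1-3) right_unitor_arr
  right_unitor_simps(1,2) braiding_simps(1-3) associator_simps(1-3) tar_simps(1,2)
  comod_comp_simps(1,2) comod_id_simps(1,2) com_tob com_unit arr_com

lemmas pr_simps = comod_comp_simps(3) comod_id_simps(3) tar_pr left_unitor_pr right_unitor_pr
  braiding_pr associator_pr pr_closed arr_closed arr_smult arr_zero pr_smult_left pr_smult_right
  pr_smult_closed

lemma tar_id: "com F \<Longrightarrow> com G \<Longrightarrow> tar M (idn F) (idn G) = idn (F \<boxtimes> G)"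
  by (rule arr_ext2[of F G]) (simp_all add: arr_simps pr_simps)

lemma tar_comp:
  assumes "arr f" "arr f'" "arr g" "arr g'" "trg f = src f'" "trg g = src g'"
  shows "tar M (f' \<bullet> f) (g' \<bullet> g) = tar M f' g' \<bullet> tar M f g"
  by (rule arr_ext2[of "src f" "src g"]) (use assms in \<open>simp_all add: arr_simps pr_simps\<close>)

lemma braiding_natural:
  assumes "arr f" "arr g"
  shows "braiding M (trg f) (trg g) \<bullet> tar M f g = tar M g f \<bullet> braiding M (src f) (src g)"
  by (rule arr_ext2[of "src f" "src g"])
    (use assms D_sym in \<open>simp_all add: arr_simps pr_simps\<close>)

lemma braiding_braiding:
  assumes "com F" "com G"
  shows "braiding M G F \<bullet> braiding M F G = idn (F \<boxtimes> G)"
  by (rule arr_ext2[of F G])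
    (use assms D_sym in \<open>simp_all add: arr_simps pr_simps koszul_smult[OF tob_module] koszul_even_smult[OF tob_module]\<close>)

lemma left_unitor_natural:
  assumes "arr f"
  shows "left_unitor M (trg f) \<bullet> tar M (idn U) f = f \<bullet> left_unitor M (src f)"
proof (rule arr_ext2[of U "src f"])
  fix S A B p q c x assume S: "finite S" "D S A B" "finite A" "finite B"
    and x: "c \<in> el U A p" "x \<in> el (src f) B q"
  show "act (act (left_unitor M (trg f) \<bullet> tar M (idn U) f) S) (p + q) (pr U (src f) S A B p q c x)
    = act (act (f \<bullet> left_unitor M (src f)) S) (p + q) (pr U (src f) S A B p q c x)"
  proof (cases "A \<in> Z \<and> p = 0")
    case True
    then have "B = S" using D_unit(2)[OF S(2)] by simp
    with True show ?thesis using assms S x unit_scalar[OF x(1)] by (simp add: arr_simps pr_simps)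
  next
    case False
    then have nz: "(A \<in> Z \<and> p = 0) = False" by simp
    show ?thesis using assms S x by (simp add: nz arr_simps pr_simps)
  qed
qed (use assms in \<open>simp_all add: arr_simps\<close>)

lemma right_unitor_natural:
  assumes "arr f"
  shows "right_unitor M (trg f) \<bullet> tar M f (idn U) = f \<bullet> right_unitor M (src f)"
proof (rule arr_ext2[of "src f" U])
  fix S A B p q x c assume S: "finite S" "D S A B" "finite A" "finite B"
    and x: "x \<in> el (src f) A p" "c \<in> el U B q"
  show "act (act (right_unitor M (trg f) \<bullet> tar M f (idn U)) S) (p + q) (pr (src f) U S A B p q x c)
    = act (act (f \<bullet> right_unitor M (src f)) S) (p + q) (pr (src f) U S A B p q x c)"
  proof (cases "B \<in> Z \<and> q = 0")
    case True
    then have "A = S" using D_unit(2)[OF D_sym[OF S(2)]] by simp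
    with True show ?thesis using assms S x unit_scalar[OF x(2)] by (simp add: arr_simps pr_simps)
  next
    case False
    then have nz: "(B \<in> Z \<and> q = 0) = False" by simp
    show ?thesis using assms S x by (simp add: nz arr_simps pr_simps)
  qed
qed (use assms in \<open>simp_all add: arr_simps\<close>)

lemma associator_natural:
  assumes "arr f" "arr g" "arr h"
  shows "associator M (trg f) (trg g) (trg h) \<bullet> tar M (tar M f g) h
    = tar M f (tar M g h) \<bullet> associator M (src f) (src g) (src h)"
  by (rule arr_ext3[of "src f" "src g" "src h"])
    (use assms D_assoc in \<open>simp_all add: arr_simps pr_simps add.assoc\<close>)

lemma pentagon:
  assumes "com F" "com G" "com H" "com I"
  shows "associator M F G (H \<boxtimes> I) \<bullet> associator M (F \<boxtimes> G) H I
    = tar M (idn F) (associator M G H I) \<bullet> associator M F (G \<boxtimes> H) I \<bullet> tar M (associator M F G H) (idn I)"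
proof (rule arr_ext4[OF assms])
  fix S V X A B C E p q r s x y c d assume S: "finite S" and X: "D S X E" "D X V C" "D V A B"
    and fin: "finite X" "finite E" "finite V" "finite A" "finite B" "finite C"
    and x: "x \<in> el F A p" "y \<in> el G B q" "c \<in> el H C r" "d \<in> el I E s"
  \<comment> \<open>Every pair of subsets met along the two sides of the pentagon arises by
    regrouping; the resulting unions agree by associativity.\<close>
  note D = D_assoc[OF X(1,2)] D_assoc[OF X(2,3)]
  note D' = D_assoc[OF D(1) X(3)] D_assoc[OF X(1) D(3)]
  show "act (act (associator M F G (H \<boxtimes> I) \<bullet> associator M (F \<boxtimes> G) H I) S) (p + q + r + s)
      (pr ((F \<boxtimes> G) \<boxtimes> H) I S X E (p + q + r) s (pr (F \<boxtimes> G) H X V C (p + q) r (pr F G V A B p q x y) c) d)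
    = act (act (tar M (idn F) (associator M G H I) \<bullet> associator M F (G \<boxtimes> H) I \<bullet> tar M (associator M F G H) (idn I)) S)
      (p + q + r + s)
      (pr ((F \<boxtimes> G) \<boxtimes> H) I S X E (p + q + r) s (pr (F \<boxtimes> G) H X V C (p + q) r (pr F G V A B p q x y) c) d)"
    using assms S X D D' fin x by (simp add: arr_simps pr_simps add.assoc Un_assoc)
qed (use assms in \<open>simp_all add: arr_simps\<close>)

lemma triangle:
  assumes "com F" "com G"
  shows "tar M (idn F) (left_unitor M G) \<bullet> associator M F U G = tar M (right_unitor M F) (idn G)"
proof (rule arr_ext3[OF assms(1) com_unit assms(2)])
  fix S V A B C p q r x c y assume S: "finite S" "finite V" "finite A" "finite B" "finite C"
    and V: "D S V C" "D V A B"
    and x: "x \<in> el F A p" "c \<in> el U B q" "y \<in> el G C r"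
  note D = D_assoc[OF V]
  show "act (act (tar M (idn F) (left_unitor M G) \<bullet> associator M F U G) S) (p + q + r)
      (pr (F \<boxtimes> U) G S V C (p + q) r (pr F U V A B p q x c) y)
    = act (act (tar M (right_unitor M F) (idn G)) S) (p + q + r)
      (pr (F \<boxtimes> U) G S V C (p + q) r (pr F U V A B p q x c) y)"
  proof (cases "B \<in> Z \<and> q = 0")
    case True
    \<comment> \<open>A part lying in \<open>Z\<close> forces its partner to be everything: inside
      \<open>V\<close> this gives \<open>A = V\<close>, and inside \<open>B \<union> C\<close> it
      makes the union collapse to \<open>C\<close>.\<close>
    then have eq: "A = V" "B \<union> C = C" using D_unit(2)[OF D_sym[OF V(2)]] D_unit(2)[OF D(2)] by auto
    with True show ?thesis using assms S V D x unit_scalar[OF x(2)]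
      by (simp add: arr_simps pr_simps add.assoc eq)
  next
    case False
    have m: "module K (Mod (fob F V) n)" "module K (Mod (fob G (B \<union> C)) n)" for n
      using assms S by (simp_all add: comodule_module)
    have "pr F G S A (B \<union> C) p (q + r) x \<zero>\<^bsub>Mod (fob G (B \<union> C)) (q + r)\<^esub> = \<zero>\<^bsub>Mod (fob (F \<boxtimes> G) S) (p + (q + r))\<^esub>"
      by (rule pr_zero_right[OF assms S(1) D(1) x(1)])
    moreover have "pr F G S V C (p + q) r \<zero>\<^bsub>Mod (fob F V) (p + q)\<^esub> y = \<zero>\<^bsub>Mod (fob (F \<boxtimes> G) S) (p + q + r)\<^esub>"
      by (rule pr_zero_left[OF assms S(1) V(1) x(3)])
    moreover have nz: "(B \<in> Z \<and> q = 0) = False" using False by simp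
    ultimately show ?thesis using assms S V D x
      by (simp add: nz arr_simps pr_simps add.assoc)
  qed
qed (use assms in \<open>simp_all add: arr_simps\<close>)

text \<open>The signs agree because the exponent of the braiding is additive in each degree: moving
  \<open>x\<close> past \<open>y\<close> and then past \<open>c\<close> costs
  \<open>p * q + p * r\<close>, moving it past both at once costs
  \<open>p * (q + r)\<close>.\<close>

lemma hexagon:
  assumes "com F" "com G" "com H"
  shows "associator M G H F \<bullet> braiding M F (G \<boxtimes> H) \<bullet> associator M F G H
    = tar M (idn G) (braiding M F H) \<bullet> associator M G F H \<bullet> tar M (braiding M F G) (idn H)"
proof (rule arr_ext3[OF assms])
  fix S V A B C p q r x y c assume S: "finite S" "finite V" "finite A" "finite B" "finite C"
    and V: "D S V C" "D V A B"
    and x: "x \<in> el F A p" "y \<in> el G B q" "c \<in> el H C r"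
  note D = D_assoc[OF V]
  note D' = D_assoc[OF D_sym[OF D(1)] D(2)] D_assoc[OF V(1) D_sym[OF V(2)]]
  have e: "q + p = p + q" "r + p = p + r" "q + (p + r) = p + (q + r)" "q + r + p = p + (q + r)"
    "C \<union> A = A \<union> C" "p * q + p * r = p * (q + r)" by (auto simp: distrib_left)
  show "act (act (associator M G H F \<bullet> braiding M F (G \<boxtimes> H) \<bullet> associator M F G H) S) (p + q + r)
      (pr (F \<boxtimes> G) H S V C (p + q) r (pr F G V A B p q x y) c)
    = act (act (tar M (idn G) (braiding M F H) \<bullet> associator M G F H \<bullet> tar M (braiding M F G) (idn H)) S) (p + q + r)
      (pr (F \<boxtimes> G) H S V C (p + q) r (pr F G V A B p q x y) c)"
    using assms S V D D' D'[THEN D_sym] D[THEN D_sym] V[THEN D_sym] x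
    by (simp add: arr_simps pr_simps add.assoc e koszul_smult[OF tob_module])
qed (use assms in \<open>simp_all add: arr_simps\<close>)

lemma braiding_iso:
  assumes "com F" "com G"
  shows "is_iso (comod_category W K) (F \<boxtimes> G) (G \<boxtimes> F) (braiding M F G)"
  unfolding is_iso_def
  using assms braiding_braiding[of F G] braiding_braiding[of G F]
  by (auto simp: Hom_comod_iff arr_simps intro!: bexI[of _ "braiding M G F"])

lemma left_unitor_iso:
  assumes F: "com F"
  shows "is_iso (comod_category W K) (U \<boxtimes> F) F (left_unitor M F)"
proof -
  interpret cring K by (rule K)
  have "is_iso (comod_category W K) (src (left_unitor M F)) (trg (left_unitor M F)) (left_unitor M F)"
  proof (rule comod_isoI, unfold left_unitor_simps(2,3)[OF F])
    show "arr (left_unitor M F)" by (rule left_unitor_simps(1)[OF F])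
    fix S :: "'s set" assume S: "finite S"
    note zS = z(2)[of S] and z1 = z(1)[of S]
    note finz = D_finite(1)[OF zS S]
    let ?e = "Scalar \<one>\<^bsub>K\<^esub> :: ('k, 's, 'v) univ"
    have e: "?e \<in> el U (z S) 0" using z1 by (simp add: unit_ground ground_space_def)
    \<comment> \<open>The inverse sends \<open>x\<close> to \<open>1 \<otimes> x\<close> in the
      summand \<open>(z S, S)\<close>. By \<open>D_unit\<close> this is the only summand whose left
      factor is the ground complex.\<close>
    let ?g = "\<lambda>n x. pr U F S (z S) S 0 n ?e x"
    let ?\<psi> = "Arrow (fob F S) (\<lambda>n. \<lambda>x \<in> el F S n. ?g n x) (fob (U \<boxtimes> F) S)"
    have l: "lin K (Mod (fob F S) n) (Mod (fob (U \<boxtimes> F) S) n) (?g n)" for n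
      by (rule bilinear_right[OF pr_bilinear[OF com_unit F S zS] e]) simp
    have c: "ch_arr K ?\<psi>"
    proof (rule ch_arrI[OF comodule_cpx[OF F S] tob_cpx[OF com_unit F S] l])
      fix n x assume x: "x \<in> el F S n"
      have dx: "bd (fob F S) n x \<in> el F S (n - 1)" using lin_closed[OF comodule_bd_lin[OF F S] x] .
      have "pr U F S (z S) S (- 1) n (Scalar \<zero>\<^bsub>K\<^esub>) x = \<zero>\<^bsub>Mod (fob (U \<boxtimes> F) S) (n - 1)\<^esub>"
        using pr_zero_left[OF com_unit F S zS x, of "- 1"] by (simp add: unit_zero)
      then show "?g (n - 1) (bd (fob F S) n x) = bd (fob (U \<boxtimes> F) S) n (?g n x)"
        using bd_pr[OF com_unit F S zS _ e x, of n] lin_closed[OF l dx]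
        by (simp add: unit_bd module_simps[OF tob_module[OF com_unit F S]]
            koszul_even_smult[OF tob_module[OF com_unit F S]])
    qed
    have inv: "?g n (act (act (left_unitor M F) S) n u) = u" if u: "u \<in> el (U \<boxtimes> F) S n" for n u
    proof (rule tob_ext[OF com_unit F S lin_comp[OF comod_arr_lin[OF left_unitor_simps(1)[OF F] S] l] lin_id u])
      show "U \<boxtimes> F = src (left_unitor M F)" "F = trg (left_unitor M F)" by (simp_all add: left_unitor_simps F)
      show "module K (Mod (fob (U \<boxtimes> F) S) n)" by (rule tob_module[OF com_unit F S])
      fix A B p q c x assume AB: "D S A B" and n: "n = p + q" and cx: "c \<in> el U A p" "x \<in> el F B q"
      show "?g n (act (act (left_unitor M F) S) n (pr U F S A B p q c x)) = pr U F S A B p q c x"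
      proof (cases "A \<in> Z \<and> p = 0")
        case True
        then have AB': "A = z S" "B = S" using D_unit[OF AB] by auto
        \<comment> \<open>Bilinearity carries the scalar from \<open>x\<close> back to the unit
          factor, where it rebuilds \<open>c\<close>.\<close>
        have "?g n (scalar c \<odot>\<^bsub>Mod (fob F S) n\<^esub> x)
            = pr U F S (z S) S 0 n (scalar c \<odot>\<^bsub>Mod (fob U (z S)) 0\<^esub> ?e) x"
          using True n cx e unit_scalar[OF cx(1)] AB'
          by (simp add: pr_smult_right[OF com_unit F S zS] pr_smult_left[OF com_unit F S zS])
        also have "scalar c \<odot>\<^bsub>Mod (fob U (z S)) 0\<^esub> ?e = c"
          using z1 unit_scalar[OF cx(1)] by (simp add: unit_ground ground_space_def)
        finally show ?thesis using True n AB' cx AB S by (simp add: left_unitor_pr[OF F S])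
      next
        case False
        then have "c = \<zero>\<^bsub>Mod (fob U A) p\<^esub>" using unit_degenerate[OF cx(1)] by (simp add: unit_zero)
        then have "pr U F S A B p q c x = \<zero>\<^bsub>Mod (fob (U \<boxtimes> F) S) n\<^esub>"
          using pr_zero_left[OF com_unit F S AB cx(2)] n by simp
        moreover have nz: "(A \<in> Z \<and> p = 0) = False" using False by simp
        ultimately show ?thesis
          using left_unitor_pr[OF F S AB n cx] lin_zero[OF l, of n] by (simp only: nz if_False n)
      qed
    qed
    have inv': "act (act (left_unitor M F) S) n (?g n x) = x" if x: "x \<in> el F S n" for n x
      using left_unitor_pr[OF F S zS _ e x, of n] z1 x module.smult_one[OF comodule_module[OF F S]] by simp
    show "\<exists>\<psi>. ch_arr K \<psi> \<and> src \<psi> = fob F S \<and> trg \<psi> = fob (U \<boxtimes> F) S \<and>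
      (\<forall>n. \<forall>x \<in> el (U \<boxtimes> F) S n. act \<psi> n (act (act (left_unitor M F) S) n x) = x) \<and>
      (\<forall>n. \<forall>y \<in> el F S n. act (act (left_unitor M F) S) n (act \<psi> n y) = y)"
    proof (intro exI[of _ ?\<psi>] conjI allI ballI c)
      fix n u assume u: "u \<in> el (U \<boxtimes> F) S n"
      have "act (act (left_unitor M F) S) n u \<in> el F S n"
        using u S F by (simp add: arr_closed arr_simps)
      then show "act ?\<psi> n (act (act (left_unitor M F) S) n u) = u" using inv[OF u] by simp
    qed (simp_all add: inv')
  qed
  then show ?thesis by (simp add: left_unitor_simps F)
qed

lemma right_unitor_iso:
  assumes F: "com F"
  shows "is_iso (comod_category W K) (F \<boxtimes> U) F (right_unitor M F)"
  unfolding right_unitor_eq[OF F]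
  by (rule is_iso_comp[OF category_comod _ _ _ braiding_iso[OF F com_unit] left_unitor_iso[OF F]])
    (simp_all add: F com_tob com_unit)

text \<open>The inverse follows the path F(GH) -> (GH)F -> (HG)F -> H(GF) -> (GF)H -> (FG)H through
  known morphisms. No lift out of a right-bracketed product then has to be shown to be natural and
  compatible with differentials.\<close>

lemma associator_iso:
  assumes F: "com F" and G: "com G" and H: "com H"
  shows "is_iso (comod_category W K) ((F \<boxtimes> G) \<boxtimes> H) (F \<boxtimes> G \<boxtimes> H) (associator M F G H)"
proof -
  let ?i = "tar M (braiding M G F) (idn H) \<bullet> braiding M H (G \<boxtimes> F) \<bullet> associator M H G F \<bullet>
    tar M (braiding M G H) (idn F) \<bullet> braiding M F (G \<boxtimes> H)"
  note FGH = F G H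
  have i: "arr ?i" "src ?i = F \<boxtimes> G \<boxtimes> H" "trg ?i = (F \<boxtimes> G) \<boxtimes> H"
    using FGH by (simp_all add: arr_simps)
  have i_pr: "act (act ?i S) (p + (q + r)) (pr F (G \<boxtimes> H) S A V p (q + r) x (pr G H V B C q r y c))
      = pr (F \<boxtimes> G) H S (A \<union> B) C (p + q) r (pr F G (A \<union> B) A B p q x y) c"
    if S: "finite S" and V: "D S A V" "D V B C" and x: "x \<in> el F A p" "y \<in> el G B q" "c \<in> el H C r"
    for S A V B C p q r x y c
  proof -
    note D = D_assoc'[OF V]
    have f: "finite V" "finite A" "finite B" "finite C"
      using D_finite[OF V(1) S] D_finite[OF V(2)] by auto
    have e: "r + q = q + r" "q + p = p + q" "q + (r + p) = p + (q + r)" "q + (p + r) = p + (q + r)"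
      "r + (q + p) = p + (q + r)" "r + (p + q) = p + (q + r)" "B \<union> A = A \<union> B" by auto
    \<comment> \<open>Each of the three pairs of factors is exchanged twice along the path, so the
      exponent is twice \<open>p * q + p * r + q * r\<close>.\<close>
    have k: "koszul K (p * (q + r) + (q * r + (r * (p + q) + q * p))) = koszul K 0"
      by (rule koszul_cong) auto
    show ?thesis
      using FGH S V V[THEN D_sym] D D[THEN D_sym] f x
      by (simp add: arr_simps pr_simps add.assoc e k koszul_smult[OF tob_module]
          koszul_even_smult[OF tob_module])
  qed
  have "?i \<bullet> associator M F G H = idn ((F \<boxtimes> G) \<boxtimes> H)"
  proof (rule arr_ext3[OF F G H])
    fix S V A B C p q r x y c assume S: "finite S" "D S V C" "D V A B" "finite V" "finite A" "finite B" "finite C"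
      and x: "x \<in> el F A p" "y \<in> el G B q" "c \<in> el H C r"
    have V: "A \<union> B = V" using D_Un[OF S(3)] .
    show "act (act (?i \<bullet> associator M F G H) S) (p + q + r)
        (pr (F \<boxtimes> G) H S V C (p + q) r (pr F G V A B p q x y) c)
      = act (act (idn ((F \<boxtimes> G) \<boxtimes> H)) S) (p + q + r)
        (pr (F \<boxtimes> G) H S V C (p + q) r (pr F G V A B p q x y) c)"
      using FGH S x i_pr[OF S(1) D_assoc[OF S(2,3)] x]
      by (simp add: comod_comp_simps(3)[of W K "associator M F G H"] associator_simps associator_pr
          comod_id_simps pr_closed com_tob add.assoc V)
  qed (use FGH i in \<open>simp_all add: arr_simps\<close>)
  moreover have "associator M F G H \<bullet> ?i = idn (F \<boxtimes> G \<boxtimes> H)"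
  proof (rule arr_ext3'[OF F G H])
    fix S V A B C p q r x y c assume S: "finite S" "D S A V" "D V B C" "finite V" "finite A" "finite B" "finite C"
      and x: "x \<in> el F A p" "y \<in> el G B q" "c \<in> el H C r"
    have V: "B \<union> C = V" using D_Un[OF S(3)] .
    show "act (act (associator M F G H \<bullet> ?i) S) (p + (q + r))
        (pr F (G \<boxtimes> H) S A V p (q + r) x (pr G H V B C q r y c))
      = act (act (idn (F \<boxtimes> G \<boxtimes> H)) S) (p + (q + r))
        (pr F (G \<boxtimes> H) S A V p (q + r) x (pr G H V B C q r y c))"
      using FGH S x i D_assoc'[OF S(2,3)]
      by (simp add: comod_comp_simps(3)[of W K ?i] i_pr associator_simps associator_pr
          comod_id_simps pr_closed com_tob add.assoc V)
  qed (use FGH i in \<open>simp_all add: arr_simps\<close>)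
  ultimately show ?thesis unfolding is_iso_def
    using FGH i by (intro conjI bexI[of _ ?i]) (simp_all add: Hom_comod_iff arr_simps)
qed

theorem symmetric_monoidal: "symmetric_monoidal_category M"
proof -
  have "is_category M"
    using category_comod[of W K] unfolding is_category_def M .
  moreover have "is_iso M = is_iso (comod_category W K)"
    by (simp add: is_iso_def fun_eq_iff M)
  ultimately show ?thesis
    unfolding symmetric_monoidal_category_def
    by (auto simp: M Hom_comod_iff arr_simps tar_id tar_comp braiding_iso left_unitor_iso
        right_unitor_iso associator_iso braiding_natural left_unitor_natural associator_natural
        pentagon triangle hexagon braiding_braiding right_unitor_natural)
qed

end

section \<open>Hadamard product and Day convolution\<close>

lemma comod_arrow_cong: "(\<And>S. finite S \<Longrightarrow> t S = t' S) \<Longrightarrow> comod_arrow F t G = comod_arrow F t' G"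
  by (simp add: comod_arrow_def restrict_def fun_eq_iff)

lemma cpx_tensor_out_eq:
  "cpx_tensor_out K C D E \<beta> = lift_map (cpx_tensor K C D) (\<lambda>P. cpx_lift K C D P \<beta>) E"
  by (simp add: cpx_tensor_out_def lift_map_def)

lemma day_out_eq:
  "day_out K F G S E \<beta> = lift_map (day_cpx K F G S) (\<lambda>P. day_lift K F G S P \<beta>) E"
  by (simp add: day_out_def lift_map_def)

lemma hadamard_simps:
  "Ob (hadamard K) = Ob (comod_category UNIV K)" "Hom (hadamard K) = Hom (comod_category UNIV K)"
  "Idn (hadamard K) = Idn (comod_category UNIV K)" "Comp (hadamard K) = Comp (comod_category UNIV K)"
  "tob (hadamard K) = hadamard_ob K" "unit_ob (hadamard K) = hadamard_unit K"
  by (simp_all add: hadamard_def category.defs smc.defs)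

lemma day_simps:
  "Ob (day W K) = Ob (comod_category W K)" "Hom (day W K) = Hom (comod_category W K)"
  "Idn (day W K) = Idn (comod_category W K)" "Comp (day W K) = Comp (comod_category W K)"
  "tob (day W K) = day_ob K" "unit_ob (day W K) = day_unit K"
  by (simp_all add: day_def category.defs smc.defs)

lemma hadamard_fob: "fob (hadamard_ob K F G) S = cpx_tensor K (fob F S) (fob G S)"
  by (simp add: hadamard_ob_def)

lemma day_fob: "fob (day_ob K F G) = day_cpx K F G"
  by (simp add: day_ob_def)

text \<open>The subsets \<open>A\<close> and \<open>B\<close> give \<open>cpx_pure\<close> the shape
  of the parameter \<open>pr\<close>; for the Hadamard product both are \<open>S\<close>.\<close>

definition had_pure ::
  "'k ring \<Rightarrow> ('k, 's, 'v) comod \<Rightarrow> ('k, 's, 'v) comod \<Rightarrow> 's set \<Rightarrow> 's set \<Rightarrow> 's set \<Rightarrow> int \<Rightarrow> int \<Rightarrow>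
   ('k, 's, 'v) univ \<Rightarrow> ('k, 's, 'v) univ \<Rightarrow> ('k, 's, 'v) univ" where
  "had_pure K F G S A B p q x y = cpx_pure K (fob F S) (fob G S) p q x y"

text \<open>The unit is the ground complex in every arity, so \<open>Z\<close> is everything and
  \<open>z S\<close> is \<open>S\<close>, the only left part available. The condition on preimages
  says that an injection maps all of its source into its target.\<close>

lemma convolution_hadamard:
  fixes K :: "'k ring"
  assumes K: "cring K"
  shows "convolution K UNIV (hadamard K :: (('k, 's, 'v) comod, ('k, 's, 'v) comod_map) smc)
    (\<lambda>S A B. A = S \<and> B = S) UNIV (\<lambda>S. S) (had_pure K)
    (\<lambda>F G S P \<beta>. cpx_lift K (fob F S) (fob G S) P (\<beta> S S))"
proof (rule convolution.intro; (unfold hadamard_simps hadamard_fob)?)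
  let ?H = "hadamard_ob K"
  fix F G :: "('k, 's, 'v) comod" and S :: "'s set" and n
  assume F: "comodule K F" and G: "comodule K G" and S: "finite S"
  interpret tensor_complexes K "fob F S" "fob G S"
    by (rule tensor_complexes.intro) (use K F G S in \<open>auto intro: comodule_cpx\<close>)
  show "tensor_sum K {(A, B, p, q). (A = S \<and> B = S) \<and> p + q = n} (\<lambda>(A, B, p, q). Mod (fob F A) p)
        (\<lambda>(A, B, p, q). Mod (fob G B) q) (Mod (cpx_tensor K (fob F S) (fob G S)) n)
        (\<lambda>(A, B, p, q). had_pure K F G S A B p q)
        (\<lambda>P \<beta>. cpx_lift K (fob F S) (fob G S) P (\<lambda>p q. \<beta> (S, S, p, q)) n)"
    by (rule tensor_sum_reindex[OF tensor_sum_cpx_tensor, where h = "\<lambda>(p, q). (S, S, p, q)"])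
      (auto simp: had_pure_def)
  show "chain_complex K (cpx_tensor K (fob F S) (fob G S))" by (rule chain_complex_T)
  show "bd (cpx_tensor K (fob F S) (fob G S)) n (had_pure K F G S A B p q x y) =
      had_pure K F G S A B (p - 1) q (bd (fob F A) p x) y
        \<oplus>\<^bsub>Mod (cpx_tensor K (fob F S) (fob G S)) (n - 1)\<^esub> koszul K p
        \<odot>\<^bsub>Mod (cpx_tensor K (fob F S) (fob G S)) (n - 1)\<^esub>
          had_pure K F G S A B p (q - 1) x (bd (fob G B) q y)"
    if "A = S \<and> B = S" "n = p + q" "x \<in> carrier (Mod (fob F A) p)" "y \<in> carrier (Mod (fob G B) q)"
    for A B p q x y
    using that by (simp add: had_pure_def bd_T_pure)
next
  fix F G :: "('k, 's, 'v) comod" and f :: "'s fi_map"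
  assume F: "comodule K F" "comodule K G" and f: "fi_arr f"
  show "far (hadamard_ob K F G) f = lift_map (cpx_tensor K (fob F (trg f)) (fob G (trg f)))
      (\<lambda>P. cpx_lift K (fob F (trg f)) (fob G (trg f)) P (\<lambda>p q x y.
        had_pure K F G (src f) (fi_preimage f (trg f)) (fi_preimage f (trg f)) p q
          (act (far F (fi_restrict f (trg f))) p x) (act (far G (fi_restrict f (trg f))) q y)))
      (cpx_tensor K (fob F (src f)) (fob G (src f)))"
    by (simp add: hadamard_ob_def cpx_tensor_map_def cpx_tensor_out_eq had_pure_def
        comodule_far[OF F(1) f] comodule_far[OF F(2) f] fi_restrict_trg f)
next
  fix \<eta> \<theta> :: "('k, 's, 'v) comod_map"
  assume a: "comod_arr UNIV K \<eta>" "comod_arr UNIV K \<theta>"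
  show "tar (hadamard K) \<eta> \<theta> = comod_arrow (hadamard_ob K (src \<eta>) (src \<theta>))
        (\<lambda>S. lift_map (cpx_tensor K (fob (src \<eta>) S) (fob (src \<theta>) S))
          (\<lambda>P. cpx_lift K (fob (src \<eta>) S) (fob (src \<theta>) S) P
          (\<lambda>p q x y. had_pure K (trg \<eta>) (trg \<theta>) S S S p q (act (act \<eta> S) p x) (act (act \<theta> S) q y)))
          (cpx_tensor K (fob (trg \<eta>) S) (fob (trg \<theta>) S))) (hadamard_ob K (trg \<eta>) (trg \<theta>))"
    unfolding hadamard_def category.defs smc.defs
    by (simp, rule comod_arrow_cong)
      (simp add: cpx_tensor_map_def cpx_tensor_out_eq had_pure_def
        comod_arr_component[OF a(1)] comod_arr_component[OF a(2)])
qed (use K in \<open>auto simp: hadamard_def category.defs smc.defs fi_preimage_def fi_arr_iff PiE_iff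
    hadamard_unit_def cpx_assoc_def cpx_left_unitor_def cpx_right_unitor_def cpx_braiding_def
    cpx_tensor_out_eq had_pure_def hadamard_ob_def Let_def\<close>)

definition day_pair :: "'s set \<Rightarrow> 's set \<Rightarrow> 's set \<Rightarrow> bool" where
  "day_pair S A B \<longleftrightarrow> A \<subseteq> S \<and> B = S - A"

lemma day_sum_complexes:
  assumes "cring K" "comodule K F" "comodule K G" "finite S"
  shows "sum_complexes K (Pow S) (day_summand K F G S)"
proof (rule sum_complexes.intro)
  fix A assume A: "A \<in> Pow S"
  interpret tensor_complexes K "fob F A" "fob G (S - A)"
    by (rule tensor_complexes.intro) (use assms A finite_subset[of A S] in \<open>auto intro: comodule_cpx\<close>)
  show "chain_complex K (day_summand K F G S A)"
    unfolding day_summand_def by (rule chain_complex_T)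
qed (use assms in auto)

text \<open>A bijection restricts to a bijection from the preimage of \<open>A\<close> onto
  \<open>A\<close>. Naturality for bijections alone is thereby inherited by the parts of a
  decomposition, as tensor products of morphisms require.\<close>

lemma fi_restrict_W:
  assumes "W \<in> {UNIV, FI_bijections}" "fi_arr f" "f \<in> W" "A \<subseteq> trg f"
  shows "fi_restrict f A \<in> W"
proof (cases "W = UNIV")
  case False
  then have "bij_betw (act f) (src f) (trg f)" using assms by (simp add: FI_bijections_def)
  then have "bij_betw (restrict (act f) (fi_preimage f A)) (fi_preimage f A) A"
  proof (intro bij_betw_imageI)
    have "A \<subseteq> act f ` src f" using \<open>bij_betw (act f) (src f) (trg f)\<close> assms(4) by (simp add: bij_betw_def)
    then show "restrict (act f) (fi_preimage f A) ` fi_preimage f A = A" by (auto simp: fi_preimage_def)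
    show "inj_on (restrict (act f) (fi_preimage f A)) (fi_preimage f A)"
      using assms(2) by (auto simp: fi_arr_iff inj_on_def fi_preimage_def)
  qed
  then show ?thesis using False assms(1) by (auto simp: FI_bijections_def)
qed simp

text \<open>Here \<open>Z\<close> contains the empty set only, whose partner in a decomposition of
  \<open>S\<close> is \<open>S\<close> itself. The universal property comes from a second
  application of \<open>tensor_sum_DS\<close>, now to the tensor complexes of the single
  decompositions.\<close>

lemma convolution_day:
  fixes K :: "'k ring"
  assumes K: "cring K" and W: "W \<in> {UNIV, FI_bijections}"
  shows "convolution K W (day W K :: (('k, 's, 'v) comod, ('k, 's, 'v) comod_map) smc)
    day_pair {{}} (\<lambda>S. {}) (\<lambda>F G S A B. day_pure K F G S A) (day_lift K)"
proof (rule convolution.intro; (unfold day_simps day_fob)?)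
  fix F G :: "('k, 's, 'v) comod" and S :: "'s set" and n
  assume F: "comodule K F" and G: "comodule K G" and S: "finite S"
  interpret S: sum_complexes K "Pow S" "day_summand K F G S"
    by (rule day_sum_complexes[OF K F G S])
  interpret M: direct_sum_modules K Indexed indexed "Pow S" "\<lambda>A. Mod (day_summand K F G S A) n" for n
    by (rule S.direct_sum_modules)
  have t: "tensor_complexes K (fob F A) (fob G (S - A))" if "A \<in> Pow S" for A
    by (rule tensor_complexes.intro) (use K F G S that finite_subset[of A S] in \<open>auto intro: comodule_cpx\<close>)
  have pieces: "tensor_sum K {(p, q). p + q = n} (\<lambda>(p, q). Mod (fob F A) p) (\<lambda>(p, q). Mod (fob G (S - A)) q)
      (Mod (day_summand K F G S A) n) (\<lambda>(p, q). cpx_pure K (fob F A) (fob G (S - A)) p q)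
      (\<lambda>P \<beta>. cpx_lift K (fob F A) (fob G (S - A)) P (\<lambda>p q. \<beta> (p, q)) n)" if "A \<in> Pow S" for A
    unfolding day_summand_def using tensor_complexes.tensor_sum_cpx_tensor[OF t[OF that]] .
  have inj: "cpx_inj (Pow S) (day_summand K F G S) A n = M.inj n A" for A n
    by (intro ext) (simp add: cpx_inj_def M.inj_def)
  show "tensor_sum K {(A, B, p, q). day_pair S A B \<and> p + q = n} (\<lambda>(A, B, p, q). Mod (fob F A) p)
        (\<lambda>(A, B, p, q). Mod (fob G B) q) (Mod (day_cpx K F G S) n)
        (\<lambda>(A, B, p, q). day_pure K F G S A p q)
        (\<lambda>P \<beta>. day_lift K F G S P (\<lambda>A B p q. \<beta> (A, B, p, q)) n)"
    unfolding day_cpx_def S.Mod_S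
  proof (rule tensor_sum_reindex[OF M.tensor_sum_DS[OF pieces], where h = "\<lambda>(A, p, q). (A, S - A, p, q)"])
    show "(\<lambda>(A, p, q). (A, S - A, p, q)) ` (Sigma (Pow S) (\<lambda>A. {(p, q). p + q = n}))
        = {(A, B, p, q). day_pair S A B \<and> p + q = n}"
      by (auto simp: day_pair_def image_iff)
    fix P u and \<beta> :: "'s set \<times> 's set \<times> int \<times> int \<Rightarrow> ('k, 's, 'v) univ \<Rightarrow> ('k, 's, 'v) univ \<Rightarrow> ('k, 's, 'v) univ"
    assume P: "module K P" and u: "u \<in> carrier (M.DS n)"
      and b: "\<And>j. j \<in> {(A, B, p, q). day_pair S A B \<and> p + q = n} \<Longrightarrow>
        bilinear K (case j of (A, B, p, q) \<Rightarrow> Mod (fob F A) p) (case j of (A, B, p, q) \<Rightarrow> Mod (fob G B) q) P (\<beta> j)"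
    have l: "lin K (Mod (day_summand K F G S A) n) P
        (cpx_lift K (fob F A) (fob G (S - A)) P (\<lambda>p q. \<beta> (A, S - A, p, q)) n)" if A: "A \<in> Pow S" for A
      unfolding day_summand_def
      by (rule tensor_complexes.lin_cpx_lift[OF t[OF A] P])
        (use b[of "(A, S - A, p, q)" for p q] A in \<open>auto simp: day_pair_def\<close>)
    \<comment> \<open>\<open>day_lift\<close> sums over all subsets and the abstract lift over the
      support only; since \<open>S\<close> is finite the two agree by
      \<open>lift_superset\<close>.\<close>
    have M_supp: "M.supp n u \<subseteq> Pow S" by (auto simp: M.supp_def)
    show "day_lift K F G S P (\<lambda>A B p q. \<beta> (A, B, p, q)) n u =
        M.lift n P (\<lambda>A. cpx_lift K (fob F A) (fob G (S - A)) P
          (\<lambda>p q. \<beta> (case (A, p, q) of (A, p, q) \<Rightarrow> (A, S - A, p, q))) n) u"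
      unfolding day_lift_def
      using M_supp M.lift_superset[OF l P u, of "Pow S"] S by simp
  qed (auto simp: day_pure_def inj)
  show "chain_complex K (day_cpx K F G S)" unfolding day_cpx_def by (rule S.chain_complex_S)
  show "bd (day_cpx K F G S) n (day_pure K F G S A p q x y) =
      day_pure K F G S A (p - 1) q (bd (fob F A) p x) y
        \<oplus>\<^bsub>Mod (day_cpx K F G S) (n - 1)\<^esub> koszul K p \<odot>\<^bsub>Mod (day_cpx K F G S) (n - 1)\<^esub>
          day_pure K F G S A p (q - 1) x (bd (fob G B) q y)"
    if AB: "day_pair S A B" and n: "n = p + q" and x: "x \<in> carrier (Mod (fob F A) p)"
      and y: "y \<in> carrier (Mod (fob G B) q)" for A B p q x y
  proof -
    have A: "A \<in> Pow S" and B: "B = S - A" using AB by (auto simp: day_pair_def)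
    interpret T: tensor_complexes K "fob F A" "fob G (S - A)" by (rule t[OF A])
    let ?i = "cpx_inj (Pow S) (day_summand K F G S) A (n - 1)"
    have l: "lin K (Mod T.T (n - 1)) (Mod S.S (n - 1)) ?i"
      using S.lin_cpx_inj[OF A] by (simp add: day_summand_def)
    have e: "p - 1 + q = n - 1" "p + (q - 1) = n - 1" "p + q = n" using n by auto
    have c: "cpx_pure K (fob F A) (fob G (S - A)) (p - 1) q (bd (fob F A) p x) y \<in> carrier (Mod T.T (n - 1))"
      "cpx_pure K (fob F A) (fob G (S - A)) p (q - 1) x (bd (fob G (S - A)) q y) \<in> carrier (Mod T.T (n - 1))"
      using x y B lin_closed[OF chain_complex_bd[OF T.C] x] lin_closed[OF chain_complex_bd[OF T.D]]
      by (auto intro!: T.cpx_pure_closed simp: n)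
    have "bd S.S n (day_pure K F G S A p q x y) = ?i (bd T.T n (cpx_pure K (fob F A) (fob G (S - A)) p q x y))"
      unfolding day_pure_def e by (simp add: S.bd_cpx_inj[OF A] day_summand_def)
    then show ?thesis
      using x y B by (simp add: T.bd_T_pure[OF n] lin_add[OF l] lin_smult[OF l] c
          module_smult_closed[OF T.module_T] K day_pure_def day_cpx_def e)
  qed
next
  show "fi_restrict f A \<in> W" if "fi_arr f" "f \<in> W" "day_pair (trg f) A B" for f :: "'s fi_map" and A B
    using fi_restrict_W[OF W that(1,2)] that(3) by (simp add: day_pair_def)
next
  show "comod_arr W K \<eta> \<Longrightarrow> comod_arr W K \<theta> \<Longrightarrow> tar (day W K) \<eta> \<theta> = comod_arrow (day_ob K (src \<eta>) (src \<theta>))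
        (\<lambda>S. lift_map (day_cpx K (src \<eta>) (src \<theta>) S) (\<lambda>P. day_lift K (src \<eta>) (src \<theta>) S P
          (\<lambda>A B p q x y. day_pure K (trg \<eta>) (trg \<theta>) S A p q (act (act \<eta> A) p x) (act (act \<theta> B) q y)))
          (day_cpx K (trg \<eta>) (trg \<theta>) S)) (day_ob K (trg \<eta>) (trg \<theta>))"
    for \<eta> \<theta> :: "('k, 's, 'v) comod_map"
    by (simp add: day_def category.defs smc.defs day_out_eq)
qed (use K in \<open>auto simp: day_pair_def fi_preimage_def fi_arr_iff PiE_iff day_def category.defs smc.defs
    day_unit_def Let_def day_out_eq day_ob_def\<close>)

section \<open>The oplax structure\<close>

lemma module_finsum_cong:
  assumes "module K M" "\<And>i. i \<in> A \<Longrightarrow> f i = g i" "\<And>i. i \<in> A \<Longrightarrow> g i \<in> carrier M"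
  shows "finsum M f A = finsum M g A"
proof -
  interpret module K M by fact
  show ?thesis by (rule M.finsum_cong') (use assms in auto)
qed

lemma module_finsum_reindex:
  assumes "module K M" "inj_on h A" "\<And>i. i \<in> A \<Longrightarrow> f (h i) \<in> carrier M"
  shows "finsum M f (h ` A) = finsum M (\<lambda>i. f (h i)) A"
proof -
  interpret module K M by fact
  show ?thesis by (rule M.finsum_reindex) (use assms in auto)
qed

lemma module_finsum_Sigma:
  assumes "module K M" "finite A" "\<And>a. a \<in> A \<Longrightarrow> finite (B a)"
    and "\<And>a b. a \<in> A \<Longrightarrow> b \<in> B a \<Longrightarrow> f a b \<in> carrier M"
  shows "finsum M (\<lambda>a. finsum M (f a) (B a)) A = finsum M (\<lambda>(a, b). f a b) (Sigma A B)"
proof -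
  interpret module K M by fact
  show ?thesis using assms(2-4)
  proof (induction A)
    case (insert a A)
    have 1: "(\<lambda>b. f a b) \<in> B a \<rightarrow> carrier M" "(\<lambda>c. finsum M (f c) (B c)) \<in> A \<rightarrow> carrier M"
      using insert.prems by (auto intro!: M.finsum_closed)
    have s: "Sigma (insert a A) B = Pair a ` B a \<union> Sigma A B" by auto
    have "finsum M (\<lambda>(a, b). f a b) (Sigma (insert a A) B)
        = finsum M (\<lambda>(a, b). f a b) (Pair a ` B a) \<oplus>\<^bsub>M\<^esub> finsum M (\<lambda>(a, b). f a b) (Sigma A B)"
      unfolding s using insert by (intro M.finsum_Un_disjoint) auto
    also have "finsum M (\<lambda>(a, b). f a b) (Pair a ` B a) = finsum M (f a) (B a)"
      using insert.prems by (subst M.finsum_reindex) (auto simp: inj_on_def)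
    finally show ?case
      using insert 1 by (simp add: M.finsum_insert M.finsum_closed)
  qed simp
qed

text \<open>The components of \<open>Tw_comult\<close> tensor a projection of \<open>F\<close> with
  a projection of \<open>G\<close>. These are chain maps between different arities and not
  components of morphisms of comodules, so their tensor product is treated at the level of
  complexes.\<close>

locale tensor_chain_maps =
  fixes K :: "'k ring" and \<phi> \<psi> :: "('k, 's, 'v) ch_map"
  assumes K: "cring K" and \<phi>: "ch_arr K \<phi>" and \<psi>: "ch_arr K \<psi>"
begin

sublocale S: tensor_complexes K "src \<phi>" "src \<psi>"
  by (rule tensor_complexes.intro) (use K \<phi> \<psi> in \<open>auto simp: ch_arr_def\<close>)

sublocale R: tensor_complexes K "trg \<phi>" "trg \<psi>"
  by (rule tensor_complexes.intro) (use K \<phi> \<psi> in \<open>auto simp: ch_arr_def\<close>)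

lemma bilinear_map:
  "n = p + q \<Longrightarrow> bilinear K (Mod (src \<phi>) p) (Mod (src \<psi>) q) (Mod R.T n)
    (\<lambda>x y. cpx_pure K (trg \<phi>) (trg \<psi>) p q (act \<phi> p x) (act \<psi> q y))"
  by (rule bilinear_comp2[OF R.bilinear_cpx_pure ch_arr_lin[OF \<phi>] ch_arr_lin[OF \<psi>]])

lemma cpx_tensor_map_eq:
  "cpx_tensor_map K \<phi> \<psi> = lift_map S.T (\<lambda>P. cpx_lift K (src \<phi>) (src \<psi>) P
    (\<lambda>p q x y. cpx_pure K (trg \<phi>) (trg \<psi>) p q (act \<phi> p x) (act \<psi> q y))) R.T"
  by (simp add: cpx_tensor_map_def cpx_tensor_out_eq)

lemma lin_map: "lin K (Mod S.T n) (Mod R.T n) (act (cpx_tensor_map K \<phi> \<psi>) n)"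
  by (rule lin_cong[OF S.lin_cpx_lift[OF R.module_T bilinear_map]]) (auto simp: cpx_tensor_map_eq)

lemma map_pure:
  assumes "n = p + q" "x \<in> carrier (Mod (src \<phi>) p)" "y \<in> carrier (Mod (src \<psi>) q)"
  shows "act (cpx_tensor_map K \<phi> \<psi>) n (cpx_pure K (src \<phi>) (src \<psi>) p q x y)
    = cpx_pure K (trg \<phi>) (trg \<psi>) p q (act \<phi> p x) (act \<psi> q y)"
proof -
  have "cpx_lift K (src \<phi>) (src \<psi>) (Mod R.T n)
      (\<lambda>p q x y. cpx_pure K (trg \<phi>) (trg \<psi>) p q (act \<phi> p x) (act \<psi> q y)) n (cpx_pure K (src \<phi>) (src \<psi>) p q x y)
    = cpx_pure K (trg \<phi>) (trg \<psi>) p q (act \<phi> p x) (act \<psi> q y)"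
    by (rule S.cpx_lift_pure[OF R.module_T bilinear_map]) (use assms in auto)
  then show ?thesis using S.cpx_pure_closed[OF assms] by (simp add: cpx_tensor_map_eq)
qed

lemma bd_map:
  assumes u: "u \<in> carrier (Mod S.T n)"
  shows "act (cpx_tensor_map K \<phi> \<psi>) (n - 1) (bd S.T n u) = bd R.T n (act (cpx_tensor_map K \<phi> \<psi>) n u)"
proof (rule S.cpx_tensor_ext[OF lin_comp[OF S.lin_bd_T lin_map] lin_comp[OF lin_map R.lin_bd_T] u])
  fix p q x y assume n: "n = p + q" and x: "x \<in> carrier (Mod (src \<phi>) p)" and y: "y \<in> carrier (Mod (src \<psi>) q)"
  note dx = lin_closed[OF chain_complex_bd[OF S.C] x] and dy = lin_closed[OF chain_complex_bd[OF S.D] y]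
  have c: "cpx_pure K (src \<phi>) (src \<psi>) (p - 1) q (bd (src \<phi>) p x) y \<in> carrier (Mod S.T (n - 1))"
    "cpx_pure K (src \<phi>) (src \<psi>) p (q - 1) x (bd (src \<psi>) q y) \<in> carrier (Mod S.T (n - 1))"
    using x y dx dy by (auto intro!: S.cpx_pure_closed simp: n)
  have e: "n - 1 = p - 1 + q" "n - 1 = p + (q - 1)" using n by auto
  show "act (cpx_tensor_map K \<phi> \<psi>) (n - 1) (bd S.T n (cpx_pure K (src \<phi>) (src \<psi>) p q x y))
      = bd R.T n (act (cpx_tensor_map K \<phi> \<psi>) n (cpx_pure K (src \<phi>) (src \<psi>) p q x y))"
    by (simp add: S.bd_T_pure[OF n x y] lin_add[OF lin_map] lin_smult[OF lin_map] c K
        module_smult_closed[OF S.module_T] map_pure[OF e(1) dx y] map_pure[OF e(2) x dy] map_pure[OF n x y]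
        R.bd_T_pure[OF n] lin_closed[OF ch_arr_lin[OF \<phi>] x] lin_closed[OF ch_arr_lin[OF \<psi>] y]
        ch_arr_bd[OF \<phi> x] ch_arr_bd[OF \<psi> y])
qed

end

section \<open>Restriction along inclusions\<close>

abbreviation restr :: "('k, 's, 'v) comod \<Rightarrow> 's set \<Rightarrow> 's set \<Rightarrow> int \<Rightarrow> ('k, 's, 'v) univ \<Rightarrow> ('k, 's, 'v) univ" where
  "restr F S A p \<equiv> act (\<pi> F S A) p"

lemma restr_closed:
  "comodule K F \<Longrightarrow> finite S \<Longrightarrow> A \<subseteq> S \<Longrightarrow> x \<in> carrier (Mod (fob F S) p) \<Longrightarrow>
    restr F S A p x \<in> carrier (Mod (fob F A) p)"
  using far_closed[of K F "fi_incl A S" A x p] by (simp add: comod_proj_def fi_arr_incl)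

text \<open>Both sides are the action of one injection, from the preimage of \<open>A\<close> into
  \<open>trg f\<close>.\<close>

lemma restr_far:
  assumes F: "comodule K F" and f: "fi_arr f" and A: "A \<subseteq> trg f" and x: "x \<in> carrier (Mod (fob F (trg f)) p)"
  shows "restr F (src f) (fi_preimage f A) p (act (far F f) p x)
    = act (far F (fi_restrict f A)) p (restr F (trg f) A p x)"
proof -
  note fin = fi_arr_finite[OF f]
  have P: "fi_preimage f A \<subseteq> src f" by (auto simp: fi_preimage_def)
  note i = fi_arr_incl[OF fin(1) P] fi_arr_incl[OF fin(2) A] fi_arr_restrict[OF f A]
  have "f \<cdot>\<^bsub>FI\<^esub> fi_incl (fi_preimage f A) (src f) = fi_incl A (trg f) \<cdot>\<^bsub>FI\<^esub> fi_restrict f A"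
  proof (rule fi_arr_eqI)
    show "fi_arr (f \<cdot>\<^bsub>FI\<^esub> fi_incl (fi_preimage f A) (src f))"
      "fi_arr (fi_incl A (trg f) \<cdot>\<^bsub>FI\<^esub> fi_restrict f A)" using i f by (auto intro: fi_arr_comp)
  qed (use P in \<open>auto simp: compose_def fi_preimage_def\<close>)
  then show ?thesis
    using comodule_comp[OF F i(1) f, of x p] comodule_comp[OF F i(3,2), of x p] x
    by (simp add: comod_proj_def)
qed

lemma restr_restr:
  assumes "comodule K F" "finite S" "A \<subseteq> V" "V \<subseteq> S" "x \<in> carrier (Mod (fob F S) p)"
  shows "restr F V A p (restr F S V p x) = restr F S A p x"
proof -
  note i = fi_arr_incl[OF finite_subset[OF assms(4,2)] assms(3)] fi_arr_incl[OF assms(2,4)]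
    fi_arr_incl[OF assms(2) subset_trans[OF assms(3,4)]]
  have "fi_incl V S \<cdot>\<^bsub>FI\<^esub> fi_incl A V = fi_incl A S"
    by (rule fi_arr_eqI[OF fi_arr_comp[OF i(1,2)] i(3)]) (use assms(3) in \<open>auto simp: compose_def\<close>)
  then show ?thesis using comodule_comp[OF assms(1) i(1,2), of x p] assms(5) by (simp add: comod_proj_def)
qed

lemma restr_self:
  assumes "comodule K F" "finite S" "x \<in> carrier (Mod (fob F S) p)"
  shows "restr F S S p x = x"
proof -
  have "fi_incl S S = Idn FI S" by (simp add: fi_incl_def FI_def)
  then show ?thesis using comodule_id[OF assms] by (simp add: comod_proj_def)
qed

lemma restr_natural:
  assumes "comod_arr UNIV K \<eta>" "finite S" "A \<subseteq> S" "x \<in> carrier (Mod (fob (src \<eta>) S) p)"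
  shows "act (act \<eta> A) p (restr (src \<eta>) S A p x) = restr (trg \<eta>) S A p (act (act \<eta> S) p x)"
  using comod_arr_natural[OF assms(1) fi_arr_incl[OF assms(2,3)], of A "src \<eta>" x p] assms(4)
  by (simp add: comod_proj_def)

lemma comod_arr_mono: "comod_arr W K \<eta> \<Longrightarrow> W' \<subseteq> W \<Longrightarrow> comod_arr W' K \<eta>"
  by (auto simp: comod_arr_iff)

text \<open>The two monoidal categories enter as variables with defining equations, which keeps them
  opaque in the calculations with the two interpretations below.\<close>

locale twist =
  fixes K :: "'k ring" and Had Day :: "(('k, 's, 'v) comod, ('k, 's, 'v) comod_map) smc"
  assumes K: "cring K" and Had: "Had = hadamard K" and Day: "Day = day FI_bijections K"
begin

interpretation H: convolution K UNIV Had "\<lambda>S A B. A = S \<and> B = S" UNIV "\<lambda>S. S" "had_pure K"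
    "\<lambda>F G S P \<beta>. cpx_lift K (fob F S) (fob G S) P (\<beta> S S)"
  unfolding Had by (rule convolution_hadamard[OF K])

interpretation D: convolution K FI_bijections Day day_pair "{{}}" "\<lambda>S. {}"
    "\<lambda>F G S A B. day_pure K F G S A" "day_lift K"
  unfolding Day by (rule convolution_day[OF K]) simp

abbreviation "com \<equiv> comodule K"
abbreviation "el F S n \<equiv> carrier (Mod (fob F S) n)"
abbreviation hprod (infixr \<open>\<otimes>\<^sub>H\<close> 70) where "F \<otimes>\<^sub>H G \<equiv> tob Had F G"
abbreviation dprod (infixr \<open>\<otimes>\<^sub>D\<close> 70) where "F \<otimes>\<^sub>D G \<equiv> tob Day F G"
abbreviation "hp F G S \<equiv> had_pure K F G S S S"
abbreviation "split_pure F G S p q x y A \<equiv>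
  day_pure K F G S A p q (restr F S A p x) (restr G S (S - A) q y)"
abbreviation "\<Delta> \<equiv> Tw_comult K"
abbreviation "FB \<equiv> FI_bijections"

lemma Had_fob: "fob (F \<otimes>\<^sub>H G) S = cpx_tensor K (fob F S) (fob G S)"
  by (simp add: Had hadamard_simps hadamard_fob)

lemma Day_fob: "fob (F \<otimes>\<^sub>D G) S = day_cpx K F G S"
  by (simp add: Day day_simps day_fob)

lemma comult_src_trg: "src (\<Delta> F G) = F \<otimes>\<^sub>H G" "trg (\<Delta> F G) = F \<otimes>\<^sub>D G"
  by (simp_all add: Tw_comult_def Had Day hadamard_simps day_simps)

lemma day_pair_compl: "A \<subseteq> S \<Longrightarrow> day_pair S A (S - A)" "A \<subseteq> S \<Longrightarrow> day_pair S (S - A) A"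
  by (auto simp: day_pair_def)

context
  fixes F G :: "('k, 's, 'v) comod" assumes F: "com F" and G: "com G"
begin

lemma proj_maps:
  assumes "finite S" "A \<subseteq> S"
  shows "tensor_chain_maps K (\<pi> F S A) (\<pi> G S (S - A))"
    "src (\<pi> F S A) = fob F S" "trg (\<pi> F S A) = fob F A"
    "src (\<pi> G S (S - A)) = fob G S" "trg (\<pi> G S (S - A)) = fob G (S - A)"
  using comodule_far[OF F fi_arr_incl[OF assms]] comodule_far[OF G fi_arr_incl[of S "S - A"]] assms K
  by (auto simp: comod_proj_def intro: tensor_chain_maps.intro)

context
  fixes S :: "'s set" assumes S: "finite S"
begin

interpretation C: sum_complexes K "Pow S" "day_summand K F G S"
  by (rule day_sum_complexes[OF K F G S])

lemma proj_lin:
  "A \<in> Pow S \<Longrightarrow> lin K (Mod (fob (F \<otimes>\<^sub>H G) S) n) (Mod (day_summand K F G S A) n)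
    (act (cpx_tensor_map K (\<pi> F S A) (\<pi> G S (S - A))) n)"
  using tensor_chain_maps.lin_map[OF proj_maps(1)[OF S, of A], of n] S
  by (simp add: proj_maps Had_fob day_summand_def)

lemma comult_component:
  "act (\<Delta> F G) S = Arrow (fob (F \<otimes>\<^sub>H G) S) (\<lambda>n. \<lambda>u \<in> el (F \<otimes>\<^sub>H G) S n.
    Indexed (\<lambda>A \<in> Pow S. act (cpx_tensor_map K (\<pi> F S A) (\<pi> G S (S - A))) n u)) (fob (F \<otimes>\<^sub>D G) S)"
  using S by (simp add: Tw_comult_def Had_fob Day_fob)

text \<open>The differential of a direct sum is componentwise, so compatibility may be checked in
  each component, where the map is a tensor product of two chain maps.\<close>

lemma comult_ch_arr: "ch_arr K (act (\<Delta> F G) S)"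
  unfolding comult_component
proof (rule ch_arrI[OF H.tob_cpx[OF F G S] D.tob_cpx[OF F G S]])
  fix n
  interpret M: direct_sum_modules K Indexed indexed "Pow S" "\<lambda>A. Mod (day_summand K F G S A) n"
    by (rule C.direct_sum_modules)
  show "lin K (Mod (fob (F \<otimes>\<^sub>H G) S) n) (Mod (fob (F \<otimes>\<^sub>D G) S) n)
      (\<lambda>u. Indexed (\<lambda>A \<in> Pow S. act (cpx_tensor_map K (\<pi> F S A) (\<pi> G S (S - A))) n u))"
    unfolding Day_fob day_cpx_def C.Mod_S
    by (rule M.lin_family) (use S in \<open>auto simp: proj_lin H.tob_module[OF F G]\<close>)
  fix u assume u: "u \<in> el (F \<otimes>\<^sub>H G) S n"
  have "act (cpx_tensor_map K (\<pi> F S A) (\<pi> G S (S - A))) (n - 1) (bd (fob (F \<otimes>\<^sub>H G) S) n u)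
      = bd (day_summand K F G S A) n (act (cpx_tensor_map K (\<pi> F S A) (\<pi> G S (S - A))) n u)"
    if "A \<subseteq> S" for A
    using tensor_chain_maps.bd_map[OF proj_maps(1)[OF S that]] u that S
    by (simp add: proj_maps Had_fob day_summand_def)
  then show "Indexed (\<lambda>A \<in> Pow S. act (cpx_tensor_map K (\<pi> F S A) (\<pi> G S (S - A))) (n - 1) (bd (fob (F \<otimes>\<^sub>H G) S) n u))
      = bd (fob (F \<otimes>\<^sub>D G) S) n (Indexed (\<lambda>A \<in> Pow S. act (cpx_tensor_map K (\<pi> F S A) (\<pi> G S (S - A))) n u))"
    unfolding Day_fob day_cpx_def C.bd_S by (auto intro!: restrict_ext)
qed

text \<open>The map is defined by its components in the direct sum. Decomposing its value into
  injected components gives a sum of generators, the form on which other morphisms can be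
  evaluated.\<close>

lemma comult_pure:
  assumes n: "n = p + q" and x: "x \<in> el F S p" and y: "y \<in> el G S q"
  shows "act (act (\<Delta> F G) S) n (hp F G S p q x y) = (\<Oplus>\<^bsub>Mod (fob (F \<otimes>\<^sub>D G) S) n\<^esub>A \<in> Pow S.
      split_pure F G S p q x y A)"
proof -
  interpret M: direct_sum_modules K Indexed indexed "Pow S" "\<lambda>A. Mod (day_summand K F G S A) n"
    by (rule C.direct_sum_modules)
  let ?u = "hp F G S p q x y" and ?v = "act (act (\<Delta> F G) S) n (hp F G S p q x y)"
  have u: "?u \<in> el (F \<otimes>\<^sub>H G) S n" using n x y S F G by (intro H.pr_closed) auto
  have v: "?v = Indexed (\<lambda>A \<in> Pow S. cpx_pure K (fob F A) (fob G (S - A)) p q (restr F S A p x) (restr G S (S - A) q y))"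
    using u n x y S tensor_chain_maps.map_pure[OF proj_maps(1)[OF S] n]
    by (auto simp: comult_component had_pure_def proj_maps intro!: restrict_ext)
  have "lin K (Mod (fob (F \<otimes>\<^sub>H G) S) n) (Mod (fob (F \<otimes>\<^sub>D G) S) n) (act (act (\<Delta> F G) S) n)"
    using ch_arr_lin[OF comult_ch_arr, of n] by (simp add: comult_component)
  then have "?v \<in> carrier M.DS" using lin_closed u by (fastforce simp: Day_fob day_cpx_def C.Mod_S)
  then have "?v = (\<Oplus>\<^bsub>M.DS\<^esub>A\<in>Pow S. M.inj A (indexed ?v A))"
    by (rule M.DS_decomp) (use S in \<open>auto simp: M.supp_def\<close>)
  also have "\<dots> = (\<Oplus>\<^bsub>M.DS\<^esub>A\<in>Pow S. split_pure F G S p q x y A)"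
  proof (rule module_finsum_cong[OF M.module_DS])
    fix A assume A: "A \<in> Pow S"
    show "M.inj A (indexed ?v A) = split_pure F G S p q x y A"
      using A unfolding v by (simp add: day_pure_def cpx_inj_def M.inj_def n[symmetric])
    show "split_pure F G S p q x y A \<in> carrier M.DS"
      using D.pr_closed[OF F G S day_pair_compl(1) n restr_closed[OF F S _ x] restr_closed[OF G S _ y]] A
      by (simp add: Day_fob day_cpx_def C.Mod_S)
  qed
  finally show ?thesis by (simp add: Day_fob day_cpx_def C.Mod_S)
qed

lemma day_terms_closed:
  "n = p + q \<Longrightarrow> A \<subseteq> S \<Longrightarrow> x \<in> el F S p \<Longrightarrow> y \<in> el G S q \<Longrightarrow>
    split_pure F G S p q x y A \<in> el (F \<otimes>\<^sub>D G) S n"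
  by (rule D.pr_closed[OF F G S day_pair_compl(1)]) (use F G S in \<open>auto intro: restr_closed\<close>)

end

text \<open>Acting by \<open>f\<close> turns the terms for subsets of \<open>trg f\<close> into
  terms for their preimages. The resulting sum is the one for \<open>src f\<close> once taking
  preimages is known to be a bijection between the two families of subsets.\<close>

lemma comult_arr: "comod_arr FB K (\<Delta> F G)"
proof -
  have e: "\<Delta> F G = comod_arrow (F \<otimes>\<^sub>H G) (act (\<Delta> F G)) (F \<otimes>\<^sub>D G)"
    by (simp add: Tw_comult_def Had Day hadamard_simps day_simps comod_arrow_def restrict_def fun_eq_iff)
  show ?thesis
  proof (subst e, rule comod_arrow_arr)
    show "com (F \<otimes>\<^sub>H G)" "com (F \<otimes>\<^sub>D G)" using H.com_tob[OF F G] D.com_tob[OF F G] .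
    show "ch_arr K (act (\<Delta> F G) S) \<and> src (act (\<Delta> F G) S) = fob (F \<otimes>\<^sub>H G) S \<and>
        trg (act (\<Delta> F G) S) = fob (F \<otimes>\<^sub>D G) S" if "finite S" for S
      using comult_ch_arr[OF that] comult_component[OF that] by simp
    have l: "lin K (Mod (fob (F \<otimes>\<^sub>H G) S) n) (Mod (fob (F \<otimes>\<^sub>D G) S) n) (act (act (\<Delta> F G) S) n)"
      if "finite S" for S n
      using ch_arr_lin[OF comult_ch_arr[OF that], of n] by (simp add: comult_component[OF that])
    fix f n u assume f: "fi_arr f" "f \<in> FB" and u: "u \<in> el (F \<otimes>\<^sub>H G) (trg f) n"
    note fin = fi_arr_finite[OF f(1)]
    have bij: "bij_betw (act f) (src f) (trg f)" using f(2) by (simp add: FI_bijections_def)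
    show "act (act (\<Delta> F G) (src f)) n (act (far (F \<otimes>\<^sub>H G) f) n u)
        = act (far (F \<otimes>\<^sub>D G) f) n (act (act (\<Delta> F G) (trg f)) n u)"
    proof (rule H.tob_ext[OF F G fin(2) lin_comp[OF far_lin[OF H.com_tob[OF F G] f(1)] l]
          lin_comp[OF l far_lin[OF D.com_tob[OF F G] f(1)]] u])
      fix A B p q x y assume AB: "A = trg f \<and> B = trg f" and n: "n = p + q"
        and x: "x \<in> el F A p" and y: "y \<in> el G B q"
      let ?S = "src f" and ?T = "trg f"
      let ?t = "\<lambda>A. split_pure F G ?S p q (act (far F f) p x) (act (far G f) q y) A"
      have x': "act (far F f) p x \<in> el F ?S p" "act (far G f) q y \<in> el G ?S q"
        using AB x y f F G by (auto intro: far_closed)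
      have mS: "module K (Mod (fob (F \<otimes>\<^sub>D G) ?S) n)" by (rule D.tob_module[OF F G fin(1)])
      have pre: "fi_preimage f (?T - B) = ?S - fi_preimage f B" if "B \<subseteq> ?T" for B
        using f(1) by (auto simp: fi_preimage_def fi_arr_iff)
      \<comment> \<open>Every subset of the source is the preimage of its image; this half rests on
        injectivity.\<close>
      have img: "fi_preimage f ` Pow ?T = Pow ?S"
      proof
        show "Pow ?S \<subseteq> fi_preimage f ` Pow ?T"
        proof
          fix A assume A: "A \<in> Pow ?S"
          then have "A = fi_preimage f (act f ` A)" "act f ` A \<subseteq> ?T"
            using f(1) by (auto simp: fi_preimage_def fi_arr_iff inj_on_def)
          then show "A \<in> fi_preimage f ` Pow ?T" by blast
        qed
      qed (auto simp: fi_preimage_def)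
      \<comment> \<open>A subset of the target is recovered as the image of its preimage; this half
        needs \<open>f\<close> to be onto. For a proper inclusion several summands would be
        identified.\<close>
      have inj: "inj_on (fi_preimage f) (Pow ?T)"
      proof (rule inj_onI)
        fix B B' assume "B \<in> Pow ?T" "B' \<in> Pow ?T" "fi_preimage f B = fi_preimage f B'"
        moreover have "B = act f ` fi_preimage f B" if "B \<in> Pow ?T" for B
          using bij that by (auto simp: bij_betw_def fi_preimage_def)
        ultimately show "B = B'" by metis
      qed
      have "act (act (\<Delta> F G) ?S) n (act (far (F \<otimes>\<^sub>H G) f) n (had_pure K F G ?T A B p q x y))
          = act (act (\<Delta> F G) ?S) n (hp F G ?S p q (act (far F f) p x) (act (far G f) q y))"
        using AB n x y f by (simp add: H.far_pr[OF F G f(1)] fi_restrict_trg)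
      also have "\<dots> = finsum (Mod (fob (F \<otimes>\<^sub>D G) ?S) n) ?t (Pow ?S)"
        by (rule comult_pure[OF fin(1) n x'])
      also have "\<dots> = finsum (Mod (fob (F \<otimes>\<^sub>D G) ?S) n) (\<lambda>B. ?t (fi_preimage f B)) (Pow ?T)"
        unfolding img[symmetric]
        by (rule module_finsum_reindex[OF mS inj])
          (use x' fin n in \<open>auto intro!: day_terms_closed simp: fi_preimage_def\<close>)
      also have "\<dots> = finsum (Mod (fob (F \<otimes>\<^sub>D G) ?S) n)
          (\<lambda>B. act (far (F \<otimes>\<^sub>D G) f) n (split_pure F G ?T p q x y B)) (Pow ?T)"
      proof (rule module_finsum_cong[OF mS])
        fix B' assume "B' \<in> Pow ?T"
        then have B': "B' \<subseteq> ?T" "?T - B' \<subseteq> ?T" by auto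
        have xy: "x \<in> el F ?T p" "y \<in> el G ?T q" using AB x y by auto
        show "?t (fi_preimage f B') = act (far (F \<otimes>\<^sub>D G) f) n
            (split_pure F G ?T p q x y B')"
          using restr_far[OF F f(1) B'(1) xy(1)] restr_far[OF G f(1) B'(2) xy(2)] xy B' fin n
          by (simp add: D.far_pr[OF F G f(1) _ day_pair_compl(1)] restr_closed[OF F] restr_closed[OF G] pre)
        show "act (far (F \<otimes>\<^sub>D G) f) n (split_pure F G ?T p q x y B')
            \<in> el (F \<otimes>\<^sub>D G) ?S n"
          using B' xy fin n by (intro far_closed[OF D.com_tob[OF F G] f(1)] day_terms_closed) auto
      qed
      also have "\<dots> = act (far (F \<otimes>\<^sub>D G) f) n (act (act (\<Delta> F G) ?T) n (hp F G ?T p q x y))"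
        using AB x y fin n
        by (subst comult_pure[OF fin(2) n]) (auto intro!: lin_finsum[OF far_lin[OF D.com_tob[OF F G] f(1)], symmetric] day_terms_closed)
      finally show "act (act (\<Delta> F G) ?S) n (act (far (F \<otimes>\<^sub>H G) f) n (had_pure K F G ?T A B p q x y))
          = act (far (F \<otimes>\<^sub>D G) f) n (act (act (\<Delta> F G) ?T) n (had_pure K F G ?T A B p q x y))"
        using AB by simp
    qed (use fin in simp_all)
  qed
qed

end

abbreviation fb_comp (infixr \<open>\<bullet>\<close> 75) where "\<theta> \<bullet> \<eta> \<equiv> comod_comp FB K \<theta> \<eta>"
abbreviation "idn \<equiv> Idn (comod_category FB K)"
abbreviation "fb \<equiv> comod_arr FB K"

text \<open>Composition never mentions the naturality condition. Morphisms natural for all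
  injections can therefore be composed with those natural for bijections inside one
  category.\<close>

lemma UNIV_comp: "comod_comp UNIV K = comod_comp FB K"
  by (simp add: comod_comp_eq fun_eq_iff)

lemma UNIV_idn: "Idn (comod_category UNIV K) = idn"
  by (simp add: comod_id_eq fun_eq_iff)

lemma UNIV_fb: "comod_arr UNIV K \<eta> \<Longrightarrow> fb \<eta>"
  by (rule comod_arr_mono) auto

lemma fb_comp_assoc:
  assumes "fb f" "fb g" "fb h" "trg f = src g" "trg g = src h"
  shows "(h \<bullet> g) \<bullet> f = h \<bullet> g \<bullet> f"
  by (rule comod_arr_ext[where W = FB and K = K])
    (use assms in \<open>simp_all add: comod_comp_arr comod_comp_simps comod_arr_closed\<close>)

text \<open>Linearity distributes \<open>\<theta>\<close> over the sum of
  \<open>comult_pure\<close>. Composites that begin with \<open>\<Delta>\<close> are evaluated in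
  this form, so the axioms become identities between finite sums.\<close>

lemma act_comult:
  assumes F: "com F" and G: "com G" and \<theta>: "fb \<theta>" "src \<theta> = F \<otimes>\<^sub>D G"
    and S: "finite S" and n: "n = p + q" and x: "x \<in> el F S p" and y: "y \<in> el G S q"
  shows "act (act (\<theta> \<bullet> \<Delta> F G) S) n (hp F G S p q x y)
    = (\<Oplus>\<^bsub>Mod (fob (trg \<theta>) S) n\<^esub>A \<in> Pow S.
        act (act \<theta> S) n (split_pure F G S p q x y A))"
proof -
  have "hp F G S p q x y \<in> el (F \<otimes>\<^sub>H G) S n" using F G S n x y by (intro H.pr_closed) auto
  then have "act (act (\<theta> \<bullet> \<Delta> F G) S) n (hp F G S p q x y)
      = act (act \<theta> S) n (act (act (\<Delta> F G) S) n (hp F G S p q x y))"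
    using S by (intro comod_comp_simps(3) comult_arr F G) (simp_all add: comult_src_trg)
  also have "\<dots> = (\<Oplus>\<^bsub>Mod (fob (trg \<theta>) S) n\<^esub>A \<in> Pow S.
        act (act \<theta> S) n (split_pure F G S p q x y A))"
    unfolding comult_pure[OF F G S n x y]
    by (rule lin_finsum[OF comod_arr_lin[OF \<theta>(1) S \<theta>(2)[symmetric] HOL.refl]])
      (use F G S n x y in \<open>auto intro: day_terms_closed\<close>)
  finally show ?thesis .
qed

text \<open>The sums agree term by term, because \<open>\<eta>\<close> and \<open>\<theta>\<close>
  commute with restriction along A \<subseteq> S. Such inclusions are not bijections in general:
  here the naturality of Hadamard morphisms for all injections is used.\<close>

lemma comult_natural:
  assumes \<eta>: "comod_arr UNIV K \<eta>" and \<theta>: "comod_arr UNIV K \<theta>"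
  shows "\<Delta> (trg \<eta>) (trg \<theta>) \<bullet> tar Had \<eta> \<theta> = tar Day \<eta> \<theta> \<bullet> \<Delta> (src \<eta>) (src \<theta>)"
proof -
  note fb = UNIV_fb[OF \<eta>] UNIV_fb[OF \<theta>] and c = comod_arr_comodule[OF \<eta>] comod_arr_comodule[OF \<theta>]
  note t = UNIV_fb[OF H.tar_arr[OF \<eta> \<theta>]] D.tar_arr[OF fb]
  note st = comod_comp_simps(1,2) comult_src_trg H.tar_simps(1,2)[OF \<eta> \<theta>] D.tar_simps(1,2)[OF fb]
  show ?thesis
  proof (rule H.arr_ext2_any[where W' = FB, OF c(1,3)])
    show "fb (\<Delta> (trg \<eta>) (trg \<theta>) \<bullet> tar Had \<eta> \<theta>)" "fb (tar Day \<eta> \<theta> \<bullet> \<Delta> (src \<eta>) (src \<theta>))"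
      by (intro comod_comp_arr comult_arr t c; simp add: st)+
    fix S A B p q x y assume S: "finite S" and AB: "A = S \<and> B = S"
      and x: "x \<in> el (src \<eta>) A p" and y: "y \<in> el (src \<theta>) B q"
    have xy: "x \<in> el (src \<eta>) S p" "y \<in> el (src \<theta>) S q" using AB x y by auto
    have xy': "act (act \<eta> S) p x \<in> el (trg \<eta>) S p" "act (act \<theta> S) q y \<in> el (trg \<theta>) S q"
      using xy S by (auto intro: comod_arr_closed[OF \<eta>] comod_arr_closed[OF \<theta>])
    have "act (act (\<Delta> (trg \<eta>) (trg \<theta>) \<bullet> tar Had \<eta> \<theta>) S) (p + q) (hp (src \<eta>) (src \<theta>) S p q x y)
        = act (act (\<Delta> (trg \<eta>) (trg \<theta>)) S) (p + q) (hp (trg \<eta>) (trg \<theta>) S p q (act (act \<eta> S) p x) (act (act \<theta> S) q y))"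
      using S xy by (subst comod_comp_simps(3)[OF t(1)]) (auto simp: st H.tar_pr[OF \<eta> \<theta>] c intro!: H.pr_closed)
    also have "\<dots> = (\<Oplus>\<^bsub>Mod (fob (trg \<eta> \<otimes>\<^sub>D trg \<theta>) S) (p + q)\<^esub>A \<in> Pow S. split_pure (trg \<eta>) (trg \<theta>) S p q (act (act \<eta> S) p x) (act (act \<theta> S) q y) A)"
      by (rule comult_pure[OF c(2,4) S HOL.refl xy'])
    also have "\<dots> = (\<Oplus>\<^bsub>Mod (fob (trg \<eta> \<otimes>\<^sub>D trg \<theta>) S) (p + q)\<^esub>A \<in> Pow S. act (act (tar Day \<eta> \<theta>) S) (p + q)
        (split_pure (src \<eta>) (src \<theta>) S p q x y A))"
    proof (rule module_finsum_cong[OF D.tob_module[OF c(2,4) S]])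
      fix A assume "A \<in> Pow S"
      then have A: "A \<subseteq> S" "S - A \<subseteq> S" by auto
      have fin: "finite A" "finite (S - A)" using A S finite_subset by auto
      note r = restr_closed[OF c(1) S A(1) xy(1)] restr_closed[OF c(3) S A(2) xy(2)]
      have "act (act (tar Day \<eta> \<theta>) S) (p + q)
          (split_pure (src \<eta>) (src \<theta>) S p q x y A)
        = day_pure K (trg \<eta>) (trg \<theta>) S A p q (act (act \<eta> A) p (restr (src \<eta>) S A p x))
            (act (act \<theta> (S - A)) q (restr (src \<theta>) S (S - A) q y))"
        by (rule D.tar_pr[OF fb S day_pair_compl(1)[OF A(1)] HOL.refl r HOL.refl HOL.refl])
      then show eq: "split_pure (trg \<eta>) (trg \<theta>) S p q (act (act \<eta> S) p x) (act (act \<theta> S) q y) A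
        = act (act (tar Day \<eta> \<theta>) S) (p + q)
          (split_pure (src \<eta>) (src \<theta>) S p q x y A)"
        by (simp add: restr_natural[OF \<eta> S A(1) xy(1)] restr_natural[OF \<theta> S A(2) xy(2)])
      show "act (act (tar Day \<eta> \<theta>) S) (p + q)
          (split_pure (src \<eta>) (src \<theta>) S p q x y A)
          \<in> el (trg \<eta> \<otimes>\<^sub>D trg \<theta>) S (p + q)"
        unfolding eq[symmetric] by (rule day_terms_closed[OF c(2,4) S HOL.refl A(1) xy'])
    qed
    also have "\<dots> = act (act (tar Day \<eta> \<theta> \<bullet> \<Delta> (src \<eta>) (src \<theta>)) S) (p + q) (hp (src \<eta>) (src \<theta>) S p q x y)"
      using act_comult[OF c(1,3) t(2) _ S HOL.refl xy] by (simp add: st)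
    finally show "act (act (\<Delta> (trg \<eta>) (trg \<theta>) \<bullet> tar Had \<eta> \<theta>) S) (p + q) (had_pure K (src \<eta>) (src \<theta>) S A B p q x y)
        = act (act (tar Day \<eta> \<theta> \<bullet> \<Delta> (src \<eta>) (src \<theta>)) S) (p + q) (had_pure K (src \<eta>) (src \<theta>) S A B p q x y)"
      using AB by simp
  qed (simp_all add: st)
qed

text \<open>The braiding exchanges the two parts of a decomposition, and complementation permutes
  the subsets of \<open>S\<close>, so the sum is only reordered. The sign depends on the degrees
  alone and can be taken out of the sum.\<close>

lemma comult_braiding:
  assumes F: "com F" and G: "com G"
  shows "braiding Day F G \<bullet> \<Delta> F G = \<Delta> G F \<bullet> braiding Had F G"
proof -
  note b = D.braiding_simps(1)[OF F G] UNIV_fb[OF H.braiding_simps(1)[OF F G]]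
  note st = comod_comp_simps(1,2) comult_src_trg H.braiding_simps(2,3)[OF F G] D.braiding_simps(2,3)[OF F G]
  show ?thesis
  proof (rule H.arr_ext2_any[where W' = FB, OF F G])
    show "fb (braiding Day F G \<bullet> \<Delta> F G)" "fb (\<Delta> G F \<bullet> braiding Had F G)"
      by (intro comod_comp_arr comult_arr b F G; simp add: st)+
    fix S A B p q x y assume S: "finite S" and AB: "A = S \<and> B = S" and "x \<in> el F A p" "y \<in> el G B q"
    then have x: "x \<in> el F S p" and y: "y \<in> el G S q" by auto
    let ?N = "Mod (fob (G \<otimes>\<^sub>D F) S) (p + q)" and ?k = "koszul K (p * q)"
    let ?t = "\<lambda>A. split_pure G F S q p y x A"
    have m: "module K ?N" by (rule D.tob_module[OF G F S])
    have k: "?k \<in> carrier K" by (simp add: K)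
    have t: "?t A \<in> carrier ?N" if "A \<subseteq> S" for A
      by (rule day_terms_closed[OF G F S _ that y x]) simp
    have "act (act (braiding Day F G \<bullet> \<Delta> F G) S) (p + q) (hp F G S p q x y)
        = (\<Oplus>\<^bsub>?N\<^esub>A \<in> Pow S. act (act (braiding Day F G) S) (p + q)
            (split_pure F G S p q x y A))"
      using act_comult[OF F G b(1) _ S HOL.refl x y] by (simp add: st)
    also have "\<dots> = (\<Oplus>\<^bsub>?N\<^esub>A \<in> Pow S. ?k \<odot>\<^bsub>?N\<^esub> ?t (S - A))"
    proof (rule module_finsum_cong[OF m])
      fix A assume "A \<in> Pow S"
      then have A: "A \<subseteq> S" "S - A \<subseteq> S" "S - (S - A) = A" by auto
      show "act (act (braiding Day F G) S) (p + q) (split_pure F G S p q x y A)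
          = ?k \<odot>\<^bsub>?N\<^esub> ?t (S - A)"
        using D.braiding_pr[OF F G S day_pair_compl(1)[OF A(1)] HOL.refl
            restr_closed[OF F S A(1) x] restr_closed[OF G S A(2) y]] A(3) by simp
      show "?k \<odot>\<^bsub>?N\<^esub> ?t (S - A) \<in> carrier ?N" by (rule module_smult_closed[OF m k t[OF A(2)]])
    qed
    also have "\<dots> = (\<Oplus>\<^bsub>?N\<^esub>A \<in> (\<lambda>A. S - A) ` Pow S. ?k \<odot>\<^bsub>?N\<^esub> ?t A)"
      by (rule module_finsum_reindex[OF m, symmetric])
        (auto intro!: inj_onI module_smult_closed[OF m k] t)
    also have "(\<lambda>A. S - A) ` Pow S = Pow S"
      by (auto simp: image_iff intro!: bexI[of _ "S - A" for A])
    also have "(\<Oplus>\<^bsub>?N\<^esub>A \<in> Pow S. ?k \<odot>\<^bsub>?N\<^esub> ?t A) = ?k \<odot>\<^bsub>?N\<^esub> (\<Oplus>\<^bsub>?N\<^esub>A \<in> Pow S. ?t A)"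
      by (rule lin_finsum[OF lin_scale[OF lin_id[OF m] k], symmetric]) (auto intro: t)
    also have "(\<Oplus>\<^bsub>?N\<^esub>A \<in> Pow S. ?t A) = act (act (\<Delta> G F) S) (p + q) (hp G F S q p y x)"
      by (rule comult_pure[OF G F S _ y x, symmetric]) simp
    also have "?k \<odot>\<^bsub>?N\<^esub> \<dots> = act (act (\<Delta> G F) S) (p + q) (?k \<odot>\<^bsub>Mod (fob (G \<otimes>\<^sub>H F) S) (p + q)\<^esub> hp G F S q p y x)"
      using lin_smult[OF comod_arr_lin[OF comult_arr[OF G F] S], of "G \<otimes>\<^sub>H F" "G \<otimes>\<^sub>D F" "?k"
          "hp G F S q p y x" "p + q"] k H.pr_closed[OF G F S _ _ y x, of "p + q"]
      by (simp add: comult_src_trg)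
    also have "\<dots> = act (act (\<Delta> G F \<bullet> braiding Had F G) S) (p + q) (hp F G S p q x y)"
      using S x y F G
      by (subst comod_comp_simps(3)[OF b(2)]) (auto simp: st H.braiding_pr intro!: H.pr_closed)
    finally show "act (act (braiding Day F G \<bullet> \<Delta> F G) S) (p + q) (had_pure K F G S A B p q x y)
        = act (act (\<Delta> G F \<bullet> braiding Had F G) S) (p + q) (had_pure K F G S A B p q x y)"
      using AB by simp
  qed (simp_all add: st)
qed

lemma restr_hp:
  assumes F: "com F" and G: "com G" and S: "finite S" and V: "V \<subseteq> S" and n: "n = p + q"
    and x: "x \<in> el F S p" and y: "y \<in> el G S q"
  shows "restr (F \<otimes>\<^sub>H G) S V n (hp F G S p q x y) = hp F G V p q (restr F S V p x) (restr G S V q y)"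
  using H.far_pr[OF F G fi_arr_incl[OF S V], of S S S n p q x y] n x y
    fi_restrict_trg[OF fi_arr_incl[OF S V]] by (simp add: comod_proj_def)

text \<open>The left composite sums over chains A \<subseteq> V \<subseteq> S, the right one over
  disjoint \<open>A\<close> and \<open>B\<close>. The passage from \<open>(V, A)\<close> to
  \<open>(A, V - A)\<close> matches them, and restricting in two steps equals restricting
  once.\<close>

lemma comult_coassoc:
  assumes F: "com F" and G: "com G" and H: "com H"
  shows "associator Day F G H \<bullet> tar Day (\<Delta> F G) (idn H) \<bullet> \<Delta> (F \<otimes>\<^sub>H G) H
    = tar Day (idn F) (\<Delta> G H) \<bullet> \<Delta> F (G \<otimes>\<^sub>H H) \<bullet> associator Had F G H"
    (is "?l = ?r")
proof -
  note FG = H.com_tob[OF F G] and GH = H.com_tob[OF G H]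
  note FG' = D.com_tob[OF F G] and GH' = D.com_tob[OF G H]
  note idH = comod_id_arr[OF H, of FB] and idF = comod_id_arr[OF F, of FB]
  note a = D.associator_simps(1)[OF F G H] UNIV_fb[OF H.associator_simps(1)[OF F G H]]
  note t = D.tar_arr[OF comult_arr[OF F G] idH] D.tar_arr[OF idF comult_arr[OF G H]]
  note st = comod_comp_simps(1,2) comod_id_simps(1,2) comult_src_trg H.associator_simps(2,3)[OF F G H]
    D.associator_simps(2,3)[OF F G H] D.tar_simps(1,2)[OF comult_arr[OF F G] idH]
    D.tar_simps(1,2)[OF idF comult_arr[OF G H]]
  have at: "fb (associator Day F G H \<bullet> tar Day (\<Delta> F G) (idn H))"
    by (rule comod_comp_arr[OF t(1) a(1)]) (simp add: st)
  have td: "fb (tar Day (idn F) (\<Delta> G H) \<bullet> \<Delta> F (G \<otimes>\<^sub>H H))"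
    by (rule comod_comp_arr[OF comult_arr[OF F GH] t(2)]) (simp add: st)
  \<comment> \<open>Bracketed so that \<open>\<Delta>\<close> acts first and everything after it is
    a single morphism, as \<open>act_comult\<close> expects.\<close>
  have l: "?l = (associator Day F G H \<bullet> tar Day (\<Delta> F G) (idn H)) \<bullet> \<Delta> (F \<otimes>\<^sub>H G) H"
    by (rule fb_comp_assoc[OF comult_arr[OF FG H] t(1) a(1), symmetric]) (simp_all add: st)
  have r: "?r = (tar Day (idn F) (\<Delta> G H) \<bullet> \<Delta> F (G \<otimes>\<^sub>H H)) \<bullet> associator Had F G H"
    by (rule fb_comp_assoc[OF a(2) comult_arr[OF F GH] t(2), symmetric]) (simp_all add: st)
  show ?thesis
  proof (rule H.arr_ext3_any[where W' = FB, OF F G H])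
    show "fb ?l" unfolding l by (rule comod_comp_arr[OF comult_arr[OF FG H] at]) (simp add: st)
    show "fb ?r" unfolding r by (rule comod_comp_arr[OF a(2) td]) (simp add: st)
    fix S V' A' B' C' p q r x y c
    assume S: "finite S" and eqs: "V' = S \<and> C' = S" "A' = V' \<and> B' = V'"
      and "x \<in> el F A' p" "y \<in> el G B' q" "c \<in> el H C' r"
    then have x: "x \<in> el F S p" and y: "y \<in> el G S q" and c: "c \<in> el H S r" by auto
    let ?n = "p + q + r"
    let ?N = "Mod (fob (F \<otimes>\<^sub>D G \<otimes>\<^sub>D H) S) ?n"
    \<comment> \<open>The term for S = A \<squnion> B \<squnion> C. The third part is determined as
      \<open>S - A - B\<close>, so pairs of disjoint subsets index the common sum.\<close>
    let ?X = "\<lambda>A B. day_pure K F (G \<otimes>\<^sub>D H) S A p (q + r) (restr F S A p x)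
      (day_pure K G H (S - A) B q r (restr G S B q y) (restr H S (S - A - B) r c))"
    have m: "module K ?N" by (rule D.tob_module[OF F GH' S])
    have Xc: "?X A B \<in> carrier ?N" if "A \<subseteq> S" "B \<subseteq> S - A" for A B
    proof -
      have s: "B \<subseteq> S" "S - A - B \<subseteq> S" "finite (S - A)" using that S by auto
      show ?thesis
        by (rule D.pr_closed[OF F GH' S day_pair_compl(1)[OF that(1)] _ restr_closed[OF F S that(1) x]
              D.pr_closed[OF G H s(3) day_pair_compl(1)[OF that(2)] HOL.refl
                restr_closed[OF G S s(1) y] restr_closed[OF H S s(2) c]]]) simp
    qed
    have u: "hp F G S p q x y \<in> el (F \<otimes>\<^sub>H G) S (p + q)"
      using F G S x y by (intro H.pr_closed) auto
    have "act (act ?l S) ?n (hp (F \<otimes>\<^sub>H G) H S (p + q) r (hp F G S p q x y) c)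
      = (\<Oplus>\<^bsub>?N\<^esub>V \<in> Pow S. act (act (associator Day F G H \<bullet> tar Day (\<Delta> F G) (idn H)) S) ?n
          (split_pure (F \<otimes>\<^sub>H G) H S (p + q) r (hp F G S p q x y) c V))"
      unfolding l using act_comult[OF FG H at _ S HOL.refl u c] by (simp add: st)
    also have "\<dots> = (\<Oplus>\<^bsub>?N\<^esub>V \<in> Pow S. \<Oplus>\<^bsub>?N\<^esub>A \<in> Pow V. ?X A (V - A))"
    proof (rule module_finsum_cong[OF m])
      fix V assume "V \<in> Pow S"
      then have V: "V \<subseteq> S" "S - V \<subseteq> S" by auto
      have finV: "finite V" "finite (S - V)" using V S finite_subset by auto
      note VC = day_pair_compl(1)[OF V(1)]
      let ?c = "restr H S (S - V) r c" and ?x = "restr F S V p x" and ?y = "restr G S V q y"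
      have c': "?c \<in> el H (S - V) r" and x': "?x \<in> el F V p" and y': "?y \<in> el G V q"
        using restr_closed[OF H S V(2) c] restr_closed[OF F S V(1) x] restr_closed[OF G S V(1) y] .
      have u': "hp F G V p q ?x ?y \<in> el (F \<otimes>\<^sub>H G) V (p + q)"
        using F G finV x' y' by (intro H.pr_closed) auto
      have v': "day_pure K (F \<otimes>\<^sub>H G) H S V (p + q) r (hp F G V p q ?x ?y) ?c
          \<in> el ((F \<otimes>\<^sub>H G) \<otimes>\<^sub>D H) S ?n"
        by (rule D.pr_closed[OF FG H S VC HOL.refl u' c'])
      \<comment> \<open>Linearity in the first factor takes the inner sum, produced by
        \<open>\<Delta>\<close> at \<open>V\<close>, out of the tensor product and through the
        associator.\<close>
      have ll: "lin K (Mod (fob (F \<otimes>\<^sub>D G) V) (p + q)) ?N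
          (\<lambda>u. act (act (associator Day F G H) S) ?n (day_pure K (F \<otimes>\<^sub>D G) H S V (p + q) r u ?c))"
        by (rule lin_comp[OF bilinear_left[OF D.pr_bilinear[OF FG' H S VC HOL.refl] c']
              comod_arr_lin[OF a(1) S]]) (simp_all add: st)
      have "act (act (associator Day F G H \<bullet> tar Day (\<Delta> F G) (idn H)) S) ?n
          (day_pure K (F \<otimes>\<^sub>H G) H S V (p + q) r (restr (F \<otimes>\<^sub>H G) S V (p + q) (hp F G S p q x y)) ?c)
        = act (act (associator Day F G H) S) ?n (act (act (tar Day (\<Delta> F G) (idn H)) S) ?n
            (day_pure K (F \<otimes>\<^sub>H G) H S V (p + q) r (hp F G V p q ?x ?y) ?c))"
        using v' S by (subst restr_hp[OF F G S V(1) HOL.refl x y], subst comod_comp_simps(3)[OF t(1)])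
          (simp_all add: st)
      also have "act (act (tar Day (\<Delta> F G) (idn H)) S) ?n
            (day_pure K (F \<otimes>\<^sub>H G) H S V (p + q) r (hp F G V p q ?x ?y) ?c)
          = day_pure K (F \<otimes>\<^sub>D G) H S V (p + q) r (act (act (\<Delta> F G) V) (p + q) (hp F G V p q ?x ?y)) ?c"
        using D.tar_pr[OF comult_arr[OF F G] idH S VC HOL.refl, of "hp F G V p q ?x ?y" "p + q" ?c r] u' c' finV
        by (simp add: st comod_id_simps)
      also have "act (act (\<Delta> F G) V) (p + q) (hp F G V p q ?x ?y)
          = (\<Oplus>\<^bsub>Mod (fob (F \<otimes>\<^sub>D G) V) (p + q)\<^esub>A \<in> Pow V. split_pure F G V p q ?x ?y A)"
        by (rule comult_pure[OF F G finV(1) HOL.refl x' y'])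
      also have "act (act (associator Day F G H) S) ?n (day_pure K (F \<otimes>\<^sub>D G) H S V (p + q) r \<dots> ?c)
          = (\<Oplus>\<^bsub>?N\<^esub>A \<in> Pow V. act (act (associator Day F G H) S) ?n (day_pure K (F \<otimes>\<^sub>D G) H S V (p + q) r
              (split_pure F G V p q ?x ?y A) ?c))"
        by (rule lin_finsum[OF ll]) (auto intro: day_terms_closed[OF F G finV(1) HOL.refl _ x' y'])
      also have "\<dots> = (\<Oplus>\<^bsub>?N\<^esub>A \<in> Pow V. ?X A (V - A))"
      proof (rule module_finsum_cong[OF m])
        fix A assume "A \<in> Pow V"
        then have A: "A \<subseteq> V" "V - A \<subseteq> V" by auto
        \<comment> \<open>The chain A \<subseteq> V \<subseteq> S has the pieces A, V - A and S - V;
          these identities read it as \<open>A\<close> followed by a splitting of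
          \<open>S - A\<close>.\<close>
        have s: "V - A \<union> (S - V) = S - A" "S - A - (V - A) = S - V" using A V by auto
        note rc = restr_closed[OF F finV(1) A(1) x'] restr_closed[OF G finV(1) A(2) y']
        show "act (act (associator Day F G H) S) ?n (day_pure K (F \<otimes>\<^sub>D G) H S V (p + q) r
              (split_pure F G V p q ?x ?y A) ?c) = ?X A (V - A)"
          using D.associator_pr[OF F G H S VC day_pair_compl(1)[OF A(1)] HOL.refl HOL.refl rc c']
            restr_restr[OF F S A(1) V(1) x] restr_restr[OF G S A(2) V(1) y] by (simp add: s)
        show "?X A (V - A) \<in> carrier ?N" using A V by (intro Xc) auto
      qed
      finally show "act (act (associator Day F G H \<bullet> tar Day (\<Delta> F G) (idn H)) S) ?n
          (day_pure K (F \<otimes>\<^sub>H G) H S V (p + q) r (restr (F \<otimes>\<^sub>H G) S V (p + q) (hp F G S p q x y)) ?c)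
        = (\<Oplus>\<^bsub>?N\<^esub>A \<in> Pow V. ?X A (V - A))" .
      interpret N: module K ?N by (rule m)
      show "(\<Oplus>\<^bsub>?N\<^esub>A \<in> Pow V. ?X A (V - A)) \<in> carrier ?N"
        using V by (intro N.M.finsum_closed) (auto intro!: Xc)
    qed
    also have "\<dots> = finsum ?N (\<lambda>(V, A). ?X A (V - A)) (Sigma (Pow S) Pow)"
      by (rule module_finsum_Sigma[OF m]) (use S in \<open>auto intro!: Xc intro: finite_subset\<close>)
    also have "\<dots> = finsum ?N (\<lambda>(V, A). (\<lambda>(A, B). ?X A B) (A, V - A)) (Sigma (Pow S) Pow)"
      by simp
    also have "\<dots> = finsum ?N (\<lambda>(A, B). ?X A B) ((\<lambda>(V, A). (A, V - A)) ` Sigma (Pow S) Pow)"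
    proof (subst module_finsum_reindex[OF m])
      show "inj_on (\<lambda>(V, A). (A, V - A)) (Sigma (Pow S) Pow)" by (auto simp: inj_on_def)
      show "(case case i of (V, A) \<Rightarrow> (A, V - A) of (A, B) \<Rightarrow> ?X A B) \<in> carrier ?N"
        if "i \<in> Sigma (Pow S) Pow" for i using that by (auto intro!: Xc)
    qed (simp add: case_prod_beta')
    also have "(\<lambda>(V, A). (A, V - A)) ` Sigma (Pow S) Pow = Sigma (Pow S) (\<lambda>A. Pow (S - A))"
    proof
      show "Sigma (Pow S) (\<lambda>A. Pow (S - A)) \<subseteq> (\<lambda>(V, A). (A, V - A)) ` Sigma (Pow S) Pow"
      proof
        fix AB assume "AB \<in> Sigma (Pow S) (\<lambda>A. Pow (S - A))"
        then obtain A B where AB: "AB = (A, B)" "A \<subseteq> S" "B \<subseteq> S - A" by auto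
        \<comment> \<open>The inverse of the reindexing recovers \<open>V\<close> as the union of
          the first two parts.\<close>
        then have "AB = (\<lambda>(V, A). (A, V - A)) (A \<union> B, A)" "(A \<union> B, A) \<in> Sigma (Pow S) Pow" by auto
        then show "AB \<in> (\<lambda>(V, A). (A, V - A)) ` Sigma (Pow S) Pow" by (rule image_eqI)
      qed
    qed auto
    also have "finsum ?N (\<lambda>(A, B). ?X A B) (Sigma (Pow S) (\<lambda>A. Pow (S - A)))
        = (\<Oplus>\<^bsub>?N\<^esub>A \<in> Pow S. \<Oplus>\<^bsub>?N\<^esub>B \<in> Pow (S - A). ?X A B)"
      by (rule module_finsum_Sigma[OF m, symmetric]) (use S in \<open>auto intro!: Xc\<close>)
    also have "\<dots> = (\<Oplus>\<^bsub>?N\<^esub>A \<in> Pow S. act (act (tar Day (idn F) (\<Delta> G H)) S) ?n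
        (split_pure F (G \<otimes>\<^sub>H H) S p (q + r) x (hp G H S q r y c) A))"
    proof (rule module_finsum_cong[OF m, symmetric])
      fix A assume "A \<in> Pow S"
      then have A: "A \<subseteq> S" "S - A \<subseteq> S" by auto
      have finA: "finite A" "finite (S - A)" using A S finite_subset by auto
      note AV = day_pair_compl(1)[OF A(1)]
      let ?x = "restr F S A p x" and ?y = "restr G S (S - A) q y" and ?c = "restr H S (S - A) r c"
      have x': "?x \<in> el F A p" and y': "?y \<in> el G (S - A) q" and c': "?c \<in> el H (S - A) r"
        using restr_closed[OF F S A(1) x] restr_closed[OF G S A(2) y] restr_closed[OF H S A(2) c] .
      have u': "hp G H (S - A) q r ?y ?c \<in> el (G \<otimes>\<^sub>H H) (S - A) (q + r)"
        using G H finA c' y' by (intro H.pr_closed) auto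
      have ll: "lin K (Mod (fob (G \<otimes>\<^sub>D H) (S - A)) (q + r)) ?N (day_pure K F (G \<otimes>\<^sub>D H) S A p (q + r) ?x)"
        by (rule bilinear_right[OF D.pr_bilinear[OF F GH' S AV _] x']) simp
      have "act (act (tar Day (idn F) (\<Delta> G H)) S) ?n
          (day_pure K F (G \<otimes>\<^sub>H H) S A p (q + r) ?x (restr (G \<otimes>\<^sub>H H) S (S - A) (q + r) (hp G H S q r y c)))
        = day_pure K F (G \<otimes>\<^sub>D H) S A p (q + r) ?x (act (act (\<Delta> G H) (S - A)) (q + r) (hp G H (S - A) q r ?y ?c))"
        unfolding restr_hp[OF G H S A(2) HOL.refl y c]
        using D.tar_pr[OF idF comult_arr[OF G H] S AV, of ?n p "q + r" ?x "hp G H (S - A) q r ?y ?c"] u' x' finA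
        by (simp add: st comod_id_simps)
      also have "act (act (\<Delta> G H) (S - A)) (q + r) (hp G H (S - A) q r ?y ?c)
          = (\<Oplus>\<^bsub>Mod (fob (G \<otimes>\<^sub>D H) (S - A)) (q + r)\<^esub>B \<in> Pow (S - A).
            day_pure K G H (S - A) B q r (restr G (S - A) B q ?y) (restr H (S - A) (S - A - B) r ?c))"
        by (rule comult_pure[OF G H finA(2) HOL.refl y' c'])
      also have "day_pure K F (G \<otimes>\<^sub>D H) S A p (q + r) ?x \<dots>
          = (\<Oplus>\<^bsub>?N\<^esub>B \<in> Pow (S - A). day_pure K F (G \<otimes>\<^sub>D H) S A p (q + r) ?x
            (day_pure K G H (S - A) B q r (restr G (S - A) B q ?y) (restr H (S - A) (S - A - B) r ?c)))"
        by (rule lin_finsum[OF ll]) (auto intro: day_terms_closed[OF G H finA(2) HOL.refl _ y' c'])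
      also have "\<dots> = (\<Oplus>\<^bsub>?N\<^esub>B \<in> Pow (S - A). ?X A B)"
      proof (rule module_finsum_cong[OF m])
        fix B assume "B \<in> Pow (S - A)"
        then have B: "B \<subseteq> S - A" "S - A - B \<subseteq> S - A" by auto
        show "day_pure K F (G \<otimes>\<^sub>D H) S A p (q + r) ?x
            (day_pure K G H (S - A) B q r (restr G (S - A) B q ?y) (restr H (S - A) (S - A - B) r ?c)) = ?X A B"
          by (simp add: restr_restr[OF G S B(1) A(2) y] restr_restr[OF H S B(2) A(2) c])
        show "?X A B \<in> carrier ?N" by (rule Xc[OF A(1) B(1)])
      qed
      finally show "act (act (tar Day (idn F) (\<Delta> G H)) S) ?n
          (day_pure K F (G \<otimes>\<^sub>H H) S A p (q + r) ?x (restr (G \<otimes>\<^sub>H H) S (S - A) (q + r) (hp G H S q r y c)))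
        = (\<Oplus>\<^bsub>?N\<^esub>B \<in> Pow (S - A). ?X A B)" .
      interpret N: module K ?N by (rule m)
      show "(\<Oplus>\<^bsub>?N\<^esub>B \<in> Pow (S - A). ?X A B) \<in> carrier ?N"
        using A by (intro N.M.finsum_closed) (auto intro!: Xc)
    qed
    also have "\<dots> = act (act (tar Day (idn F) (\<Delta> G H) \<bullet> \<Delta> F (G \<otimes>\<^sub>H H)) S) ?n
        (hp F (G \<otimes>\<^sub>H H) S p (q + r) x (hp G H S q r y c))"
      using act_comult[OF F GH t(2) _ S _ x, of ?n "q + r" "hp G H S q r y c"]
        H.pr_closed[OF G H S _ HOL.refl y c] by (simp add: st add.assoc)
    also have "\<dots> = act (act ?r S) ?n (hp (F \<otimes>\<^sub>H G) H S (p + q) r (hp F G S p q x y) c)"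
      unfolding r using S x y c u
      by (subst comod_comp_simps(3)[OF a(2)])
        (auto simp: st H.associator_pr[OF F G H] intro!: H.pr_closed FG H)
    finally show "act (act ?l S) ?n (had_pure K (F \<otimes>\<^sub>H G) H S V' C' (p + q) r (had_pure K F G V' A' B' p q x y) c)
      = act (act ?r S) ?n (had_pure K (F \<otimes>\<^sub>H G) H S V' C' (p + q) r (had_pure K F G V' A' B' p q x y) c)"
      using eqs by simp
  qed (simp_all add: st)
qed

subsection \<open>The counit\<close>

definition twist_counit :: "('k, 's, 'v) comod_map" (\<open>\<epsilon>\<close>) where
  "\<epsilon> = comod_arrow (unit_ob Had)
    (\<lambda>S. if S = {} then Idn (Ch K) (ground_cpx K) else zero_map (ground_cpx K) (zero_cpx K)) (unit_ob Day)"

lemma counit_simps: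
  shows counit_arr: "fb \<epsilon>" and counit_src_trg: "src \<epsilon> = unit_ob Had" "trg \<epsilon> = unit_ob Day"
proof -
  show "src \<epsilon> = unit_ob Had" "trg \<epsilon> = unit_ob Day" by (simp_all add: twist_counit_def)
  show "fb \<epsilon>"
    unfolding twist_counit_def
  proof (rule comod_arrow_arr[OF H.com_unit D.com_unit])
    fix f n c assume f: "fi_arr f" "f \<in> FB" and c: "c \<in> el (unit_ob Had) (trg f) n"
    \<comment> \<open>A bijection has empty source exactly when its target is empty, so both sides
      of the square fall into the same case of the definition. For the inclusion of the empty set
      into a point they would not.\<close>
    have e: "src f = {} \<longleftrightarrow> trg f = {}" using f(2) by (auto simp: FI_bijections_def bij_betw_def)
    have c': "c \<in> el (unit_ob Had) (src f) n" using c by (simp add: H.unit(1))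
    have z: "Scalar \<zero>\<^bsub>K\<^esub> \<in> el (unit_ob Day) (trg f) n"
      using module_zero_closed[OF chain_complex_module[OF D.unit_cpx]] D.unit_zero by simp
    have z': "\<zero>\<^bsub>Mod (zero_cpx K) n\<^esub> = (Scalar \<zero>\<^bsub>K\<^esub> :: ('k, 's, 'v) univ)"
      by (simp add: zero_cpx_def zero_space_def)
    show "act (if src f = {} then Idn (Ch K) (ground_cpx K) else zero_map (ground_cpx K) (zero_cpx K)) n
          (act (far (unit_ob Had) f) n c)
        = act (far (unit_ob Day) f) n
          (act (if trg f = {} then Idn (Ch K) (ground_cpx K) else zero_map (ground_cpx K) (zero_cpx K)) n c)"
    proof (cases "trg f = {}")
      case True
      then have "c \<in> el (unit_ob Day) (trg f) n" using c by (simp add: H.unit(1) D.unit(1))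
      then show ?thesis using True e c f by (simp add: H.far_unit D.far_unit H.unit(1))
    next
      case False
      then show ?thesis using e c f z by (simp add: H.far_unit D.far_unit H.unit(1) z')
    qed
  qed (auto simp: H.unit(1) D.unit(1) ch_id ch_zero_map chain_complex_ground[OF K] chain_complex_zero[OF K])
qed

lemma counit_act:
  assumes "finite S" "c \<in> el (unit_ob Had) S n"
  shows "act (act \<epsilon> S) n c = (if S = {} then c else Scalar \<zero>\<^bsub>K\<^esub>)"
proof -
  have "\<zero>\<^bsub>Mod (zero_cpx K) n\<^esub> = (Scalar \<zero>\<^bsub>K\<^esub> :: ('k, 's, 'v) univ)"
    by (simp add: zero_cpx_def zero_space_def)
  then show ?thesis using assms by (simp add: twist_counit_def H.unit(1))
qed

text \<open>Day convolution sees only the term with empty \<open>A\<close>: on every nonempty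
  \<open>A\<close> the counit is zero. In that term the second factor is restricted to all of
  \<open>S\<close>, which leaves it unchanged.\<close>

lemma comult_left_unit:
  assumes F: "com F"
  shows "left_unitor Day F \<bullet> tar Day \<epsilon> (idn F) \<bullet> \<Delta> (unit_ob Had) F = left_unitor Had F"
    (is "?l = ?r")
proof -
  note U = H.com_unit and idF = comod_id_arr[OF F, of FB]
  note t = D.tar_arr[OF counit_arr idF] and u = D.left_unitor_simps(1)[OF F]
    and u' = UNIV_fb[OF H.left_unitor_simps(1)[OF F]]
  note st = comod_comp_simps(1,2) comod_id_simps(1,2) comult_src_trg counit_src_trg
    H.left_unitor_simps(2,3)[OF F] D.left_unitor_simps(2,3)[OF F] D.tar_simps(1,2)[OF counit_arr idF]
  have ut: "fb (left_unitor Day F \<bullet> tar Day \<epsilon> (idn F))"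
    by (rule comod_comp_arr[OF t u]) (simp add: st)
  have l: "?l = (left_unitor Day F \<bullet> tar Day \<epsilon> (idn F)) \<bullet> \<Delta> (unit_ob Had) F"
    by (rule fb_comp_assoc[OF comult_arr[OF U F] t u, symmetric]) (simp_all add: st)
  show ?thesis
  proof (rule H.arr_ext2_any[where W' = FB, OF U F])
    show "fb ?l" unfolding l by (rule comod_comp_arr[OF comult_arr[OF U F] ut]) (simp add: st)
    show "fb ?r" by (rule u')
    fix S A' B' p q c x assume S: "finite S" and AB: "A' = S \<and> B' = S"
      and "c \<in> el (unit_ob Had) A' p" "x \<in> el F B' q"
    then have c: "c \<in> el (unit_ob Had) S p" and x: "x \<in> el F S q" by auto
    let ?N = "Mod (fob F S) (p + q)"
    let ?v = "if p = 0 then scalar c \<odot>\<^bsub>Mod (fob F S) q\<^esub> x else \<zero>\<^bsub>?N\<^esub>"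
    have m: "module K (Mod (fob F S) n)" for n by (rule comodule_module[OF F S])
    interpret N: module K ?N by (rule m)
    have v: "?v \<in> carrier ?N"
      using x H.unit_scalar[OF c] by (auto intro: module_smult_closed[OF m])
    have summand: "act (act (left_unitor Day F \<bullet> tar Day \<epsilon> (idn F)) S) (p + q)
          (split_pure (unit_ob Had) F S p q c x A)
        = (if {} = A then ?v else \<zero>\<^bsub>?N\<^esub>)" if "A \<in> Pow S" for A
    proof -
      have A: "A \<subseteq> S" "S - A \<subseteq> S" using that by auto
      have fin: "finite A" "finite (S - A)" using A S finite_subset by auto
      note P = day_pair_compl(1)[OF A(1)]
      \<comment> \<open>The Hadamard unit is constant, and its structure maps act as the identity on
        scalars.\<close>
      have rc: "restr (unit_ob Had) S A p c = c"
        using H.far_unit[OF fi_arr_incl[OF S A(1)], of c p] c by (simp add: comod_proj_def)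
      have c': "c \<in> el (unit_ob Had) A p" using c by (simp add: H.unit(1))
      have x': "restr F S (S - A) q x \<in> el F (S - A) q" by (rule restr_closed[OF F S A(2) x])
      have e': "act (act \<epsilon> A) p c \<in> el (unit_ob Day) A p"
        by (rule comod_arr_closed[OF counit_arr fin(1)]) (simp_all add: st c')
      have w: "day_pure K (unit_ob Had) F S A p q c (restr F S (S - A) q x) \<in> el (unit_ob Had \<otimes>\<^sub>D F) S (p + q)"
        by (rule D.pr_closed[OF U F S P HOL.refl c' x'])
      have "act (act (left_unitor Day F \<bullet> tar Day \<epsilon> (idn F)) S) (p + q)
          (day_pure K (unit_ob Had) F S A p q c (restr F S (S - A) q x))
        = act (act (left_unitor Day F) S) (p + q) (day_pure K (unit_ob Day) F S A p q (act (act \<epsilon> A) p c)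
            (restr F S (S - A) q x))"
        using w S c' x' fin D.tar_pr[OF counit_arr idF S P HOL.refl, of c p "restr F S (S - A) q x" q]
        by (subst comod_comp_simps(3)[OF t]) (simp_all add: st comod_id_simps)
      also have "\<dots> = (if A \<in> {{}} \<and> p = 0 then scalar (act (act \<epsilon> A) p c) \<odot>\<^bsub>Mod (fob F (S - A)) q\<^esub> restr F S (S - A) q x
          else \<zero>\<^bsub>?N\<^esub>)"
        by (rule D.left_unitor_pr[OF F S P HOL.refl e' x'])
      also have "\<dots> = (if {} = A then ?v else \<zero>\<^bsub>?N\<^esub>)"
        using counit_act[OF fin(1) c'] restr_self[OF F S x] by auto
      finally show ?thesis unfolding rc .
    qed
    have "act (act ?l S) (p + q) (hp (unit_ob Had) F S p q c x)
      = (\<Oplus>\<^bsub>?N\<^esub>A \<in> Pow S. act (act (left_unitor Day F \<bullet> tar Day \<epsilon> (idn F)) S) (p + q)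
          (split_pure (unit_ob Had) F S p q c x A))"
      unfolding l using act_comult[OF U F ut _ S HOL.refl c x] by (simp add: st)
    also have "\<dots> = (\<Oplus>\<^bsub>?N\<^esub>A \<in> Pow S. if {} = A then ?v else \<zero>\<^bsub>?N\<^esub>)"
      by (rule module_finsum_cong[OF m summand]) (use v in auto)
    also have "\<dots> = ?v"
      using N.M.finsum_singleton[of "{}" "Pow S" "\<lambda>_. ?v"] v S by auto
    also have "\<dots> = act (act ?r S) (p + q) (hp (unit_ob Had) F S p q c x)"
      using H.left_unitor_pr[OF F S _ HOL.refl c x] by simp
    finally show "act (act ?l S) (p + q) (had_pure K (unit_ob Had) F S A' B' p q c x)
      = act (act ?r S) (p + q) (had_pure K (unit_ob Had) F S A' B' p q c x)" using AB by simp
  qed (simp_all add: st)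
qed

text \<open>Writing the right unitor as the left unitor after the braiding, naturality of the
  braiding and the symmetry of \<open>\<Delta>\<close> carry the braiding through to the Hadamard
  side, where the left counit law applies.\<close>

lemma comult_right_unit:
  assumes F: "com F"
  shows "right_unitor Day F \<bullet> tar Day (idn F) \<epsilon> \<bullet> \<Delta> F (unit_ob Had) = right_unitor Had F"
proof -
  let ?U = "unit_ob Had" and ?V = "unit_ob Day"
  note U = H.com_unit and V = D.com_unit and idF = comod_id_arr[OF F, of FB]
  note a = D.left_unitor_simps(1)[OF F] D.braiding_simps(1)[OF F V] D.braiding_simps(1)[OF F U]
    UNIV_fb[OF H.braiding_simps(1)[OF F U]] D.tar_arr[OF idF counit_arr] D.tar_arr[OF counit_arr idF]
    comult_arr[OF F U] comult_arr[OF U F]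
  note st = comod_comp_simps(1,2) comod_id_simps(1,2) comult_src_trg counit_src_trg
    D.left_unitor_simps(2,3)[OF F] D.braiding_simps(2,3)[OF F V] D.braiding_simps(2,3)[OF F U]
    H.braiding_simps(2,3)[OF F U] D.tar_simps(1,2)[OF counit_arr idF] D.tar_simps(1,2)[OF idF counit_arr]
  have "right_unitor Day F \<bullet> tar Day (idn F) \<epsilon> \<bullet> \<Delta> F ?U
      = left_unitor Day F \<bullet> (braiding Day F ?V \<bullet> tar Day (idn F) \<epsilon>) \<bullet> \<Delta> F ?U"
    unfolding D.right_unitor_eq[OF F]
    by (simp add: fb_comp_assoc a st comod_comp_arr)
  also have "braiding Day F ?V \<bullet> tar Day (idn F) \<epsilon> = tar Day \<epsilon> (idn F) \<bullet> braiding Day F ?U"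
    using D.braiding_natural[OF idF counit_arr] by (simp add: st)
  also have "left_unitor Day F \<bullet> (tar Day \<epsilon> (idn F) \<bullet> braiding Day F ?U) \<bullet> \<Delta> F ?U
      = left_unitor Day F \<bullet> tar Day \<epsilon> (idn F) \<bullet> (braiding Day F ?U \<bullet> \<Delta> F ?U)"
    by (simp add: fb_comp_assoc a st comod_comp_arr)
  also have "braiding Day F ?U \<bullet> \<Delta> F ?U = \<Delta> ?U F \<bullet> braiding Had F ?U"
    by (rule comult_braiding[OF F U])
  also have "left_unitor Day F \<bullet> tar Day \<epsilon> (idn F) \<bullet> (\<Delta> ?U F \<bullet> braiding Had F ?U)
      = (left_unitor Day F \<bullet> tar Day \<epsilon> (idn F) \<bullet> \<Delta> ?U F) \<bullet> braiding Had F ?U"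
    by (simp add: fb_comp_assoc a st comod_comp_arr)
  also have "\<dots> = right_unitor Had F"
    unfolding comult_left_unit[OF F] using H.right_unitor_eq[OF F] by (simp add: UNIV_comp)
  finally show ?thesis .
qed

text \<open>\<open>is_Tw_counit\<close> prescribes the component at every finite set, and a morphism
  has no further freedom; together with naturality for bijections this gives existence and
  uniqueness at once.\<close>

lemma is_Tw_counit_iff:
  "{e \<in> Hom Day (unit_ob Had) (unit_ob Day). is_Tw_counit K e} = {\<epsilon>}"
proof -
  have "is_Tw_counit K \<epsilon>" by (simp add: is_Tw_counit_def twist_counit_def)
  moreover have "e = \<epsilon>" if e: "fb e" "src e = unit_ob Had" "trg e = unit_ob Day" "is_Tw_counit K e" for e
  proof (rule comod_arr_ext[OF e(1) counit_arr])
    fix S n c assume "finite S" "c \<in> el (src e) S n"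
    then show "act (act e S) n c = act (act \<epsilon> S) n c"
      using e(4) by (cases "S = {}") (auto simp: is_Tw_counit_def twist_counit_def)
  qed (simp_all add: e counit_src_trg)
  ultimately show ?thesis
    by (auto simp: D.M Hom_comod_iff H.com_unit D.com_unit counit_arr counit_src_trg)
qed

lemma twist_oplax:
  "symmetric_oplax_monoidal_functor Had Day
    \<lparr>fob = \<lambda>F. F, far = \<lambda>f. f, comult = \<Delta>, counit = \<epsilon>\<rparr>"
proof -
  let ?T = "\<lparr>fob = \<lambda>F. F, far = \<lambda>f. f, comult = \<Delta>, counit = \<epsilon>\<rparr>"
  have "is_functor Had Day ?T"
    by (auto simp: is_functor_def H.M D.M Hom_comod_iff UNIV_comp UNIV_idn UNIV_fb)
  then show ?thesis
    unfolding symmetric_oplax_monoidal_functor_def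
    by (auto simp: H.symmetric_monoidal D.symmetric_monoidal H.M D.M Hom_comod_iff H.com_unit D.com_unit
        counit_arr counit_src_trg comult_arr comult_src_trg H.com_tob D.com_tob comult_natural
        comult_coassoc comult_left_unit comult_right_unit comult_braiding)
qed

end

text \<open>Day convolution is coherent for morphisms natural under all injections as well, which is
  the first conjunct. It is the oplax structure that forces the passage to bijections in the target,
  with objects unchanged. The counit is pinned down as the only morphism satisfying its
  description.\<close>

theorem proposition4p6:
  fixes K :: "'k ring"
    and Had DayFI DayFB :: "(('k, 's, 'v) comod, ('k, 's, 'v) comod_map) smc"
  assumes "field K"
    and "Had = hadamard K" and "DayFI = day UNIV K" and "DayFB = day FI_bijections K"
  shows "symmetric_monoidal_category DayFI \<and>
    (\<exists>Tw. symmetric_oplax_monoidal_functor Had DayFB Tw \<and>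
      (\<forall>F \<in> Ob Had. fob Tw F = F) \<and>
      (\<forall>F \<in> Ob Had. \<forall>G \<in> Ob Had. \<forall>f \<in> Hom Had F G. far Tw f = f) \<and>
      (\<forall>F \<in> Ob Had. \<forall>G \<in> Ob Had. comult Tw F G = Tw_comult K F G) \<and>
      {e \<in> Hom DayFB (unit_ob Had) (unit_ob DayFB). is_Tw_counit K e} = {counit Tw})"
proof
  have K: "cring K" by (rule fieldE(1)[OF assms(1)])
  show "symmetric_monoidal_category DayFI"
    unfolding assms(3) by (rule convolution.symmetric_monoidal[OF convolution_day[OF K]]) simp
  interpret twist K Had DayFB by (rule twist.intro[OF K assms(2,4)])
  show "\<exists>Tw. symmetric_oplax_monoidal_functor Had DayFB Tw \<and>
      (\<forall>F \<in> Ob Had. fob Tw F = F) \<and>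
      (\<forall>F \<in> Ob Had. \<forall>G \<in> Ob Had. \<forall>f \<in> Hom Had F G. far Tw f = f) \<and>
      (\<forall>F \<in> Ob Had. \<forall>G \<in> Ob Had. comult Tw F G = Tw_comult K F G) \<and>
      {e \<in> Hom DayFB (unit_ob Had) (unit_ob DayFB). is_Tw_counit K e} = {counit Tw}"
    by (rule exI[of _ "\<lparr>fob = \<lambda>F. F, far = \<lambda>f. f, comult = Tw_comult K, counit = twist_counit\<rparr>"])
      (simp add: twist_oplax is_Tw_counit_iff)
qed

end
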